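(* Let $n\ge 2$, $1\le \ell\le n-1$, and let $\Omega\subset\mathbb{R}^n$ be a bounded domain which supports the Hardy inequality with finite Hardy constant $H_\Omega$, that is, $$\left\|\tfrac{1}{\rho_\Omega}v\right\|^2\le H_\Omega\,|v|_1^2\quad\text{for every } v\in H_0^1(\Omega,\Lambda^\ell).$$ Then $\Omega$ supports the Friedrichs-Velte inequality of order $\ell$, and simultaneously the Babuška-Aziz inequality of order $\ell$, if and only if $\Omega$ supports the improved Poincaré inequality of order $\ell$ (so the three properties are equivalent). Moreover, the optimal constants in these inequalities satisfy $$\frac14\left(C_{\Omega,\ell}-1\right)=\frac14\Gamma_{\Omega,\ell}\le P_{\Omega,\ell}\le H_\Omega C_{\Omega,\ell}=H_\Omega\left(1+\Gamma_{\Omega,\ell}\right).$$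
   Context: Let $\Omega\subset\mathbb{R}^n$ ($n\ge2$) be a bounded domain and $\rho_\Omega(x)=\mathrm{dist}(x,\partial\Omega)$ for $x\in\Omega$. $\Lambda^\ell$ is the space of exterior $\ell$-forms on $\mathbb{R}^n$ with Euclidean norm $|\cdot|$. $L_2(\Omega,\Lambda^\ell)$ is the space of differential $\ell$-forms with square integrable coefficients, with norm $\|u\|^2=\int_\Omega|u|^2$ and inner product $\langle\cdot,\cdot\rangle$. $\mathsf{d}$ is the exterior derivative and $\mathsf{d}^*$ its formal $L_2$-adjoint (coderivative), lowering the order of a form by one. $H_0^1(\Omega,\Lambda^\ell)$ is the completion of $C_0^\infty(\Omega,\Lambda^\ell)$ under $|u|_1=\langle\Delta u,u\rangle^{1/2}$, where $\Delta=\mathsf{d}^*\mathsf{d}+\mathsf{d}\mathsf{d}^*$ (so $|u|_1^2$ is the sum of $\int_\Omega|\nabla u_I|^2$ over the coefficients $u_I$ of $u$). $H^{-1}(\Omega,\Lambda^\ell)$ is its dual. The operators extend (distributionally) to $\mathsf{d}:L_2(\Omega,\Lambda^{\ell-1})\to H^{-1}(\Omega,\Lambda^\ell)$, $\mathsf{d}^*:L_2(\Omega,\Lambda^{\ell+1})\to H^{-1}(\Omega,\Lambda^\ell)$ and $\mathsf{d}^*:H_0^1(\Omega,\Lambda^\ell)\to L_2(\Omega,\Lambda^{\ell-1})$. $M$ is the orthogonal complement in $L_2(\Omega,\Lambda^{\ell-1})$ of the kernel of $\mathsf{d}:L_2(\Omega,\Lambda^{\ell-1})\to H^{-1}(\Omega,\Lambda^\ell)$.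 The Hardy constant $H_\Omega$ is the least constant such that $\int_\Omega\rho_\Omega^{-2}|f|^2\le H_\Omega\int_\Omega|\nabla f|^2$ for every scalar $f\in H_0^1(\Omega)$. Babuška-Aziz inequality of order $\ell$: there is a finite positive constant $C_\ell$ depending only on $\Omega$ and $\ell$ such that for every $u\in M$ there is $w\in H_0^1(\Omega,\Lambda^\ell)$ with $\mathsf{d}^*w=u$ and $|w|_1^2\le C_\ell\|u\|^2$. The least possible constant is $C_{\Omega,\ell}$. Friedrichs-Velte inequality of order $\ell$: there is a finite positive constant $\Gamma_\ell$ depending only on $\Omega$ and $\ell$ such that $\|u\|^2\le\Gamma_\ell\|v\|^2$ for every $u\in M$ and $v\in L_2(\Omega,\Lambda^{\ell+1})$ that are conjugate, i.e. $\mathsf{d}u=\mathsf{d}^*v$ (in $H^{-1}(\Omega,\Lambda^\ell)$). The least possible constant is $\Gamma_{\Omega,\ell}$. Improved Poincaré inequality of order $\ell$: there is a finite constant $P_\ell$ depending only on $\Omega$ and $\ell$ such that $\|u\|^2\le P_\ell\|\rho_\Omega\mathsf{d}u\|^2$ for every $u\in M$, where the right-hand side is understood as $+\infty$ if $\rho_\Omega\mathsf{d}u\notin L_2(\Omega,\Lambda^\ell)$. The least possible constant is $P_{\Omega,\ell}$. *)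

theory Defs
  imports "HOL-Analysis.Analysis"
begin

section \<open>Square integrable functions and smooth test functions\<close>

definition l2_inner :: "(real^'n) set \<Rightarrow> (real^'n \<Rightarrow> 'b::euclidean_space) \<Rightarrow> (real^'n \<Rightarrow> 'b) \<Rightarrow> real" where
  "l2_inner \<Omega> u v = (LINT x | lebesgue_on \<Omega>. u x \<bullet> v x)"

definition l2_norm :: "(real^'n) set \<Rightarrow> (real^'n \<Rightarrow> 'b::euclidean_space) \<Rightarrow> real" where
  "l2_norm \<Omega> u = sqrt (l2_inner \<Omega> u u)"

text \<open>Elements of \<open>L\<^sub>2(\<Omega>)\<close> are represented by functions on the whole space, of which only the
  restriction to \<open>\<Omega>\<close> matters. Almost everywhere equal functions are not identified; all notions
  below are invariant under changes on null sets.\<close>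

definition L2 :: "(real^'n) set \<Rightarrow> (real^'n \<Rightarrow> 'b::euclidean_space) set" where
  "L2 \<Omega> = {u. u \<in> borel_measurable (lebesgue_on \<Omega>) \<and>
              integrable (lebesgue_on \<Omega>) (\<lambda>x. (norm (u x))\<^sup>2)}"

definition partial_deriv :: "'n \<Rightarrow> (real^'n \<Rightarrow> 'b::euclidean_space) \<Rightarrow> real^'n \<Rightarrow> 'b" where
  "partial_deriv i f x = frechet_derivative f (at x) (axis i 1)"

primrec C_k :: "nat \<Rightarrow> (real^'n \<Rightarrow> 'b::euclidean_space) \<Rightarrow> bool" where
  "C_k 0 f \<longleftrightarrow> continuous_on UNIV f"
| "C_k (Suc k) f \<longleftrightarrow> (\<forall>x. f differentiable (at x)) \<and> (\<forall>i. C_k k (partial_deriv i f))"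

text \<open>\<open>C\<^sub>0\<^sup>\<infinity>(\<Omega>)\<close>, with functions extended by zero to the whole space.\<close>

definition test_fun :: "(real^'n) set \<Rightarrow> (real^'n \<Rightarrow> 'b::euclidean_space) set" where
  "test_fun \<Omega> = {\<phi>. (\<forall>k. C_k k \<phi>) \<and> (\<exists>K. compact K \<and> K \<subseteq> \<Omega> \<and> (\<forall>x. x \<notin> K \<longrightarrow> \<phi> x = 0))}"


section \<open>Completion of a space of test functions inside \<open>L\<^sub>2\<close>\<close>

text \<open>\<open>T\<close> is a space of test functions with norm \<open>N\<close>. An element of the completion, that is, a
  class of \<open>N\<close>-Cauchy sequences in \<open>T\<close>, is represented by its limit in \<open>L\<^sub>2(\<Omega>)\<close>. For the norms
  used below on bounded \<open>\<Omega>\<close> the limit exists by the Poincare inequality and determines the class,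
  because the first derivatives are closable. The norm of the completion is the limit of the norms
  along any representing sequence.\<close>

definition completion_seq ::
  "(real^'n) set \<Rightarrow> (real^'n \<Rightarrow> 'b::euclidean_space) set \<Rightarrow> ((real^'n \<Rightarrow> 'b) \<Rightarrow> real) \<Rightarrow>
   (real^'n \<Rightarrow> 'b) \<Rightarrow> (nat \<Rightarrow> real^'n \<Rightarrow> 'b) \<Rightarrow> bool" where
  "completion_seq \<Omega> T N w \<phi> \<longleftrightarrow>
     (\<forall>k. \<phi> k \<in> T) \<and>
     (\<forall>e>0. \<exists>K. \<forall>j\<ge>K. \<forall>k\<ge>K. N (\<lambda>x. \<phi> j x - \<phi> k x) < e) \<and>
     (\<lambda>k. l2_norm \<Omega> (\<lambda>x. \<phi> k x - w x)) \<longlonglongrightarrow> 0"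

definition completion_norm ::
  "(real^'n) set \<Rightarrow> (real^'n \<Rightarrow> 'b::euclidean_space) set \<Rightarrow> ((real^'n \<Rightarrow> 'b) \<Rightarrow> real) \<Rightarrow>
   (real^'n \<Rightarrow> 'b) \<Rightarrow> real" where
  "completion_norm \<Omega> T N w = lim (\<lambda>k. N ((SOME \<phi>. completion_seq \<Omega> T N w \<phi>) k))"


section \<open>Hardy inequality\<close>

definition rho :: "(real^'n) set \<Rightarrow> real^'n \<Rightarrow> real" where
  "rho \<Omega> x = infdist x (frontier \<Omega>)"

definition grad_norm :: "(real^'n) set \<Rightarrow> (real^'n \<Rightarrow> real) \<Rightarrow> real" where
  "grad_norm \<Omega> f = l2_norm \<Omega> (\<lambda>x. (\<chi> i. partial_deriv i f x) :: real^'n)"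

definition H01_scalar :: "(real^'n) set \<Rightarrow> (real^'n \<Rightarrow> real) set" where
  "H01_scalar \<Omega> = {f \<in> L2 \<Omega>. \<exists>\<phi>. completion_seq \<Omega> (test_fun \<Omega>) (grad_norm \<Omega>) f \<phi>}"

definition H01_scalar_norm :: "(real^'n) set \<Rightarrow> (real^'n \<Rightarrow> real) \<Rightarrow> real" where
  "H01_scalar_norm \<Omega> = completion_norm \<Omega> (test_fun \<Omega>) (grad_norm \<Omega>)"

text \<open>Membership in \<open>L2\<close> expresses that the left-hand side is finite; the Bochner integral of a
  non-integrable function would be 0.\<close>

definition hardy_inequality :: "(real^'n) set \<Rightarrow> real \<Rightarrow> bool" where
  "hardy_inequality \<Omega> H \<longleftrightarrow>
     (\<forall>f \<in> H01_scalar \<Omega>. (\<lambda>x. f x / rho \<Omega> x) \<in> L2 \<Omega> \<and>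
        (l2_norm \<Omega> (\<lambda>x. f x / rho \<Omega> x))\<^sup>2 \<le> H * (H01_scalar_norm \<Omega> f)\<^sup>2)"

definition supports_hardy :: "(real^'n) set \<Rightarrow> bool" where
  "supports_hardy \<Omega> \<longleftrightarrow> (\<exists>H. hardy_inequality \<Omega> H)"

definition hardy_const :: "(real^'n) set \<Rightarrow> real" where
  "hardy_const \<Omega> = Inf {H. hardy_inequality \<Omega> H}"


section \<open>Differential forms\<close>

text \<open>The exterior algebra of \<open>\<real>\<^sup>n\<close> is coordinatised by the orthonormal basis
  \<open>dx\<^sub>I = dx\<^bsub>i1\<^esub> \<and> \<dots> \<and> dx\<^bsub>il\<^esub>\<close>, \<open>I = {i1 < \<dots> < il}\<close>: the coefficient of \<open>dx\<^sub>I\<close> in \<open>a\<close> is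
  \<open>a $ I\<close>. The inner product and norm of \<open>real ^ ('n set)\<close> are then the Euclidean ones.\<close>

type_synonym 'n form = "real^'n \<Rightarrow> real^('n set)"

definition Lam :: "nat \<Rightarrow> (real^('n::finite set)) set" where
  "Lam l = {a. \<forall>I. card I \<noteq> l \<longrightarrow> a $ I = 0}"

text \<open>\<open>dx\<^sub>i \<and> dx\<^sub>J = wedge_sign i J dx\<^bsub>J \<union> {i}\<^esub>\<close> for \<open>i \<notin> J\<close>.\<close>

definition wedge_sign :: "'n::{finite,linorder} \<Rightarrow> 'n set \<Rightarrow> real" where
  "wedge_sign i J = (-1) ^ card {j \<in> J. j < i}"

definition ext_deriv :: "'n::{finite,linorder} form \<Rightarrow> 'n form" where
  "ext_deriv u x = (\<chi> I. \<Sum>i\<in>I. wedge_sign i (I - {i}) * partial_deriv i u x $ (I - {i}))"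

definition coderiv :: "'n::{finite,linorder} form \<Rightarrow> 'n form" where
  "coderiv u x = (\<chi> J. - (\<Sum>i\<in>-J. wedge_sign i J * partial_deriv i u x $ insert i J))"

definition hodge_laplacian :: "'n::{finite,linorder} form \<Rightarrow> 'n form" where
  "hodge_laplacian u x = coderiv (ext_deriv u) x + ext_deriv (coderiv u) x"

definition L2_form :: "(real^'n) set \<Rightarrow> nat \<Rightarrow> 'n form set" where
  "L2_form \<Omega> l = {u \<in> L2 \<Omega>. \<forall>x\<in>\<Omega>. u x \<in> Lam l}"

definition test_form :: "(real^'n) set \<Rightarrow> nat \<Rightarrow> 'n form set" where
  "test_form \<Omega> l = {\<phi> \<in> test_fun \<Omega>. \<forall>x. \<phi> x \<in> Lam l}"

definition energy_norm :: "(real^'n::{finite,linorder}) set \<Rightarrow> 'n form \<Rightarrow> real" where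
  "energy_norm \<Omega> u = sqrt (l2_inner \<Omega> (hodge_laplacian u) u)"

definition H01 :: "(real^'n::{finite,linorder}) set \<Rightarrow> nat \<Rightarrow> 'n form set" where
  "H01 \<Omega> l = {w \<in> L2_form \<Omega> l. \<exists>\<phi>. completion_seq \<Omega> (test_form \<Omega> l) (energy_norm \<Omega>) w \<phi>}"

definition H01_norm :: "(real^'n::{finite,linorder}) set \<Rightarrow> nat \<Rightarrow> 'n form \<Rightarrow> real" where
  "H01_norm \<Omega> l = completion_norm \<Omega> (test_form \<Omega> l) (energy_norm \<Omega>)"


section \<open>Extensions of the exterior derivative and the coderivative\<close>

text \<open>\<open>g\<close> is an \<open>L\<^sub>2\<close> form of degree \<open>k\<close> which is the distributional exterior derivative
  (coderivative) of \<open>w\<close> on \<open>\<Omega>\<close>.\<close>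

definition is_ext_deriv :: "(real^'n::{finite,linorder}) set \<Rightarrow> nat \<Rightarrow> 'n form \<Rightarrow> 'n form \<Rightarrow> bool" where
  "is_ext_deriv \<Omega> k w g \<longleftrightarrow> g \<in> L2_form \<Omega> k \<and>
     (\<forall>\<psi> \<in> test_form \<Omega> k. l2_inner \<Omega> g \<psi> = l2_inner \<Omega> w (coderiv \<psi>))"

definition is_coderiv :: "(real^'n::{finite,linorder}) set \<Rightarrow> nat \<Rightarrow> 'n form \<Rightarrow> 'n form \<Rightarrow> bool" where
  "is_coderiv \<Omega> k w g \<longleftrightarrow> g \<in> L2_form \<Omega> k \<and>
     (\<forall>\<psi> \<in> test_form \<Omega> k. l2_inner \<Omega> g \<psi> = l2_inner \<Omega> w (ext_deriv \<psi>))"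

text \<open>For \<open>w \<in> H01 \<Omega> l\<close> these exist and are unique up to null sets.\<close>

definition ext_deriv_H01 :: "(real^'n::{finite,linorder}) set \<Rightarrow> nat \<Rightarrow> 'n form \<Rightarrow> 'n form" where
  "ext_deriv_H01 \<Omega> l w = (SOME g. is_ext_deriv \<Omega> (l + 1) w g)"

definition coderiv_H01 :: "(real^'n::{finite,linorder}) set \<Rightarrow> nat \<Rightarrow> 'n form \<Rightarrow> 'n form" where
  "coderiv_H01 \<Omega> l w = (SOME g. is_coderiv \<Omega> (l - 1) w g)"

text \<open>\<open>d : L\<^sub>2(\<Omega>, \<Lambda>\<^bsup>l-1\<^esup>) \<rightarrow> H\<^bsup>-1\<^esup>(\<Omega>, \<Lambda>\<^bsup>l\<^esup>)\<close> and \<open>d\<^sup>* : L\<^sub>2(\<Omega>, \<Lambda>\<^bsup>l+1\<^esup>) \<rightarrow> H\<^bsup>-1\<^esup>(\<Omega>, \<Lambda>\<^bsup>l\<^esup>)\<close>. An element of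
  the dual space \<open>H\<^bsup>-1\<^esup>(\<Omega>, \<Lambda>\<^bsup>l\<^esup>)\<close> is a functional on \<open>H01 \<Omega> l\<close>, made extensional so that equality in
  \<open>H\<^bsup>-1\<^esup>\<close> is equality of functions.\<close>

definition d_dual :: "(real^'n::{finite,linorder}) set \<Rightarrow> nat \<Rightarrow> 'n form \<Rightarrow> ('n form \<Rightarrow> real)" where
  "d_dual \<Omega> l u = (\<lambda>\<phi> \<in> H01 \<Omega> l. l2_inner \<Omega> u (coderiv_H01 \<Omega> l \<phi>))"

definition dstar_dual :: "(real^'n::{finite,linorder}) set \<Rightarrow> nat \<Rightarrow> 'n form \<Rightarrow> ('n form \<Rightarrow> real)" where
  "dstar_dual \<Omega> l v = (\<lambda>\<phi> \<in> H01 \<Omega> l. l2_inner \<Omega> v (ext_deriv_H01 \<Omega> l \<phi>))"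

definition ker_d :: "(real^'n::{finite,linorder}) set \<Rightarrow> nat \<Rightarrow> 'n form set" where
  "ker_d \<Omega> l = {z \<in> L2_form \<Omega> (l - 1). d_dual \<Omega> l z = (\<lambda>\<phi> \<in> H01 \<Omega> l. 0)}"

definition M_space :: "(real^'n::{finite,linorder}) set \<Rightarrow> nat \<Rightarrow> 'n form set" where
  "M_space \<Omega> l = {u \<in> L2_form \<Omega> (l - 1). \<forall>z \<in> ker_d \<Omega> l. l2_inner \<Omega> u z = 0}"


section \<open>The three inequalities\<close>

definition babuska_aziz :: "(real^'n::{finite,linorder}) set \<Rightarrow> nat \<Rightarrow> real \<Rightarrow> bool" where
  "babuska_aziz \<Omega> l C \<longleftrightarrow> 0 < C \<and>
     (\<forall>u \<in> M_space \<Omega> l. \<exists>w \<in> H01 \<Omega> l.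
        is_coderiv \<Omega> (l - 1) w u \<and> (H01_norm \<Omega> l w)\<^sup>2 \<le> C * (l2_norm \<Omega> u)\<^sup>2)"

definition supports_babuska_aziz :: "(real^'n::{finite,linorder}) set \<Rightarrow> nat \<Rightarrow> bool" where
  "supports_babuska_aziz \<Omega> l \<longleftrightarrow> (\<exists>C. babuska_aziz \<Omega> l C)"

definition babuska_aziz_const :: "(real^'n::{finite,linorder}) set \<Rightarrow> nat \<Rightarrow> real" where
  "babuska_aziz_const \<Omega> l = Inf {C. babuska_aziz \<Omega> l C}"

definition conjugate_forms ::
  "(real^'n::{finite,linorder}) set \<Rightarrow> nat \<Rightarrow> 'n form \<Rightarrow> 'n form \<Rightarrow> bool" where
  "conjugate_forms \<Omega> l u v \<longleftrightarrow> d_dual \<Omega> l u = dstar_dual \<Omega> l v"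

definition friedrichs_velte :: "(real^'n::{finite,linorder}) set \<Rightarrow> nat \<Rightarrow> real \<Rightarrow> bool" where
  "friedrichs_velte \<Omega> l \<Gamma> \<longleftrightarrow> 0 < \<Gamma> \<and>
     (\<forall>u \<in> M_space \<Omega> l. \<forall>v \<in> L2_form \<Omega> (l + 1). conjugate_forms \<Omega> l u v \<longrightarrow>
        (l2_norm \<Omega> u)\<^sup>2 \<le> \<Gamma> * (l2_norm \<Omega> v)\<^sup>2)"

definition supports_friedrichs_velte :: "(real^'n::{finite,linorder}) set \<Rightarrow> nat \<Rightarrow> bool" where
  "supports_friedrichs_velte \<Omega> l \<longleftrightarrow> (\<exists>\<Gamma>. friedrichs_velte \<Omega> l \<Gamma>)"

definition friedrichs_velte_const :: "(real^'n::{finite,linorder}) set \<Rightarrow> nat \<Rightarrow> real" where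
  "friedrichs_velte_const \<Omega> l = Inf {\<Gamma>. friedrichs_velte \<Omega> l \<Gamma>}"

text \<open>\<open>\<rho>\<^sub>\<Omega> du \<in> L\<^sub>2\<close> means that the distribution \<open>du\<close> is a function \<open>g\<close> on \<open>\<Omega>\<close> with \<open>\<rho>\<^sub>\<Omega> g \<in> L\<^sub>2\<close>;
  such a \<open>g\<close> is square integrable on compact subsets of \<open>\<Omega>\<close>, because \<open>\<rho>\<^sub>\<Omega>\<close> is bounded below there,
  and unique up to null sets. If there is no such \<open>g\<close>, then \<open>\<parallel>\<rho>\<^sub>\<Omega> du\<parallel> = \<infinity>\<close> and nothing is required
  of \<open>u\<close>.\<close>

definition weighted_d_repr ::
  "(real^'n::{finite,linorder}) set \<Rightarrow> nat \<Rightarrow> 'n form \<Rightarrow> 'n form \<Rightarrow> bool" where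
  "weighted_d_repr \<Omega> l u g \<longleftrightarrow> (\<lambda>x. rho \<Omega> x *\<^sub>R g x) \<in> L2_form \<Omega> l \<and>
     (\<forall>\<phi> \<in> test_form \<Omega> l. d_dual \<Omega> l u \<phi> = l2_inner \<Omega> g \<phi>)"

definition improved_poincare :: "(real^'n::{finite,linorder}) set \<Rightarrow> nat \<Rightarrow> real \<Rightarrow> bool" where
  "improved_poincare \<Omega> l P \<longleftrightarrow>
     (\<forall>u \<in> M_space \<Omega> l. \<forall>g. weighted_d_repr \<Omega> l u g \<longrightarrow>
        (l2_norm \<Omega> u)\<^sup>2 \<le> P * (l2_norm \<Omega> (\<lambda>x. rho \<Omega> x *\<^sub>R g x))\<^sup>2)"

definition supports_improved_poincare :: "(real^'n::{finite,linorder}) set \<Rightarrow> nat \<Rightarrow> bool" where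
  "supports_improved_poincare \<Omega> l \<longleftrightarrow> (\<exists>P. improved_poincare \<Omega> l P)"

definition improved_poincare_const :: "(real^'n::{finite,linorder}) set \<Rightarrow> nat \<Rightarrow> real" where
  "improved_poincare_const \<Omega> l = Inf {P. improved_poincare \<Omega> l P}"

end

theory Submission
  imports Defs
begin

text \<open>
  Let \<open>S\<close> be the operator \<open>u \<mapsto> d\<^sup>* w\<close> on \<open>M\<close>, where \<open>w \<in> H01\<close> is the weak solution of
  \<open>(d\<^sup>* d + d d\<^sup>*) w = d u\<close> (lemma \<open>hodge_dirichlet_problem\<close>). It is symmetric, and
  \<open>\<langle>S u, u\<rangle> = |w|\<^sub>1\<^sup>2 = \<parallel>d u\<parallel>\<^sup>2\<close> in the norm of the dual space. The equation says that
  \<open>u - S u\<close> and \<open>d w\<close> are conjugate. So, with \<open>T = 1 - S\<close>, the Friedrichs-Velte inequality gives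
  \<open>\<parallel>T u\<parallel>\<^sup>2 \<le> \<Gamma> \<parallel>d w\<parallel>\<^sup>2 = \<Gamma> (\<langle>T u, u\<rangle> - \<parallel>T u\<parallel>\<^sup>2)\<close>. The Cauchy-Schwarz inequality turns this into
  \<open>(1 + \<Gamma>) \<parallel>T u\<parallel> \<le> \<Gamma> \<parallel>u\<parallel>\<close>, hence into \<open>\<parallel>u\<parallel>\<^sup>2 \<le> (1 + \<Gamma>) \<langle>S u, u\<rangle>\<close> (\<open>friedrichs_velte_inf_sup\<close>).
  A coercive symmetric operator is invertible by the Riesz representation theorem, and the solution
  of the Dirichlet problem for \<open>S\<^bsup>-1\<^esup> u\<close> is the preimage of \<open>u\<close> under \<open>d\<^sup>*\<close> that the Babuska-Aziz
  inequality asks for, with \<open>C = 1 + \<Gamma>\<close>. Conversely, if \<open>d\<^sup>* w = u\<close> and \<open>d u = d\<^sup>* v\<close>, then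
  \<open>\<parallel>u\<parallel>\<^sup>2 = \<langle>v, d w\<rangle>\<close>, and \<open>\<parallel>d w\<parallel>\<^sup>2 = |w|\<^sub>1\<^sup>2 - \<parallel>u\<parallel>\<^sup>2 \<le> (C - 1) \<parallel>u\<parallel>\<^sup>2\<close>, which is the
  Friedrichs-Velte inequality with \<open>\<Gamma> = C - 1\<close>.

  The Babuska-Aziz and Hardy inequalities imply the improved Poincare inequality:
  \<open>\<parallel>u\<parallel>\<^sup>2 = \<langle>u, d\<^sup>* w\<rangle> = \<langle>\<rho> d u, w / \<rho>\<rangle>\<close>, and \<open>\<parallel>w / \<rho>\<parallel>\<^sup>2 \<le> H |w|\<^sub>1\<^sup>2 \<le> H C \<parallel>u\<parallel>\<^sup>2\<close>.

  The improved Poincare inequality implies the Friedrichs-Velte inequality, because \<open>d u = d\<^sup>* v\<close>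
  entails \<open>\<parallel>\<rho> d u\<parallel> \<le> 2 \<parallel>v\<parallel>\<close> (\<open>ex_weighted_d_repr\<close>). For smooth forms put \<open>g = d u\<close>. Since
  \<open>d g = 0\<close> and \<open>\<rho>\<close> has gradient of length at most one,
  \<open>\<parallel>\<rho> g\<parallel>\<^sup>2 = \<langle>\<rho>\<^sup>2 g, d\<^sup>* v\<rangle> = \<langle>d (\<rho>\<^sup>2 g), v\<rangle> = \<langle>2 \<rho> d\<rho> \<and> g, v\<rangle> \<le> 2 \<parallel>\<rho> g\<parallel> \<parallel>v\<parallel>\<close>. In general \<open>d u\<close>
  is only a distribution. The computation is done for mollified forms, with a smooth cutoff of
  Lipschitz constant one in place of \<open>\<rho>\<close> (\<open>cutoff_estimate\<close>). In the limit it bounds the functional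
  \<open>\<phi> \<mapsto> \<langle>u, d\<^sup>* \<phi>\<rangle>\<close> by \<open>2 \<parallel>v\<parallel> \<parallel>\<phi> / \<rho>\<parallel>\<close>, and the Riesz representation theorem in the weighted space
  produces the function \<open>g\<close> together with the estimate.

  Two facts tie the concrete definitions to this argument. The first is the fundamental lemma of the
  calculus of variations: weak derivatives are determined up to null sets, so that the chosen
  derivatives and the norms of the completions have the expected values (\<open>d_dual_eq\<close>,
  \<open>H01_limit_norm\<close>). The second is that the energy of a test form splits both as
  \<open>\<parallel>d \<phi>\<parallel>\<^sup>2 + \<parallel>d\<^sup>* \<phi>\<parallel>\<^sup>2\<close> and as the sum of the squared norms of its partial derivatives (\<open>energy_eq\<close>).
  This follows from the anticommutation relations between exterior and interior multiplication.
\<close>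

section \<open>Riesz representation in a space with a semi-inner product\<close>

text \<open>The elements will be functions that are not identified when they agree almost everywhere, so the
  form is only semidefinite. Linear combinations are a parameter; for functions they are
  formed pointwise.\<close>
locale semi_inner_space =
  fixes V :: "'a set" and lc :: "real \<Rightarrow> 'a \<Rightarrow> real \<Rightarrow> 'a \<Rightarrow> 'a" and B :: "'a \<Rightarrow> 'a \<Rightarrow> real"
  assumes V_ne: "V \<noteq> {}"
    and lc_closed: "x \<in> V \<Longrightarrow> y \<in> V \<Longrightarrow> lc a x b y \<in> V"
    and B_lc: "x \<in> V \<Longrightarrow> y \<in> V \<Longrightarrow> z \<in> V \<Longrightarrow> B z (lc a x b y) = a * B z x + b * B z y"
    and B_sym: "x \<in> V \<Longrightarrow> y \<in> V \<Longrightarrow> B x y = B y x"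
    and B_nonneg: "x \<in> V \<Longrightarrow> 0 \<le> B x x"
begin

lemma B_lc_self:
  assumes "x \<in> V" "y \<in> V"
  shows "B (lc a x b y) (lc a x b y) = a\<^sup>2 * B x x + 2 * a * b * B x y + b\<^sup>2 * B y y"
proof -
  have c: "lc a x b y \<in> V" using assms by (rule lc_closed)
  have "B (lc a x b y) (lc a x b y) = a * B (lc a x b y) x + b * B (lc a x b y) y"
    by (rule B_lc[OF assms c])
  also have "B (lc a x b y) x = a * B x x + b * B x y"
    by (simp add: B_sym[OF c assms(1)] B_lc assms)
  also have "B (lc a x b y) y = a * B x y + b * B y y"
    by (simp add: B_sym[OF c assms(2)] B_lc assms B_sym[OF assms(2) assms(1)])
  finally show ?thesis by (simp add: power2_eq_square algebra_simps)
qed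

lemma cauchy_schwarz:
  assumes "x \<in> V" "y \<in> V"
  shows "(B x y)\<^sup>2 \<le> B x x * B y y"
proof -
  have q: "0 \<le> t\<^sup>2 * B x x + 2 * t * s * B x y + s\<^sup>2 * B y y" for t s
    using B_nonneg[OF lc_closed[OF assms]] B_lc_self[OF assms] by metis
  show ?thesis
  proof (cases "B x x = 0")
    case False
    hence p: "B x x > 0" using B_nonneg[OF assms(1)] by simp
    have "0 \<le> B x x * (B x x * B y y - (B x y)\<^sup>2)"
      using q[of "- B x y" "B x x"] by (simp add: power2_eq_square algebra_simps)
    thus ?thesis using p by (simp add: zero_le_mult_iff)
  next
    case True
    \<comment> \<open>The discriminant argument breaks down here; the value at this point already forces \<open>B x y = 0\<close>.\<close>
    have "0 \<le> 2 * (-(B y y + 1) * B x y) * B x y + (B x y)\<^sup>2 * B y y"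
      using q[of "-(B y y + 1)" "B x y"] True by (simp add: power2_eq_square algebra_simps)
    hence "(B x y)\<^sup>2 * (B y y + 2) \<le> 0" by (simp add: power2_eq_square algebra_simps)
    moreover have "B y y + 2 > 0" using B_nonneg[OF assms(2)] by simp
    ultimately have "(B x y)\<^sup>2 \<le> 0" by (simp add: mult_le_0_iff)
    thus ?thesis using True by simp
  qed
qed

text \<open>A minimising sequence of \<open>B x x - 2 F x\<close> is Cauchy by the parallelogram law and
  represents \<open>F\<close> in the limit. Completeness is left to the applications, which find
  the limit in a larger space than \<open>V\<close>.\<close>
lemma riesz_sequence:
  assumes F_lc: "\<And>a x b y. x \<in> V \<Longrightarrow> y \<in> V \<Longrightarrow> F (lc a x b y) = a * F x + b * F y"
    and F_bound: "\<And>x. x \<in> V \<Longrightarrow> (F x)\<^sup>2 \<le> K * B x x"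
  obtains x :: "nat \<Rightarrow> 'a" where "\<And>k. x k \<in> V"
    and "\<And>e. 0 < e \<Longrightarrow> \<exists>N. \<forall>j\<ge>N. \<forall>k\<ge>N. B (lc 1 (x j) (-1) (x k)) (lc 1 (x j) (-1) (x k)) < e"
    and "\<And>y. y \<in> V \<Longrightarrow> (\<lambda>k. B (x k) y) \<longlonglongrightarrow> F y"
proof -
  define J where "J x = B x x - 2 * F x" for x
  have J_lower: "- \<bar>K\<bar> \<le> J x" if x: "x \<in> V" for x
  proof -
    define b where "b = B x x"
    have b0: "0 \<le> b" using B_nonneg[OF x] by (simp add: b_def)
    have "(F x)\<^sup>2 \<le> \<bar>K\<bar> * b"
      using F_bound[OF x] b0 mult_right_mono[of K "\<bar>K\<bar>" b] unfolding b_def by linarith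
    moreover have "4 * (\<bar>K\<bar> * b) \<le> (\<bar>K\<bar> + b)\<^sup>2"
      using sum_squares_ge_zero[of "\<bar>K\<bar> - b" 0] by (simp add: power2_eq_square algebra_simps)
    ultimately have "(2 * F x)\<^sup>2 \<le> (\<bar>K\<bar> + b)\<^sup>2" by (simp add: power_mult_distrib)
    hence "2 * F x \<le> \<bar>K\<bar> + b" using b0 power2_le_imp_le[of "2 * F x" "\<bar>K\<bar> + b"] by simp
    thus ?thesis by (simp add: J_def b_def)
  qed
  define m where "m = Inf (J ` V)"
  have bdd: "bdd_below (J ` V)" using J_lower by (auto simp: bdd_below_def)
  have m_le: "m \<le> J x" if "x \<in> V" for x
    unfolding m_def using bdd that by (simp add: cInf_lower)
  have "\<exists>x\<in>V. J x < m + 1 / real (Suc k)" for k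
    using cInf_lessD[of "J ` V" "m + 1 / real (Suc k)"] V_ne unfolding m_def[symmetric] by auto
  then obtain x where xV: "\<And>k. x k \<in> V" and xJ: "\<And>k. J (x k) < m + 1 / real (Suc k)"
    by metis
  have diff: "B (lc 1 (x j) (-1) (x k)) (lc 1 (x j) (-1) (x k)) \<le> 2 / real (Suc j) + 2 / real (Suc k)"
    for j k
  proof -
    have "m \<le> J (lc (1/2) (x j) (1/2) (x k))" by (intro m_le lc_closed xV)
    hence "4 * m \<le> B (x j) (x j) + 2 * B (x j) (x k) + B (x k) (x k) - 4 * F (x j) - 4 * F (x k)"
      unfolding J_def B_lc_self[OF xV xV] F_lc[OF xV xV] by (simp add: power2_eq_square)
    moreover have "B (x j) (x j) - 2 * F (x j) < m + 1 / real (Suc j)"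
      "B (x k) (x k) - 2 * F (x k) < m + 1 / real (Suc k)" using xJ unfolding J_def by auto
    ultimately show ?thesis unfolding B_lc_self[OF xV xV] by (simp add: power2_eq_square)
  qed
  show ?thesis
  proof
    show "x k \<in> V" for k by (rule xV)
    fix e :: real assume e: "0 < e"
    obtain N :: nat where N: "4 / e < real N" using reals_Archimedean2 by blast
    show "\<exists>N. \<forall>j\<ge>N. \<forall>k\<ge>N. B (lc 1 (x j) (-1) (x k)) (lc 1 (x j) (-1) (x k)) < e"
    proof (intro exI allI impI)
      fix j k assume "N \<le> j" "N \<le> k"
      hence "4 / e < real (Suc j)" "4 / e < real (Suc k)" using N by auto
      hence "2 / real (Suc j) < e / 2" "2 / real (Suc k) < e / 2" using e by (auto simp: field_simps)
      thus "B (lc 1 (x j) (-1) (x k)) (lc 1 (x j) (-1) (x k)) < e" using diff[of j k] by linarith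
    qed
  next
    fix y assume y: "y \<in> V"
    have est: "(B (x k) y - F y)\<^sup>2 \<le> (B y y + 1) * (1 / real (Suc k))" for k
    proof -
      define b where "b = B y y + 1"
      define r where "r = B (x k) y - F y"
      have b: "0 < b" using B_nonneg[OF y] by (simp add: b_def)
      \<comment> \<open>Moving from \<open>x k\<close> in the direction \<open>y\<close> by the nearly optimal amount \<open>c\<close> cannot
        lower \<open>J\<close> by more than \<open>1 / (k + 1)\<close>. The summand 1 in \<open>b\<close> covers the case \<open>B y y = 0\<close>.\<close>
      define c where "c = - (r / b)"
      have cr: "c * r = - (r * r / b)" by (simp add: c_def)
      have "m \<le> J (lc 1 (x k) c y)" by (intro m_le lc_closed xV y)
      also have "\<dots> = J (x k) + 2 * (c * r) + c\<^sup>2 * B y y"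
        unfolding J_def B_lc_self[OF xV y] F_lc[OF xV y] r_def by (simp add: algebra_simps)
      also have "c\<^sup>2 * B y y \<le> c\<^sup>2 * b" unfolding b_def by (intro mult_left_mono) auto
      also have "c\<^sup>2 * b = r * r / b" using b by (simp add: c_def power2_eq_square)
      finally have "r * r / b \<le> 1 / real (Suc k)" using xJ[of k] cr by simp
      thus ?thesis using b unfolding r_def b_def by (simp add: field_simps power2_eq_square)
    qed
    have "(\<lambda>k. (B y y + 1) * (1 / real (Suc k))) \<longlonglongrightarrow> (B y y + 1) * 0"
      by (intro tendsto_intros LIMSEQ_Suc lim_1_over_n)
    hence lim: "(\<lambda>k. (B y y + 1) * (1 / real (Suc k))) \<longlonglongrightarrow> 0" by simp
    have "(\<lambda>k. (B (x k) y - F y)\<^sup>2) \<longlonglongrightarrow> 0"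
      by (rule tendsto_sandwich[OF always_eventually always_eventually tendsto_const lim])
         (use est in auto)
    hence "(\<lambda>k. B (x k) y - F y) \<longlonglongrightarrow> 0" by simp
    thus "(\<lambda>k. B (x k) y) \<longlonglongrightarrow> F y" by (simp add: LIM_zero_iff)
  qed
qed

end

section \<open>Exterior and interior multiplication\<close>

text \<open>Left multiplication with \<open>dx\<^sub>i\<close> in the exterior algebra. Its adjoint below is the contraction with the
  \<open>i\<close>-th coordinate vector. In terms of these operators \<open>d = \<Sum>\<^sub>i dx\<^sub>i \<and> \<partial>\<^sub>i\<close>, and all sign computations
  are confined to the anticommutation relations.\<close>
definition ext_mult :: "'n::{finite,linorder} \<Rightarrow> real^('n set) \<Rightarrow> real^('n set)" where
  "ext_mult i a = (\<chi> I. if i \<in> I then wedge_sign i (I - {i}) * a $ (I - {i}) else 0)"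

definition int_mult :: "'n::{finite,linorder} \<Rightarrow> real^('n set) \<Rightarrow> real^('n set)" where
  "int_mult i a = (\<chi> J. if i \<notin> J then wedge_sign i J * a $ (insert i J) else 0)"

lemma linear_ext_mult: "linear (ext_mult i)"
  by (rule linearI) (auto simp: ext_mult_def vec_eq_iff algebra_simps)

lemma linear_int_mult: "linear (int_mult i)"
  by (rule linearI) (auto simp: int_mult_def vec_eq_iff algebra_simps)

lemmas bounded_linear_ext_mult = linear_conv_bounded_linear[THEN iffD1, OF linear_ext_mult]
lemmas bounded_linear_int_mult = linear_conv_bounded_linear[THEN iffD1, OF linear_int_mult]

lemma wedge_sign_square [simp]: "wedge_sign i J * wedge_sign i J = 1"
  by (simp add: wedge_sign_def flip: power_add mult_2)

lemma wedge_sign_square' [simp]: "wedge_sign i J * (wedge_sign i J * c) = c"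
  by (simp flip: mult.assoc)

lemma wedge_sign_insert:
  assumes "k \<notin> J"
  shows "wedge_sign i (insert k J) = (if k < i then - wedge_sign i J else wedge_sign i J)"
proof (cases "k < i")
  case True
  have "{j \<in> insert k J. j < i} = insert k {j \<in> J. j < i}" using True by auto
  moreover have "finite {j \<in> J. j < i}" by simp
  ultimately show ?thesis using assms True by (simp add: wedge_sign_def)
next
  case False
  hence "{j \<in> insert k J. j < i} = {j \<in> J. j < i}" by auto
  thus ?thesis using False by (simp add: wedge_sign_def)
qed

lemma int_ext_anticomm:
  "int_mult i (ext_mult k a) + ext_mult k (int_mult i a) = (if i = k then a else 0)"
proof (cases "i = k")
  case True
  thus ?thesis
    by (auto simp: vec_eq_iff int_mult_def ext_mult_def insert_absorb)
next
  case False
  have "(int_mult i (ext_mult k a) + ext_mult k (int_mult i a)) $ J = 0" for J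
  proof (cases "i \<notin> J \<and> k \<in> J")
    case True
    define J' where "J' = J - {k}"
    have J: "J = insert k J'" and k: "k \<notin> J'" and i: "i \<notin> J'" using True by (auto simp: J'_def)
    have e: "insert i (insert k J') - {k} = insert i J'" using False k by auto
    show ?thesis
      using False True i k
      by (auto simp: int_mult_def ext_mult_def J e wedge_sign_insert insert_Diff_if)
  next
    case F: False
    thus ?thesis using False by (auto simp: int_mult_def ext_mult_def)
  qed
  thus ?thesis using False by (simp add: vec_eq_iff)
qed

lemma ext_mult_anticomm: "ext_mult i (ext_mult k a) = - ext_mult k (ext_mult i a)"
proof -
  have "ext_mult i (ext_mult k a) $ J = - ext_mult k (ext_mult i a) $ J" for J
  proof (cases "i \<in> J \<and> k \<in> J \<and> i \<noteq> k")
    case True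
    define J' where "J' = J - {k} - {i}"
    have J: "J - {k} = insert i J'" "J - {i} = insert k J'" and k: "k \<notin> J'" and i: "i \<notin> J'"
      using True by (auto simp: J'_def)
    show ?thesis using True i k
      by (auto simp: ext_mult_def J wedge_sign_insert insert_Diff_if)
  next
    case False thus ?thesis by (auto simp: ext_mult_def)
  qed
  thus ?thesis by (simp add: vec_eq_iff)
qed

lemma ext_mult_inner: "ext_mult i a \<bullet> b = a \<bullet> int_mult i b"
proof -
  have "ext_mult i a \<bullet> b = (\<Sum>I\<in>{I. i \<in> I}. wedge_sign i (I - {i}) * a $ (I - {i}) * b $ I)"
    unfolding inner_vec_def by (rule sum.mono_neutral_cong_right) (auto simp: ext_mult_def)
  also have "\<dots> = (\<Sum>J\<in>{J. i \<notin> J}. a $ J * (wedge_sign i J * b $ (insert i J)))"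
    by (rule sum.reindex_bij_witness[of _ "insert i" "\<lambda>I. I - {i}"]) (auto simp: insert_absorb)
  also have "\<dots> = a \<bullet> int_mult i b"
    unfolding inner_vec_def by (rule sum.mono_neutral_cong_left) (auto simp: int_mult_def)
  finally show ?thesis .
qed

lemma ext_mult_Lam: "a \<in> Lam l \<Longrightarrow> ext_mult i a \<in> Lam (l + 1)"
proof -
  have "card (I - {i}) \<noteq> l" if "i \<in> I" "card I \<noteq> l + 1" for I
    using that card_Suc_Diff1[of I i] by auto
  moreover assume "a \<in> Lam l"
  ultimately show ?thesis unfolding Lam_def ext_mult_def by simp
qed

lemma int_mult_Lam: "a \<in> Lam (l + 1) \<Longrightarrow> int_mult i a \<in> Lam l"
  unfolding Lam_def int_mult_def by auto

lemma int_mult_Lam': "a \<in> Lam l \<Longrightarrow> 1 \<le> l \<Longrightarrow> int_mult i a \<in> Lam (l - 1)"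
  using int_mult_Lam[of a "l - 1"] by simp

lemma subspace_Lam: "subspace (Lam l)"
  by (auto simp: subspace_def Lam_def)

text \<open>Summing the anticommutation relations against a symmetric array leaves the trace. For second
  derivatives this is \<open>d\<^sup>* d + d d\<^sup>* = - \<Delta>\<close>; for \<open>\<xi>\<^sub>i \<xi>\<^sub>k a\<close> it is
  \<open>|\<xi> \<and> a|\<^sup>2 + |\<xi> \<rfloor> a|\<^sup>2 = |\<xi>|\<^sup>2 |a|\<^sup>2\<close>.\<close>
lemma int_ext_sum:
  fixes c :: "'n::{finite,linorder} \<Rightarrow> 'n \<Rightarrow> real^('n set)"
  assumes sym: "\<And>i k. c i k = c k i"
  shows "(\<Sum>i\<in>UNIV. \<Sum>k\<in>UNIV. int_mult i (ext_mult k (c i k)) + ext_mult i (int_mult k (c i k)))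
    = (\<Sum>i\<in>UNIV. c i i)"
proof -
  have "(\<Sum>i\<in>UNIV. \<Sum>k\<in>UNIV. ext_mult i (int_mult k (c i k)))
      = (\<Sum>i\<in>UNIV. \<Sum>k\<in>UNIV. ext_mult k (int_mult i (c i k)))"
    by (subst sum.swap) (simp add: sym)
  hence "(\<Sum>i\<in>UNIV. \<Sum>k\<in>UNIV. int_mult i (ext_mult k (c i k)) + ext_mult i (int_mult k (c i k)))
    = (\<Sum>i\<in>UNIV. \<Sum>k\<in>UNIV. int_mult i (ext_mult k (c i k)) + ext_mult k (int_mult i (c i k)))"
    by (simp add: sum.distrib)
  also have "\<dots> = (\<Sum>i\<in>UNIV. \<Sum>k\<in>UNIV. if i = k then c i k else 0)"
    by (simp add: int_ext_anticomm)
  finally show ?thesis by simp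
qed

text \<open>For second derivatives this is \<open>d d = 0\<close>.\<close>
lemma ext_ext_sum:
  fixes c :: "'n::{finite,linorder} \<Rightarrow> 'n \<Rightarrow> real^('n set)"
  assumes sym: "\<And>i k. c i k = c k i"
  shows "(\<Sum>i\<in>UNIV. \<Sum>k\<in>UNIV. ext_mult i (ext_mult k (c i k))) = 0"
proof -
  define S where "S = (\<Sum>i\<in>UNIV. \<Sum>k\<in>UNIV. ext_mult i (ext_mult k (c i k)))"
  have "S = (\<Sum>i\<in>UNIV. \<Sum>k\<in>UNIV. - ext_mult k (ext_mult i (c i k)))"
    unfolding S_def by (subst ext_mult_anticomm) simp
  also have "\<dots> = - (\<Sum>i\<in>UNIV. \<Sum>k\<in>UNIV. ext_mult k (ext_mult i (c i k)))"
    by (simp add: sum_negf)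
  also have "(\<Sum>i\<in>UNIV. \<Sum>k\<in>UNIV. ext_mult k (ext_mult i (c i k))) = S"
    unfolding S_def by (subst sum.swap) (simp add: sym)
  finally have "S = - S" .
  hence "S + S = 0" by (metis ab_left_minus)
  hence "2 *\<^sub>R S = 0" by (simp add: scaleR_2)
  thus ?thesis by (simp add: S_def)
qed

lemma norm_wedge_le:
  fixes \<xi> :: "'n::{finite,linorder} \<Rightarrow> real"
  shows "(norm (\<Sum>i\<in>UNIV. \<xi> i *\<^sub>R ext_mult i a))\<^sup>2 \<le> (\<Sum>i\<in>UNIV. (\<xi> i)\<^sup>2) * (norm a)\<^sup>2"
proof -
  let ?W = "\<Sum>i\<in>UNIV. \<xi> i *\<^sub>R ext_mult i a" and ?C = "\<Sum>i\<in>UNIV. \<xi> i *\<^sub>R int_mult i a"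
  have W: "?W \<bullet> ?W = (\<Sum>i\<in>UNIV. \<Sum>k\<in>UNIV. (\<xi> i * \<xi> k) * (a \<bullet> int_mult i (ext_mult k a)))"
    by (subst sum.swap)
      (simp add: inner_sum_left inner_sum_right ext_mult_inner sum_distrib_left mult_ac)
  have C: "?C \<bullet> ?C = (\<Sum>i\<in>UNIV. \<Sum>k\<in>UNIV. (\<xi> i * \<xi> k) * (a \<bullet> ext_mult i (int_mult k a)))"
    by (simp add: inner_sum_left inner_sum_right inner_commute[of a] ext_mult_inner mult.assoc)
       (simp add: inner_commute sum_distrib_left)
  have "?W \<bullet> ?W + ?C \<bullet> ?C
     = a \<bullet> (\<Sum>i\<in>UNIV. \<Sum>k\<in>UNIV. int_mult i (ext_mult k ((\<xi> i * \<xi> k) *\<^sub>R a))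
          + ext_mult i (int_mult k ((\<xi> i * \<xi> k) *\<^sub>R a)))"
    unfolding W C
    by (simp add: inner_sum_right inner_add_right sum.distrib
        linear_scale[OF linear_ext_mult] linear_scale[OF linear_int_mult])
  also have "\<dots> = a \<bullet> (\<Sum>i\<in>UNIV. (\<xi> i * \<xi> i) *\<^sub>R a)"
    by (subst int_ext_sum) (auto simp: mult.commute)
  also have "\<dots> = (\<Sum>i\<in>UNIV. (\<xi> i)\<^sup>2) * (norm a)\<^sup>2"
    by (simp add: inner_sum_right sum_distrib_right flip: power2_norm_eq_inner)
      (simp add: power2_eq_square)
  finally show ?thesis using inner_ge_zero[of ?C] unfolding power2_norm_eq_inner[of ?W] by linarith
qed

section \<open>Calculus of iterated partial derivatives\<close>

lemma partial_derivI:
  "(f has_derivative D) (at x) \<Longrightarrow> partial_deriv i f x = D (axis i 1)"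
  unfolding partial_deriv_def using frechet_derivative_at by metis

lemma has_derivative_partial_deriv:
  assumes "f differentiable (at x)"
  shows "(f has_derivative (\<lambda>h. \<Sum>i\<in>UNIV. h $ i *\<^sub>R partial_deriv i f x)) (at x)"
proof -
  have d: "(f has_derivative frechet_derivative f (at x)) (at x)"
    using assms frechet_derivative_works by blast
  have l: "linear (frechet_derivative f (at x))" by (rule linear_frechet_derivative[OF assms])
  have "frechet_derivative f (at x) h = (\<Sum>i\<in>UNIV. h $ i *\<^sub>R partial_deriv i f x)" for h
  proof -
    have "h = (\<Sum>i\<in>UNIV. h $ i *\<^sub>R axis i 1)"
      by (simp add: vec_eq_iff axis_def if_distrib cong: if_cong)
    hence "frechet_derivative f (at x) h = frechet_derivative f (at x) (\<Sum>i\<in>UNIV. h $ i *\<^sub>R axis i 1)"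
      by simp
    also have "\<dots> = (\<Sum>i\<in>UNIV. h $ i *\<^sub>R partial_deriv i f x)"
      by (simp add: linear_sum[OF l] linear_scale[OF l] partial_deriv_def)
    finally show ?thesis .
  qed
  thus ?thesis using d by (metis (no_types, lifting) ext)
qed

lemma partial_deriv_has_vector_derivative:
  fixes f :: "real^'n \<Rightarrow> 'b::euclidean_space"
  assumes "f differentiable (at (x + t *\<^sub>R axis i 1))"
  shows "((\<lambda>t. f (x + t *\<^sub>R axis i 1)) has_vector_derivative partial_deriv i f (x + t *\<^sub>R axis i 1)) (at t within S)"
proof -
  have "((\<lambda>t. f (x + t *\<^sub>R axis i 1)) has_derivative
      (\<lambda>h. \<Sum>k\<in>UNIV. (h *\<^sub>R axis i 1) $ k *\<^sub>R partial_deriv k f (x + t *\<^sub>R axis i 1))) (at t within S)"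
    by (rule has_derivative_compose[of "\<lambda>t. x + t *\<^sub>R axis i 1" _ _ S f, OF _ has_derivative_partial_deriv[OF assms]])
       (auto intro!: derivative_eq_intros)
  moreover have "(\<Sum>k\<in>UNIV. (h *\<^sub>R axis i (1::real)) $ k *\<^sub>R c k) = h *\<^sub>R c i" for h and c :: "_ \<Rightarrow> 'b"
    by (subst sum.mono_neutral_cong_right[where S="{i}" and h="\<lambda>k. h *\<^sub>R c k"]) (auto simp: axis_def)
  ultimately show ?thesis unfolding has_vector_derivative_def by simp
qed

lemma C_k_imp_continuous: "C_k k f \<Longrightarrow> continuous_on UNIV f"
  by (cases k) (auto intro!: continuous_at_imp_continuous_on differentiable_imp_continuous_within)

lemma C_k_SucD: "C_k (Suc k) f \<Longrightarrow> C_k k f"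
proof (induction k arbitrary: f)
  case 0
  hence "continuous_on UNIV f" by (rule C_k_imp_continuous)
  thus ?case by simp
next
  case (Suc k)
  have "C_k k (partial_deriv i f)" for i
    using Suc.prems C_k.simps(2)[of "Suc k" f] by (intro Suc.IH) blast
  thus ?case unfolding C_k.simps(2)[of k f] using Suc.prems C_k.simps(2)[of "Suc k" f] by blast
qed

lemma partial_deriv_bounded_linear:
  assumes "bounded_linear L" "f differentiable (at x)"
  shows "partial_deriv i (\<lambda>x. L (f x)) x = L (partial_deriv i f x)"
  using partial_derivI[OF bounded_linear.has_derivative[OF assms(1) assms(2)[unfolded frechet_derivative_works]]]
  by (simp add: partial_deriv_def)

lemma C_k_bounded_linear:
  assumes L: "bounded_linear L" and "C_k k f"
  shows "C_k k (\<lambda>x. L (f x))"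
  using assms(2)
proof (induction k arbitrary: f)
  case 0 thus ?case by (auto intro: bounded_linear.continuous_on[OF L])
next
  case (Suc k)
  hence "partial_deriv i (\<lambda>x. L (f x)) = (\<lambda>x. L (partial_deriv i f x))" for i
    by (auto simp: partial_deriv_bounded_linear[OF L])
  moreover have "(\<lambda>x. L (f x)) differentiable at x" for x
    using Suc.prems bounded_linear.has_derivative[OF L] unfolding differentiable_def C_k.simps by blast
  ultimately show ?case using Suc by simp
qed

lemma partial_deriv_bilinear:
  assumes "bounded_bilinear p" "f differentiable (at x)" "g differentiable (at x)"
  shows "partial_deriv i (\<lambda>x. p (f x) (g x)) x = p (f x) (partial_deriv i g x) + p (partial_deriv i f x) (g x)"
  using partial_derivI[OF bounded_bilinear.FDERIV[OF assms(1) assms(2,3)[unfolded frechet_derivative_works]]]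
  by (simp add: partial_deriv_def)

lemma partial_deriv_add:
  assumes "f differentiable (at x)" "g differentiable (at x)"
  shows "partial_deriv i (\<lambda>x. f x + g x) x = partial_deriv i f x + partial_deriv i g x"
  using partial_derivI[OF has_derivative_add[OF assms[unfolded frechet_derivative_works]]]
  by (simp add: partial_deriv_def)

lemma C_k_add:
  assumes "C_k k f" "C_k k g"
  shows "C_k k (\<lambda>x. f x + g x)"
  using assms
proof (induction k arbitrary: f g)
  case 0 thus ?case by (auto intro: continuous_intros)
next
  case (Suc k)
  hence "partial_deriv i (\<lambda>x. f x + g x) = (\<lambda>x. partial_deriv i f x + partial_deriv i g x)" for i
    by (auto simp: partial_deriv_add)
  thus ?case using Suc by simp
qed

lemma C_k_bilinear:
  assumes p: "bounded_bilinear p" and "C_k k f" "C_k k g"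
  shows "C_k k (\<lambda>x. p (f x) (g x))"
  using assms(2,3)
proof (induction k arbitrary: f g)
  case 0 thus ?case by (auto intro: bounded_bilinear.continuous_on[OF p])
next
  case (Suc k)
  hence e: "partial_deriv i (\<lambda>x. p (f x) (g x)) = (\<lambda>x. p (f x) (partial_deriv i g x) + p (partial_deriv i f x) (g x))" for i
    by (auto simp: partial_deriv_bilinear[OF p])
  have "(\<lambda>x. p (f x) (g x)) differentiable at x" for x
    using Suc.prems bounded_bilinear.FDERIV[OF p] unfolding differentiable_def C_k.simps by blast
  moreover have "C_k k f" "C_k k g" using Suc.prems C_k_SucD by auto
  ultimately show ?case using Suc by (auto simp: e intro!: C_k_add)
qed

lemma partial_deriv_const [simp]: "partial_deriv i (\<lambda>x. c) x = 0"
  using partial_derivI[OF has_derivative_const] by blast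

lemma C_k_const [simp]: "C_k k (\<lambda>x::real^'n. c)"
proof (induction k arbitrary: c)
  case (Suc k)
  have "partial_deriv i (\<lambda>x::real^'n. c) = (\<lambda>x. 0)" for i by (rule ext) simp
  thus ?case using Suc[of 0] by simp
qed auto

lemma C_k_linear_fun:
  assumes "bounded_linear L" shows "C_k k L"
proof (cases k)
  case 0 thus ?thesis using assms by (simp add: linear_continuous_on)
next
  case (Suc m)
  have "partial_deriv i L = (\<lambda>x. L (axis i 1))" for i
    using partial_derivI[OF bounded_linear_imp_has_derivative[OF assms]] by blast
  thus ?thesis using Suc assms bounded_linear_imp_differentiable by auto
qed

lemma partial_deriv_reflect:
  assumes "f differentiable (at (x - y))"
  shows "partial_deriv i (\<lambda>y. f (x - y)) y = - partial_deriv i f (x - y)"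
proof -
  have "((\<lambda>y. f (x - y)) has_derivative (\<lambda>h. frechet_derivative f (at (x - y)) (- h))) (at y)"
    by (rule has_derivative_compose[of "\<lambda>y. x - y" _ _ UNIV f, OF _ assms[unfolded frechet_derivative_works]])
       (auto intro!: derivative_eq_intros)
  from partial_derivI[OF this] show ?thesis
    using linear_frechet_derivative[OF assms] by (simp add: partial_deriv_def linear_neg)
qed

lemma C_k_reflect:
  assumes "C_k k f" shows "C_k k (\<lambda>y. f (x - y))"
  using assms
proof (induction k arbitrary: f)
  case 0 thus ?case by (auto intro!: continuous_on_compose2[of UNIV f UNIV "\<lambda>y. x - y"] continuous_intros)
next
  case (Suc k)
  have "partial_deriv i (\<lambda>y. f (x - y)) = (\<lambda>y. - partial_deriv i f (x - y))" for i
    using Suc.prems by (auto simp: partial_deriv_reflect)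
  moreover have "C_k k (\<lambda>y. - partial_deriv i f (x - y))" for i
    using Suc by (intro C_k_bounded_linear[OF bounded_linear_minus[OF bounded_linear_ident]]) auto
  moreover have "(\<lambda>y. f (x - y)) differentiable at y" for y
    by (rule differentiable_compose[of f "\<lambda>y. x - y"]) (use Suc.prems in \<open>auto intro: derivative_intros\<close>)
  ultimately show ?case by simp
qed

definition smooth :: "(real^'n \<Rightarrow> 'b::euclidean_space) \<Rightarrow> bool" where
  "smooth f \<longleftrightarrow> (\<forall>k. C_k k f)"

lemma smoothD_diff: "smooth f \<Longrightarrow> f differentiable (at x)"
  unfolding smooth_def using C_k.simps(2) by blast
lemma smoothD_cont: "smooth f \<Longrightarrow> continuous_on UNIV f"
  unfolding smooth_def using C_k_imp_continuous by blast
lemma smooth_partial_deriv: "smooth f \<Longrightarrow> smooth (partial_deriv i f)"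
  unfolding smooth_def using C_k.simps(2) by blast
lemma smooth_bounded_linear: "bounded_linear L \<Longrightarrow> smooth f \<Longrightarrow> smooth (\<lambda>x. L (f x))"
  unfolding smooth_def using C_k_bounded_linear by blast
lemma smooth_bilinear: "bounded_bilinear p \<Longrightarrow> smooth f \<Longrightarrow> smooth g \<Longrightarrow> smooth (\<lambda>x. p (f x) (g x))"
  unfolding smooth_def using C_k_bilinear by blast
lemma smooth_add: "smooth f \<Longrightarrow> smooth g \<Longrightarrow> smooth (\<lambda>x. f x + g x)"
  unfolding smooth_def using C_k_add by blast
lemma smooth_const [simp]: "smooth (\<lambda>x. c)" by (simp add: smooth_def)
lemma smooth_linear_fun: "bounded_linear L \<Longrightarrow> smooth L"
  unfolding smooth_def using C_k_linear_fun by blast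
lemma smooth_reflect: "smooth f \<Longrightarrow> smooth (\<lambda>y. f (x - y))"
  unfolding smooth_def using C_k_reflect by blast
lemma smooth_sum: "(\<And>i. i \<in> A \<Longrightarrow> smooth (f i)) \<Longrightarrow> smooth (\<lambda>x. \<Sum>i\<in>A. f i x)"
  by (induction A rule: infinite_finite_induct) (auto intro: smooth_add)

lemma smooth_scaleR_fun: "smooth f \<Longrightarrow> smooth g \<Longrightarrow> smooth (\<lambda>x. f x *\<^sub>R g x)"
  by (rule smooth_bilinear[OF bounded_bilinear_scaleR])
lemma smooth_inner: "smooth f \<Longrightarrow> smooth g \<Longrightarrow> smooth (\<lambda>x. f x \<bullet> g x)"
  by (rule smooth_bilinear[OF bounded_bilinear_inner])
lemma smooth_mult: "smooth f \<Longrightarrow> smooth g \<Longrightarrow> smooth (\<lambda>x. f x * g x :: real)"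
  using smooth_scaleR_fun[of f g] by simp
lemma smooth_scaleR: "smooth f \<Longrightarrow> smooth (\<lambda>x. c *\<^sub>R f x)"
  by (rule smooth_bounded_linear[OF bounded_linear_scaleR_right])
lemma smooth_minus: "smooth f \<Longrightarrow> smooth (\<lambda>x. - f x)"
  using smooth_scaleR[of f "-1"] by simp
lemma smooth_diff: "smooth f \<Longrightarrow> smooth g \<Longrightarrow> smooth (\<lambda>x. f x - g x)"
  using smooth_add[OF _ smooth_minus] by fastforce
lemma smooth_component: "smooth f \<Longrightarrow> smooth (\<lambda>x. f x $ i)" for f :: "real^'n \<Rightarrow> real^'m"
  by (rule smooth_bounded_linear[OF bounded_linear_vec_nth])

lemma partial_deriv_scaleR:
  "smooth f \<Longrightarrow> partial_deriv i (\<lambda>x. c *\<^sub>R f x) x = c *\<^sub>R partial_deriv i f x"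
  by (rule partial_deriv_bounded_linear[OF bounded_linear_scaleR_right smoothD_diff])
lemma partial_deriv_component:
  fixes f :: "real^'n \<Rightarrow> real^'m"
  shows "smooth f \<Longrightarrow> partial_deriv i (\<lambda>x. f x $ j) x = partial_deriv i f x $ j"
  by (rule partial_deriv_bounded_linear[OF bounded_linear_vec_nth smoothD_diff])

lemma partial_deriv_sum:
  assumes "\<And>k. k \<in> A \<Longrightarrow> smooth (f k)"
  shows "partial_deriv i (\<lambda>x. \<Sum>k\<in>A. f k x) x = (\<Sum>k\<in>A. partial_deriv i (f k) x)"
  using assms
  by (induction A rule: infinite_finite_induct)
     (auto simp: partial_deriv_add smoothD_diff smooth_sum)

lemma partial_deriv_zero_off_closed:
  assumes "closed K" "\<And>x. x \<notin> K \<Longrightarrow> f x = 0" "x \<notin> K"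
  shows "partial_deriv i f x = 0"
proof -
  have "((\<lambda>x. 0) has_derivative (\<lambda>x. 0)) (at x)" by simp
  hence "(f has_derivative (\<lambda>x. 0)) (at x)"
    by (rule has_derivative_transform_within_open[where s="-K"]) (use assms in auto)
  thus ?thesis using partial_derivI by blast
qed

text \<open>The mean value theorem is applied first in direction \<open>i\<close> and then in direction \<open>j\<close>. The
  second difference is symmetric in \<open>i\<close> and \<open>j\<close>, so letting \<open>h\<close> tend to zero proves that
  partial derivatives commute.\<close>
lemma second_difference:
  fixes f :: "real^'n \<Rightarrow> real"
  assumes f: "smooth f" and h: "0 < h"
  shows "\<exists>p. dist p x \<le> 2 * h \<and>
    f (x + h *\<^sub>R axis i 1 + h *\<^sub>R axis j 1) - f (x + h *\<^sub>R axis i 1) - f (x + h *\<^sub>R axis j 1) + f x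
      = h\<^sup>2 * partial_deriv j (partial_deriv i f) p"
proof -
  note [simp] = has_real_derivative_iff_has_vector_derivative
  define \<phi> where "\<phi> s = f ((x + h *\<^sub>R axis j 1) + s *\<^sub>R axis i 1) - f (x + s *\<^sub>R axis i 1)" for s
  have "\<exists>s>0. s < h \<and> \<phi> h - \<phi> 0 = (h - 0) *
     (partial_deriv i f ((x + h *\<^sub>R axis j 1) + s *\<^sub>R axis i 1) - partial_deriv i f (x + s *\<^sub>R axis i 1))"
    unfolding \<phi>_def
    by (rule MVT2[OF h]) (auto intro!: derivative_intros partial_deriv_has_vector_derivative smoothD_diff f)
  then obtain s where s: "0 < s" "s < h" and \<phi>: "\<phi> h - \<phi> 0 = h *
     (partial_deriv i f ((x + h *\<^sub>R axis j 1) + s *\<^sub>R axis i 1) - partial_deriv i f (x + s *\<^sub>R axis i 1))"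
    by auto
  define \<psi> where "\<psi> t = partial_deriv i f ((x + s *\<^sub>R axis i 1) + t *\<^sub>R axis j 1)" for t
  have "\<exists>t>0. t < h \<and> \<psi> h - \<psi> 0 = (h - 0) * partial_deriv j (partial_deriv i f) ((x + s *\<^sub>R axis i 1) + t *\<^sub>R axis j 1)"
    unfolding \<psi>_def
    by (rule MVT2[OF h]) (auto intro!: partial_deriv_has_vector_derivative smoothD_diff smooth_partial_deriv f)
  then obtain t where t: "0 < t" "t < h"
    and \<psi>: "\<psi> h - \<psi> 0 = h * partial_deriv j (partial_deriv i f) ((x + s *\<^sub>R axis i 1) + t *\<^sub>R axis j 1)"
    by auto
  let ?p = "(x + s *\<^sub>R axis i 1) + t *\<^sub>R axis j 1"
  have "dist ?p x = norm (s *\<^sub>R axis i (1::real) + t *\<^sub>R axis j 1)" by (simp add: dist_norm algebra_simps)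
  also have "\<dots> \<le> norm (s *\<^sub>R axis i (1::real)) + norm (t *\<^sub>R axis j (1::real))" by (rule norm_triangle_ineq)
  also have "\<dots> \<le> 2 * h" using s t by simp
  finally have "dist ?p x \<le> 2 * h" .
  moreover have "f (x + h *\<^sub>R axis i 1 + h *\<^sub>R axis j 1) - f (x + h *\<^sub>R axis i 1) - f (x + h *\<^sub>R axis j 1) + f x = \<phi> h - \<phi> 0"
    unfolding \<phi>_def by (simp add: algebra_simps)
  moreover have "\<phi> h - \<phi> 0 = h * (\<psi> h - \<psi> 0)" unfolding \<phi> \<psi>_def by (simp add: algebra_simps)
  ultimately show ?thesis using \<psi> by (intro exI[of _ ?p]) (simp add: power2_eq_square)
qed

lemma partial_deriv_commute_real:
  fixes f :: "real^'n \<Rightarrow> real"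
  assumes f: "smooth f"
  shows "partial_deriv i (partial_deriv j f) x = partial_deriv j (partial_deriv i f) x"
proof -
  let ?h = "\<lambda>k. 1 / real (Suc k)"
  have "\<exists>p q. dist p x \<le> 2 * ?h k \<and> dist q x \<le> 2 * ?h k \<and>
    partial_deriv j (partial_deriv i f) p = partial_deriv i (partial_deriv j f) q" for k
  proof -
    have h: "?h k > 0" by simp
    obtain p where p: "dist p x \<le> 2 * ?h k" "f (x + ?h k *\<^sub>R axis i 1 + ?h k *\<^sub>R axis j 1) - f (x + ?h k *\<^sub>R axis i 1) - f (x + ?h k *\<^sub>R axis j 1) + f x
      = (?h k)\<^sup>2 * partial_deriv j (partial_deriv i f) p" using second_difference[OF f h] by blast
    obtain q where q: "dist q x \<le> 2 * ?h k" "f (x + ?h k *\<^sub>R axis j 1 + ?h k *\<^sub>R axis i 1) - f (x + ?h k *\<^sub>R axis j 1) - f (x + ?h k *\<^sub>R axis i 1) + f x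
      = (?h k)\<^sup>2 * partial_deriv i (partial_deriv j f) q" using second_difference[OF f h] by blast
    have "(?h k)\<^sup>2 * partial_deriv j (partial_deriv i f) p = (?h k)\<^sup>2 * partial_deriv i (partial_deriv j f) q"
      unfolding p(2)[symmetric] q(2)[symmetric] by (simp add: add_ac)
    thus ?thesis using p(1) q(1) h by (intro exI[of _ p] exI[of _ q]) simp
  qed
  then obtain p q where pq: "\<And>k. dist (p k) x \<le> 2 * ?h k" "\<And>k. dist (q k) x \<le> 2 * ?h k"
    and e: "\<And>k. partial_deriv j (partial_deriv i f) (p k) = partial_deriv i (partial_deriv j f) (q k)"
    by metis
  have "(\<lambda>k. 2 * ?h k) \<longlonglongrightarrow> 2 * 0" by (intro tendsto_intros LIMSEQ_Suc lim_1_over_n)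
  hence h0: "(\<lambda>k. 2 * ?h k) \<longlonglongrightarrow> 0" by simp
  have lim: "r \<longlonglongrightarrow> x" if "\<And>k. dist (r k) x \<le> 2 * ?h k" for r
    by (rule tendsto_dist_iff[THEN iffD2], rule tendsto_sandwich[OF always_eventually always_eventually tendsto_const h0])
       (use that in auto)
  from lim[OF pq(1)] lim[OF pq(2)] have "p \<longlonglongrightarrow> x" "q \<longlonglongrightarrow> x" .
  moreover have "isCont (partial_deriv j (partial_deriv i f)) x" "isCont (partial_deriv i (partial_deriv j f)) x"
    using smoothD_cont[OF smooth_partial_deriv[OF smooth_partial_deriv[OF f]]]
    by (auto simp: continuous_on_eq_continuous_at)
  ultimately have "(\<lambda>k. partial_deriv j (partial_deriv i f) (p k)) \<longlonglongrightarrow> partial_deriv j (partial_deriv i f) x"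
    "(\<lambda>k. partial_deriv i (partial_deriv j f) (q k)) \<longlonglongrightarrow> partial_deriv i (partial_deriv j f) x"
    by (auto intro: isCont_tendsto_compose)
  thus ?thesis unfolding e using LIMSEQ_unique by blast
qed

lemma partial_deriv_commute:
  fixes f :: "real^'n \<Rightarrow> 'b::euclidean_space"
  assumes f: "smooth f"
  shows "partial_deriv i (partial_deriv j f) x = partial_deriv j (partial_deriv i f) x"
proof (rule euclidean_eqI)
  fix b :: 'b assume "b \<in> Basis"
  have bl: "bounded_linear (\<lambda>y. y \<bullet> b)" by (rule bounded_linear_inner_left)
  have e: "partial_deriv i (partial_deriv j f) x \<bullet> b = partial_deriv i (partial_deriv j (\<lambda>x. f x \<bullet> b)) x" for i j
  proof -
    have "partial_deriv j (\<lambda>x. f x \<bullet> b) = (\<lambda>x. partial_deriv j f x \<bullet> b)"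
      by (auto simp: partial_deriv_bounded_linear[OF bl] smoothD_diff[OF f])
    thus ?thesis
      by (simp add: partial_deriv_bounded_linear[OF bl] smoothD_diff smooth_partial_deriv f)
  qed
  show "partial_deriv i (partial_deriv j f) x \<bullet> b = partial_deriv j (partial_deriv i f) x \<bullet> b"
    unfolding e by (rule partial_deriv_commute_real) (rule smooth_bounded_linear[OF bl f])
qed

lemma ext_deriv_eq: "ext_deriv u x = (\<Sum>i\<in>UNIV. ext_mult i (partial_deriv i u x))"
proof -
  have "(\<Sum>i\<in>I. wedge_sign i (I - {i}) * partial_deriv i u x $ (I - {i}))
     = (\<Sum>i\<in>UNIV. if i \<in> I then wedge_sign i (I - {i}) * partial_deriv i u x $ (I - {i}) else 0)" for I
    by (simp add: sum.If_cases)
  thus ?thesis by (simp add: vec_eq_iff ext_deriv_def ext_mult_def)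
qed

lemma coderiv_eq: "coderiv u x = - (\<Sum>i\<in>UNIV. int_mult i (partial_deriv i u x))"
proof -
  have "(\<Sum>i\<in>-J. wedge_sign i J * partial_deriv i u x $ (insert i J))
     = (\<Sum>i\<in>UNIV. if i \<notin> J then wedge_sign i J * partial_deriv i u x $ (insert i J) else 0)" for J
    by (simp add: sum.If_cases Compl_eq)
  thus ?thesis by (simp add: vec_eq_iff coderiv_def int_mult_def)
qed

lemma smooth_ext_deriv: "smooth u \<Longrightarrow> smooth (ext_deriv u)"
  unfolding ext_deriv_eq[abs_def]
  by (intro smooth_sum smooth_bounded_linear[OF bounded_linear_ext_mult] smooth_partial_deriv)

lemma smooth_coderiv: "smooth u \<Longrightarrow> smooth (coderiv u)"
  unfolding coderiv_eq[abs_def]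
  by (intro smooth_minus smooth_sum smooth_bounded_linear[OF bounded_linear_int_mult] smooth_partial_deriv)

lemma partial_deriv_ext_deriv:
  assumes "smooth u"
  shows "partial_deriv k (ext_deriv u) x = (\<Sum>i\<in>UNIV. ext_mult i (partial_deriv k (partial_deriv i u) x))"
  unfolding ext_deriv_eq[abs_def]
  by (simp add: partial_deriv_sum smooth_bounded_linear[OF bounded_linear_ext_mult] smooth_partial_deriv assms
      partial_deriv_bounded_linear[OF bounded_linear_ext_mult] smoothD_diff)

lemma partial_deriv_coderiv:
  assumes "smooth u"
  shows "partial_deriv k (coderiv u) x = - (\<Sum>i\<in>UNIV. int_mult i (partial_deriv k (partial_deriv i u) x))"
  unfolding coderiv_eq[abs_def]
  by (simp add: partial_deriv_sum smooth_bounded_linear[OF bounded_linear_int_mult] smooth_partial_deriv assms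
      partial_deriv_bounded_linear[OF bounded_linear_int_mult] smoothD_diff smooth_sum
      partial_deriv_bounded_linear[OF bounded_linear_minus[OF bounded_linear_ident]])

lemma ext_deriv_ext_deriv: 
  assumes "smooth u" shows "ext_deriv (ext_deriv u) x = 0"
  unfolding ext_deriv_eq[of "ext_deriv u"] partial_deriv_ext_deriv[OF assms]
  using ext_ext_sum[of "\<lambda>i k. partial_deriv i (partial_deriv k u) x"] partial_deriv_commute[OF assms]
  by (simp add: linear_sum[OF linear_ext_mult])

lemma hodge_laplacian_eq:
  assumes "smooth u"
  shows "hodge_laplacian u x = - (\<Sum>i\<in>UNIV. partial_deriv i (partial_deriv i u) x)"
proof -
  have "hodge_laplacian u x = - (\<Sum>i\<in>UNIV. \<Sum>k\<in>UNIV.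
      int_mult i (ext_mult k (partial_deriv i (partial_deriv k u) x))
      + ext_mult i (int_mult k (partial_deriv i (partial_deriv k u) x)))"
    unfolding hodge_laplacian_def ext_deriv_eq[of "coderiv u"] coderiv_eq[of "ext_deriv u"]
      partial_deriv_ext_deriv[OF assms] partial_deriv_coderiv[OF assms]
    by (simp add: linear_sum[OF linear_ext_mult] linear_sum[OF linear_int_mult]
        linear_neg[OF linear_ext_mult] sum.distrib sum_negf)
  thus ?thesis
    using int_ext_sum[of "\<lambda>i k. partial_deriv i (partial_deriv k u) x"] partial_deriv_commute[OF assms] by simp
qed

section \<open>Integration by parts for compactly supported functions\<close>

lemma integrable_csupp:
  fixes f :: "real^'n \<Rightarrow> 'b::euclidean_space"
  assumes "continuous_on UNIV f" "compact K" "\<And>x. x \<notin> K \<Longrightarrow> f x = 0"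
  shows "integrable lborel f"
proof -
  have "integrable lborel (\<lambda>x. indicator K x *\<^sub>R f x)"
    using assms by (intro borel_integrable_compact) (auto intro: continuous_on_subset)
  moreover have "(\<lambda>x. indicator K x *\<^sub>R f x) = f" using assms(3) by (auto simp: indicator_def)
  ultimately show ?thesis by simp
qed

lemma bounded_csupp:
  fixes f :: "real^'n \<Rightarrow> 'b::euclidean_space"
  assumes "continuous_on UNIV f" "compact K" "\<And>x. x \<notin> K \<Longrightarrow> f x = 0"
  obtains M where "0 < M" "\<And>x. norm (f x) \<le> M"
proof -
  have "compact (f ` K)" using assms by (auto intro: compact_continuous_image continuous_on_subset)
  then obtain M where M: "0 < M" "\<forall>y\<in>f ` K. norm y \<le> M" using compact_imp_bounded bounded_pos by blast
  have "norm (f x) \<le> M" for x using M assms(3) by (cases "x \<in> K") auto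
  thus ?thesis using that M(1) by blast
qed

lemma integral_translate:
  fixes f :: "real^'n \<Rightarrow> real"
  assumes "f \<in> borel_measurable borel"
  shows "(LINT x|lborel. f (x + c)) = (LINT x|lborel. f x)"
proof -
  have "(LINT x|lborel. f x) = (LINT x|distr lborel borel ((+) c). f x)" by (simp add: lborel_distr_plus)
  also have "\<dots> = (LINT x|lborel. f (c + x))" using assms by (subst integral_distr) auto
  finally show ?thesis by (simp add: add.commute)
qed

lemma integrable_translate:
  fixes f :: "real^'n \<Rightarrow> real"
  assumes "integrable lborel f"
  shows "integrable lborel (\<lambda>x. f (x + c))"
proof -
  have [measurable]: "f \<in> borel_measurable borel" using borel_measurable_integrable[OF assms] by simp
  have "integrable (distr lborel borel ((+) c)) f" using assms by (simp add: lborel_distr_plus)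
  hence "integrable lborel (\<lambda>x. f (c + x))" by (subst (asm) integrable_distr_eq) auto
  thus ?thesis by (simp add: add.commute)
qed

text \<open>By translation invariance every difference quotient has integral zero. The difference quotients
  are dominated by a multiple of the indicator of a fixed ball, so the limit may be taken under the integral.\<close>
lemma integral_partial_deriv:
  fixes f :: "real^'n \<Rightarrow> real"
  assumes f: "smooth f" and K: "compact K" "\<And>x. x \<notin> K \<Longrightarrow> f x = 0"
  shows "(LINT x|lborel. partial_deriv i f x) = 0"
proof -
  let ?h = "\<lambda>k. 1 / real (Suc k)"
  let ?s = "\<lambda>k x. (f (x + ?h k *\<^sub>R axis i 1) - f x) / ?h k"
  have clK: "closed K" using K(1) by (rule compact_imp_closed)
  have fc: "continuous_on UNIV f" by (rule smoothD_cont[OF f])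
  have pc: "continuous_on UNIV (partial_deriv i f)" by (intro smoothD_cont smooth_partial_deriv f)
  have pz: "partial_deriv i f x = 0" if "x \<notin> K" for x
    by (rule partial_deriv_zero_off_closed[OF clK K(2) that])
  obtain M where M: "0 < M" "\<And>x. norm (partial_deriv i f x) \<le> M"
    using bounded_csupp[OF pc K(1) pz] by blast
  obtain R where R: "0 < R" "K \<subseteq> cball 0 R"
    using bounded_subset_ballD[OF compact_imp_bounded[OF K(1)], of 0] ball_subset_cball by blast
  have mf [measurable]: "f \<in> borel_measurable borel" using fc by (rule borel_measurable_continuous_onI)
  have mp [measurable]: "partial_deriv i f \<in> borel_measurable borel" using pc by (rule borel_measurable_continuous_onI)
  have int_f: "integrable lborel f" by (rule integrable_csupp[OF fc K])
  have h0: "?h \<longlonglongrightarrow> 0" by (intro LIMSEQ_Suc lim_1_over_n)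
  have lim: "(\<lambda>k. ?s k x) \<longlonglongrightarrow> partial_deriv i f x" for x
  proof -
    have "((\<lambda>t. f (x + t *\<^sub>R axis i 1)) has_real_derivative partial_deriv i f (x + 0 *\<^sub>R axis i 1)) (at 0)"
      unfolding has_real_derivative_iff_has_vector_derivative
      by (rule partial_deriv_has_vector_derivative[OF smoothD_diff[OF f]])
    hence "((\<lambda>h. (f (x + h *\<^sub>R axis i 1) - f x) / h) \<longlongrightarrow> partial_deriv i f x) (at 0)"
      by (simp add: DERIV_def)
    moreover have "filterlim ?h (at 0) sequentially" using h0 by (simp add: filterlim_at)
    ultimately show ?thesis by (rule filterlim_compose)
  qed
  \<comment> \<open>The increments are at most 1, so the quotients vanish outside the support enlarged by 1.\<close>
  have bound: "norm (?s k x) \<le> M * indicator (cball 0 (R + 1)) x" for k x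
  proof (cases "x \<in> cball 0 (R + 1)")
    case True
    have h: "0 < ?h k" by simp
    have "\<exists>t>0. t < ?h k \<and> f (x + ?h k *\<^sub>R axis i 1) - f (x + 0 *\<^sub>R axis i 1)
        = (?h k - 0) * partial_deriv i f (x + t *\<^sub>R axis i 1)"
      by (rule MVT2[OF h]) (auto simp: has_real_derivative_iff_has_vector_derivative
          intro!: partial_deriv_has_vector_derivative smoothD_diff f)
    then obtain t where "f (x + ?h k *\<^sub>R axis i 1) - f x = ?h k * partial_deriv i f (x + t *\<^sub>R axis i 1)"
      by auto
    hence "?s k x = partial_deriv i f (x + t *\<^sub>R axis i 1)" using h by simp
    thus ?thesis using M(2) True by simp
  next
    case False
    have "norm x \<le> norm (x + ?h k *\<^sub>R axis i 1) + norm (?h k *\<^sub>R axis i (1::real))"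
      by (metis add_diff_cancel_right' norm_triangle_ineq4)
    moreover have "norm (?h k *\<^sub>R axis i (1::real)) \<le> 1" by simp
    moreover have "R + 1 < norm x" using False by simp
    ultimately have "R < norm x" "R < norm (x + ?h k *\<^sub>R axis i 1)" by linarith+
    hence "x \<notin> K" "x + ?h k *\<^sub>R axis i 1 \<notin> K" using R(2) by auto
    thus ?thesis using False K(2) by simp
  qed
  have L: "(\<lambda>k. LINT x|lborel. ?s k x) \<longlonglongrightarrow> (LINT x|lborel. partial_deriv i f x)"
  proof (rule integral_dominated_convergence)
    show "integrable lborel (\<lambda>x::real^'n. M * indicator (cball 0 (R + 1)) x)"
      by (intro integrable_mult_right integrable_real_indicator) (use emeasure_bounded_finite[of "cball (0::real^'n) (R + 1)"] in auto)
  qed (use lim bound in auto)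
  have "(LINT x|lborel. ?s k x) = 0" for k
  proof -
    have "integrable lborel (\<lambda>x. f (x + ?h k *\<^sub>R axis i 1))"
      by (rule integrable_translate[OF int_f])
    hence "(LINT x|lborel. f (x + ?h k *\<^sub>R axis i 1) - f x) = 0"
      using int_f integral_translate[OF mf] by simp
    thus ?thesis by (subst integral_divide_zero) simp
  qed
  hence "(\<lambda>k. LINT x|lborel. ?s k x) = (\<lambda>_. 0)" by (rule ext)
  with L have "(\<lambda>k. 0) \<longlonglongrightarrow> (LINT x|lborel. partial_deriv i f x)" by metis
  thus ?thesis by (simp add: LIMSEQ_const_iff)
qed

lemma integral_by_parts:
  fixes f g :: "real^'n \<Rightarrow> 'b::euclidean_space"
  assumes f: "smooth f" and g: "smooth g" and K: "compact K" "\<And>x. x \<notin> K \<Longrightarrow> f x = 0"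
  shows "(LINT x|lborel. partial_deriv i f x \<bullet> g x) = - (LINT x|lborel. f x \<bullet> partial_deriv i g x)"
proof -
  have clK: "closed K" using K(1) by (rule compact_imp_closed)
  have pz: "partial_deriv i f x = 0" if "x \<notin> K" for x
    by (rule partial_deriv_zero_off_closed[OF clK K(2) that])
  have "integrable lborel (\<lambda>x. partial_deriv i f x \<bullet> g x)" "integrable lborel (\<lambda>x. f x \<bullet> partial_deriv i g x)"
    by (intro integrable_csupp[OF _ K(1)] smoothD_cont smooth_inner smooth_partial_deriv f g; simp add: pz K)+
  moreover have "(LINT x|lborel. partial_deriv i (\<lambda>x. f x \<bullet> g x) x) = 0"
    by (rule integral_partial_deriv[OF smooth_inner[OF f g] K(1)]) (simp add: K)
  moreover have "partial_deriv i (\<lambda>x. f x \<bullet> g x) x = f x \<bullet> partial_deriv i g x + partial_deriv i f x \<bullet> g x" for x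
    by (rule partial_deriv_bilinear[OF bounded_bilinear_inner smoothD_diff[OF f] smoothD_diff[OF g]])
  ultimately show ?thesis by simp
qed

lemma integral_by_parts':
  fixes f g :: "real^'n \<Rightarrow> 'b::euclidean_space"
  assumes f: "smooth f" and g: "smooth g" and K: "compact K" "\<And>x. x \<notin> K \<Longrightarrow> g x = 0"
  shows "(LINT x|lborel. partial_deriv i f x \<bullet> g x) = - (LINT x|lborel. f x \<bullet> partial_deriv i g x)"
  using integral_by_parts[OF g f K, of i] by (simp add: inner_commute)

lemma ext_deriv_zero_off_closed:
  assumes "closed K" "\<And>x. x \<notin> K \<Longrightarrow> f x = 0" "x \<notin> K"
  shows "ext_deriv f x = 0"
  by (simp add: ext_deriv_eq partial_deriv_zero_off_closed[OF assms] linear_0[OF linear_ext_mult])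

lemma coderiv_zero_off_closed:
  assumes "closed K" "\<And>x. x \<notin> K \<Longrightarrow> f x = 0" "x \<notin> K"
  shows "coderiv f x = 0"
  by (simp add: coderiv_eq partial_deriv_zero_off_closed[OF assms] linear_0[OF linear_int_mult])

lemma green_ext_coderiv:
  fixes f g :: "'n::{finite,linorder} form"
  assumes f: "smooth f" and g: "smooth g" and K: "compact K" "(\<forall>x. x \<notin> K \<longrightarrow> f x = 0) \<or> (\<forall>x. x \<notin> K \<longrightarrow> g x = 0)"
  shows "(LINT x|lborel. ext_deriv f x \<bullet> g x) = (LINT x|lborel. f x \<bullet> coderiv g x)"
proof -
  have clK: "closed K" using K(1) by (rule compact_imp_closed)
  have K': "(\<forall>x. x \<notin> K \<longrightarrow> f x = 0) \<or> (\<forall>x. x \<notin> K \<longrightarrow> g x = 0)" using K(2) by auto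
  have z: "f x = 0 \<and> partial_deriv i f x = 0 \<or> g x = 0 \<and> partial_deriv i g x = 0" if "x \<notin> K" for x i
    using K' partial_deriv_zero_off_closed[OF clK _ that] that by blast
  have sg: "smooth (\<lambda>x. int_mult i (g x))" for i by (rule smooth_bounded_linear[OF bounded_linear_int_mult g])
  have pg: "partial_deriv i (\<lambda>x. int_mult i (g x)) x = int_mult i (partial_deriv i g x)" for i x
    by (rule partial_deriv_bounded_linear[OF bounded_linear_int_mult smoothD_diff[OF g]])
  have z1: "partial_deriv i f x \<bullet> int_mult i (g x) = 0" "f x \<bullet> int_mult i (partial_deriv i g x) = 0" if "x \<notin> K" for x i
    using z[OF that, of i] by (auto simp: linear_0[OF linear_int_mult])
  have i1: "integrable lborel (\<lambda>x. partial_deriv i f x \<bullet> int_mult i (g x))" for i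
    by (intro integrable_csupp[OF _ K(1)] smoothD_cont smooth_inner smooth_partial_deriv f sg z1)
  have i2: "integrable lborel (\<lambda>x. f x \<bullet> int_mult i (partial_deriv i g x))" for i
    unfolding pg[symmetric]
    by (intro integrable_csupp[OF _ K(1)] smoothD_cont smooth_inner smooth_partial_deriv f sg)
       (simp add: z1 pg)
  have e: "(LINT x|lborel. partial_deriv i f x \<bullet> int_mult i (g x)) = - (LINT x|lborel. f x \<bullet> int_mult i (partial_deriv i g x))" for i
    using K'
  proof
    assume "\<forall>x. x \<notin> K \<longrightarrow> f x = 0"
    thus ?thesis using integral_by_parts[OF f sg K(1), of i i] by (simp add: pg)
  next
    assume "\<forall>x. x \<notin> K \<longrightarrow> g x = 0"
    thus ?thesis using integral_by_parts'[OF f sg K(1), of i i] by (simp add: pg linear_0[OF linear_int_mult])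
  qed
  have "(LINT x|lborel. ext_deriv f x \<bullet> g x) = (LINT x|lborel. (\<Sum>i\<in>UNIV. partial_deriv i f x \<bullet> int_mult i (g x)))"
    by (simp add: ext_deriv_eq inner_sum_left ext_mult_inner)
  also have "\<dots> = (\<Sum>i\<in>UNIV. - (LINT x|lborel. f x \<bullet> int_mult i (partial_deriv i g x)))"
    by (subst Bochner_Integration.integral_sum) (auto intro: i1 simp: e)
  also have "\<dots> = - (LINT x|lborel. (\<Sum>i\<in>UNIV. f x \<bullet> int_mult i (partial_deriv i g x)))"
    by (subst Bochner_Integration.integral_sum) (auto intro: i2 simp: sum_negf)
  also have "\<dots> = (LINT x|lborel. f x \<bullet> coderiv g x)"
    by (simp add: coderiv_eq inner_sum_right)
  finally show ?thesis .
qed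

lemma hodge_integral:
  fixes f g :: "'n::{finite,linorder} form"
  assumes f: "smooth f" and g: "smooth g" and K: "compact K" "\<And>x. x \<notin> K \<Longrightarrow> g x = 0"
  shows "(LINT x|lborel. hodge_laplacian f x \<bullet> g x)
    = (LINT x|lborel. ext_deriv f x \<bullet> ext_deriv g x) + (LINT x|lborel. coderiv f x \<bullet> coderiv g x)"
proof -
  have clK: "closed K" using K(1) by (rule compact_imp_closed)
  note sm = smooth_ext_deriv smooth_coderiv f g
  have "integrable lborel (\<lambda>x. coderiv (ext_deriv f) x \<bullet> g x)" "integrable lborel (\<lambda>x. ext_deriv (coderiv f) x \<bullet> g x)"
    by (intro integrable_csupp[OF _ K(1)] smoothD_cont smooth_inner sm; simp add: K)+
  moreover have "(LINT x|lborel. coderiv (ext_deriv f) x \<bullet> g x) = (LINT x|lborel. ext_deriv f x \<bullet> ext_deriv g x)"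
    using green_ext_coderiv[OF g smooth_ext_deriv[OF f] K(1)] K(2) by (simp add: inner_commute)
  moreover have "(LINT x|lborel. ext_deriv (coderiv f) x \<bullet> g x) = (LINT x|lborel. coderiv f x \<bullet> coderiv g x)"
    using green_ext_coderiv[OF smooth_coderiv[OF f] g K(1)] K(2) by simp
  ultimately show ?thesis by (simp add: hodge_laplacian_def inner_add_left)
qed

lemma hodge_integral_partial:
  fixes f g :: "'n::{finite,linorder} form"
  assumes f: "smooth f" and g: "smooth g" and K: "compact K" "\<And>x. x \<notin> K \<Longrightarrow> g x = 0"
  shows "(LINT x|lborel. hodge_laplacian f x \<bullet> g x)
    = (\<Sum>i\<in>UNIV. LINT x|lborel. partial_deriv i f x \<bullet> partial_deriv i g x)"
proof -
  note sm = smooth_partial_deriv f g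
  have i: "integrable lborel (\<lambda>x. partial_deriv i (partial_deriv i f) x \<bullet> g x)" for i
    by (intro integrable_csupp[OF _ K(1)] smoothD_cont smooth_inner sm) (simp add: K)
  have "(LINT x|lborel. hodge_laplacian f x \<bullet> g x) = (LINT x|lborel. - (\<Sum>i\<in>UNIV. partial_deriv i (partial_deriv i f) x \<bullet> g x))"
    by (simp add: hodge_laplacian_eq[OF f] inner_sum_left)
  also have "\<dots> = (\<Sum>i\<in>UNIV. - (LINT x|lborel. partial_deriv i (partial_deriv i f) x \<bullet> g x))"
    using i by (simp add: sum_negf)
  also have "\<dots> = (\<Sum>i\<in>UNIV. LINT x|lborel. partial_deriv i f x \<bullet> partial_deriv i g x)"
    using integral_by_parts'[OF smooth_partial_deriv[OF f] g K] by simp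
  finally show ?thesis .
qed

text \<open>Integrate \<open>\<partial>\<^sub>i (x\<^sub>i |f|\<^sup>2) = |f|\<^sup>2 + 2 x\<^sub>i f \<bullet> \<partial>\<^sub>i f\<close> and absorb half of \<open>|f|\<^sup>2\<close>, using \<open>|x\<^sub>i| \<le> R\<close> on the
  support.\<close>
lemma poincare_csupp:
  fixes f :: "real^'n \<Rightarrow> 'b::euclidean_space"
  assumes f: "smooth f" and K: "compact K" "\<And>x. x \<notin> K \<Longrightarrow> f x = 0" and R: "K \<subseteq> cball 0 R"
  shows "(LINT x|lborel. f x \<bullet> f x) \<le> 4 * R\<^sup>2 * (LINT x|lborel. partial_deriv i f x \<bullet> partial_deriv i f x)"
proof -
  have clK: "closed K" using K(1) by (rule compact_imp_closed)
  have pz: "partial_deriv i f x = 0" if "x \<notin> K" for x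
    by (rule partial_deriv_zero_off_closed[OF clK K(2) that])
  define g where "g x = x $ i * (f x \<bullet> f x)" for x
  have sx: "smooth (\<lambda>x::real^'n. x $ i)" by (rule smooth_linear_fun[OF bounded_linear_vec_nth])
  have sff: "smooth (\<lambda>x. f x \<bullet> f x)" by (rule smooth_inner[OF f f])
  have sg: "smooth g" unfolding g_def by (rule smooth_mult[OF sx sff])
  have px: "partial_deriv i (\<lambda>x::real^'n. x $ i) x = 1" for x
  proof -
    have "((\<lambda>x::real^'n. x $ i) has_derivative (\<lambda>x. x $ i)) (at x)"
      by (rule bounded_linear_imp_has_derivative[OF bounded_linear_vec_nth])
    from partial_derivI[OF this] show ?thesis by (simp add: axis_def)
  qed
  have pg: "partial_deriv i g x = 2 * (x $ i * (f x \<bullet> partial_deriv i f x)) + f x \<bullet> f x" for x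
    unfolding g_def
    using partial_deriv_bilinear[OF bounded_bilinear_mult smoothD_diff[OF sx] smoothD_diff[OF sff], of i x]
      partial_deriv_bilinear[OF bounded_bilinear_inner smoothD_diff[OF f] smoothD_diff[OF f], of i x]
    by (simp add: px inner_commute algebra_simps)
  have i1: "integrable lborel (\<lambda>x. f x \<bullet> f x)" "integrable lborel (\<lambda>x. partial_deriv i f x \<bullet> partial_deriv i f x)"
    by (intro integrable_csupp[OF _ K(1)] smoothD_cont smooth_inner smooth_partial_deriv f; simp add: K pz)+
  have pw: "f x \<bullet> f x - partial_deriv i g x \<le> (f x \<bullet> f x) / 2 + 2 * R\<^sup>2 * (partial_deriv i f x \<bullet> partial_deriv i f x)" for x
  proof (cases "x \<in> K")
    case True
    hence "\<bar>x $ i\<bar> \<le> R" using R component_le_norm_cart[of x i] by auto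
    let ?v = "(1/2) *\<^sub>R f x + (x $ i) *\<^sub>R partial_deriv i f x"
    have "?v \<bullet> ?v = (f x \<bullet> f x) / 4 + x $ i * (f x \<bullet> partial_deriv i f x) + (x $ i)\<^sup>2 * (partial_deriv i f x \<bullet> partial_deriv i f x)"
      by (simp add: inner_add_left inner_add_right inner_commute[of "partial_deriv i f x" "f x"] power2_eq_square algebra_simps)
    hence "- (x $ i * (f x \<bullet> partial_deriv i f x)) \<le> (f x \<bullet> f x) / 4 + (x $ i)\<^sup>2 * (partial_deriv i f x \<bullet> partial_deriv i f x)"
      using inner_ge_zero[of ?v] by linarith
    moreover have "(x $ i)\<^sup>2 * (partial_deriv i f x \<bullet> partial_deriv i f x) \<le> R\<^sup>2 * (partial_deriv i f x \<bullet> partial_deriv i f x)"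
      using power_mono[OF \<open>\<bar>x $ i\<bar> \<le> R\<close>, of 2] by (intro mult_right_mono) auto
    ultimately show ?thesis unfolding pg by simp
  next
    case False thus ?thesis using K pz by (simp add: pg)
  qed
  have gz: "x \<notin> K \<Longrightarrow> g x = 0" for x using K by (simp add: g_def)
  have ig: "integrable lborel (partial_deriv i g)"
    by (intro integrable_csupp[OF _ K(1)] smoothD_cont smooth_partial_deriv sg partial_deriv_zero_off_closed[OF clK gz])
  have "(LINT x|lborel. f x \<bullet> f x) = (LINT x|lborel. f x \<bullet> f x - partial_deriv i g x)"
    using i1 ig integral_partial_deriv[OF sg K(1) gz] by simp
  also have "\<dots> \<le> (LINT x|lborel. (f x \<bullet> f x) / 2 + 2 * R\<^sup>2 * (partial_deriv i f x \<bullet> partial_deriv i f x))"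
    using i1 ig pw by (intro integral_mono) auto
  also have "\<dots> = (LINT x|lborel. f x \<bullet> f x) / 2 + 2 * R\<^sup>2 * (LINT x|lborel. partial_deriv i f x \<bullet> partial_deriv i f x)"
    using i1 by simp
  finally show ?thesis by simp
qed

section \<open>The space of square integrable functions\<close>

abbreviation lcf :: "real \<Rightarrow> ('a \<Rightarrow> 'b::real_vector) \<Rightarrow> real \<Rightarrow> ('a \<Rightarrow> 'b) \<Rightarrow> ('a \<Rightarrow> 'b)" where
  "lcf a f b g \<equiv> (\<lambda>x. a *\<^sub>R f x + b *\<^sub>R g x)"

lemma L2_measurable: "u \<in> L2 \<Omega> \<Longrightarrow> u \<in> borel_measurable (lebesgue_on \<Omega>)"
  by (simp add: L2_def)

lemma L2_integrable: "u \<in> L2 \<Omega> \<Longrightarrow> integrable (lebesgue_on \<Omega>) (\<lambda>x. (norm (u x))\<^sup>2)"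
  by (simp add: L2_def)

lemma L2_inner_integrable:
  assumes "u \<in> L2 \<Omega>" "v \<in> L2 \<Omega>"
  shows "integrable (lebesgue_on \<Omega>) (\<lambda>x. u x \<bullet> v x)"
proof (rule Bochner_Integration.integrable_bound)
  show "integrable (lebesgue_on \<Omega>) (\<lambda>x. (norm (u x))\<^sup>2 + (norm (v x))\<^sup>2)"
    using assms by (intro Bochner_Integration.integrable_add L2_integrable)
  show "(\<lambda>x. u x \<bullet> v x) \<in> borel_measurable (lebesgue_on \<Omega>)"
    using assms by (intro borel_measurable_inner L2_measurable)
  have "\<bar>a \<bullet> b\<bar> \<le> (norm a)\<^sup>2 + (norm b)\<^sup>2" for a b :: 'b
  proof -
    have "\<bar>a \<bullet> b\<bar> \<le> norm a * norm b" by (rule Cauchy_Schwarz_ineq2)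
    moreover have "2 * (norm a * norm b) \<le> (norm a)\<^sup>2 + (norm b)\<^sup>2"
      using sum_squares_bound[of "norm a" "norm b"] by simp
    moreover have "0 \<le> norm a * norm b" by simp
    ultimately show ?thesis by linarith
  qed
  thus "AE x in lebesgue_on \<Omega>. norm (u x \<bullet> v x) \<le> norm ((norm (u x))\<^sup>2 + (norm (v x))\<^sup>2)" by simp
qed

lemma L2_iff_inner:
  "u \<in> L2 \<Omega> \<longleftrightarrow> u \<in> borel_measurable (lebesgue_on \<Omega>) \<and> integrable (lebesgue_on \<Omega>) (\<lambda>x. u x \<bullet> u x)"
  by (simp add: L2_def power2_norm_eq_inner)

lemma L2_lc:
  assumes "u \<in> L2 \<Omega>" "v \<in> L2 \<Omega>"
  shows "lcf a u b v \<in> L2 \<Omega>"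
  unfolding L2_iff_inner
proof
  show "lcf a u b v \<in> borel_measurable (lebesgue_on \<Omega>)"
    using assms L2_measurable by (intro borel_measurable_add borel_measurable_scaleR) auto
  have "integrable (lebesgue_on \<Omega>) (\<lambda>x. a\<^sup>2 * (u x \<bullet> u x) + 2 * a * b * (u x \<bullet> v x) + b\<^sup>2 * (v x \<bullet> v x))"
    using assms by (intro Bochner_Integration.integrable_add integrable_mult_right L2_inner_integrable)
  thus "integrable (lebesgue_on \<Omega>) (\<lambda>x. lcf a u b v x \<bullet> lcf a u b v x)"
    by (simp add: inner_add_left inner_add_right inner_commute power2_eq_square algebra_simps)
qed

lemma L2_diff: "u \<in> L2 \<Omega> \<Longrightarrow> v \<in> L2 \<Omega> \<Longrightarrow> (\<lambda>x. u x - v x) \<in> L2 \<Omega>"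
  using L2_lc[of u \<Omega> v 1 "-1"] by simp

lemma L2_zero [simp]: "(\<lambda>x. 0) \<in> L2 \<Omega>" by (simp add: L2_def)

lemma l2_inner_commute: "l2_inner \<Omega> u v = l2_inner \<Omega> v u"
  by (simp add: l2_inner_def inner_commute)

lemma l2_inner_lc:
  assumes "u \<in> L2 \<Omega>" "v \<in> L2 \<Omega>" "w \<in> L2 \<Omega>"
  shows "l2_inner \<Omega> w (lcf a u b v) = a * l2_inner \<Omega> w u + b * l2_inner \<Omega> w v"
proof -
  have "integrable (lebesgue_on \<Omega>) (\<lambda>x. a * (w x \<bullet> u x))" "integrable (lebesgue_on \<Omega>) (\<lambda>x. b * (w x \<bullet> v x))"
    using assms by (intro integrable_mult_right L2_inner_integrable; simp)+
  thus ?thesis by (simp add: l2_inner_def inner_add_right)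
qed

lemma l2_inner_lc_left:
  assumes "u \<in> L2 \<Omega>" "v \<in> L2 \<Omega>" "w \<in> L2 \<Omega>"
  shows "l2_inner \<Omega> (lcf a u b v) w = a * l2_inner \<Omega> u w + b * l2_inner \<Omega> v w"
  using l2_inner_lc[OF assms] by (simp add: l2_inner_commute)

lemma l2_inner_diff:
  assumes "u \<in> L2 \<Omega>" "v \<in> L2 \<Omega>" "w \<in> L2 \<Omega>"
  shows "l2_inner \<Omega> w (\<lambda>x. u x - v x) = l2_inner \<Omega> w u - l2_inner \<Omega> w v"
    "l2_inner \<Omega> (\<lambda>x. u x - v x) w = l2_inner \<Omega> u w - l2_inner \<Omega> v w"
  using l2_inner_lc[OF assms, of 1 "-1"] l2_inner_lc_left[OF assms, of 1 "-1"] by simp_all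

lemma l2_inner_self_nonneg [simp]: "0 \<le> l2_inner \<Omega> u u"
  unfolding l2_inner_def by (rule Bochner_Integration.integral_nonneg) simp

lemma semi_inner_space_L2: "semi_inner_space (L2 \<Omega>) lcf (l2_inner \<Omega>)"
  apply unfold_locales
  subgoal using L2_zero by blast
  subgoal by (rule L2_lc)
  subgoal by (rule l2_inner_lc)
  subgoal by (rule l2_inner_commute)
  subgoal by simp
  done

lemma l2_norm_nonneg [simp]: "0 \<le> l2_norm \<Omega> u" by (simp add: l2_norm_def)

lemma l2_norm_square: "(l2_norm \<Omega> u)\<^sup>2 = l2_inner \<Omega> u u" by (simp add: l2_norm_def)

lemma l2_cauchy_schwarz:
  assumes "u \<in> L2 \<Omega>" "v \<in> L2 \<Omega>"
  shows "\<bar>l2_inner \<Omega> u v\<bar> \<le> l2_norm \<Omega> u * l2_norm \<Omega> v"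
proof (rule power2_le_imp_le)
  show "\<bar>l2_inner \<Omega> u v\<bar>\<^sup>2 \<le> (l2_norm \<Omega> u * l2_norm \<Omega> v)\<^sup>2"
    using semi_inner_space.cauchy_schwarz[OF semi_inner_space_L2 assms] by (simp add: power_mult_distrib l2_norm_square)
qed simp

lemma l2_norm_triangle:
  assumes "u \<in> L2 \<Omega>" "v \<in> L2 \<Omega>"
  shows "l2_norm \<Omega> (\<lambda>x. u x + v x) \<le> l2_norm \<Omega> u + l2_norm \<Omega> v"
proof (rule power2_le_imp_le)
  have "(l2_norm \<Omega> (\<lambda>x. u x + v x))\<^sup>2 = l2_inner \<Omega> u u + 2 * l2_inner \<Omega> u v + l2_inner \<Omega> v v"
    using semi_inner_space.B_lc_self[OF semi_inner_space_L2 assms, of 1 1] by (simp add: l2_norm_square)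
  also have "\<dots> \<le> (l2_norm \<Omega> u)\<^sup>2 + 2 * (l2_norm \<Omega> u * l2_norm \<Omega> v) + (l2_norm \<Omega> v)\<^sup>2"
    using l2_cauchy_schwarz[OF assms] by (simp add: l2_norm_square)
  finally show "(l2_norm \<Omega> (\<lambda>x. u x + v x))\<^sup>2 \<le> (l2_norm \<Omega> u + l2_norm \<Omega> v)\<^sup>2"
    by (simp add: power2_eq_square algebra_simps)
qed simp

lemma l2_norm_minus_commute: "l2_norm \<Omega> (\<lambda>x. u x - v x) = l2_norm \<Omega> (\<lambda>x. v x - u x)"
proof -
  have "(a - b) \<bullet> (a - b) = (b - a) \<bullet> (b - a)" for a b :: 'b by (simp add: inner_diff_left inner_diff_right)
  thus ?thesis unfolding l2_norm_def l2_inner_def by metis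
qed

lemma l2_norm_triangle3:
  assumes "u \<in> L2 \<Omega>" "v \<in> L2 \<Omega>" "w \<in> L2 \<Omega>"
  shows "l2_norm \<Omega> (\<lambda>x. u x - w x) \<le> l2_norm \<Omega> (\<lambda>x. u x - v x) + l2_norm \<Omega> (\<lambda>x. v x - w x)"
  using l2_norm_triangle[OF L2_diff[OF assms(1,2)] L2_diff[OF assms(2,3)]] by simp

lemma l2_norm_mono:
  assumes "v \<in> L2 \<Omega>" "u \<in> borel_measurable (lebesgue_on \<Omega>)" "open \<Omega>" "0 \<le> c" "\<And>x. x \<in> \<Omega> \<Longrightarrow> norm (u x) \<le> c * norm (v x)"
  shows "u \<in> L2 \<Omega>" "l2_norm \<Omega> u \<le> c * l2_norm \<Omega> v"
proof -
  have le: "(norm (u x))\<^sup>2 \<le> c\<^sup>2 * (norm (v x))\<^sup>2" if "x \<in> \<Omega>" for x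
    using power_mono[OF assms(5)[OF that], of 2] by (simp add: power_mult_distrib)
  have sp: "space (lebesgue_on \<Omega>) = \<Omega>" by simp
  have iv: "integrable (lebesgue_on \<Omega>) (\<lambda>x. c\<^sup>2 * (norm (v x))\<^sup>2)" using L2_integrable[OF assms(1)] by simp
  have iu: "integrable (lebesgue_on \<Omega>) (\<lambda>x. (norm (u x))\<^sup>2)"
    by (rule Bochner_Integration.integrable_bound[OF iv])
       (use assms(2) le in \<open>auto intro!: AE_I2 borel_measurable_power borel_measurable_norm\<close>)
  thus "u \<in> L2 \<Omega>" using assms(2) by (simp add: L2_def)
  have "l2_inner \<Omega> u u \<le> c\<^sup>2 * l2_inner \<Omega> v v"
    unfolding l2_inner_def power2_norm_eq_inner[symmetric] integral_mult_right_zero[symmetric]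
    by (rule integral_mono[OF iu iv]) (use le sp in auto)
  hence "sqrt (l2_inner \<Omega> u u) \<le> sqrt (c\<^sup>2 * l2_inner \<Omega> v v)" by simp
  thus "l2_norm \<Omega> u \<le> c * l2_norm \<Omega> v" using assms(4) by (simp add: l2_norm_def real_sqrt_mult)
qed

lemma l2_norm_zero_iff:
  assumes "u \<in> L2 \<Omega>"
  shows "l2_norm \<Omega> u = 0 \<longleftrightarrow> (AE x in lebesgue_on \<Omega>. u x = 0)"
proof -
  have "l2_norm \<Omega> u = 0 \<longleftrightarrow> (LINT x|lebesgue_on \<Omega>. u x \<bullet> u x) = 0" by (simp add: l2_norm_def l2_inner_def)
  also have "\<dots> \<longleftrightarrow> (AE x in lebesgue_on \<Omega>. u x \<bullet> u x = 0)"
    by (rule integral_nonneg_eq_0_iff_AE) (use L2_inner_integrable[OF assms assms] in auto)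
  finally show ?thesis by simp
qed

lemma l2_inner_cong_AE:
  assumes "u \<in> L2 \<Omega>" "u' \<in> L2 \<Omega>" "v \<in> L2 \<Omega>" "l2_norm \<Omega> (\<lambda>x. u x - u' x) = 0"
  shows "l2_inner \<Omega> u v = l2_inner \<Omega> u' v"
  using l2_cauchy_schwarz[OF L2_diff[OF assms(1,2)] assms(3)] assms by (simp add: l2_inner_diff)

subsection \<open>Convergence\<close>

definition l2_tendsto :: "(real^'n) set \<Rightarrow> (nat \<Rightarrow> real^'n \<Rightarrow> 'b::euclidean_space) \<Rightarrow> (real^'n \<Rightarrow> 'b) \<Rightarrow> bool" where
  "l2_tendsto \<Omega> f g \<longleftrightarrow> (\<forall>k. f k \<in> L2 \<Omega>) \<and> g \<in> L2 \<Omega> \<and> (\<lambda>k. l2_norm \<Omega> (\<lambda>x. f k x - g x)) \<longlonglongrightarrow> 0"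

lemma l2_tendsto_norm:
  assumes "l2_tendsto \<Omega> f g"
  shows "(\<lambda>k. l2_norm \<Omega> (f k)) \<longlonglongrightarrow> l2_norm \<Omega> g"
proof -
  have m: "f k \<in> L2 \<Omega>" "g \<in> L2 \<Omega>" for k using assms by (auto simp: l2_tendsto_def)
  have lim: "(\<lambda>k. l2_norm \<Omega> (\<lambda>x. f k x - g x)) \<longlonglongrightarrow> 0" using assms by (auto simp: l2_tendsto_def)
  have "\<bar>l2_norm \<Omega> (f k) - l2_norm \<Omega> g\<bar> \<le> l2_norm \<Omega> (\<lambda>x. f k x - g x)" for k
    using l2_norm_triangle3[OF m(1)[of k] m(2) L2_zero] l2_norm_triangle3[OF m(2) m(1)[of k] L2_zero]
      l2_norm_minus_commute[of \<Omega> "f k" g] by simp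
  hence "(\<lambda>k. l2_norm \<Omega> (f k) - l2_norm \<Omega> g) \<longlonglongrightarrow> 0"
    by (intro Lim_null_comparison[OF _ lim]) auto
  thus ?thesis by (simp add: LIM_zero_iff)
qed

lemma l2_tendsto_inner:
  assumes "l2_tendsto \<Omega> f g" "l2_tendsto \<Omega> f' g'"
  shows "(\<lambda>k. l2_inner \<Omega> (f k) (f' k)) \<longlonglongrightarrow> l2_inner \<Omega> g g'"
proof -
  have m: "f k \<in> L2 \<Omega>" "g \<in> L2 \<Omega>" "f' k \<in> L2 \<Omega>" "g' \<in> L2 \<Omega>" for k using assms by (auto simp: l2_tendsto_def)
  have lim: "(\<lambda>k. l2_norm \<Omega> (\<lambda>x. f k x - g x)) \<longlonglongrightarrow> 0" "(\<lambda>k. l2_norm \<Omega> (\<lambda>x. f' k x - g' x)) \<longlonglongrightarrow> 0"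
    using assms by (auto simp: l2_tendsto_def)
  have b: "norm (l2_inner \<Omega> (f k) (f' k) - l2_inner \<Omega> g g') \<le> l2_norm \<Omega> (\<lambda>x. f k x - g x) * l2_norm \<Omega> (f' k)
      + l2_norm \<Omega> g * l2_norm \<Omega> (\<lambda>x. f' k x - g' x)" for k
  proof -
    have "l2_inner \<Omega> (f k) (f' k) - l2_inner \<Omega> g g'
        = l2_inner \<Omega> (\<lambda>x. f k x - g x) (f' k) + l2_inner \<Omega> g (\<lambda>x. f' k x - g' x)"
      by (simp add: l2_inner_diff m)
    thus ?thesis
      using l2_cauchy_schwarz[OF L2_diff[OF m(1)[of k] m(2)] m(3)[of k]]
        l2_cauchy_schwarz[OF m(2) L2_diff[OF m(3)[of k] m(4)]] by simp
  qed
  have "(\<lambda>k. l2_norm \<Omega> (\<lambda>x. f k x - g x) * l2_norm \<Omega> (f' k)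
      + l2_norm \<Omega> g * l2_norm \<Omega> (\<lambda>x. f' k x - g' x)) \<longlonglongrightarrow> 0 * l2_norm \<Omega> g' + l2_norm \<Omega> g * 0"
    by (intro tendsto_intros lim l2_tendsto_norm[OF assms(2)])
  hence z: "(\<lambda>k. l2_norm \<Omega> (\<lambda>x. f k x - g x) * l2_norm \<Omega> (f' k)
      + l2_norm \<Omega> g * l2_norm \<Omega> (\<lambda>x. f' k x - g' x)) \<longlonglongrightarrow> 0" by simp
  have "(\<lambda>k. l2_inner \<Omega> (f k) (f' k) - l2_inner \<Omega> g g') \<longlonglongrightarrow> 0"
    by (rule Lim_null_comparison[OF always_eventually z]) (use b in auto)
  thus ?thesis by (simp add: LIM_zero_iff)
qed

lemma l2_tendsto_const: "g \<in> L2 \<Omega> \<Longrightarrow> l2_tendsto \<Omega> (\<lambda>k. g) g"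
  by (simp add: l2_tendsto_def l2_norm_def l2_inner_def)

lemma l2_tendsto_inner_const:
  assumes "l2_tendsto \<Omega> f g" "h \<in> L2 \<Omega>"
  shows "(\<lambda>k. l2_inner \<Omega> (f k) h) \<longlonglongrightarrow> l2_inner \<Omega> g h"
  using l2_tendsto_inner[OF assms(1) l2_tendsto_const[OF assms(2)]] .

definition l2_Cauchy :: "(real^'n) set \<Rightarrow> (nat \<Rightarrow> real^'n \<Rightarrow> 'b::euclidean_space) \<Rightarrow> bool" where
  "l2_Cauchy \<Omega> f \<longleftrightarrow> (\<forall>k. f k \<in> L2 \<Omega>) \<and> (\<forall>e>0. \<exists>N. \<forall>j\<ge>N. \<forall>k\<ge>N. l2_norm \<Omega> (\<lambda>x. f j x - f k x) < e)"

text \<open>A subsequence with geometrically decreasing steps converges almost everywhere, since on a finite measure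
  space the steps are summable in \<open>L\<^sub>1\<close>. Fatou's lemma then bounds the distance to the limit.\<close>
lemma l2_complete:
  fixes f :: "nat \<Rightarrow> real^'n \<Rightarrow> 'b::euclidean_space"
  assumes fin: "finite_measure (lebesgue_on \<Omega>)" and C: "l2_Cauchy \<Omega> f"
  shows "\<exists>g. l2_tendsto \<Omega> f g"
proof -
  interpret finite_measure "lebesgue_on \<Omega>" by (rule fin)
  let ?M = "lebesgue_on \<Omega>"
  have fL [simp]: "f k \<in> L2 \<Omega>" for k using C by (simp add: l2_Cauchy_def)
  have [measurable]: "f k \<in> borel_measurable ?M" for k by (rule L2_measurable) simp
  have "\<exists>N. \<forall>j\<ge>N. \<forall>k\<ge>N. l2_norm \<Omega> (\<lambda>x. f j x - f k x) < (1/2)^i" for i :: nat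
    using C by (simp add: l2_Cauchy_def)
  then obtain N where N: "\<And>i j k. j \<ge> N i \<Longrightarrow> k \<ge> N i \<Longrightarrow> l2_norm \<Omega> (\<lambda>x. f j x - f k x) < (1/2)^i"
    by metis
  \<comment> \<open>Adding up the thresholds makes \<open>r\<close> monotone without losing \<open>N k \<le> r k\<close>; the summand \<open>k\<close> makes it
    unbounded.\<close>
  define r where "r k = (\<Sum>i\<le>k. N i) + k" for k
  have rN: "N k \<le> r k" for k unfolding r_def by (simp add: member_le_sum trans_le_add1)
  have rS: "r k \<le> r (Suc k)" for k unfolding r_def by simp
  have rk: "k \<le> r k" for k unfolding r_def by simp
  define d where "d k x = f (r (Suc k)) x - f (r k) x" for k x
  have dL: "d k \<in> L2 \<Omega>" for k unfolding d_def by (rule L2_diff) simp_all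
  have [measurable]: "d k \<in> borel_measurable ?M" for k using dL by (rule L2_measurable)
  have dn: "l2_norm \<Omega> (d k) \<le> (1/2)^k" for k
    unfolding d_def using N[of k "r (Suc k)" "r k"] rN[of k] rS[of k] by simp
  have oneL: "(\<lambda>x. 1::real) \<in> L2 \<Omega>" by (simp add: L2_def)
  have dnL: "(\<lambda>x. norm (d k x)) \<in> L2 \<Omega>" for k using dL[of k] by (simp add: L2_def)
  have dint: "integrable ?M (\<lambda>x. norm (d k x))" for k
    using L2_inner_integrable[OF dnL[of k] oneL] by simp
  have dle: "(LINT x|?M. norm (d k x)) \<le> l2_norm \<Omega> (\<lambda>x. 1::real) * (1/2)^k" for k
  proof -
    have "(LINT x|?M. norm (d k x)) = l2_inner \<Omega> (\<lambda>x. norm (d k x)) (\<lambda>x. 1)" by (simp add: l2_inner_def)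
    also have "\<dots> \<le> l2_norm \<Omega> (\<lambda>x. norm (d k x)) * l2_norm \<Omega> (\<lambda>x. 1::real)"
      using l2_cauchy_schwarz[OF dnL[of k] oneL] by simp
    also have "l2_norm \<Omega> (\<lambda>x. norm (d k x)) = l2_norm \<Omega> (d k)"
      by (simp add: l2_norm_def l2_inner_def flip: power2_norm_eq_inner) (simp add: power2_eq_square)
    also have "l2_norm \<Omega> (d k) * l2_norm \<Omega> (\<lambda>x. 1::real) \<le> (1/2)^k * l2_norm \<Omega> (\<lambda>x. 1::real)"
      by (intro mult_right_mono dn) simp
    finally show ?thesis by (simp add: mult.commute)
  qed
  have "(\<integral>\<^sup>+x. (\<Sum>k. ennreal (norm (d k x))) \<partial>?M) = (\<Sum>k. \<integral>\<^sup>+x. ennreal (norm (d k x)) \<partial>?M)"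
    by (rule nn_integral_suminf) measurable
  also have "\<dots> = (\<Sum>k. ennreal (LINT x|?M. norm (d k x)))"
    by (simp add: nn_integral_eq_integral[OF dint])
  also have "\<dots> \<le> (\<Sum>k. ennreal (l2_norm \<Omega> (\<lambda>x. 1::real) * (1/2)^k))"
    by (intro suminf_le) (auto intro: ennreal_leI dle)
  also have "\<dots> = ennreal (\<Sum>k. l2_norm \<Omega> (\<lambda>x. 1::real) * (1/2)^k)"
    by (rule suminf_ennreal2) (auto intro!: summable_mult summable_geometric)
  also have "\<dots> < \<infinity>" by simp
  finally have "AE x in ?M. (\<Sum>k. ennreal (norm (d k x))) \<noteq> \<infinity>"
    by (intro nn_integral_PInf_AE) (auto simp: less_top)
  hence AEconv: "AE x in ?M. (\<lambda>k. f (r k) x) \<longlonglongrightarrow> lim (\<lambda>k. f (r k) x)"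
  proof eventually_elim
    case (elim x)
    hence "summable (\<lambda>k. norm (d k x))" by (intro summable_suminf_not_top) (auto simp: top_ennreal_def infinity_ennreal_def)
    hence "summable (\<lambda>k. d k x)" by (rule summable_norm_cancel)
    hence "convergent (\<lambda>n. \<Sum>k<n. d k x)" by (simp add: summable_iff_convergent)
    moreover have "(\<Sum>k<n. d k x) = f (r n) x - f (r 0) x" for n
      unfolding d_def by (rule sum_lessThan_telescope)
    ultimately have "convergent (\<lambda>n. f (r n) x - f (r 0) x)" by simp
    hence "convergent (\<lambda>n. f (r n) x)" by (simp add: convergent_diff_const_right_iff)
    thus ?case by (simp add: convergent_LIMSEQ_iff)
  qed
  define g where "g x = lim (\<lambda>k. f (r k) x)" for x
  have [measurable]: "g \<in> borel_measurable ?M" unfolding g_def by (rule borel_measurable_lim_metric) measurable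
  have key: "(\<lambda>x. f j x - g x) \<in> L2 \<Omega> \<and> l2_norm \<Omega> (\<lambda>x. f j x - g x) \<le> (1/2)^i" if j: "j \<ge> N i" for i j
  proof -
    have "(\<integral>\<^sup>+x. ennreal ((norm (f j x - g x))\<^sup>2) \<partial>?M) = (\<integral>\<^sup>+x. liminf (\<lambda>k. ennreal ((norm (f j x - f (r k) x))\<^sup>2)) \<partial>?M)"
    proof (rule nn_integral_cong_AE, use AEconv in eventually_elim)
      case (elim x)
      hence "(\<lambda>k. ennreal ((norm (f j x - f (r k) x))\<^sup>2)) \<longlonglongrightarrow> ennreal ((norm (f j x - g x))\<^sup>2)"
        unfolding g_def by (intro tendsto_ennrealI tendsto_intros)
      from lim_imp_Liminf[OF sequentially_bot this] show ?case by simp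
    qed
    also have "\<dots> \<le> liminf (\<lambda>k. \<integral>\<^sup>+x. ennreal ((norm (f j x - f (r k) x))\<^sup>2) \<partial>?M)"
      by (rule nn_integral_liminf) measurable
    also have "\<dots> \<le> ennreal (((1/2)^i)\<^sup>2)"
    proof (rule Liminf_le)
      show "\<forall>\<^sub>F k in sequentially. (\<integral>\<^sup>+x. ennreal ((norm (f j x - f (r k) x))\<^sup>2) \<partial>?M) \<le> ennreal (((1/2)^i)\<^sup>2)"
        unfolding eventually_sequentially
      proof (intro exI allI impI)
        fix k assume "N i \<le> k"
        hence "l2_norm \<Omega> (\<lambda>x. f j x - f (r k) x) \<le> (1/2)^i"
          using N[of i j "r k"] j rk[of k] by simp
        hence "(l2_norm \<Omega> (\<lambda>x. f j x - f (r k) x))\<^sup>2 \<le> ((1/2)^i)\<^sup>2" by (intro power_mono) auto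
        moreover have "(\<integral>\<^sup>+x. ennreal ((norm (f j x - f (r k) x))\<^sup>2) \<partial>?M) = ennreal ((l2_norm \<Omega> (\<lambda>x. f j x - f (r k) x))\<^sup>2)"
          unfolding l2_norm_square l2_inner_def power2_norm_eq_inner[symmetric]
          by (rule nn_integral_eq_integral) (auto intro!: L2_integrable L2_diff)
        ultimately show "(\<integral>\<^sup>+x. ennreal ((norm (f j x - f (r k) x))\<^sup>2) \<partial>?M) \<le> ennreal (((1/2)^i)\<^sup>2)"
          by (simp add: ennreal_leI)
      qed
    qed simp
    finally have le: "(\<integral>\<^sup>+x. ennreal ((norm (f j x - g x))\<^sup>2) \<partial>?M) \<le> ennreal (((1/2)^i)\<^sup>2)" .
    have int: "integrable ?M (\<lambda>x. (norm (f j x - g x))\<^sup>2)"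
      by (rule integrableI_bounded) (use le in \<open>auto simp: le_less_trans ennreal_less_top\<close>)
    hence L: "(\<lambda>x. f j x - g x) \<in> L2 \<Omega>" by (simp add: L2_def)
    have "ennreal ((l2_norm \<Omega> (\<lambda>x. f j x - g x))\<^sup>2) \<le> ennreal (((1/2)^i)\<^sup>2)"
      using le unfolding l2_norm_square l2_inner_def power2_norm_eq_inner[symmetric]
      by (subst (asm) nn_integral_eq_integral[OF int]) auto
    hence "(l2_norm \<Omega> (\<lambda>x. f j x - g x))\<^sup>2 \<le> ((1/2)^i)\<^sup>2" by (simp add: ennreal_le_iff)
    hence "l2_norm \<Omega> (\<lambda>x. f j x - g x) \<le> (1/2)^i" by (rule power2_le_imp_le) simp
    thus ?thesis using L by blast
  qed
  have "(\<lambda>x. f (N 0) x - (f (N 0) x - g x)) \<in> L2 \<Omega>" by (rule L2_diff) (use key[of 0 "N 0"] in auto)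
  hence gL: "g \<in> L2 \<Omega>" by simp
  have "(\<lambda>k. l2_norm \<Omega> (\<lambda>x. f k x - g x)) \<longlonglongrightarrow> 0"
  proof (rule LIMSEQ_I)
    fix e :: real assume "0 < e"
    then obtain i where i: "(1/2)^i < e" using real_arch_pow_inv[of e "1/2"] by auto
    show "\<exists>no. \<forall>n\<ge>no. norm (l2_norm \<Omega> (\<lambda>x. f n x - g x) - 0) < e"
      using key i by (intro exI[of _ "N i"]) (auto intro: le_less_trans)
  qed
  thus ?thesis using gL by (auto simp: l2_tendsto_def)
qed

section \<open>Mollification\<close>

subsection \<open>A smooth bump\<close>

text \<open>The family \<open>t\<^bsup>-k\<^esup> exp (-1 / t)\<close>, extended by 0, is closed under differentiation up to linear
  combinations. The case \<open>k = 0\<close> is the standard smooth function that is flat at 0.\<close>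
definition flat_exp :: "nat \<Rightarrow> real \<Rightarrow> real" where
  "flat_exp k t = (if 0 < t then (1 / t) ^ k * exp (- (1 / t)) else 0)"

lemma flat_exp_at_right: "(flat_exp k \<longlongrightarrow> 0) (at_right 0)"
proof -
  have "((\<lambda>t. inverse t ^ k / exp (inverse t)) \<longlongrightarrow> (0::real)) (at_right 0)"
    by (rule filterlim_compose[OF tendsto_power_div_exp_0 filterlim_inverse_at_top_right])
  moreover have "\<forall>\<^sub>F t in at_right 0. flat_exp k t = inverse t ^ k / exp (inverse t)"
    unfolding eventually_at_right_field
    by (intro exI[of _ 1]) (auto simp: flat_exp_def exp_minus divide_simps)
  ultimately show ?thesis using tendsto_cong by fast
qed

lemma flat_exp_derivative:
  "(flat_exp k has_real_derivative (- real k * flat_exp (k + 1) t + flat_exp (k + 2) t)) (at t)"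
proof -
  consider "0 < t" | "t < 0" | "t = 0" by linarith
  thus ?thesis
  proof cases
    case 1
    have d1: "((\<lambda>t. 1 / t) has_real_derivative - (1 / t)\<^sup>2) (at t)"
      using 1 by (auto intro!: derivative_eq_intros simp: power2_eq_square)
    have d2: "((\<lambda>t. exp (- (1 / t))) has_real_derivative exp (- (1 / t)) * (1 / t)\<^sup>2) (at t)"
      using DERIV_fun_exp[OF DERIV_minus[OF d1]] by simp
    have "real k * (- s\<^sup>2 * s ^ (k - Suc 0)) = - real k * s ^ (k + 1)" for s :: real
      by (cases k) (simp_all add: power2_eq_square algebra_simps)
    from this[of "1 / t"] DERIV_mult[OF DERIV_power[OF d1, of k] d2]
    have "((\<lambda>t. (1 / t) ^ k * exp (- (1 / t))) has_real_derivative
        (- real k * (1 / t) ^ (k + 1)) * exp (- (1 / t)) + (exp (- (1 / t)) * (1 / t)\<^sup>2) * (1 / t) ^ k) (at t)"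
      by simp
    also have "(- real k * (1 / t) ^ (k + 1)) * exp (- (1 / t)) + (exp (- (1 / t)) * (1 / t)\<^sup>2) * (1 / t) ^ k
        = - real k * flat_exp (k + 1) t + flat_exp (k + 2) t"
      using 1 by (simp add: flat_exp_def power_add power2_eq_square mult_ac)
    finally have "((\<lambda>t. (1 / t) ^ k * exp (- (1 / t))) has_real_derivative
        (- real k * flat_exp (k + 1) t + flat_exp (k + 2) t)) (at t)" .
    thus ?thesis
      by (rule has_field_derivative_transform_within_open[of _ _ _ "{0<..}"]) (use 1 in \<open>auto simp: flat_exp_def\<close>)
  next
    case 2
    have "((\<lambda>t. 0) has_real_derivative (- real k * flat_exp (k + 1) t + flat_exp (k + 2) t)) (at t)"
      using 2 by (simp add: flat_exp_def)
    thus ?thesis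
      by (rule has_field_derivative_transform_within_open[of _ _ _ "{..<0}"]) (use 2 in \<open>auto simp: flat_exp_def\<close>)
  next
    case 3
    have "((\<lambda>h. flat_exp (k + 1) h) \<longlongrightarrow> 0) (at 0)"
    proof (rule filterlim_split_at)
      have "\<forall>\<^sub>F t in at_left 0. flat_exp (k + 1) t = 0"
        unfolding eventually_at_left_field by (intro exI[of _ "-1"]) (auto simp: flat_exp_def)
      thus "(flat_exp (k + 1) \<longlongrightarrow> 0) (at_left 0)" by (rule tendsto_eventually)
    qed (rule flat_exp_at_right)
    moreover have "(flat_exp k (0 + h) - flat_exp k 0) / h = flat_exp (k + 1) h" for h
      by (simp add: flat_exp_def)
    ultimately show ?thesis using 3 by (simp add: DERIV_def flat_exp_def)
  qed
qed

lemma C_k_flat_exp: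
  assumes g: "smooth g"
  shows "C_k m (\<lambda>x. flat_exp k (g x))"
proof (induction m arbitrary: k)
  case 0
  have "continuous_on UNIV (flat_exp k)"
    using flat_exp_derivative DERIV_isCont by (blast intro: continuous_at_imp_continuous_on)
  hence "continuous_on UNIV (\<lambda>x. flat_exp k (g x))"
    by (rule continuous_on_compose2) (use smoothD_cont[OF g] in auto)
  thus ?case by simp
next
  case (Suc m)
  let ?D = "\<lambda>x. - real k * flat_exp (k + 1) (g x) + flat_exp (k + 2) (g x)"
  have d: "((\<lambda>x. flat_exp k (g x)) has_derivative (\<lambda>h. frechet_derivative g (at x) h * ?D x)) (at x)" for x
  proof -
    have "(g has_derivative frechet_derivative g (at x)) (at x)"
      using smoothD_diff[OF g] frechet_derivative_works by blast
    from has_derivative_compose[OF this flat_exp_derivative[unfolded has_field_derivative_def]]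
    show ?thesis by (simp add: mult.commute)
  qed
  have "partial_deriv i (\<lambda>x. flat_exp k (g x)) = (\<lambda>x. partial_deriv i g x * ?D x)" for i
    using partial_derivI[OF d] by (auto simp: partial_deriv_def)
  moreover have "C_k m (\<lambda>x. partial_deriv i g x * ?D x)" for i
  proof (rule C_k_bilinear[OF bounded_bilinear_mult])
    show "C_k m (partial_deriv i g)" using smooth_partial_deriv[OF g] by (simp add: smooth_def)
    show "C_k m ?D"
      by (rule C_k_add[OF C_k_bounded_linear[OF bounded_linear_mult_right Suc] Suc])
  qed
  ultimately show ?case using d by (auto simp: differentiable_def)
qed

text \<open>Kernels are even, so that convolution is symmetric with respect to the \<open>L\<^sub>2\<close> pairing.\<close>
definition mollifier :: "real \<Rightarrow> (real^'n \<Rightarrow> real) \<Rightarrow> bool" where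
  "mollifier \<epsilon> \<eta> \<longleftrightarrow> smooth \<eta> \<and> (\<forall>x. 0 \<le> \<eta> x) \<and> (\<forall>x. \<epsilon> \<le> norm x \<longrightarrow> \<eta> x = 0) \<and>
     (LINT x|lborel. \<eta> x) = 1 \<and> (\<forall>x. \<eta> (- x) = \<eta> x)"

lemma ex_bump:
  assumes "0 < \<epsilon>"
  shows "\<exists>b :: real^'n \<Rightarrow> real. smooth b \<and> (\<forall>x. 0 \<le> b x) \<and> (\<forall>x. \<epsilon> \<le> norm x \<longrightarrow> b x = 0)
    \<and> (\<forall>x. norm x < \<epsilon> \<longrightarrow> 0 < b x) \<and> (\<forall>x. b (- x) = b x)"
proof (intro exI conjI allI impI)
  let ?b = "\<lambda>x::real^'n. flat_exp 0 (\<epsilon>\<^sup>2 - x \<bullet> x)"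
  have "smooth (\<lambda>x::real^'n. \<epsilon>\<^sup>2 - x \<bullet> x)"
    by (intro smooth_diff smooth_const smooth_inner smooth_linear_fun bounded_linear_ident)
  thus "smooth ?b" using C_k_flat_exp unfolding smooth_def by blast
  show "0 \<le> ?b x" "?b (- x) = ?b x" for x by (auto simp: flat_exp_def)
  show "?b x = 0" if "\<epsilon> \<le> norm x" for x
  proof -
    have "\<epsilon>\<^sup>2 \<le> x \<bullet> x" using power_mono[OF that, of 2] assms by (simp add: power2_norm_eq_inner)
    thus ?thesis by (simp add: flat_exp_def)
  qed
  show "0 < ?b x" if "norm x < \<epsilon>" for x
  proof -
    have "x \<bullet> x < \<epsilon>\<^sup>2" using power_strict_mono[OF that, of 2] assms by (simp add: power2_norm_eq_inner)
    thus ?thesis by (simp add: flat_exp_def)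
  qed
qed

lemma ex_mollifier:
  assumes e: "0 < \<epsilon>"
  obtains \<eta> :: "real^'n \<Rightarrow> real" where "mollifier \<epsilon> \<eta>"
proof -
  obtain b :: "real^'n \<Rightarrow> real" where b: "smooth b" "\<And>x. 0 \<le> b x" "\<And>x. \<epsilon> \<le> norm x \<Longrightarrow> b x = 0"
    "\<And>x. norm x < \<epsilon> \<Longrightarrow> 0 < b x" "\<And>x. b (- x) = b x" using ex_bump[OF e] by blast
  have ib: "integrable lborel b"
    by (rule integrable_csupp[OF smoothD_cont[OF b(1)], of "cball 0 \<epsilon>"]) (auto simp: b(3))
  define c where "c = (LINT x|lborel. b x)"
  have "c \<noteq> 0"
  proof
    assume "c = 0"
    hence "AE x in lborel. b x = 0"
      using integral_nonneg_eq_0_iff_AE[OF ib] b(2) by (simp add: c_def)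
    hence "AE x in lebesgue. b x = 0" by (rule AE_completion)
    hence "AE x in lebesgue. x \<notin> ball (0::real^'n) \<epsilon>"
      by eventually_elim (use b(4) in \<open>force\<close>)
    hence "negligible (ball (0::real^'n) \<epsilon>)" by (simp add: negligible_iff_null_sets AE_iff_null_sets)
    thus False using open_not_negligible[of "ball (0::real^'n) \<epsilon>"] e by simp
  qed
  moreover have "0 \<le> c" unfolding c_def by (simp add: b(2))
  ultimately have c: "0 < c" by simp
  have "mollifier \<epsilon> (\<lambda>x. (1 / c) *\<^sub>R b x)"
    unfolding mollifier_def
    using b c smooth_scaleR[OF b(1), of "1 / c"] by (auto simp: c_def[symmetric])
  thus ?thesis by (rule that)
qed

subsection \<open>Convolution with a smooth kernel\<close>

definition conv :: "(real^'n \<Rightarrow> real) \<Rightarrow> (real^'n \<Rightarrow> 'b::euclidean_space) \<Rightarrow> real^'n \<Rightarrow> 'b" where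
  "conv \<eta> f x = (LINT y|lborel. \<eta> (x - y) *\<^sub>R f y)"

lemma integrable_conv:
  fixes f :: "real^'n \<Rightarrow> 'b::euclidean_space"
  assumes "continuous_on UNIV \<eta>" "compact K" "\<And>x. x \<notin> K \<Longrightarrow> \<eta> x = 0" "integrable lborel f"
  shows "integrable lborel (\<lambda>y. \<eta> (x - y) *\<^sub>R f y)"
proof -
  obtain M where M: "0 < M" "\<And>x. norm (\<eta> x) \<le> M" using bounded_csupp[OF assms(1-3)] by blast
  have "continuous_on UNIV (\<lambda>y. \<eta> (x - y))"
    by (rule continuous_on_compose2[OF assms(1)]) (auto intro: continuous_intros)
  hence [measurable]: "(\<lambda>y. \<eta> (x - y)) \<in> borel_measurable borel" by (rule borel_measurable_continuous_onI)
  have [measurable]: "f \<in> borel_measurable borel" using borel_measurable_integrable[OF assms(4)] by simp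
  show ?thesis
  proof (rule Bochner_Integration.integrable_bound)
    show "integrable lborel (\<lambda>y. M * norm (f y))" using assms(4) by simp
    show "AE y in lborel. norm (\<eta> (x - y) *\<^sub>R f y) \<le> norm (M * norm (f y))"
      using M by (auto simp: abs_mult intro!: AE_I2 mult_right_mono)
  qed simp
qed

lemma directional_derivative:
  fixes f :: "real^'n \<Rightarrow> real"
  assumes "smooth f"
  shows "((\<lambda>t. f (z + t *\<^sub>R h)) has_real_derivative (\<Sum>i\<in>UNIV. h $ i * partial_deriv i f (z + t *\<^sub>R h))) (at t)"
proof -
  have "((\<lambda>t. f (z + t *\<^sub>R h)) has_derivative
      (\<lambda>s. \<Sum>i\<in>UNIV. (s *\<^sub>R h) $ i *\<^sub>R partial_deriv i f (z + t *\<^sub>R h))) (at t)"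
    by (rule has_derivative_compose[of "\<lambda>t. z + t *\<^sub>R h" _ _ UNIV f, OF _ has_derivative_partial_deriv[OF smoothD_diff[OF assms]]])
       (auto intro!: derivative_eq_intros)
  moreover have "(\<lambda>s. \<Sum>i\<in>UNIV. (s *\<^sub>R h) $ i *\<^sub>R partial_deriv i f (z + t *\<^sub>R h))
      = (*) (\<Sum>i\<in>UNIV. h $ i * partial_deriv i f (z + t *\<^sub>R h))"
    by (rule ext) (simp add: sum_distrib_left mult_ac)
  ultimately show ?thesis by (simp add: has_field_derivative_def)
qed

text \<open>A Taylor remainder that is uniform in the base point. It permits
  differentiation under the convolution integral for functions that are merely integrable.\<close>
lemma second_order_bound:
  fixes f :: "real^'n \<Rightarrow> real"
  assumes f: "smooth f" and K: "compact K" "\<And>x. x \<notin> K \<Longrightarrow> f x = 0"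
  obtains M where "0 \<le> M" "\<And>z h. \<bar>f (z + h) - f z - (\<Sum>i\<in>UNIV. h $ i * partial_deriv i f z)\<bar> \<le> M * (norm h)\<^sup>2"
proof -
  have clK: "closed K" using K(1) by (rule compact_imp_closed)
  note pz = partial_deriv_zero_off_closed[OF clK K(2)]
  note pz2 = partial_deriv_zero_off_closed[OF clK pz]
  have "\<exists>B. \<forall>x. norm (partial_deriv i (partial_deriv j f) x) \<le> B" for i j
    using bounded_csupp[OF smoothD_cont[OF smooth_partial_deriv[OF smooth_partial_deriv[OF f]]] K(1) pz2] by metis
  then obtain B where B: "\<And>i j x. norm (partial_deriv i (partial_deriv j f) x) \<le> B i j" by metis
  define M where "M = (\<Sum>i\<in>UNIV. \<Sum>j\<in>UNIV. B i j)"
  have B0: "0 \<le> B i j" for i j using B[of i j] norm_ge_zero order_trans by blast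
  have "\<bar>f (z + h) - f z - (\<Sum>i\<in>UNIV. h $ i * partial_deriv i f z)\<bar> \<le> M * (norm h)\<^sup>2" for z h
  proof -
    let ?g = "\<lambda>t. \<Sum>i\<in>UNIV. h $ i * partial_deriv i f (z + t *\<^sub>R h)"
    let ?g2 = "\<lambda>t. \<Sum>i\<in>UNIV. h $ i * (\<Sum>j\<in>UNIV. h $ j * partial_deriv j (partial_deriv i f) (z + t *\<^sub>R h))"
    have "\<exists>s>0. s < 1 \<and> f (z + 1 *\<^sub>R h) - f (z + 0 *\<^sub>R h) = (1 - 0) * ?g s"
      by (rule MVT2) (auto intro: directional_derivative[OF f])
    then obtain s where s: "0 < s" "s < 1" "f (z + h) - f z = ?g s" by auto
    have "\<exists>t>0. t < s \<and> ?g s - ?g 0 = (s - 0) * ?g2 t"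
      by (rule MVT2[OF s(1)]) (auto intro!: DERIV_sum DERIV_cmult directional_derivative[OF smooth_partial_deriv[OF f]])
    then obtain t where t: "?g s - ?g 0 = s * ?g2 t" by auto
    \<comment> \<open>\<open>?g\<close> and \<open>?g2\<close> are the first and second derivative of \<open>f\<close> along the segment from \<open>z\<close> to \<open>z + h\<close>.\<close>
    have "\<bar>?g2 t\<bar> \<le> (\<Sum>i\<in>UNIV. \<bar>h $ i * (\<Sum>j\<in>UNIV. h $ j * partial_deriv j (partial_deriv i f) (z + t *\<^sub>R h))\<bar>)"
      by (rule sum_abs)
    also have "\<dots> \<le> (\<Sum>i\<in>UNIV. norm h * (\<Sum>j\<in>UNIV. norm h * B j i))"
      unfolding abs_mult
      by (intro sum_mono mult_mono component_le_norm_cart sum_nonneg order_trans[OF sum_abs])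
         (auto simp: abs_mult B0 intro!: mult_mono component_le_norm_cart B[unfolded real_norm_def] sum_mono)
    also have "\<dots> = M * (norm h)\<^sup>2"
      unfolding M_def by (subst sum.swap) (simp add: sum_distrib_left sum_distrib_right power2_eq_square mult_ac)
    finally have "s * \<bar>?g2 t\<bar> \<le> 1 * (M * (norm h)\<^sup>2)" using s by (intro mult_mono) auto
    moreover have "f (z + h) - f z - (\<Sum>i\<in>UNIV. h $ i * partial_deriv i f z) = s * ?g2 t" using s t by simp
    ultimately show ?thesis using s by (simp add: abs_mult)
  qed
  moreover have "0 \<le> M" unfolding M_def by (intro sum_nonneg B0)
  ultimately show ?thesis using that by blast
qed

lemma conv_has_derivative:
  fixes f :: "real^'n \<Rightarrow> 'b::euclidean_space"
  assumes \<eta>: "smooth \<eta>" and K: "compact K" "\<And>x. x \<notin> K \<Longrightarrow> \<eta> x = 0" and f: "integrable lborel f"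
  shows "(conv \<eta> f has_derivative (\<lambda>h. \<Sum>i\<in>UNIV. h $ i *\<^sub>R conv (partial_deriv i \<eta>) f x)) (at x)"
proof -
  have clK: "closed K" using K(1) by (rule compact_imp_closed)
  note pz = partial_deriv_zero_off_closed[OF clK K(2)]
  obtain M where M: "0 \<le> M" "\<And>z h. \<bar>\<eta> (z + h) - \<eta> z - (\<Sum>i\<in>UNIV. h $ i * partial_deriv i \<eta> z)\<bar> \<le> M * (norm h)\<^sup>2"
    using second_order_bound[OF \<eta> K] by blast
  have i1: "integrable lborel (\<lambda>y. \<eta> (x - y) *\<^sub>R f y)" for x
    by (rule integrable_conv[OF smoothD_cont[OF \<eta>] K f])
  have i2: "integrable lborel (\<lambda>y. partial_deriv i \<eta> (x - y) *\<^sub>R f y)" for x i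
    by (rule integrable_conv[OF smoothD_cont[OF smooth_partial_deriv[OF \<eta>]] K(1) pz f])
  have bnd: "norm (conv \<eta> f y - conv \<eta> f x - (\<Sum>i\<in>UNIV. (y - x) $ i *\<^sub>R conv (partial_deriv i \<eta>) f x))
      \<le> M * (norm (y - x))\<^sup>2 * (LINT z|lborel. norm (f z))" for y
  proof -
    let ?h = "y - x"
    let ?r = "\<lambda>z. \<eta> (y - z) - \<eta> (x - z) - (\<Sum>i\<in>UNIV. ?h $ i * partial_deriv i \<eta> (x - z))"
    have "conv \<eta> f y - conv \<eta> f x - (\<Sum>i\<in>UNIV. ?h $ i *\<^sub>R conv (partial_deriv i \<eta>) f x)
       = (LINT z|lborel. \<eta> (y - z) *\<^sub>R f z - \<eta> (x - z) *\<^sub>R f z - (\<Sum>i\<in>UNIV. ?h $ i *\<^sub>R (partial_deriv i \<eta> (x - z) *\<^sub>R f z)))"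
      unfolding conv_def using i1 i2 by (simp del: scaleR_scaleR vector_minus_component)
    also have "\<dots> = (LINT z|lborel. ?r z *\<^sub>R f z)"
      by (intro Bochner_Integration.integral_cong) (auto simp: scaleR_sum_left scaleR_diff_left)
    also have "norm \<dots> \<le> (LINT z|lborel. M * (norm ?h)\<^sup>2 * norm (f z))"
    proof (rule Bochner_Integration.integral_norm_bound_integral)
      show "integrable lborel (\<lambda>z. ?r z *\<^sub>R f z)"
      proof -
        have "integrable lborel (\<lambda>z. \<eta> (y - z) *\<^sub>R f z - \<eta> (x - z) *\<^sub>R f z - (\<Sum>i\<in>UNIV. ?h $ i *\<^sub>R (partial_deriv i \<eta> (x - z) *\<^sub>R f z)))"
          using i1 i2 by (simp del: scaleR_scaleR vector_minus_component)
        moreover have "(\<lambda>z. \<eta> (y - z) *\<^sub>R f z - \<eta> (x - z) *\<^sub>R f z - (\<Sum>i\<in>UNIV. ?h $ i *\<^sub>R (partial_deriv i \<eta> (x - z) *\<^sub>R f z)))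
            = (\<lambda>z. ?r z *\<^sub>R f z)" by (auto simp: scaleR_sum_left scaleR_diff_left)
        ultimately show ?thesis by simp
      qed
      show "integrable lborel (\<lambda>z. M * (norm ?h)\<^sup>2 * norm (f z))" using f by simp
      fix z
      have "\<bar>?r z\<bar> \<le> M * (norm ?h)\<^sup>2" using M(2)[of "x - z" ?h] by (simp add: algebra_simps)
      thus "norm (?r z *\<^sub>R f z) \<le> M * (norm ?h)\<^sup>2 * norm (f z)" by (auto intro: mult_right_mono)
    qed
    finally show ?thesis by simp
  qed
  show ?thesis
  proof (rule has_derivativeI_sandwich[of 1])
    show "bounded_linear (\<lambda>h. \<Sum>i\<in>UNIV. h $ i *\<^sub>R conv (partial_deriv i \<eta>) f x)"
      by (intro bounded_linear_sum bounded_linear_compose[OF bounded_linear_scaleR_left bounded_linear_vec_nth])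
    let ?C = "M * (LINT z|lborel. norm (f z))"
    show "norm (conv \<eta> f y - conv \<eta> f x - (\<Sum>i\<in>UNIV. (y - x) $ i *\<^sub>R conv (partial_deriv i \<eta>) f x)) / norm (y - x)
       \<le> ?C * norm (y - x)" if "y \<noteq> x" for y
      using bnd[of y] that by (simp add: field_simps power2_eq_square)
    have "((\<lambda>y. ?C * norm (y - x)) \<longlongrightarrow> ?C * norm (x - x)) (at x)" by (intro tendsto_intros)
    thus "((\<lambda>y. ?C * norm (y - x)) \<longlongrightarrow> 0) (at x)" by simp
  qed simp
qed

lemma partial_deriv_conv:
  fixes f :: "real^'n \<Rightarrow> 'b::euclidean_space"
  assumes \<eta>: "smooth \<eta>" and K: "compact K" "\<And>x. x \<notin> K \<Longrightarrow> \<eta> x = 0" and f: "integrable lborel f"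
  shows "partial_deriv i (conv \<eta> f) = conv (partial_deriv i \<eta>) f"
proof
  fix x
  have "(\<Sum>k\<in>UNIV. axis i (1::real) $ k *\<^sub>R c k) = c i" for c :: "_ \<Rightarrow> 'b"
    by (subst sum.mono_neutral_cong_right[where S="{i}" and h="\<lambda>k. c k"]) (auto simp: axis_def)
  thus "partial_deriv i (conv \<eta> f) x = conv (partial_deriv i \<eta>) f x"
    using partial_derivI[OF conv_has_derivative[OF assms]] by simp
qed

lemma smooth_conv:
  fixes f :: "real^'n \<Rightarrow> 'b::euclidean_space"
  assumes \<eta>: "smooth \<eta>" and K: "compact K" "\<And>x. x \<notin> K \<Longrightarrow> \<eta> x = 0" and f: "integrable lborel f"
  shows "smooth (conv \<eta> f)"
proof -
  have "C_k k (conv \<eta> f)" for k using \<eta> K(2)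
  proof (induction k arbitrary: \<eta>)
    case 0
    have "conv \<eta> f differentiable (at x)" for x
      using conv_has_derivative[OF 0(1) K(1) 0(2) f] differentiable_def by blast
    thus ?case by (auto intro!: continuous_at_imp_continuous_on differentiable_imp_continuous_within)
  next
    case (Suc k)
    have "conv \<eta> f differentiable (at x)" for x
      using conv_has_derivative[OF Suc.prems(1) K(1) Suc.prems(2) f] differentiable_def by blast
    moreover have "C_k k (conv (partial_deriv i \<eta>) f)" for i
      by (intro Suc.IH smooth_partial_deriv Suc.prems(1)
          partial_deriv_zero_off_closed[OF compact_imp_closed[OF K(1)] Suc.prems(2)])
    ultimately show ?case by (simp add: partial_deriv_conv[OF Suc.prems(1) K(1) Suc.prems(2) f])
  qed
  thus ?thesis by (simp add: smooth_def)
qed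

subsection \<open>Mollifiers\<close>

lemma mollifierD:
  assumes "mollifier \<epsilon> \<eta>"
  shows "smooth \<eta>" "0 \<le> \<eta> x" "\<epsilon> \<le> norm x \<Longrightarrow> \<eta> x = 0" "(LINT x|lborel. \<eta> x) = 1" "\<eta> (- x) = \<eta> x"
    "x \<notin> cball 0 \<epsilon> \<Longrightarrow> \<eta> x = 0" "\<eta> \<in> borel_measurable borel" "integrable lborel \<eta>"
proof -
  show s: "smooth \<eta>" and z: "\<epsilon> \<le> norm x \<Longrightarrow> \<eta> x = 0" for x using assms by (auto simp: mollifier_def)
  show z': "x \<notin> cball 0 \<epsilon> \<Longrightarrow> \<eta> x = 0" for x using z[of x] by simp
  show "\<eta> \<in> borel_measurable borel" using smoothD_cont[OF s] by (rule borel_measurable_continuous_onI)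
  show "integrable lborel \<eta>" by (rule integrable_csupp[OF smoothD_cont[OF s] compact_cball z'])
qed (use assms in \<open>auto simp: mollifier_def\<close>)

lemma mollifier_sym: "mollifier \<epsilon> \<eta> \<Longrightarrow> \<eta> (x - y) = \<eta> (y - x)"
  using mollifierD(5)[of \<epsilon> \<eta> "y - x"] by simp

lemma lborel_reflect: "distr lborel borel (\<lambda>y. x - y) = (lborel :: (real^'n) measure)"
  using lborel_affine[of "-1" x] by (simp add: density_1)

lemma integral_reflect:
  fixes f :: "real^'n \<Rightarrow> 'b::euclidean_space"
  assumes [measurable]: "f \<in> borel_measurable borel"
  shows "(LINT y|lborel. f (x - y)) = (LINT y|lborel. f y)"
proof -
  have "(LINT y|lborel. f y) = (LINT y|distr lborel borel (\<lambda>y. x - y). f y)" by (simp add: lborel_reflect)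
  also have "\<dots> = (LINT y|lborel. f (x - y))" by (rule integral_distr) auto
  finally show ?thesis by simp
qed

lemma integrable_reflect:
  fixes f :: "real^'n \<Rightarrow> 'b::euclidean_space"
  assumes "integrable lborel f"
  shows "integrable lborel (\<lambda>y. f (x - y))"
proof -
  have [measurable]: "f \<in> borel_measurable borel" using borel_measurable_integrable[OF assms] by simp
  have "integrable (distr lborel borel (\<lambda>y. x - y)) f" using assms by (simp add: lborel_reflect)
  thus ?thesis by (subst (asm) integrable_distr_eq) auto
qed

context
  fixes \<epsilon> :: real and \<eta> :: "real^'n \<Rightarrow> real"
  assumes m: "mollifier \<epsilon> \<eta>"
begin

lemma mollifier_measurable: "\<eta> \<in> borel_measurable borel" by (rule mollifierD[OF m])

lemma integrable_mollify:
  fixes f :: "real^'n \<Rightarrow> 'b::euclidean_space"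
  shows "integrable lborel f \<Longrightarrow> integrable lborel (\<lambda>y. \<eta> (x - y) *\<^sub>R f y)"
  by (rule integrable_conv[OF smoothD_cont[OF mollifierD(1)[OF m]] compact_cball mollifierD(6)[OF m]])

lemma smooth_mollify:
  fixes f :: "real^'n \<Rightarrow> 'b::euclidean_space"
  shows "integrable lborel f \<Longrightarrow> smooth (conv \<eta> f)"
  by (rule smooth_conv[OF mollifierD(1)[OF m] compact_cball mollifierD(6)[OF m]])

lemma mollifier_integral: "(LINT y|lborel. \<eta> (x - y)) = 1"
  using integral_reflect[OF mollifier_measurable, of x] mollifierD(4)[OF m] by simp

lemma mollify_zero:
  assumes "\<And>y. dist x y < \<epsilon> \<Longrightarrow> f y = 0"
  shows "conv \<eta> f x = 0"
proof -
  have z: "\<eta> (x - y) *\<^sub>R f y = 0" for y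
    using assms[of y] mollifierD(3)[OF m, of "x - y"] by (cases "dist x y < \<epsilon>") (auto simp: dist_norm)
  show ?thesis unfolding conv_def z by simp
qed

text \<open>The variance of \<open>f\<close> with respect to the probability density \<open>\<eta> (x - _)\<close> is nonnegative.\<close>
lemma mollify_jensen:
  fixes f :: "real^'n \<Rightarrow> 'b::euclidean_space"
  assumes f: "integrable lborel f" and f2: "integrable lborel (\<lambda>x. (norm (f x))\<^sup>2)"
  shows "(norm (conv \<eta> f x))\<^sup>2 \<le> (LINT y|lborel. \<eta> (x - y) * (norm (f y))\<^sup>2)"
proof -
  define c where "c = conv \<eta> f x"
  have i1: "integrable lborel (\<lambda>y. \<eta> (x - y) * (norm (f y))\<^sup>2)" using integrable_mollify[OF f2] by simp
  have i2: "integrable lborel (\<lambda>y. \<eta> (x - y) *\<^sub>R f y)" by (rule integrable_mollify[OF f])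
  have i3: "integrable lborel (\<lambda>y. \<eta> (x - y))" by (rule integrable_reflect[OF mollifierD(8)[OF m]])
  have i4: "integrable lborel (\<lambda>y. (\<eta> (x - y) *\<^sub>R f y) \<bullet> c)" using i2 by (rule integrable_inner_left)
  have e4: "(LINT y|lborel. (\<eta> (x - y) *\<^sub>R f y) \<bullet> c) = c \<bullet> c"
    using integral_inner_left[OF i2, of c] by (simp add: c_def conv_def)
  have "0 \<le> (LINT y|lborel. \<eta> (x - y) * (norm (f y - c))\<^sup>2)"
    by (intro Bochner_Integration.integral_nonneg mult_nonneg_nonneg mollifierD(2)[OF m]) simp
  also have "\<dots> = (LINT y|lborel. \<eta> (x - y) * (norm (f y))\<^sup>2 - 2 * ((\<eta> (x - y) *\<^sub>R f y) \<bullet> c) + \<eta> (x - y) * (norm c)\<^sup>2)"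
    by (intro Bochner_Integration.integral_cong)
       (auto simp: power2_norm_eq_inner inner_diff_left inner_diff_right inner_commute algebra_simps)
  also have "\<dots> = (LINT y|lborel. \<eta> (x - y) * (norm (f y))\<^sup>2) - 2 * (c \<bullet> c) + (norm c)\<^sup>2"
    using i1 i3 i4 e4 by (simp add: mollifier_integral del: inner_scaleR_left)
  finally show ?thesis by (simp add: c_def power2_norm_eq_inner)
qed

text \<open>Integrate the pointwise inequality and exchange the order of integration.\<close>
lemma mollify_young:
  fixes f :: "real^'n \<Rightarrow> 'b::euclidean_space"
  assumes f: "integrable lborel f" and f2: "integrable lborel (\<lambda>x. (norm (f x))\<^sup>2)"
  shows "integrable lborel (\<lambda>x. (norm (conv \<eta> f x))\<^sup>2)"
    "(LINT x|lborel. (norm (conv \<eta> f x))\<^sup>2) \<le> (LINT x|lborel. (norm (f x))\<^sup>2)"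
proof -
  note [measurable] = mollifier_measurable
  have [measurable]: "f \<in> borel_measurable borel" using borel_measurable_integrable[OF f] by simp
  have [measurable]: "conv \<eta> f \<in> borel_measurable borel"
    by (rule borel_measurable_continuous_onI[OF smoothD_cont[OF smooth_mollify[OF f]]])
  have "(\<integral>\<^sup>+x. ennreal ((norm (conv \<eta> f x))\<^sup>2) \<partial>lborel) \<le> (\<integral>\<^sup>+x. (\<integral>\<^sup>+y. ennreal (\<eta> (x - y) * (norm (f y))\<^sup>2) \<partial>lborel) \<partial>lborel)"
  proof (rule nn_integral_mono)
    fix x
    have "integrable lborel (\<lambda>y. \<eta> (x - y) * (norm (f y))\<^sup>2)" using integrable_mollify[OF f2] by simp
    hence "(\<integral>\<^sup>+y. ennreal (\<eta> (x - y) * (norm (f y))\<^sup>2) \<partial>lborel) = ennreal (LINT y|lborel. \<eta> (x - y) * (norm (f y))\<^sup>2)"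
      by (rule nn_integral_eq_integral) (auto simp: mollifierD(2)[OF m])
    thus "ennreal ((norm (conv \<eta> f x))\<^sup>2) \<le> (\<integral>\<^sup>+y. ennreal (\<eta> (x - y) * (norm (f y))\<^sup>2) \<partial>lborel)"
      using mollify_jensen[OF assms] by (simp add: ennreal_leI)
  qed
  also have "\<dots> = (\<integral>\<^sup>+y. (\<integral>\<^sup>+x. ennreal (\<eta> (x - y) * (norm (f y))\<^sup>2) \<partial>lborel) \<partial>lborel)"
    by (rule lborel_pair.Fubini'[symmetric]) measurable
  also have "\<dots> = (\<integral>\<^sup>+y. ennreal ((norm (f y))\<^sup>2) \<partial>lborel)"
  proof (rule nn_integral_cong)
    fix y
    have "(\<integral>\<^sup>+x. ennreal (\<eta> (x - y) * (norm (f y))\<^sup>2) \<partial>lborel) = (\<integral>\<^sup>+x. ennreal (\<eta> (y - x)) * ennreal ((norm (f y))\<^sup>2) \<partial>lborel)"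
      by (intro nn_integral_cong) (simp add: ennreal_mult mollifierD(2)[OF m] mollifier_sym[OF m, of _ y])
    also have "\<dots> = (\<integral>\<^sup>+x. ennreal (\<eta> (y - x)) \<partial>lborel) * ennreal ((norm (f y))\<^sup>2)"
      by (rule nn_integral_multc) measurable
    also have "(\<integral>\<^sup>+x. ennreal (\<eta> (y - x)) \<partial>lborel) = ennreal 1"
      by (subst nn_integral_eq_integral[OF integrable_reflect[OF mollifierD(8)[OF m]]])
         (auto simp: mollifierD(2)[OF m] mollifier_integral)
    finally show "(\<integral>\<^sup>+x. ennreal (\<eta> (x - y) * (norm (f y))\<^sup>2) \<partial>lborel) = ennreal ((norm (f y))\<^sup>2)" by simp
  qed
  also have "\<dots> = ennreal (LINT x|lborel. (norm (f x))\<^sup>2)"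
    by (rule nn_integral_eq_integral[OF f2]) simp
  finally have le: "(\<integral>\<^sup>+x. ennreal ((norm (conv \<eta> f x))\<^sup>2) \<partial>lborel) \<le> ennreal (LINT x|lborel. (norm (f x))\<^sup>2)" .
  show i: "integrable lborel (\<lambda>x. (norm (conv \<eta> f x))\<^sup>2)"
    by (rule integrableI_bounded) (use le in \<open>auto simp: le_less_trans ennreal_less_top\<close>)
  have "ennreal (LINT x|lborel. (norm (conv \<eta> f x))\<^sup>2) \<le> ennreal (LINT x|lborel. (norm (f x))\<^sup>2)"
    using le by (subst (asm) nn_integral_eq_integral[OF i]) auto
  thus "(LINT x|lborel. (norm (conv \<eta> f x))\<^sup>2) \<le> (LINT x|lborel. (norm (f x))\<^sup>2)"
    by (subst (asm) ennreal_le_iff) (auto intro: Bochner_Integration.integral_nonneg)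
qed

lemma mollify_adjoint:
  fixes f g :: "real^'n \<Rightarrow> 'b::euclidean_space"
  assumes f: "integrable lborel f" and g: "integrable lborel g"
  shows "(LINT x|lborel. conv \<eta> f x \<bullet> g x) = (LINT y|lborel. f y \<bullet> conv \<eta> g y)"
proof -
  note [measurable] = mollifier_measurable
  have [measurable]: "f \<in> borel_measurable borel" "g \<in> borel_measurable borel"
    using borel_measurable_integrable[OF f] borel_measurable_integrable[OF g] by simp_all
  obtain M where M: "0 < M" "\<And>x. norm (\<eta> x) \<le> M"
    using bounded_csupp[OF smoothD_cont[OF mollifierD(1)[OF m]] compact_cball mollifierD(6)[OF m]] by blast
  have P: "integrable (lborel \<Otimes>\<^sub>M lborel) (\<lambda>p. M * (norm (g (fst p)) * norm (f (snd p))))"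
  proof (rule lborel_pair.Fubini_integrable)
    show "integrable lborel (\<lambda>x. LINT y|lborel. norm (M * (norm (g (fst (x, y))) * norm (f (snd (x, y))))))"
      using M(1) g by (simp add: abs_mult)
    show "AE x in lborel. integrable lborel (\<lambda>y. M * (norm (g (fst (x, y))) * norm (f (snd (x, y)))))"
      using f by simp
  qed measurable
  have I: "integrable (lborel \<Otimes>\<^sub>M lborel) (case_prod (\<lambda>x y. \<eta> (x - y) * (f y \<bullet> g x)))"
  proof (rule Bochner_Integration.integrable_bound[OF P])
    have "\<bar>\<eta> (x - y)\<bar> * \<bar>f y \<bullet> g x\<bar> \<le> M * (norm (f y) * norm (g x))" for x y
      using M by (intro mult_mono Cauchy_Schwarz_ineq2) auto
    thus "AE p in lborel \<Otimes>\<^sub>M lborel. norm (case_prod (\<lambda>x y. \<eta> (x - y) * (f y \<bullet> g x)) p)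
        \<le> norm (M * (norm (g (fst p)) * norm (f (snd p))))"
      using M(1) by (auto simp: abs_mult mult_ac intro!: AE_I2)
  qed measurable
  have "(LINT x|lborel. conv \<eta> f x \<bullet> g x) = (LINT x|lborel. LINT y|lborel. \<eta> (x - y) * (f y \<bullet> g x))"
    unfolding conv_def using integrable_mollify[OF f] by (subst integral_inner_left[symmetric]) auto
  also have "\<dots> = (LINT y|lborel. LINT x|lborel. \<eta> (x - y) * (f y \<bullet> g x))"
    by (rule lborel_pair.Fubini_integral[OF I, symmetric])
  also have "\<dots> = (LINT y|lborel. LINT x|lborel. f y \<bullet> (\<eta> (y - x) *\<^sub>R g x))"
    by (simp add: mollifier_sym[OF m])
  also have "\<dots> = (LINT y|lborel. f y \<bullet> conv \<eta> g y)"
    unfolding conv_def using integrable_mollify[OF g] by (subst integral_inner_right) auto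
  finally show ?thesis .
qed

lemma mollify_reflect:
  fixes f :: "real^'n \<Rightarrow> 'b::euclidean_space"
  assumes [measurable]: "f \<in> borel_measurable borel"
  shows "conv \<eta> f x = (LINT y|lborel. \<eta> y *\<^sub>R f (x - y))"
proof -
  note [measurable] = mollifier_measurable
  show ?thesis unfolding conv_def using integral_reflect[of "\<lambda>y. \<eta> y *\<^sub>R f (x - y)" x] by simp
qed

lemma integrable_mollify_reflect:
  fixes f :: "real^'n \<Rightarrow> 'b::euclidean_space"
  assumes "integrable lborel f"
  shows "integrable lborel (\<lambda>y. \<eta> y *\<^sub>R f (x - y))"
  using integrable_reflect[OF integrable_mollify[OF assms, of x], of x] by simp

text \<open>Averages of translates move by at most \<open>L \<epsilon>\<close> and inherit the Lipschitz constant. The latter keeps the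
  gradient of a mollified distance function bounded by one.\<close>
lemma mollify_lipschitz:
  fixes g :: "real^'n \<Rightarrow> 'b::euclidean_space"
  assumes g: "integrable lborel g" and L: "\<And>x y. norm (g x - g y) \<le> L * norm (x - y)"
  shows "norm (conv \<eta> g x - g x) \<le> L * \<epsilon>" "norm (conv \<eta> g x - conv \<eta> g y) \<le> L * norm (x - y)"
proof -
  have [measurable]: "g \<in> borel_measurable borel" using borel_measurable_integrable[OF g] by simp
  note ir = integrable_mollify_reflect[OF g]
  have ic: "integrable lborel (\<lambda>y. \<eta> y *\<^sub>R c)" for c :: 'b using mollifierD(8)[OF m] by simp
  have ib: "integrable lborel (\<lambda>y. \<eta> y * c)" for c :: real using mollifierD(8)[OF m] by simp
  have "conv \<eta> g x - g x = (LINT y|lborel. \<eta> y *\<^sub>R (g (x - y) - g x))"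
    using ir ic mollifierD(4,8)[OF m] by (simp add: mollify_reflect scaleR_diff_right)
  also have "norm \<dots> \<le> (LINT y|lborel. \<eta> y * (L * \<epsilon>))"
  proof (rule Bochner_Integration.integral_norm_bound_integral)
    show "integrable lborel (\<lambda>y. \<eta> y *\<^sub>R (g (x - y) - g x))"
      using ir ic by (simp add: scaleR_diff_right)
    fix y
    show "norm (\<eta> y *\<^sub>R (g (x - y) - g x)) \<le> \<eta> y * (L * \<epsilon>)"
    proof (cases "\<epsilon> \<le> norm y")
      case False
      have "0 \<le> L * norm (axis undefined 1 - 0 :: real^'n)" by (rule order_trans[OF norm_ge_zero L])
      hence "0 \<le> L" by simp
      have "norm (g (x - y) - g x) \<le> L * norm (x - y - x)" by (rule L)
      also have "\<dots> \<le> L * \<epsilon>" using False \<open>0 \<le> L\<close> by (intro mult_left_mono) auto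
      finally show ?thesis using mollifierD(2)[OF m, of y] by (simp add: mult_left_mono)
    qed (simp add: mollifierD(3)[OF m])
  qed (rule ib)
  finally show "norm (conv \<eta> g x - g x) \<le> L * \<epsilon>" using mollifierD(4)[OF m] by simp
  have "conv \<eta> g x - conv \<eta> g y = (LINT z|lborel. \<eta> z *\<^sub>R (g (x - z) - g (y - z)))"
    using ir by (simp add: mollify_reflect scaleR_diff_right)
  also have "norm \<dots> \<le> (LINT z|lborel. \<eta> z * (L * norm (x - y)))"
  proof (rule Bochner_Integration.integral_norm_bound_integral)
    show "integrable lborel (\<lambda>z. \<eta> z *\<^sub>R (g (x - z) - g (y - z)))"
      using ir by (simp add: scaleR_diff_right)
    show "norm (\<eta> z *\<^sub>R (g (x - z) - g (y - z))) \<le> \<eta> z * (L * norm (x - y))" for z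
      using L[of "x - z" "y - z"] mollifierD(2)[OF m, of z] by (simp add: mult_left_mono)
  qed (rule ib)
  finally show "norm (conv \<eta> g x - conv \<eta> g y) \<le> L * norm (x - y)" using mollifierD(4)[OF m] by simp
qed

end

text \<open>The kernel is moved to the Lipschitz factor, where convergence is uniform.\<close>
lemma mollify_weak_limit:
  fixes f g :: "real^'n \<Rightarrow> 'b::euclidean_space"
  assumes m: "\<And>k. mollifier (e k) (\<eta> k)" and e: "e \<longlonglongrightarrow> 0"
    and f: "integrable lborel f" and g: "integrable lborel g" "bounded (range g)"
    and L: "\<And>x y. norm (g x - g y) \<le> L * norm (x - y)"
  shows "(\<lambda>k. LINT x|lborel. conv (\<eta> k) f x \<bullet> g x) \<longlonglongrightarrow> (LINT x|lborel. f x \<bullet> g x)"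
proof -
  have [measurable]: "f \<in> borel_measurable borel" "g \<in> borel_measurable borel"
    using borel_measurable_integrable[OF f] borel_measurable_integrable[OF g(1)] by simp_all
  obtain M where M: "\<And>x. norm (g x) \<le> M" using g(2) by (auto simp: bounded_iff)
  have ig: "integrable lborel (\<lambda>x. f x \<bullet> g x)"
  proof (rule Bochner_Integration.integrable_bound)
    show "integrable lborel (\<lambda>x. M * norm (f x))" using f by simp
    have "\<bar>f x \<bullet> g x\<bar> \<le> \<bar>M * norm (f x)\<bar>" for x
      using Cauchy_Schwarz_ineq2[of "f x" "g x"] mult_left_mono[OF M[of x] norm_ge_zero[of "f x"]]
        abs_ge_self[of "M * norm (f x)"] mult.commute[of M "norm (f x)"] by linarith
    thus "AE x in lborel. norm (f x \<bullet> g x) \<le> norm (M * norm (f x))" by simp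
  qed measurable
  have [measurable]: "conv (\<eta> k) g \<in> borel_measurable borel" for k
    by (rule borel_measurable_continuous_onI[OF smoothD_cont[OF smooth_mollify[OF m g(1)]]])
  have b: "\<bar>f x \<bullet> conv (\<eta> k) g x - f x \<bullet> g x\<bar> \<le> L * e k * norm (f x)" for k x
  proof -
    have "\<bar>f x \<bullet> (conv (\<eta> k) g x - g x)\<bar> \<le> norm (f x) * norm (conv (\<eta> k) g x - g x)"
      by (rule Cauchy_Schwarz_ineq2)
    also have "\<dots> \<le> norm (f x) * (L * e k)"
      by (intro mult_left_mono mollify_lipschitz[OF m g(1) L]) simp
    finally show ?thesis by (simp add: inner_diff_right mult_ac)
  qed
  have id: "integrable lborel (\<lambda>x. f x \<bullet> conv (\<eta> k) g x - f x \<bullet> g x)" for k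
  proof (rule Bochner_Integration.integrable_bound)
    show "integrable lborel (\<lambda>x. L * e k * norm (f x))" using f by simp
    show "AE x in lborel. norm (f x \<bullet> conv (\<eta> k) g x - f x \<bullet> g x) \<le> norm (L * e k * norm (f x))"
      using order_trans[OF b abs_ge_self] by simp
  qed measurable
  have nb: "norm ((LINT x|lborel. conv (\<eta> k) f x \<bullet> g x) - (LINT x|lborel. f x \<bullet> g x)) \<le> L * e k * (LINT x|lborel. norm (f x))" for k
  proof -
    have "integrable lborel (\<lambda>x. f x \<bullet> conv (\<eta> k) g x)"
      using Bochner_Integration.integrable_add[OF id[of k] ig] by simp
    hence "(LINT x|lborel. conv (\<eta> k) f x \<bullet> g x) - (LINT x|lborel. f x \<bullet> g x)
        = (LINT x|lborel. f x \<bullet> conv (\<eta> k) g x - f x \<bullet> g x)"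
      using ig by (simp add: mollify_adjoint[OF m f g(1)])
    also have "norm \<dots> \<le> (LINT x|lborel. L * e k * norm (f x))"
      by (rule Bochner_Integration.integral_norm_bound_integral[OF id]) (use f b in auto)
    finally show ?thesis by simp
  qed
  have nl: "(\<lambda>k. L * e k * (LINT x|lborel. norm (f x))) \<longlonglongrightarrow> 0"
  proof -
    have "(\<lambda>k. L * e k * (LINT x|lborel. norm (f x))) \<longlonglongrightarrow> L * 0 * (LINT x|lborel. norm (f x))"
      by (intro tendsto_intros e)
    thus ?thesis by simp
  qed
  have "(\<lambda>k. (LINT x|lborel. conv (\<eta> k) f x \<bullet> g x) - (LINT x|lborel. f x \<bullet> g x)) \<longlonglongrightarrow> 0"
    by (rule Lim_null_comparison[OF always_eventually nl]) (use nb in simp)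
  thus ?thesis by (simp add: LIM_zero_iff)
qed

text \<open>The difference quotient in the direction of the gradient tends to the squared length of the gradient.\<close>
lemma gradient_bound_lipschitz:
  fixes f :: "real^'n \<Rightarrow> real"
  assumes f: "smooth f" and L: "\<And>x y. \<bar>f x - f y\<bar> \<le> L * norm (x - y)"
  shows "(\<Sum>i\<in>UNIV. (partial_deriv i f x)\<^sup>2) \<le> L\<^sup>2"
proof -
  define h :: "real^'n" where "h = (\<chi> i. partial_deriv i f x)"
  define s where "s = (\<Sum>i\<in>UNIV. (partial_deriv i f x)\<^sup>2)"
  have nh: "(norm h)\<^sup>2 = s" unfolding power2_norm_eq_inner inner_vec_def h_def s_def by (simp add: power2_eq_square)
  have "((\<lambda>t. f (x + t *\<^sub>R h)) has_real_derivative s) (at 0)"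
    using directional_derivative[OF f, of x h 0] by (simp add: h_def s_def power2_eq_square)
  hence "((\<lambda>t. (f (x + t *\<^sub>R h) - f x) / t) \<longlongrightarrow> s) (at 0)" by (simp add: DERIV_def)
  moreover have "\<forall>\<^sub>F t in at 0. (f (x + t *\<^sub>R h) - f x) / t \<le> L * norm h"
    unfolding eventually_at
  proof (intro exI[of _ 1] conjI ballI impI)
    fix t :: real assume t: "t \<noteq> 0 \<and> dist t 0 < 1"
    have "\<bar>(f (x + t *\<^sub>R h) - f x) / t\<bar> \<le> L * norm (t *\<^sub>R h) / \<bar>t\<bar>"
      unfolding abs_divide using L[of "x + t *\<^sub>R h" x] by (intro divide_right_mono) auto
    also have "\<dots> = L * norm h" using t by simp
    finally show "(f (x + t *\<^sub>R h) - f x) / t \<le> L * norm h" by linarith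
  qed simp
  ultimately have "s \<le> L * norm h" by (rule tendsto_upperbound) simp
  hence le: "(norm h)\<^sup>2 \<le> L * norm h" by (simp add: nh)
  have "norm h \<le> L"
  proof (cases "norm h = 0")
    case True
    have "0 \<le> L * norm (axis undefined 1 - 0 :: real^'n)" by (rule order_trans[OF abs_ge_zero L])
    hence "0 \<le> L" by simp
    thus ?thesis using True by simp
  qed (use le in \<open>simp add: power2_eq_square\<close>)
  hence "(norm h)\<^sup>2 \<le> L\<^sup>2" by (intro power_mono) auto
  thus ?thesis by (simp add: nh s_def)
qed

section \<open>Square integrable functions on an open set and on the whole space\<close>

lemma l2_inner_whole_space:
  fixes u v :: "real^'n \<Rightarrow> 'b::euclidean_space"
  assumes "open \<Omega>" "u \<in> borel_measurable borel" "v \<in> borel_measurable borel" "\<And>x. x \<notin> \<Omega> \<Longrightarrow> u x \<bullet> v x = 0"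
  shows "l2_inner \<Omega> u v = (LINT x|lborel. u x \<bullet> v x)"
proof -
  have "l2_inner \<Omega> u v = (LINT x|lebesgue. indicator \<Omega> x *\<^sub>R (u x \<bullet> v x))"
    unfolding l2_inner_def by (rule integral_restrict_space) (use assms(1) in simp)
  also have "\<dots> = (LINT x|lebesgue. u x \<bullet> v x)"
    by (intro Bochner_Integration.integral_cong) (use assms(4) in \<open>auto simp: indicator_def\<close>)
  also have "\<dots> = (LINT x|lborel. u x \<bullet> v x)"
    by (rule integral_completion) (use assms(2,3) in auto)
  finally show ?thesis .
qed

lemma integrable_whole_space:
  fixes f :: "real^'n \<Rightarrow> 'b::euclidean_space"
  assumes "open \<Omega>" "f \<in> borel_measurable borel" "\<And>x. x \<notin> \<Omega> \<Longrightarrow> f x = 0"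
  shows "integrable (lebesgue_on \<Omega>) f \<longleftrightarrow> integrable lborel f"
proof -
  have "integrable (lebesgue_on \<Omega>) f \<longleftrightarrow> integrable lebesgue (\<lambda>x. indicator \<Omega> x *\<^sub>R f x)"
    by (rule integrable_restrict_space) (use assms(1) in simp)
  also have "(\<lambda>x. indicator \<Omega> x *\<^sub>R f x) = f" using assms(3) by (auto simp: indicator_def)
  also have "integrable lebesgue f \<longleftrightarrow> integrable lborel f"
    by (rule integrable_completion) (use assms(2) in auto)
  finally show ?thesis .
qed

lemma borel_imp_lebesgue_on:
  "f \<in> borel_measurable borel \<Longrightarrow> f \<in> borel_measurable (lebesgue_on \<Omega>)"
  by (intro measurable_restrict_space1 measurable_completion) simp

lemma L2_whole_space:
  fixes f :: "real^'n \<Rightarrow> 'b::euclidean_space"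
  assumes "open \<Omega>" "f \<in> borel_measurable borel" "\<And>x. x \<notin> \<Omega> \<Longrightarrow> f x = 0"
  shows "f \<in> L2 \<Omega> \<longleftrightarrow> integrable lborel (\<lambda>x. (norm (f x))\<^sup>2)"
  unfolding L2_def using borel_imp_lebesgue_on[OF assms(2), of \<Omega>] assms(2,3)
  by (simp add: integrable_whole_space[OF assms(1)])

lemma finite_measure_lebesgue_on:
  "bounded \<Omega> \<Longrightarrow> open \<Omega> \<Longrightarrow> finite_measure (lebesgue_on (\<Omega> :: (real^'n) set))"
  using emeasure_bounded_finite[of \<Omega>]
  by (intro finite_measureI) (auto simp: emeasure_restrict_space)

text \<open>Convolution and Fubini's theorem are used for the product Borel structure, so a Lebesgue
  measurable class is first replaced by a Borel function on the whole space.\<close>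
lemma L2_borel_representative:
  fixes u :: "real^'n \<Rightarrow> 'b::euclidean_space"
  assumes \<Omega>: "open \<Omega>" "bounded \<Omega>" and u: "u \<in> L2 \<Omega>"
  obtains u' where "u' \<in> borel_measurable borel" "AE x in lebesgue_on \<Omega>. u' x = u x" "\<And>x. x \<notin> \<Omega> \<Longrightarrow> u' x = 0"
    "integrable lborel u'" "integrable lborel (\<lambda>x. (norm (u' x))\<^sup>2)" "u' \<in> L2 \<Omega>"
proof -
  have mu: "(\<lambda>x. indicator \<Omega> x *\<^sub>R u x) \<in> borel_measurable lebesgue"
    using borel_measurable_restrict_space_iff[of \<Omega> lebesgue u] L2_measurable[OF u] \<Omega> by simp
  have rep: "\<exists>f\<in>borel_measurable lborel. AE x in lborel. (indicator \<Omega> x *\<^sub>R u x) \<bullet> b = f x" for b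
    by (rule completion_ex_borel_measurable_real) (rule borel_measurable_inner[OF mu borel_measurable_const])
  have "\<forall>b. \<exists>f. f \<in> borel_measurable borel \<and> (AE x in lborel. (indicator \<Omega> x *\<^sub>R u x) \<bullet> b = f x)"
  proof
    fix b
    from rep[of b] obtain f where "f \<in> borel_measurable lborel" "AE x in lborel. (indicator \<Omega> x *\<^sub>R u x) \<bullet> b = f x"
      by (rule bexE)
    thus "\<exists>f. f \<in> borel_measurable borel \<and> (AE x in lborel. (indicator \<Omega> x *\<^sub>R u x) \<bullet> b = f x)"
      by (intro exI[of _ f]) simp
  qed
  from choice[OF this] obtain f where
    f: "\<forall>b. f b \<in> borel_measurable borel \<and> (AE x in lborel. (indicator \<Omega> x *\<^sub>R u x) \<bullet> b = f b x)"
    by (rule exE)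
  have fm: "f b \<in> borel_measurable borel" and fae: "AE x in lborel. (indicator \<Omega> x *\<^sub>R u x) \<bullet> b = f b x" for b
    using f[THEN spec, of b] by (rule conjunct1, rule conjunct2)
  define u' where "u' x = indicator \<Omega> x *\<^sub>R (\<Sum>b\<in>Basis. f b x *\<^sub>R b)" for x
  have m: "u' \<in> borel_measurable borel"
    unfolding u'_def using fm \<Omega>(1) by (intro borel_measurable_scaleR borel_measurable_sum) auto
  have z: "u' x = 0" if "x \<notin> \<Omega>" for x using that by (simp add: u'_def)
  have "AE x in lborel. \<forall>b\<in>Basis. (indicator \<Omega> x *\<^sub>R u x) \<bullet> b = f b x"
    using fae by (intro AE_finite_allI) auto
  hence "AE x in lborel. x \<in> \<Omega> \<longrightarrow> u' x = u x"
  proof eventually_elim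
    case (elim x)
    show ?case
    proof
      assume "x \<in> \<Omega>"
      hence "u' x = (\<Sum>b\<in>Basis. (u x \<bullet> b) *\<^sub>R b)" using elim unfolding u'_def by (simp cong: sum.cong)
      thus "u' x = u x" by (simp add: euclidean_representation)
    qed
  qed
  hence "AE x in lebesgue. x \<in> \<Omega> \<longrightarrow> u' x = u x" by (rule AE_completion)
  hence ae: "AE x in lebesgue_on \<Omega>. u' x = u x" using \<Omega>(1) by (subst AE_restrict_space_iff) auto
  have uL: "u' \<in> L2 \<Omega>"
  proof -
    have "integrable (lebesgue_on \<Omega>) (\<lambda>x. (norm (u x))\<^sup>2) \<longleftrightarrow> integrable (lebesgue_on \<Omega>) (\<lambda>x. (norm (u' x))\<^sup>2)"
      by (rule integrable_cong_AE)
         (use L2_measurable[OF u] borel_imp_lebesgue_on[OF m] ae in \<open>auto elim: eventually_mono\<close>)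
    with L2_integrable[OF u] borel_imp_lebesgue_on[OF m, of \<Omega>] show ?thesis by (simp add: L2_def)
  qed
  have i2: "integrable lborel (\<lambda>x. (norm (u' x))\<^sup>2)" using L2_whole_space[OF \<Omega>(1) m z] uL by simp
  interpret finite_measure "lebesgue_on \<Omega>" by (rule finite_measure_lebesgue_on[OF \<Omega>(2,1)])
  have "integrable (lebesgue_on \<Omega>) (\<lambda>x. norm (u' x))"
    by (rule square_integrable_imp_integrable) (use L2_integrable[OF uL] borel_imp_lebesgue_on[OF m] in auto)
  hence "integrable (lebesgue_on \<Omega>) u'" using borel_imp_lebesgue_on[OF m] by (simp add: integrable_norm_iff)
  hence "integrable lborel u'" using integrable_whole_space[OF \<Omega>(1) m z] by simp
  thus ?thesis using that m ae z i2 uL by blast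
qed

lemma l2_norm_AE:
  assumes "AE x in lebesgue_on \<Omega>. u x = v x" 
  shows "l2_norm \<Omega> (\<lambda>x. u x - v x) = 0"
proof -
  have "l2_inner \<Omega> (\<lambda>x. u x - v x) (\<lambda>x. u x - v x) = (LINT x|lebesgue_on \<Omega>. (if u x = v x then 0 else (u x - v x) \<bullet> (u x - v x)))"
    unfolding l2_inner_def by (intro Bochner_Integration.integral_cong) auto
  also have "\<dots> = 0"
    by (rule integral_eq_zero_AE) (use assms in \<open>auto elim: eventually_mono\<close>)
  finally show ?thesis by (simp add: l2_norm_def)
qed

subsection \<open>Test functions\<close>

lemma test_fun_iff:
  "\<phi> \<in> test_fun \<Omega> \<longleftrightarrow> smooth \<phi> \<and> (\<exists>K. compact K \<and> K \<subseteq> \<Omega> \<and> (\<forall>x. x \<notin> K \<longrightarrow> \<phi> x = 0))"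
  by (simp add: test_fun_def smooth_def)

lemma L2_csupp:
  fixes f :: "real^'n \<Rightarrow> 'b::euclidean_space"
  assumes \<Omega>: "open \<Omega>" and "continuous_on UNIV f" "compact K" "\<And>x. x \<notin> K \<Longrightarrow> f x = 0"
  shows "f \<in> L2 \<Omega>"
proof -
  have m: "f \<in> borel_measurable borel" by (rule borel_measurable_continuous_onI[OF assms(2)])
  have "integrable lborel (\<lambda>x. (norm (f x))\<^sup>2)"
    by (rule integrable_csupp[OF _ assms(3)]) (use assms in \<open>auto intro: continuous_intros\<close>)
  hence "f \<in> L2 UNIV" using L2_whole_space[of UNIV f] m by simp
  hence "integrable lebesgue (\<lambda>x. (norm (f x))\<^sup>2)" by (simp add: L2_def lebesgue_on_UNIV_eq)
  hence "integrable lebesgue (\<lambda>x. indicator \<Omega> x *\<^sub>R (norm (f x))\<^sup>2)"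
    by (intro integrable_mult_indicator) (use \<Omega> in auto)
  hence "integrable (lebesgue_on \<Omega>) (\<lambda>x. (norm (f x))\<^sup>2)"
    by (subst integrable_restrict_space) (use \<Omega> in auto)
  thus ?thesis using borel_imp_lebesgue_on[OF m] by (simp add: L2_def)
qed

lemma test_fun_L2: "open \<Omega> \<Longrightarrow> \<phi> \<in> test_fun \<Omega> \<Longrightarrow> \<phi> \<in> L2 \<Omega>"
  unfolding test_fun_iff using L2_csupp smoothD_cont by metis

lemma test_fun_scaleR:
  assumes "\<psi> \<in> test_fun \<Omega>"
  shows "(\<lambda>x. \<psi> x *\<^sub>R b) \<in> test_fun \<Omega>"
proof -
  obtain K where K: "compact K" "K \<subseteq> \<Omega>" "\<forall>x. x \<notin> K \<longrightarrow> \<psi> x = 0" and s: "smooth \<psi>"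
    using assms unfolding test_fun_iff by blast
  show ?thesis unfolding test_fun_iff
    by (intro conjI exI[of _ K] K(1,2) smooth_scaleR_fun[OF s smooth_const]) (use K(3) in simp)
qed

lemma compact_separation:
  fixes K :: "(real^'n) set"
  assumes "compact K" "open \<Omega>" "K \<subseteq> \<Omega>"
  obtains d where "0 < d" "\<And>x y. x \<in> K \<Longrightarrow> dist x y \<le> d \<Longrightarrow> y \<in> \<Omega>"
proof -
  obtain e where e: "e > 0" "(\<Union>x\<in>K. cball x e) \<subseteq> \<Omega>"
    using compact_subset_open_imp_cball_epsilon_subset[OF assms] by blast
  thus ?thesis using that by (metis UN_I mem_cball subsetD)
qed

text \<open>A Lipschitz function that is 1 on \<open>T\<close> and vanishes at distance \<open>r\<close> from \<open>T\<close>.\<close>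
definition tent :: "real \<Rightarrow> (real^'n) set \<Rightarrow> real^'n \<Rightarrow> real" where
  "tent r T x = max 0 (1 - infdist x T / r)"

lemma tent_lipschitz: "0 < r \<Longrightarrow> norm (tent r T x - tent r T y) \<le> (1 / r) * norm (x - y)"
proof -
  assume r: "0 < r"
  have "\<bar>infdist x T - infdist y T\<bar> \<le> norm (x - y)"
    using infdist_triangle_abs[of x T y] by (simp add: dist_norm)
  hence "\<bar>infdist x T / r - infdist y T / r\<bar> \<le> norm (x - y) / r"
    using r by (simp add: diff_divide_distrib[symmetric] divide_right_mono)
  thus ?thesis unfolding tent_def by (auto simp: max_def abs_le_iff)
qed

lemma tent_continuous: "0 < r \<Longrightarrow> continuous_on UNIV (tent r T)"
  unfolding tent_def by (intro continuous_intros) auto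

lemma tent_zero: "0 < r \<Longrightarrow> r \<le> infdist x T \<Longrightarrow> tent r T x = 0"
  by (simp add: tent_def)

lemma tent_le_one: "0 < r \<Longrightarrow> \<bar>tent r T x\<bar> \<le> 1"
  using infdist_nonneg[of x T] by (simp add: tent_def)

text \<open>Mollified tents are test functions. They converge to the tent as the kernel shrinks, and the tents
  converge to the indicator of \<open>T\<close> as \<open>r\<close> tends to zero.\<close>
lemma fundamental_lemma_compact:
  fixes f :: "real^'n \<Rightarrow> real"
  assumes \<Omega>: "open \<Omega>" and f: "integrable lborel f"
    and z: "\<And>\<psi>. \<psi> \<in> test_fun \<Omega> \<Longrightarrow> (LINT x|lborel. f x * \<psi> x) = 0"
    and T: "compact T" "T \<subseteq> \<Omega>" "T \<noteq> {}"
  shows "(LINT x|lborel. f x * indicator T x) = 0"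
proof -
  have [measurable]: "f \<in> borel_measurable borel" using borel_measurable_integrable[OF f] by simp
  have clT: "closed T" using T(1) by (rule compact_imp_closed)
  hence [measurable]: "T \<in> sets borel" by (rule borel_closed)
  obtain d0 where d0: "0 < d0" "\<And>x y. x \<in> T \<Longrightarrow> dist x y \<le> d0 \<Longrightarrow> y \<in> \<Omega>"
    using compact_separation[OF T(1) \<Omega> T(2)] by blast
  define d where "d = d0 / 2"
  have d: "0 < d" "d < d0" using d0(1) by (auto simp: d_def)
  have near: "y \<in> \<Omega>" if "infdist y T \<le> d" for y
  proof -
    have "Inf (dist y ` T) < d0" using that d infdist_notempty[OF T(3), of y] by simp
    then obtain x where "x \<in> T" "dist y x < d0" using cInf_lessD[of "dist y ` T" d0] T(3) by auto
    thus ?thesis using d0(2)[of x y] by (simp add: dist_commute)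
  qed
  have comp: "compact {x. infdist x T \<le> s}" if "0 < s" for s
    by (rule compact_infdist_le[OF T(3,1) that])
  have zero: "(LINT x|lborel. f x * tent r T x) = 0" if r: "0 < r" "r \<le> d / 2" for r
  proof -
    have tc: "continuous_on UNIV (tent r T)"
      by (rule tent_continuous[OF r(1)])
    have tz: "tent r T x = 0" if "x \<notin> {x. infdist x T \<le> r}" for x
      using that r by (simp add: tent_def)
    have ti: "integrable lborel (tent r T)" by (rule integrable_csupp[OF tc comp[OF r(1)] tz])
    have tb: "bounded (range (tent r T))"
      using bounded_csupp[OF tc comp[OF r(1)] tz] by (metis boundedI rangeE)
    let ?e = "\<lambda>k. d / 2 / real (Suc k)"
    have "\<exists>\<eta> :: real^'n \<Rightarrow> real. mollifier (?e k) \<eta>" for k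
      using ex_mollifier[of "?e k"] d(1) by (metis divide_pos_pos of_nat_0_less_iff zero_less_Suc zero_less_numeral)
    then obtain \<eta> :: "nat \<Rightarrow> real^'n \<Rightarrow> real" where m: "\<And>k. mollifier (?e k) (\<eta> k)" by metis
    have "(\<lambda>k. d / 2 * (1 / real (Suc k))) \<longlonglongrightarrow> d / 2 * 0"
      by (intro tendsto_intros LIMSEQ_Suc lim_1_over_n)
    hence e0: "?e \<longlonglongrightarrow> 0" by simp
    have lim: "(\<lambda>k. LINT x|lborel. conv (\<eta> k) f x \<bullet> tent r T x) \<longlonglongrightarrow> (LINT x|lborel. f x \<bullet> tent r T x)"
      by (rule mollify_weak_limit[OF m e0 f ti tb tent_lipschitz[OF r(1)]])
    have "(LINT x|lborel. conv (\<eta> k) f x \<bullet> tent r T x) = 0" for k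
    proof -
      have "conv (\<eta> k) (tent r T) \<in> test_fun \<Omega>"
        unfolding test_fun_iff
      proof (intro conjI exI[of _ "{x. infdist x T \<le> d}"] allI impI)
        show "smooth (conv (\<eta> k) (tent r T))" by (rule smooth_mollify[OF m ti])
        show "{x. infdist x T \<le> d} \<subseteq> \<Omega>" using near by auto
        fix x assume x: "x \<notin> {x. infdist x T \<le> d}"
        have ek: "?e k \<le> d / 2" using d(1) by (simp add: field_simps)
        show "conv (\<eta> k) (tent r T) x = 0"
        proof (rule mollify_zero[OF m])
          fix y assume "dist x y < ?e k"
          hence "infdist y T > d / 2" using infdist_triangle[of x T y] x ek unfolding mem_Collect_eq not_le by linarith
          thus "tent r T y = 0" using r tz by auto
        qed
      qed (rule comp[OF d(1)])
      from z[OF this] show ?thesis using mollify_adjoint[OF m[of k] f ti] by simp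
    qed
    hence "(\<lambda>k. 0) \<longlonglongrightarrow> (LINT x|lborel. f x \<bullet> tent r T x)" using lim by simp
    thus ?thesis by (simp add: LIMSEQ_const_iff)
  qed
  let ?r = "\<lambda>k. d / 2 / real (Suc k)"
  have rpos: "0 < ?r k" "?r k \<le> d / 2" for k using d(1) by (auto simp: field_simps)
  have L: "(\<lambda>k. LINT x|lborel. f x * tent (?r k) T x) \<longlonglongrightarrow> (LINT x|lborel. f x * indicator T x)"
  proof (rule integral_dominated_convergence)
    show "integrable lborel (\<lambda>x. \<bar>f x\<bar>)" using f by simp
    show "(\<lambda>x. f x * indicator T x) \<in> borel_measurable lborel" by measurable
    show "(\<lambda>x. f x * tent (?r k) T x) \<in> borel_measurable lborel" for k
      using borel_measurable_continuous_onI[OF tent_continuous[OF rpos(1)[of k]], of T] by simp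
    have "\<bar>tent (?r k) T x\<bar> \<le> 1" for k x by (rule tent_le_one[OF rpos(1)])
    thus "AE x in lborel. norm (f x * tent (?r k) T x) \<le> \<bar>f x\<bar>" for k
      by (intro AE_I2) (simp add: abs_mult mult_left_le)
    have "(\<lambda>k. tent (?r k) T x) \<longlonglongrightarrow> indicator T x" for x
    proof (cases "x \<in> T")
      case True thus ?thesis by (simp add: tent_def)
    next
      case False
      hence p: "0 < infdist x T" using in_closed_iff_infdist_zero[OF clT T(3)] infdist_nonneg[of x T] by (simp add: less_le)
      obtain N :: nat where N: "d / 2 / infdist x T < real N" using reals_Archimedean2 by blast
      have "tent (?r k) T x = 0" if "N \<le> k" for k
      proof -
        have "d / 2 / infdist x T < real (Suc k)" using N that by simp
        hence "?r k < infdist x T" using p by (simp add: field_simps)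
        thus ?thesis by (intro tent_zero rpos(1)) simp
      qed
      hence "\<forall>\<^sub>F k in sequentially. tent (?r k) T x = 0" unfolding eventually_sequentially by blast
      from tendsto_eventually[OF this] show ?thesis using False by simp
    qed
    thus "AE x in lborel. (\<lambda>k. f x * tent (?r k) T x) \<longlonglongrightarrow> f x * indicator T x"
      by (intro AE_I2 tendsto_mult_left)
  qed
  have "(LINT x|lborel. f x * tent (?r k) T x) = 0" for k using rpos by (intro zero)
  hence "(\<lambda>k. 0) \<longlonglongrightarrow> (LINT x|lborel. f x * indicator T x)" using L by simp
  thus ?thesis by (simp add: LIMSEQ_const_iff)
qed

text \<open>By inner regularity a set of positive measure on which \<open>f > 0\<close> would contain compact sets of
  positive measure, over which the integral of \<open>f\<close> could not vanish.\<close>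
lemma fundamental_lemma_nonpos:
  fixes f :: "real^'n \<Rightarrow> real"
  assumes \<Omega>: "open \<Omega>" "bounded \<Omega>" and f: "integrable lborel f"
    and z: "\<And>\<psi>. \<psi> \<in> test_fun \<Omega> \<Longrightarrow> (LINT x|lborel. f x * \<psi> x) = 0"
  shows "AE x in lebesgue. x \<in> \<Omega> \<longrightarrow> f x \<le> 0"
proof -
  have [measurable]: "f \<in> borel_measurable borel" using borel_measurable_integrable[OF f] by simp
  define A where "A = {x \<in> \<Omega>. 0 < f x}"
  have "A = \<Omega> \<inter> (f -` {0<..} \<inter> space borel)" by (auto simp: A_def)
  moreover have "f -` {0<..} \<inter> space borel \<in> sets borel" by (rule measurable_sets[of f borel borel]) auto
  ultimately have Ab: "A \<in> sets borel" using \<Omega>(1) by auto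
  hence Al: "A \<in> sets lebesgue" by (simp add: sets_completionI_sets)
  have small: "emeasure lebesgue A \<le> ennreal e" if e: "0 < e" for e
  proof -
    obtain T where T: "closed T" "T \<subseteq> A" "A - T \<in> lmeasurable" "emeasure lebesgue (A - T) < ennreal e"
      using sets_lebesgue_inner_closed[OF Al e] by blast
    have Tc: "compact T" using T(1,2) \<Omega>(2) by (auto simp: compact_eq_bounded_closed A_def intro: bounded_subset)
    have "emeasure lborel T = 0"
    proof (cases "T = {}")
      case False
      have "(LINT x|lborel. f x * indicator T x) = 0"
        by (rule fundamental_lemma_compact[OF \<Omega>(1) f z Tc _ False]) (use T(2) in \<open>auto simp: A_def\<close>)
      moreover have "integrable lborel (\<lambda>x. f x * indicator T x)"
        using integrable_mult_indicator[of T lborel f] T(1) f by (simp add: mult.commute)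
      moreover have "0 \<le> f x * indicator T x" for x using T(2) by (auto simp: A_def indicator_def)
      ultimately have "AE x in lborel. f x * indicator T x = 0"
        using integral_nonneg_eq_0_iff_AE[of lborel "\<lambda>x. f x * indicator T x"] by auto
      hence "AE x in lborel. x \<notin> T" by eventually_elim (use T(2) in \<open>auto simp: A_def indicator_def\<close>)
      thus ?thesis using T(1) by (subst (asm) AE_iff_measurable[of T]) auto
    qed simp
    hence T0: "emeasure lebesgue T = 0" using T(1) by simp
    have "emeasure lebesgue A \<le> emeasure lebesgue T + emeasure lebesgue (A - T)"
      using emeasure_subadditive[of T lebesgue "A - T"] T Al by (simp add: Un_absorb1 fmeasurableD)
    thus ?thesis using T0 T(4) by simp
  qed
  have "emeasure lebesgue A \<le> 0" by (rule ennreal_le_epsilon) (use small in auto)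
  hence "emeasure lebesgue A = 0" by simp
  hence "A \<in> null_sets lebesgue" using Al by blast
  thus ?thesis by (rule AE_I') (auto simp: A_def)
qed

lemma fundamental_lemma:
  fixes u :: "real^'n \<Rightarrow> 'b::euclidean_space"
  assumes \<Omega>: "open \<Omega>" "bounded \<Omega>" and u: "u \<in> L2 \<Omega>"
    and z: "\<And>\<psi> b. \<psi> \<in> test_fun \<Omega> \<Longrightarrow> b \<in> Basis \<Longrightarrow> l2_inner \<Omega> u (\<lambda>x. \<psi> x *\<^sub>R b) = 0"
  shows "l2_norm \<Omega> u = 0"
proof -
  obtain u' where u': "u' \<in> borel_measurable borel" "AE x in lebesgue_on \<Omega>. u' x = u x" "\<And>x. x \<notin> \<Omega> \<Longrightarrow> u' x = 0"
    "integrable lborel u'" "integrable lborel (\<lambda>x. (norm (u' x))\<^sup>2)" "u' \<in> L2 \<Omega>"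
    using L2_borel_representative[OF \<Omega> u] by blast
  have b0: "AE x in lebesgue. x \<in> \<Omega> \<longrightarrow> u' x \<bullet> b = 0" if b: "b \<in> Basis" for b
  proof -
    have i: "integrable lborel (\<lambda>x. u' x \<bullet> b)" using u'(4) by simp
    have zz: "(LINT x|lborel. (u' x \<bullet> b) * \<psi> x) = 0" if p: "\<psi> \<in> test_fun \<Omega>" for \<psi>
    proof -
      have s: "smooth \<psi>" using p by (simp add: test_fun_iff)
      have sb: "smooth (\<lambda>x. \<psi> x *\<^sub>R b)" by (rule smooth_scaleR_fun[OF s smooth_const])
      have "(\<lambda>x. \<psi> x *\<^sub>R b) \<in> test_fun \<Omega>" by (rule test_fun_scaleR[OF p])
      hence tL: "(\<lambda>x. \<psi> x *\<^sub>R b) \<in> L2 \<Omega>" by (rule test_fun_L2[OF \<Omega>(1)])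
      have "l2_inner \<Omega> u' (\<lambda>x. \<psi> x *\<^sub>R b) = l2_inner \<Omega> u (\<lambda>x. \<psi> x *\<^sub>R b)"
        by (rule l2_inner_cong_AE[OF u'(6) u tL l2_norm_AE[OF u'(2)]])
      hence "l2_inner \<Omega> u' (\<lambda>x. \<psi> x *\<^sub>R b) = 0" using z[OF p b] by simp
      moreover have "l2_inner \<Omega> u' (\<lambda>x. \<psi> x *\<^sub>R b) = (LINT x|lborel. u' x \<bullet> (\<psi> x *\<^sub>R b))"
        by (rule l2_inner_whole_space[OF \<Omega>(1) u'(1) borel_measurable_continuous_onI[OF smoothD_cont[OF sb]]]) (simp add: u'(3))
      ultimately show ?thesis by (simp add: mult.commute)
    qed
    have "AE x in lebesgue. x \<in> \<Omega> \<longrightarrow> u' x \<bullet> b \<le> 0"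
      by (rule fundamental_lemma_nonpos[OF \<Omega> i zz])
    moreover have "AE x in lebesgue. x \<in> \<Omega> \<longrightarrow> - (u' x \<bullet> b) \<le> 0"
      by (rule fundamental_lemma_nonpos[OF \<Omega>]) (use i zz in auto)
    ultimately show ?thesis by eventually_elim auto
  qed
  have "AE x in lebesgue. \<forall>b\<in>Basis. x \<in> \<Omega> \<longrightarrow> u' x \<bullet> b = 0"
    using b0 by (intro AE_finite_allI) auto
  hence "AE x in lebesgue. x \<in> \<Omega> \<longrightarrow> u' x = 0" 
  proof eventually_elim
    case (elim x)
    show ?case
    proof (rule impI, rule euclidean_eqI)
      fix b :: 'b assume "x \<in> \<Omega>" "b \<in> Basis"
      thus "u' x \<bullet> b = 0 \<bullet> b" using elim by simp
    qed
  qed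
  hence "AE x in lebesgue_on \<Omega>. u' x = 0" using \<Omega>(1) by (subst AE_restrict_space_iff) auto
  hence "AE x in lebesgue_on \<Omega>. u x = 0" using u'(2) by eventually_elim auto
  thus ?thesis using l2_norm_zero_iff[OF u] by simp
qed

section \<open>Differential forms on a bounded open set\<close>

lemma partial_deriv_Lam:
  assumes "smooth u" "\<And>x. u x \<in> Lam l" shows "partial_deriv i u x \<in> Lam l"
proof -
  have "partial_deriv i u x $ I = 0" if "card I \<noteq> l" for I
  proof -
    have "(\<lambda>x. u x $ I) = (\<lambda>x. 0)" using assms(2) that by (auto simp: Lam_def)
    hence "partial_deriv i (\<lambda>x. u x $ I) x = 0" by simp
    thus ?thesis by (simp add: partial_deriv_component[OF assms(1)])
  qed
  thus ?thesis by (simp add: Lam_def)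
qed

lemma partial_deriv_lc:
  assumes "smooth f" "smooth g"
  shows "partial_deriv i (lcf a f b g) x = a *\<^sub>R partial_deriv i f x + b *\<^sub>R partial_deriv i g x"
  using partial_deriv_add[OF smoothD_diff[OF smooth_scaleR[OF assms(1)]] smoothD_diff[OF smooth_scaleR[OF assms(2)]]]
  by (simp add: partial_deriv_scaleR assms)

lemma smooth_lc: "smooth f \<Longrightarrow> smooth g \<Longrightarrow> smooth (lcf a f b g)"
  by (intro smooth_add smooth_scaleR)

lemma ext_deriv_lc:
  assumes "smooth f" "smooth g"
  shows "ext_deriv (lcf a f b g) x = a *\<^sub>R ext_deriv f x + b *\<^sub>R ext_deriv g x"
  by (simp add: ext_deriv_eq partial_deriv_lc[OF assms] linear_add[OF linear_ext_mult]
      linear_scale[OF linear_ext_mult] sum.distrib scaleR_sum_right)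

lemma coderiv_lc:
  assumes "smooth f" "smooth g"
  shows "coderiv (lcf a f b g) x = a *\<^sub>R coderiv f x + b *\<^sub>R coderiv g x"
  by (simp add: coderiv_eq partial_deriv_lc[OF assms] linear_add[OF linear_int_mult]
      linear_scale[OF linear_int_mult] sum.distrib scaleR_sum_right)

lemma ext_deriv_diff:
  assumes "smooth f" "smooth g"
  shows "ext_deriv (\<lambda>x. f x - g x) x = ext_deriv f x - ext_deriv g x"
  using ext_deriv_lc[OF assms, of 1 "-1"] by simp

lemma coderiv_diff:
  assumes "smooth f" "smooth g"
  shows "coderiv (\<lambda>x. f x - g x) x = coderiv f x - coderiv g x"
  using coderiv_lc[OF assms, of 1 "-1"] by simp

lemma partial_deriv_diff:
  assumes "smooth f" "smooth g"
  shows "partial_deriv i (\<lambda>x. f x - g x) x = partial_deriv i f x - partial_deriv i g x"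
  using partial_deriv_lc[OF assms, of i 1 "-1"] by simp

subsection \<open>Square integrable forms\<close>

lemma L2_form_L2: "u \<in> L2_form \<Omega> l \<Longrightarrow> u \<in> L2 \<Omega>" by (simp add: L2_form_def)

lemma Lam_lc: "a \<in> Lam l \<Longrightarrow> b \<in> Lam l \<Longrightarrow> s *\<^sub>R a + t *\<^sub>R b \<in> Lam l"
  using subspace_Lam[of l] by (auto simp: subspace_def)

lemma L2_form_lc: "u \<in> L2_form \<Omega> l \<Longrightarrow> v \<in> L2_form \<Omega> l \<Longrightarrow> lcf a u b v \<in> L2_form \<Omega> l"
  by (auto simp: L2_form_def L2_lc Lam_lc)

lemma L2_form_diff: "u \<in> L2_form \<Omega> l \<Longrightarrow> v \<in> L2_form \<Omega> l \<Longrightarrow> (\<lambda>x. u x - v x) \<in> L2_form \<Omega> l"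
  using L2_form_lc[of u \<Omega> l v 1 "-1"] by simp

definition Lam_proj :: "nat \<Rightarrow> real^('n::finite set) \<Rightarrow> real^('n set)" where
  "Lam_proj l a = (\<chi> I. if card I = l then a $ I else 0)"

lemma linear_Lam_proj: "linear (Lam_proj l)"
  by (rule linearI) (auto simp: Lam_proj_def vec_eq_iff)

lemma continuous_Lam_proj: "continuous_on UNIV (Lam_proj l)"
  using linear_Lam_proj[of l] linear_conv_bounded_linear linear_continuous_on by blast

lemma Lam_proj_Lam: "Lam_proj l a \<in> Lam l" by (simp add: Lam_def Lam_proj_def)

lemma Lam_proj_id: "a \<in> Lam l \<Longrightarrow> Lam_proj l a = a" by (auto simp: Lam_def Lam_proj_def vec_eq_iff)

lemma norm_Lam_proj: "norm (Lam_proj l a) \<le> norm a"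
  by (rule norm_le_componentwise_cart) (simp add: Lam_proj_def)

text \<open>The limit is only determined almost everywhere; projecting it to forms of degree \<open>l\<close> does not
  increase the distances.\<close>
lemma L2_form_closed:
  assumes \<Omega>: "open \<Omega>" and f: "\<And>k. f k \<in> L2_form \<Omega> l" and lim: "l2_tendsto \<Omega> f g"
  obtains g' where "g' \<in> L2_form \<Omega> l" "l2_tendsto \<Omega> f g'"
proof
  let ?g = "\<lambda>x. Lam_proj l (g x)"
  have g: "g \<in> L2 \<Omega>" using lim by (simp add: l2_tendsto_def)
  have m: "?g \<in> borel_measurable (lebesgue_on \<Omega>)"
    by (rule measurable_compose[OF L2_measurable[OF g] borel_measurable_continuous_onI[OF continuous_Lam_proj]])
  have gL: "?g \<in> L2 \<Omega>"
    by (rule l2_norm_mono(1)[OF g m \<Omega>, of 1]) (simp_all add: norm_Lam_proj)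
  show "?g \<in> L2_form \<Omega> l" using gL by (simp add: L2_form_def Lam_proj_Lam)
  have fk: "f k \<in> L2 \<Omega>" for k using f by (simp add: L2_form_def)
  have b: "l2_norm \<Omega> (\<lambda>x. f k x - ?g x) \<le> l2_norm \<Omega> (\<lambda>x. f k x - g x)" for k
  proof -
    have "l2_norm \<Omega> (\<lambda>x. f k x - ?g x) \<le> 1 * l2_norm \<Omega> (\<lambda>x. f k x - g x)"
    proof (rule l2_norm_mono(2)[OF L2_diff[OF fk g] L2_measurable[OF L2_diff[OF fk gL]] \<Omega>])
      fix x assume "x \<in> \<Omega>"
      hence "f k x - ?g x = Lam_proj l (f k x - g x)"
        using f[of k] by (simp add: L2_form_def linear_diff[OF linear_Lam_proj] Lam_proj_id)
      thus "norm (f k x - ?g x) \<le> 1 * norm (f k x - g x)" using norm_Lam_proj by simp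
    qed simp
    thus ?thesis by simp
  qed
  have l0: "(\<lambda>k. l2_norm \<Omega> (\<lambda>x. f k x - g x)) \<longlonglongrightarrow> 0" using lim by (simp add: l2_tendsto_def)
  have "(\<lambda>k. l2_norm \<Omega> (\<lambda>x. f k x - ?g x)) \<longlonglongrightarrow> 0"
    by (rule Lim_null_comparison[OF always_eventually l0]) (use b in simp)
  thus "l2_tendsto \<Omega> f ?g" using fk gL by (simp add: l2_tendsto_def)
qed

lemma L2_form_complete:
  assumes \<Omega>: "open \<Omega>" "bounded \<Omega>" and f: "\<And>k. f k \<in> L2_form \<Omega> l" and C: "l2_Cauchy \<Omega> f"
  obtains g where "g \<in> L2_form \<Omega> l" "l2_tendsto \<Omega> f g"
proof -
  obtain g where "l2_tendsto \<Omega> f g"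
    using l2_complete[OF finite_measure_lebesgue_on[OF \<Omega>(2,1)] C] by blast
  from L2_form_closed[OF \<Omega>(1) f this] that show ?thesis by blast
qed

subsection \<open>Test forms\<close>

lemma test_formD:
  assumes "\<phi> \<in> test_form \<Omega> l"
  shows "\<phi> \<in> test_fun \<Omega>" "smooth \<phi>" "\<phi> x \<in> Lam l"
  using assms by (auto simp: test_form_def test_fun_iff)

lemma test_form_support:
  assumes "\<phi> \<in> test_form \<Omega> l"
  obtains K where "compact K" "K \<subseteq> \<Omega>" "\<And>x. x \<notin> K \<Longrightarrow> \<phi> x = 0"
  using test_formD(1)[OF assms] unfolding test_fun_iff by blast

lemma test_formI:
  "smooth \<phi> \<Longrightarrow> compact K \<Longrightarrow> K \<subseteq> \<Omega> \<Longrightarrow> (\<And>x. x \<notin> K \<Longrightarrow> \<phi> x = 0) \<Longrightarrow> (\<And>x. \<phi> x \<in> Lam l) \<Longrightarrow> \<phi> \<in> test_form \<Omega> l"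
  unfolding test_form_def test_fun_iff by blast

lemma test_form_L2_form: "open \<Omega> \<Longrightarrow> \<phi> \<in> test_form \<Omega> l \<Longrightarrow> \<phi> \<in> L2_form \<Omega> l"
  using test_formD test_fun_L2 unfolding L2_form_def by blast

lemma test_form_lc:
  assumes "\<phi> \<in> test_form \<Omega> l" "\<psi> \<in> test_form \<Omega> l"
  shows "lcf a \<phi> b \<psi> \<in> test_form \<Omega> l"
proof -
  obtain K where K: "compact K" "K \<subseteq> \<Omega>" "\<And>x. x \<notin> K \<Longrightarrow> \<phi> x = 0" using test_form_support[OF assms(1)] by blast
  obtain K' where K': "compact K'" "K' \<subseteq> \<Omega>" "\<And>x. x \<notin> K' \<Longrightarrow> \<psi> x = 0" using test_form_support[OF assms(2)] by blast
  show ?thesis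
    by (rule test_formI[of _ "K \<union> K'"])
       (use K K' smooth_lc[OF test_formD(2)[OF assms(1)] test_formD(2)[OF assms(2)]]
          Lam_lc[OF test_formD(3)[OF assms(1)] test_formD(3)[OF assms(2)]] in auto)
qed

lemma test_form_diff: "\<phi> \<in> test_form \<Omega> l \<Longrightarrow> \<psi> \<in> test_form \<Omega> l \<Longrightarrow> (\<lambda>x. \<phi> x - \<psi> x) \<in> test_form \<Omega> l"
  using test_form_lc[of \<phi> \<Omega> l \<psi> 1 "-1"] by simp

lemma test_form_zero: "(\<lambda>x. 0) \<in> test_form \<Omega> l"
  by (rule test_formI[of _ "{}"]) (auto simp: Lam_def)

lemma test_form_ext_deriv:
  assumes "\<phi> \<in> test_form \<Omega> l" shows "ext_deriv \<phi> \<in> test_form \<Omega> (l + 1)"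
proof -
  obtain K where K: "compact K" "K \<subseteq> \<Omega>" "\<And>x. x \<notin> K \<Longrightarrow> \<phi> x = 0" using test_form_support[OF assms] by blast
  note t = test_formD[OF assms]
  have "ext_deriv \<phi> x \<in> Lam (l + 1)" for x
    unfolding ext_deriv_eq by (intro subspace_sum[OF subspace_Lam] ext_mult_Lam partial_deriv_Lam t)
  thus ?thesis
    by (intro test_formI[OF smooth_ext_deriv[OF t(2)] K(1,2)] ext_deriv_zero_off_closed[OF compact_imp_closed[OF K(1)] K(3)])
qed

lemma test_form_coderiv:
  assumes "\<phi> \<in> test_form \<Omega> l" "1 \<le> l" shows "coderiv \<phi> \<in> test_form \<Omega> (l - 1)"
proof -
  obtain K where K: "compact K" "K \<subseteq> \<Omega>" "\<And>x. x \<notin> K \<Longrightarrow> \<phi> x = 0" using test_form_support[OF assms(1)] by blast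
  note t = test_formD[OF assms(1)]
  have "coderiv \<phi> x \<in> Lam (l - 1)" for x
    unfolding coderiv_eq
    by (intro subspace_neg[OF subspace_Lam] subspace_sum[OF subspace_Lam] int_mult_Lam' partial_deriv_Lam t assms(2))
  thus ?thesis
    by (intro test_formI[OF smooth_coderiv[OF t(2)] K(1,2)] coderiv_zero_off_closed[OF compact_imp_closed[OF K(1)] K(3)])
qed

lemma l2_inner_smooth:
  fixes f g :: "real^'n \<Rightarrow> 'b::euclidean_space"
  assumes "open \<Omega>" "smooth f" "smooth g" "\<And>x. x \<notin> \<Omega> \<Longrightarrow> f x \<bullet> g x = 0"
  shows "l2_inner \<Omega> f g = (LINT x|lborel. f x \<bullet> g x)"
  by (rule l2_inner_whole_space[OF assms(1) borel_measurable_continuous_onI[OF smoothD_cont[OF assms(2)]]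
        borel_measurable_continuous_onI[OF smoothD_cont[OF assms(3)]] assms(4)])

lemma l2_green:
  assumes \<Omega>: "open \<Omega>" and f: "smooth f" and g: "g \<in> test_form \<Omega> l"
  shows "l2_inner \<Omega> (ext_deriv f) g = l2_inner \<Omega> f (coderiv g)"
    "l2_inner \<Omega> (coderiv f) g = l2_inner \<Omega> f (ext_deriv g)"
proof -
  note t = test_formD[OF g]
  obtain K where K: "compact K" "K \<subseteq> \<Omega>" "\<And>x. x \<notin> K \<Longrightarrow> g x = 0" using test_form_support[OF g] by blast
  have off: "g x = 0" "ext_deriv g x = 0" "coderiv g x = 0" if "x \<notin> \<Omega>" for x
  proof -
    have x: "x \<notin> K" using K(2) that by blast
    show "g x = 0" "ext_deriv g x = 0" "coderiv g x = 0"
      using K(3) ext_deriv_zero_off_closed[OF compact_imp_closed[OF K(1)] K(3) x]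
        coderiv_zero_off_closed[OF compact_imp_closed[OF K(1)] K(3) x] x by auto
  qed
  have K': "\<forall>x. x \<notin> K \<longrightarrow> g x = 0" using K(3) by blast
  show "l2_inner \<Omega> (ext_deriv f) g = l2_inner \<Omega> f (coderiv g)"
    using green_ext_coderiv[OF f t(2) K(1) disjI2[OF K']]
      l2_inner_smooth[OF \<Omega> smooth_ext_deriv[OF f] t(2)] l2_inner_smooth[OF \<Omega> f smooth_coderiv[OF t(2)]]
    by (simp add: off)
  show "l2_inner \<Omega> (coderiv f) g = l2_inner \<Omega> f (ext_deriv g)"
    using green_ext_coderiv[OF t(2) f K(1) disjI1[OF K']]
      l2_inner_smooth[OF \<Omega> smooth_coderiv[OF f] t(2)] l2_inner_smooth[OF \<Omega> f smooth_ext_deriv[OF t(2)]]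
    by (simp add: off inner_commute)
qed

text \<open>The Hodge Laplacian is integrated by parts in two ways: as \<open>d\<^sup>* d + d d\<^sup>*\<close> and as minus the sum
  of the pure second derivatives.\<close>
lemma energy_eq:
  assumes \<Omega>: "open \<Omega>" and g: "g \<in> test_form \<Omega> l"
  shows "(energy_norm \<Omega> g)\<^sup>2 = (l2_norm \<Omega> (ext_deriv g))\<^sup>2 + (l2_norm \<Omega> (coderiv g))\<^sup>2"
    "(energy_norm \<Omega> g)\<^sup>2 = (\<Sum>i\<in>UNIV. (l2_norm \<Omega> (partial_deriv i g))\<^sup>2)"
    "0 \<le> energy_norm \<Omega> g"
proof -
  note t = test_formD[OF g]
  obtain K where K: "compact K" "K \<subseteq> \<Omega>" "\<And>x. x \<notin> K \<Longrightarrow> g x = 0" using test_form_support[OF g] by blast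
  note clK = compact_imp_closed[OF K(1)]
  have off: "g x = 0" "ext_deriv g x = 0" "coderiv g x = 0" "partial_deriv i g x = 0" if "x \<notin> \<Omega>" for x i
  proof -
    have x: "x \<notin> K" using K(2) that by blast
    show "g x = 0" "ext_deriv g x = 0" "coderiv g x = 0" "partial_deriv i g x = 0"
      using K(3) ext_deriv_zero_off_closed[OF clK K(3) x]
        coderiv_zero_off_closed[OF clK K(3) x] partial_deriv_zero_off_closed[OF clK K(3) x] x by auto
  qed
  have sh: "smooth (hodge_laplacian g)"
    unfolding hodge_laplacian_def
    by (intro smooth_add smooth_coderiv smooth_ext_deriv t)
  have e: "l2_inner \<Omega> (hodge_laplacian g) g = (LINT x|lborel. hodge_laplacian g x \<bullet> g x)"
    by (rule l2_inner_smooth[OF \<Omega> sh t(2)]) (simp add: off)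
  have e1: "l2_inner \<Omega> (hodge_laplacian g) g = (l2_norm \<Omega> (ext_deriv g))\<^sup>2 + (l2_norm \<Omega> (coderiv g))\<^sup>2"
    using e hodge_integral[OF t(2) t(2) K(1,3)]
      l2_inner_smooth[OF \<Omega> smooth_ext_deriv[OF t(2)] smooth_ext_deriv[OF t(2)]]
      l2_inner_smooth[OF \<Omega> smooth_coderiv[OF t(2)] smooth_coderiv[OF t(2)]]
    by (simp add: l2_norm_square off)
  moreover have "0 \<le> (l2_norm \<Omega> (ext_deriv g))\<^sup>2 + (l2_norm \<Omega> (coderiv g))\<^sup>2" by simp
  ultimately show "(energy_norm \<Omega> g)\<^sup>2 = (l2_norm \<Omega> (ext_deriv g))\<^sup>2 + (l2_norm \<Omega> (coderiv g))\<^sup>2"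
    "0 \<le> energy_norm \<Omega> g"
    unfolding energy_norm_def by simp_all
  hence "(energy_norm \<Omega> g)\<^sup>2 = l2_inner \<Omega> (hodge_laplacian g) g" using e1 by simp
  also have "\<dots> = (\<Sum>i\<in>UNIV. (l2_norm \<Omega> (partial_deriv i g))\<^sup>2)"
    using e hodge_integral_partial[OF t(2) t(2) K(1,3)]
      l2_inner_smooth[OF \<Omega> smooth_partial_deriv[OF t(2)] smooth_partial_deriv[OF t(2)]]
    by (simp add: l2_norm_square off)
  finally show "(energy_norm \<Omega> g)\<^sup>2 = (\<Sum>i\<in>UNIV. (l2_norm \<Omega> (partial_deriv i g))\<^sup>2)" .
qed

lemma energy_bounds:
  assumes \<Omega>: "open \<Omega>" and g: "g \<in> test_form \<Omega> l"
  shows "l2_norm \<Omega> (ext_deriv g) \<le> energy_norm \<Omega> g" "l2_norm \<Omega> (coderiv g) \<le> energy_norm \<Omega> g"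
    "energy_norm \<Omega> g \<le> l2_norm \<Omega> (ext_deriv g) + l2_norm \<Omega> (coderiv g)"
proof -
  note e = energy_eq[OF assms]
  show "l2_norm \<Omega> (ext_deriv g) \<le> energy_norm \<Omega> g" "l2_norm \<Omega> (coderiv g) \<le> energy_norm \<Omega> g"
    by (rule power2_le_imp_le[OF _ e(3)], simp add: e(1))+
  have "(energy_norm \<Omega> g)\<^sup>2 \<le> (l2_norm \<Omega> (ext_deriv g) + l2_norm \<Omega> (coderiv g))\<^sup>2"
    unfolding e(1) by (simp add: power2_sum)
  thus "energy_norm \<Omega> g \<le> l2_norm \<Omega> (ext_deriv g) + l2_norm \<Omega> (coderiv g)"
    by (rule power2_le_imp_le) simp
qed

lemma poincare_forms:
  fixes \<Omega> :: "(real^'n::{finite,linorder}) set"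
  assumes \<Omega>: "open \<Omega>" "bounded \<Omega>"
  obtains c where "0 < c" "\<And>g l. g \<in> test_form \<Omega> l \<Longrightarrow> l2_norm \<Omega> g \<le> c * energy_norm \<Omega> g"
    "\<And>g l i. g \<in> test_form \<Omega> l \<Longrightarrow> l2_norm \<Omega> g \<le> c * l2_norm \<Omega> (partial_deriv i g)"
proof -
  obtain R where R: "0 < R" "\<Omega> \<subseteq> cball 0 R"
    using bounded_subset_ballD[OF \<Omega>(2), of 0] ball_subset_cball by blast
  have A: "l2_norm \<Omega> g \<le> 2 * R * l2_norm \<Omega> (partial_deriv i g)" if g: "g \<in> test_form \<Omega> l" for g l i
  proof -
    note t = test_formD[OF g]
    obtain K where K: "compact K" "K \<subseteq> \<Omega>" "\<And>x. x \<notin> K \<Longrightarrow> g x = 0" using test_form_support[OF g] by blast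
    have off: "g x = 0" "partial_deriv i g x = 0" if "x \<notin> \<Omega>" for x
    proof -
      have x: "x \<notin> K" using K(2) that by blast
      show "g x = 0" "partial_deriv i g x = 0"
        using K(3) partial_deriv_zero_off_closed[OF compact_imp_closed[OF K(1)] K(3) x] x by auto
    qed
    have "K \<subseteq> cball 0 R" using K(2) R(2) by blast
    from poincare_csupp[OF t(2) K(1,3) this, of i]
    have "(l2_norm \<Omega> g)\<^sup>2 \<le> (2 * R * l2_norm \<Omega> (partial_deriv i g))\<^sup>2"
      unfolding l2_norm_square power_mult_distrib
      by (simp add: l2_inner_smooth[OF \<Omega>(1)] smooth_partial_deriv t off)
    thus ?thesis by (rule power2_le_imp_le) (use R in simp)
  qed
  have B: "l2_norm \<Omega> g \<le> 2 * R * energy_norm \<Omega> g" if g: "g \<in> test_form \<Omega> l" for g l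
  proof -
    fix i :: 'n
    have "(l2_norm \<Omega> (partial_deriv i g))\<^sup>2 \<le> (energy_norm \<Omega> g)\<^sup>2"
      unfolding energy_eq(2)[OF \<Omega>(1) g] by (rule member_le_sum) auto
    hence "l2_norm \<Omega> (partial_deriv i g) \<le> energy_norm \<Omega> g"
      by (rule power2_le_imp_le[OF _ energy_eq(3)[OF \<Omega>(1) g]])
    hence "2 * R * l2_norm \<Omega> (partial_deriv i g) \<le> 2 * R * energy_norm \<Omega> g"
      using R by (intro mult_left_mono) auto
    thus "l2_norm \<Omega> g \<le> 2 * R * energy_norm \<Omega> g" using A[OF g, of i] by linarith
  qed
  show ?thesis by (rule that[of "2 * R"]) (use R A B in auto)
qed

lemma l2_tendsto_Cauchy:
  assumes "l2_tendsto \<Omega> f g"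
  shows "l2_Cauchy \<Omega> f"
  unfolding l2_Cauchy_def
proof (intro conjI allI impI)
  have m: "f k \<in> L2 \<Omega>" "g \<in> L2 \<Omega>" for k using assms by (auto simp: l2_tendsto_def)
  show "f k \<in> L2 \<Omega>" for k by (rule m)
  fix e :: real assume "0 < e"
  then obtain N where N: "\<And>k. N \<le> k \<Longrightarrow> l2_norm \<Omega> (\<lambda>x. f k x - g x) < e / 2"
    using assms LIMSEQ_D[of _ 0 "e / 2"] unfolding l2_tendsto_def by fastforce
  have "l2_norm \<Omega> (\<lambda>x. f j x - f k x) < e" if "N \<le> j" "N \<le> k" for j k
    using l2_norm_triangle3[OF m(1)[of j] m(2) m(1)[of k]] N[OF that(1)] N[OF that(2)]
      l2_norm_minus_commute[of \<Omega> g "f k"] by linarith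
  thus "\<exists>N. \<forall>j\<ge>N. \<forall>k\<ge>N. l2_norm \<Omega> (\<lambda>x. f j x - f k x) < e" by blast
qed

subsection \<open>The space \<open>H01\<close>\<close>

text \<open>A witness that \<open>w\<close> belongs to \<open>H01\<close>, with \<open>v = d w\<close> and \<open>h = d\<^sup>* w\<close>: test forms
  that converge to \<open>w\<close> together with their exterior derivatives and coderivatives. All
  statements about \<open>H01\<close> are derived from such witnesses.\<close>
definition H01_limit :: "(real^'n::{finite,linorder}) set \<Rightarrow> nat \<Rightarrow> (nat \<Rightarrow> 'n form) \<Rightarrow> 'n form \<Rightarrow> 'n form \<Rightarrow> 'n form \<Rightarrow> bool" where
  "H01_limit \<Omega> l \<phi> w v h \<longleftrightarrow> (\<forall>k. \<phi> k \<in> test_form \<Omega> l) \<and> w \<in> L2_form \<Omega> l \<and> v \<in> L2_form \<Omega> (l + 1) \<and> h \<in> L2_form \<Omega> (l - 1) \<and>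
     l2_tendsto \<Omega> \<phi> w \<and> l2_tendsto \<Omega> (\<lambda>k. ext_deriv (\<phi> k)) v \<and> l2_tendsto \<Omega> (\<lambda>k. coderiv (\<phi> k)) h"

locale form_domain =
  fixes \<Omega> :: "(real^'n::{finite,linorder}) set" and l :: nat
  assumes op: "open \<Omega>" and bd: "bounded \<Omega>" and l1: "1 \<le> l"
begin

lemma test_L2: "\<phi> \<in> test_form \<Omega> m \<Longrightarrow> \<phi> \<in> L2 \<Omega>"
  by (rule L2_form_L2[OF test_form_L2_form[OF op]])

text \<open>The fundamental lemma requires test functions with values in all degrees; those of degree
  other than \<open>m\<close> are orthogonal to \<open>g\<close> pointwise.\<close>
lemma L2_form_zero:
  assumes g: "g \<in> L2_form \<Omega> m" and z: "\<And>\<psi>. \<psi> \<in> test_form \<Omega> m \<Longrightarrow> l2_inner \<Omega> g \<psi> = 0"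
  shows "l2_norm \<Omega> g = 0"
proof (rule fundamental_lemma[OF op bd L2_form_L2[OF g]])
  fix \<psi> :: "(real, 'n) vec \<Rightarrow> real" and b :: "(real, 'n set) vec" assume p: "\<psi> \<in> test_fun \<Omega>" and b: "b \<in> Basis"
  then obtain I where I: "b = axis I 1" by (auto simp: Basis_vec_def)
  have t: "(\<lambda>x. \<psi> x *\<^sub>R b) \<in> test_fun \<Omega>" by (rule test_fun_scaleR[OF p])
  show "l2_inner \<Omega> g (\<lambda>x. \<psi> x *\<^sub>R b) = 0"
  proof (cases "card I = m")
    case True
    have "(\<lambda>x. \<psi> x *\<^sub>R b) \<in> test_form \<Omega> m"
      using t True by (auto simp: test_form_def Lam_def I axis_def)
    thus ?thesis by (rule z)
  next
    case False
    have "(LINT x|lebesgue_on \<Omega>. g x \<bullet> (\<psi> x *\<^sub>R b)) = (LINT x|lebesgue_on \<Omega>. 0)"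
    proof (rule Bochner_Integration.integral_cong[OF refl])
      fix x assume "x \<in> space (lebesgue_on \<Omega>)"
      hence "x \<in> \<Omega>" by simp
      hence "g x $ I = 0" using g False by (auto simp: L2_form_def Lam_def)
      thus "g x \<bullet> (\<psi> x *\<^sub>R b) = 0" by (simp add: I inner_axis)
    qed
    thus ?thesis by (simp add: l2_inner_def)
  qed
qed

lemma L2_form_eqI:
  assumes g: "g \<in> L2_form \<Omega> m" "g' \<in> L2_form \<Omega> m"
    and z: "\<And>\<psi>. \<psi> \<in> test_form \<Omega> m \<Longrightarrow> l2_inner \<Omega> g \<psi> = l2_inner \<Omega> g' \<psi>"
  shows "l2_norm \<Omega> (\<lambda>x. g x - g' x) = 0"
  by (rule L2_form_zero[OF L2_form_diff[OF g]])
     (simp add: z l2_inner_diff L2_form_L2[OF g(1)] L2_form_L2[OF g(2)] test_L2)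

lemma coderiv_unique:
  "is_coderiv \<Omega> m w g \<Longrightarrow> is_coderiv \<Omega> m w g' \<Longrightarrow> l2_norm \<Omega> (\<lambda>x. g x - g' x) = 0"
  by (rule L2_form_eqI[of _ m]) (auto simp: is_coderiv_def)

lemma ext_deriv_unique:
  "is_ext_deriv \<Omega> m w g \<Longrightarrow> is_ext_deriv \<Omega> m w g' \<Longrightarrow> l2_norm \<Omega> (\<lambda>x. g x - g' x) = 0"
  by (rule L2_form_eqI[of _ m]) (auto simp: is_ext_deriv_def)

lemma l2_norm_eq:
  assumes "g \<in> L2 \<Omega>" "g' \<in> L2 \<Omega>" "l2_norm \<Omega> (\<lambda>x. g x - g' x) = 0"
  shows "l2_norm \<Omega> g = l2_norm \<Omega> g'"
  using l2_inner_cong_AE[OF assms(1,2,1,3)] l2_inner_cong_AE[OF assms(1,2,2,3)]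
  by (simp add: l2_norm_def l2_inner_commute[of \<Omega> g g'])

lemma H01_limit_is_deriv:
  assumes "H01_limit \<Omega> l \<phi> w v h"
  shows "is_ext_deriv \<Omega> (l + 1) w v" "is_coderiv \<Omega> (l - 1) w h"
proof -
  have t: "\<phi> k \<in> test_form \<Omega> l" for k using assms by (simp add: H01_limit_def)
  have lim: "l2_tendsto \<Omega> \<phi> w" "l2_tendsto \<Omega> (\<lambda>k. ext_deriv (\<phi> k)) v" "l2_tendsto \<Omega> (\<lambda>k. coderiv (\<phi> k)) h"
    using assms by (auto simp: H01_limit_def)
  note sm = test_formD(2)[OF t]
  have "l2_inner \<Omega> v \<psi> = l2_inner \<Omega> w (coderiv \<psi>)" if p: "\<psi> \<in> test_form \<Omega> (l + 1)" for \<psi>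
  proof (rule LIMSEQ_unique)
    show "(\<lambda>k. l2_inner \<Omega> (ext_deriv (\<phi> k)) \<psi>) \<longlonglongrightarrow> l2_inner \<Omega> v \<psi>"
      by (rule l2_tendsto_inner_const[OF lim(2) test_L2[OF p]])
    show "(\<lambda>k. l2_inner \<Omega> (ext_deriv (\<phi> k)) \<psi>) \<longlonglongrightarrow> l2_inner \<Omega> w (coderiv \<psi>)"
      unfolding l2_green(1)[OF op sm p]
      by (rule l2_tendsto_inner_const[OF lim(1) test_L2[OF test_form_coderiv[OF p]]]) simp
  qed
  thus "is_ext_deriv \<Omega> (l + 1) w v" using assms by (simp add: is_ext_deriv_def H01_limit_def)
  have "l2_inner \<Omega> h \<psi> = l2_inner \<Omega> w (ext_deriv \<psi>)" if p: "\<psi> \<in> test_form \<Omega> (l - 1)" for \<psi>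
  proof (rule LIMSEQ_unique)
    show "(\<lambda>k. l2_inner \<Omega> (coderiv (\<phi> k)) \<psi>) \<longlonglongrightarrow> l2_inner \<Omega> h \<psi>"
      by (rule l2_tendsto_inner_const[OF lim(3) test_L2[OF p]])
    show "(\<lambda>k. l2_inner \<Omega> (coderiv (\<phi> k)) \<psi>) \<longlonglongrightarrow> l2_inner \<Omega> w (ext_deriv \<psi>)"
      unfolding l2_green(2)[OF op sm p]
      by (rule l2_tendsto_inner_const[OF lim(1) test_L2[OF test_form_ext_deriv[OF p]]])
  qed
  thus "is_coderiv \<Omega> (l - 1) w h" using assms by (simp add: is_coderiv_def H01_limit_def)
qed

definition energy_Cauchy :: "(nat \<Rightarrow> 'n form) \<Rightarrow> bool" where
  "energy_Cauchy \<phi> \<longleftrightarrow> (\<forall>e>0. \<exists>N. \<forall>j\<ge>N. \<forall>k\<ge>N. energy_norm \<Omega> (\<lambda>x. \<phi> j x - \<phi> k x) < e)"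

lemma energy_Cauchy_iff:
  assumes t: "\<And>k. \<phi> k \<in> test_form \<Omega> l"
  shows "energy_Cauchy \<phi> \<longleftrightarrow> l2_Cauchy \<Omega> (\<lambda>k. ext_deriv (\<phi> k)) \<and> l2_Cauchy \<Omega> (\<lambda>k. coderiv (\<phi> k))"
proof -
  note sm = test_formD(2)[OF t]
  have d: "(\<lambda>x. \<phi> j x - \<phi> k x) \<in> test_form \<Omega> l" for j k by (intro test_form_diff t)
  have L: "ext_deriv (\<phi> k) \<in> L2 \<Omega>" "coderiv (\<phi> k) \<in> L2 \<Omega>" for k
    by (rule test_L2[OF test_form_ext_deriv[OF t]], rule test_L2[OF test_form_coderiv[OF t l1]])
  have b: "l2_norm \<Omega> (\<lambda>x. ext_deriv (\<phi> j) x - ext_deriv (\<phi> k) x) \<le> energy_norm \<Omega> (\<lambda>x. \<phi> j x - \<phi> k x)"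
    "l2_norm \<Omega> (\<lambda>x. coderiv (\<phi> j) x - coderiv (\<phi> k) x) \<le> energy_norm \<Omega> (\<lambda>x. \<phi> j x - \<phi> k x)"
    "energy_norm \<Omega> (\<lambda>x. \<phi> j x - \<phi> k x) \<le> l2_norm \<Omega> (\<lambda>x. ext_deriv (\<phi> j) x - ext_deriv (\<phi> k) x)
       + l2_norm \<Omega> (\<lambda>x. coderiv (\<phi> j) x - coderiv (\<phi> k) x)" for j k
  proof -
    have "ext_deriv (\<lambda>x. \<phi> j x - \<phi> k x) = (\<lambda>x. ext_deriv (\<phi> j) x - ext_deriv (\<phi> k) x)"
      "coderiv (\<lambda>x. \<phi> j x - \<phi> k x) = (\<lambda>x. coderiv (\<phi> j) x - coderiv (\<phi> k) x)"
      by (rule ext, rule ext_deriv_diff[OF sm sm], rule ext, rule coderiv_diff[OF sm sm])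
    from energy_bounds[OF op d[of j k], unfolded this]
    show "l2_norm \<Omega> (\<lambda>x. ext_deriv (\<phi> j) x - ext_deriv (\<phi> k) x) \<le> energy_norm \<Omega> (\<lambda>x. \<phi> j x - \<phi> k x)"
      "l2_norm \<Omega> (\<lambda>x. coderiv (\<phi> j) x - coderiv (\<phi> k) x) \<le> energy_norm \<Omega> (\<lambda>x. \<phi> j x - \<phi> k x)"
      "energy_norm \<Omega> (\<lambda>x. \<phi> j x - \<phi> k x) \<le> l2_norm \<Omega> (\<lambda>x. ext_deriv (\<phi> j) x - ext_deriv (\<phi> k) x)
         + l2_norm \<Omega> (\<lambda>x. coderiv (\<phi> j) x - coderiv (\<phi> k) x)" .
  qed
  show ?thesis
  proof
    assume C: "energy_Cauchy \<phi>"
    show "l2_Cauchy \<Omega> (\<lambda>k. ext_deriv (\<phi> k)) \<and> l2_Cauchy \<Omega> (\<lambda>k. coderiv (\<phi> k))"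
      unfolding l2_Cauchy_def
    proof (intro conjI allI impI L)
      fix e :: real assume "0 < e"
      then obtain N where N: "\<forall>j\<ge>N. \<forall>k\<ge>N. energy_norm \<Omega> (\<lambda>x. \<phi> j x - \<phi> k x) < e"
        using C unfolding energy_Cauchy_def by blast
      show "\<exists>N. \<forall>j\<ge>N. \<forall>k\<ge>N. l2_norm \<Omega> (\<lambda>x. ext_deriv (\<phi> j) x - ext_deriv (\<phi> k) x) < e"
        by (intro exI[of _ N] allI impI le_less_trans[OF b(1)]) (use N in blast)
      show "\<exists>N. \<forall>j\<ge>N. \<forall>k\<ge>N. l2_norm \<Omega> (\<lambda>x. coderiv (\<phi> j) x - coderiv (\<phi> k) x) < e"
        by (intro exI[of _ N] allI impI le_less_trans[OF b(2)]) (use N in blast)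
    qed
  next
    assume C: "l2_Cauchy \<Omega> (\<lambda>k. ext_deriv (\<phi> k)) \<and> l2_Cauchy \<Omega> (\<lambda>k. coderiv (\<phi> k))"
    show "energy_Cauchy \<phi>" unfolding energy_Cauchy_def
    proof (intro allI impI)
      fix e :: real assume "0 < e"
      hence e2: "0 < e / 2" by simp
      obtain N where N: "\<forall>j\<ge>N. \<forall>k\<ge>N. l2_norm \<Omega> (\<lambda>x. ext_deriv (\<phi> j) x - ext_deriv (\<phi> k) x) < e / 2"
        using C e2 unfolding l2_Cauchy_def by blast
      obtain N' where N': "\<forall>j\<ge>N'. \<forall>k\<ge>N'. l2_norm \<Omega> (\<lambda>x. coderiv (\<phi> j) x - coderiv (\<phi> k) x) < e / 2"
        using C e2 unfolding l2_Cauchy_def by blast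
      show "\<exists>N. \<forall>j\<ge>N. \<forall>k\<ge>N. energy_norm \<Omega> (\<lambda>x. \<phi> j x - \<phi> k x) < e"
      proof (intro exI[of _ "max N N'"] allI impI)
        fix j k assume "max N N' \<le> j" "max N N' \<le> k"
        hence "l2_norm \<Omega> (\<lambda>x. ext_deriv (\<phi> j) x - ext_deriv (\<phi> k) x) < e / 2"
          "l2_norm \<Omega> (\<lambda>x. coderiv (\<phi> j) x - coderiv (\<phi> k) x) < e / 2" using N N' by auto
        thus "energy_norm \<Omega> (\<lambda>x. \<phi> j x - \<phi> k x) < e" using b(3)[of j k] by linarith
      qed
    qed
  qed
qed

lemma completion_seq_iff:
  "completion_seq \<Omega> (test_form \<Omega> l) (energy_norm \<Omega>) w \<phi> \<longleftrightarrow>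
    (\<forall>k. \<phi> k \<in> test_form \<Omega> l) \<and> energy_Cauchy \<phi> \<and> (\<lambda>k. l2_norm \<Omega> (\<lambda>x. \<phi> k x - w x)) \<longlonglongrightarrow> 0"
  by (simp add: completion_seq_def energy_Cauchy_def)

lemma completion_seq_limit:
  assumes w: "w \<in> L2_form \<Omega> l" and c: "completion_seq \<Omega> (test_form \<Omega> l) (energy_norm \<Omega>) w \<phi>"
  obtains v h where "H01_limit \<Omega> l \<phi> w v h"
proof -
  have t: "\<phi> k \<in> test_form \<Omega> l" for k using c unfolding completion_seq_iff by auto
  have C: "energy_Cauchy \<phi>" and L: "(\<lambda>k. l2_norm \<Omega> (\<lambda>x. \<phi> k x - w x)) \<longlonglongrightarrow> 0"
    using c unfolding completion_seq_iff by auto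
  have C': "l2_Cauchy \<Omega> (\<lambda>k. ext_deriv (\<phi> k))" "l2_Cauchy \<Omega> (\<lambda>k. coderiv (\<phi> k))"
    using C energy_Cauchy_iff[of \<phi>] t by auto
  obtain v where v: "v \<in> L2_form \<Omega> (l + 1)" "l2_tendsto \<Omega> (\<lambda>k. ext_deriv (\<phi> k)) v"
    using L2_form_complete[where f="\<lambda>k. ext_deriv (\<phi> k)", OF op bd test_form_L2_form[OF op test_form_ext_deriv[OF t]] C'(1)] by blast
  obtain h where h: "h \<in> L2_form \<Omega> (l - 1)" "l2_tendsto \<Omega> (\<lambda>k. coderiv (\<phi> k)) h"
    using L2_form_complete[where f="\<lambda>k. coderiv (\<phi> k)", OF op bd test_form_L2_form[OF op test_form_coderiv[OF t l1]] C'(2)] by blast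
  have "l2_tendsto \<Omega> \<phi> w" unfolding l2_tendsto_def using test_L2[OF t] L2_form_L2[OF w] L by simp
  thus ?thesis using that t w v h unfolding H01_limit_def by blast
qed

lemma H01_limit_exists:
  assumes "w \<in> H01 \<Omega> l"
  obtains \<phi> v h where "H01_limit \<Omega> l \<phi> w v h"
  using assms completion_seq_limit unfolding H01_def by blast

lemma H01_limit_completion_seq:
  assumes "H01_limit \<Omega> l \<phi> w v h"
  shows "completion_seq \<Omega> (test_form \<Omega> l) (energy_norm \<Omega>) w \<phi>"
proof -
  have t: "\<phi> k \<in> test_form \<Omega> l" for k using assms by (simp add: H01_limit_def)
  have "energy_Cauchy \<phi>"
    unfolding energy_Cauchy_iff[OF t] using assms l2_tendsto_Cauchy by (auto simp: H01_limit_def)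
  thus ?thesis using assms t unfolding completion_seq_iff H01_limit_def l2_tendsto_def by blast
qed

lemma H01_limit_H01: "H01_limit \<Omega> l \<phi> w v h \<Longrightarrow> w \<in> H01 \<Omega> l"
  using H01_limit_completion_seq[of \<phi> w v h] unfolding H01_def by (simp add: H01_limit_def) blast

lemma H01_limit_energy:
  assumes "H01_limit \<Omega> l \<phi> w v h"
  shows "(\<lambda>k. energy_norm \<Omega> (\<phi> k)) \<longlonglongrightarrow> sqrt ((l2_norm \<Omega> v)\<^sup>2 + (l2_norm \<Omega> h)\<^sup>2)"
proof -
  have t: "\<phi> k \<in> test_form \<Omega> l" for k using assms by (simp add: H01_limit_def)
  have "energy_norm \<Omega> (\<phi> k) = sqrt ((l2_norm \<Omega> (ext_deriv (\<phi> k)))\<^sup>2 + (l2_norm \<Omega> (coderiv (\<phi> k)))\<^sup>2)" for k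
    using energy_eq(1,3)[OF op t[of k]] by (metis real_sqrt_unique)
  moreover have "(\<lambda>k. sqrt ((l2_norm \<Omega> (ext_deriv (\<phi> k)))\<^sup>2 + (l2_norm \<Omega> (coderiv (\<phi> k)))\<^sup>2))
      \<longlonglongrightarrow> sqrt ((l2_norm \<Omega> v)\<^sup>2 + (l2_norm \<Omega> h)\<^sup>2)"
    using assms by (intro tendsto_intros l2_tendsto_norm) (auto simp: H01_limit_def)
  ultimately show ?thesis by simp
qed

text \<open>The sequence chosen in the definition of the norm may differ from \<open>\<phi>\<close>, but the derivatives of its limit
  are weak derivatives of the same form \<open>w\<close>, which are unique.\<close>
lemma H01_limit_norm:
  assumes A: "H01_limit \<Omega> l \<phi> w v h"
  shows "(H01_norm \<Omega> l w)\<^sup>2 = (l2_norm \<Omega> v)\<^sup>2 + (l2_norm \<Omega> h)\<^sup>2"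
proof -
  let ?C = "completion_seq \<Omega> (test_form \<Omega> l) (energy_norm \<Omega>) w"
  have w: "w \<in> L2_form \<Omega> l" using A by (simp add: H01_limit_def)
  have "?C (SOME \<phi>. ?C \<phi>)" by (rule someI[of ?C, OF H01_limit_completion_seq[OF A]])
  then obtain v' h' where B: "H01_limit \<Omega> l (SOME \<phi>. ?C \<phi>) w v' h'" using completion_seq_limit[OF w] by blast
  have "v \<in> L2 \<Omega>" "v' \<in> L2 \<Omega>" "h \<in> L2 \<Omega>" "h' \<in> L2 \<Omega>"
    using A B L2_form_L2 by (auto simp: H01_limit_def)
  hence "l2_norm \<Omega> v = l2_norm \<Omega> v'" "l2_norm \<Omega> h = l2_norm \<Omega> h'"
    using ext_deriv_unique[OF H01_limit_is_deriv(1)[OF A] H01_limit_is_deriv(1)[OF B]]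
      coderiv_unique[OF H01_limit_is_deriv(2)[OF A] H01_limit_is_deriv(2)[OF B]] l2_norm_eq by blast+
  hence "H01_norm \<Omega> l w = sqrt ((l2_norm \<Omega> v)\<^sup>2 + (l2_norm \<Omega> h)\<^sup>2)"
    unfolding H01_norm_def completion_norm_def using limI[OF H01_limit_energy[OF B]] by simp
  thus ?thesis by simp
qed

text \<open>The Poincare inequality makes an energy Cauchy sequence converge in \<open>L\<^sub>2\<close>.\<close>
lemma H01_complete:
  assumes t: "\<And>k. \<phi> k \<in> test_form \<Omega> l" and C: "energy_Cauchy \<phi>"
  obtains w v h where "H01_limit \<Omega> l \<phi> w v h"
proof -
  obtain c where c: "0 < c" "\<And>g l. g \<in> test_form \<Omega> l \<Longrightarrow> l2_norm \<Omega> g \<le> c * energy_norm \<Omega> g"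
    using poincare_forms[OF op bd] by metis
  have "l2_Cauchy \<Omega> \<phi>" unfolding l2_Cauchy_def
  proof (intro conjI allI impI test_L2[OF t])
    fix e :: real assume "0 < e"
    hence "0 < e / c" using c(1) by simp
    then obtain N where N: "\<forall>j\<ge>N. \<forall>k\<ge>N. energy_norm \<Omega> (\<lambda>x. \<phi> j x - \<phi> k x) < e / c"
      using C unfolding energy_Cauchy_def by blast
    show "\<exists>N. \<forall>j\<ge>N. \<forall>k\<ge>N. l2_norm \<Omega> (\<lambda>x. \<phi> j x - \<phi> k x) < e"
    proof (intro exI[of _ N] allI impI)
      fix j k assume "N \<le> j" "N \<le> k"
      hence "c * energy_norm \<Omega> (\<lambda>x. \<phi> j x - \<phi> k x) < e" using N c(1) by (simp add: pos_less_divide_eq mult.commute)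
      thus "l2_norm \<Omega> (\<lambda>x. \<phi> j x - \<phi> k x) < e" using c(2)[OF test_form_diff[OF t t]] by (meson le_less_trans)
    qed
  qed
  then obtain w where w: "w \<in> L2_form \<Omega> l" "l2_tendsto \<Omega> \<phi> w"
    using L2_form_complete[where f=\<phi>, OF op bd test_form_L2_form[OF op t]] by blast
  have "completion_seq \<Omega> (test_form \<Omega> l) (energy_norm \<Omega>) w \<phi>"
    unfolding completion_seq_iff using t C w(2) by (simp add: l2_tendsto_def)
  from completion_seq_limit[OF w(1) this] that show ?thesis by blast
qed

lemma test_form_H01_limit:
  assumes "\<phi> \<in> test_form \<Omega> l"
  shows "H01_limit \<Omega> l (\<lambda>k. \<phi>) \<phi> (ext_deriv \<phi>) (coderiv \<phi>)"
  unfolding H01_limit_def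
  using test_form_ext_deriv[OF assms] test_form_coderiv[OF assms l1] assms
  by (auto intro!: l2_tendsto_const test_form_L2_form[OF op] intro: test_L2)

lemma d_dual_eq:
  assumes A: "H01_limit \<Omega> l \<phi> w v h" and u: "u \<in> L2 \<Omega>"
  shows "d_dual \<Omega> l u w = l2_inner \<Omega> u h"
proof -
  have w: "w \<in> H01 \<Omega> l" by (rule H01_limit_H01[OF A])
  have i: "is_coderiv \<Omega> (l - 1) w h" by (rule H01_limit_is_deriv[OF A])
  hence s: "is_coderiv \<Omega> (l - 1) w (coderiv_H01 \<Omega> l w)" unfolding coderiv_H01_def by (rule someI[where P="is_coderiv \<Omega> (l - 1) w"])
  have L: "h \<in> L2 \<Omega>" "coderiv_H01 \<Omega> l w \<in> L2 \<Omega>" using i s L2_form_L2 by (auto simp: is_coderiv_def)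
  show ?thesis using l2_inner_cong_AE[OF L(2,1) u coderiv_unique[OF s i]] w
    by (simp add: d_dual_def l2_inner_commute)
qed

lemma dstar_dual_eq:
  assumes A: "H01_limit \<Omega> l \<phi> w v h" and u: "u \<in> L2 \<Omega>"
  shows "dstar_dual \<Omega> l u w = l2_inner \<Omega> u v"
proof -
  have w: "w \<in> H01 \<Omega> l" by (rule H01_limit_H01[OF A])
  have i: "is_ext_deriv \<Omega> (l + 1) w v" by (rule H01_limit_is_deriv[OF A])
  hence s: "is_ext_deriv \<Omega> (l + 1) w (ext_deriv_H01 \<Omega> l w)" unfolding ext_deriv_H01_def by (rule someI[where P="is_ext_deriv \<Omega> (l + 1) w"])
  have L: "v \<in> L2 \<Omega>" "ext_deriv_H01 \<Omega> l w \<in> L2 \<Omega>" using i s L2_form_L2 by (auto simp: is_ext_deriv_def)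
  show ?thesis using l2_inner_cong_AE[OF L(2,1) u ext_deriv_unique[OF s i]] w
    by (simp add: dstar_dual_def l2_inner_commute)
qed

lemma M_space_L2_form: "u \<in> M_space \<Omega> l \<Longrightarrow> u \<in> L2_form \<Omega> (l - 1)" by (simp add: M_space_def)

lemma M_space_L2: "u \<in> M_space \<Omega> l \<Longrightarrow> u \<in> L2 \<Omega>" using M_space_L2_form L2_form_L2 by blast

lemma ker_d_L2: "z \<in> ker_d \<Omega> l \<Longrightarrow> z \<in> L2 \<Omega>" by (auto simp: ker_d_def L2_form_def)

lemma M_space_lc: "u \<in> M_space \<Omega> l \<Longrightarrow> v \<in> M_space \<Omega> l \<Longrightarrow> lcf a u b v \<in> M_space \<Omega> l"
  using l2_inner_lc_left[OF M_space_L2 M_space_L2 ker_d_L2]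
  by (simp add: M_space_def L2_form_lc)

lemma coderiv_in_M_space:
  assumes A: "H01_limit \<Omega> l \<phi> w v h"
  shows "h \<in> M_space \<Omega> l"
proof -
  have "l2_inner \<Omega> h z = 0" if z: "z \<in> ker_d \<Omega> l" for z
    using d_dual_eq[OF A ker_d_L2[OF z]] z H01_limit_H01[OF A] by (simp add: ker_d_def l2_inner_commute)
  thus ?thesis using A by (simp add: M_space_def H01_limit_def)
qed
end

section \<open>Friedrichs-Velte and Babuska-Aziz inequalities\<close>

context form_domain begin

text \<open>Pairing \<open>d u = d\<^sup>* v\<close> with a solution \<open>w\<close> of \<open>d\<^sup>* w = u\<close> gives \<open>\<parallel>u\<parallel>\<^sup>2 = \<langle>v, d w\<rangle>\<close>.\<close>
lemma babuska_aziz_imp_friedrichs_velte: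
  assumes BA: "babuska_aziz \<Omega> l C" and C: "1 \<le> C" and u: "u \<in> M_space \<Omega> l" and v: "v \<in> L2_form \<Omega> (l + 1)"
    and conj: "conjugate_forms \<Omega> l u v"
  shows "(l2_norm \<Omega> u)\<^sup>2 \<le> (C - 1) * (l2_norm \<Omega> v)\<^sup>2"
proof -
  obtain w where w: "w \<in> H01 \<Omega> l" "is_coderiv \<Omega> (l - 1) w u" "(H01_norm \<Omega> l w)\<^sup>2 \<le> C * (l2_norm \<Omega> u)\<^sup>2"
    using BA u unfolding babuska_aziz_def by blast
  obtain \<phi> v' h where A: "H01_limit \<Omega> l \<phi> w v' h" using H01_limit_exists[OF w(1)] by blast
  have L: "u \<in> L2 \<Omega>" "v \<in> L2 \<Omega>" "v' \<in> L2 \<Omega>" "h \<in> L2 \<Omega>"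
    using M_space_L2[OF u] L2_form_L2[OF v] A L2_form_L2 by (auto simp: H01_limit_def)
  note uh = coderiv_unique[OF w(2) H01_limit_is_deriv(2)[OF A]]
  have n: "l2_norm \<Omega> u = l2_norm \<Omega> h" by (rule l2_norm_eq[OF L(1,4) uh])
  have "(l2_norm \<Omega> u)\<^sup>2 = l2_inner \<Omega> u h"
    using l2_inner_cong_AE[OF L(1,4,1) uh] by (simp add: l2_norm_square l2_inner_commute)
  also have "\<dots> = d_dual \<Omega> l u w" by (rule d_dual_eq[OF A L(1), symmetric])
  also have "\<dots> = dstar_dual \<Omega> l v w" using conj by (simp add: conjugate_forms_def)
  also have "\<dots> = l2_inner \<Omega> v v'" by (rule dstar_dual_eq[OF A L(2)])
  also have "\<dots> \<le> l2_norm \<Omega> v * l2_norm \<Omega> v'" using l2_cauchy_schwarz[OF L(2,3)] by simp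
  finally have 1: "(l2_norm \<Omega> u)\<^sup>2 \<le> l2_norm \<Omega> v * l2_norm \<Omega> v'" .
  have 2: "(l2_norm \<Omega> v')\<^sup>2 \<le> (C - 1) * (l2_norm \<Omega> u)\<^sup>2"
    using w(3) H01_limit_norm[OF A] n by (simp add: algebra_simps)
  show ?thesis
  proof (cases "l2_norm \<Omega> u = 0")
    case True thus ?thesis using C by simp
  next
    case False
    hence p: "0 < (l2_norm \<Omega> u)\<^sup>2" by simp
    have "((l2_norm \<Omega> u)\<^sup>2)\<^sup>2 \<le> (l2_norm \<Omega> v * l2_norm \<Omega> v')\<^sup>2"
      by (rule power_mono[OF 1]) simp
    also have "\<dots> = (l2_norm \<Omega> v)\<^sup>2 * (l2_norm \<Omega> v')\<^sup>2" by (simp add: power_mult_distrib)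
    also have "\<dots> \<le> (l2_norm \<Omega> v)\<^sup>2 * ((C - 1) * (l2_norm \<Omega> u)\<^sup>2)" by (rule mult_left_mono[OF 2]) simp
    finally have "(l2_norm \<Omega> u)\<^sup>2 * (l2_norm \<Omega> u)\<^sup>2 \<le> ((C - 1) * (l2_norm \<Omega> v)\<^sup>2) * (l2_norm \<Omega> u)\<^sup>2"
      by (simp add: power2_eq_square mult_ac)
    thus ?thesis using p by (rule mult_right_le_imp_le)
  qed
qed

definition H01_form :: "'n form \<Rightarrow> 'n form \<Rightarrow> real" where
  "H01_form \<phi> \<psi> = l2_inner \<Omega> (ext_deriv \<phi>) (ext_deriv \<psi>) + l2_inner \<Omega> (coderiv \<phi>) (coderiv \<psi>)"

lemma test_form_deriv_L2:
  assumes "\<phi> \<in> test_form \<Omega> l"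
  shows "ext_deriv \<phi> \<in> L2 \<Omega>" "coderiv \<phi> \<in> L2 \<Omega>"
  by (rule test_L2[OF test_form_ext_deriv[OF assms]], rule test_L2[OF test_form_coderiv[OF assms l1]])

lemma H01_form_self: "\<phi> \<in> test_form \<Omega> l \<Longrightarrow> H01_form \<phi> \<phi> = (energy_norm \<Omega> \<phi>)\<^sup>2"
  by (simp add: H01_form_def energy_eq(1)[OF op] l2_norm_square)

lemma semi_inner_space_test_form: "semi_inner_space (test_form \<Omega> l) lcf H01_form"
proof
  show "test_form \<Omega> l \<noteq> {}" using test_form_zero by blast
  fix x y :: "'n form" and a b assume x: "x \<in> test_form \<Omega> l" and y: "y \<in> test_form \<Omega> l"
  show "lcf a x b y \<in> test_form \<Omega> l" by (rule test_form_lc[OF x y])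
next
  fix x y z :: "'n form" and a b
  assume x: "x \<in> test_form \<Omega> l" and y: "y \<in> test_form \<Omega> l" and z: "z \<in> test_form \<Omega> l"
  have "ext_deriv (lcf a x b y) = lcf a (ext_deriv x) b (ext_deriv y)"
    "coderiv (lcf a x b y) = lcf a (coderiv x) b (coderiv y)"
    by (rule ext, rule ext_deriv_lc[OF test_formD(2)[OF x] test_formD(2)[OF y]],
        rule ext, rule coderiv_lc[OF test_formD(2)[OF x] test_formD(2)[OF y]])
  thus "H01_form z (lcf a x b y) = a * H01_form z x + b * H01_form z y"
    using l2_inner_lc[OF test_form_deriv_L2(1)[OF x] test_form_deriv_L2(1)[OF y] test_form_deriv_L2(1)[OF z]]
      l2_inner_lc[OF test_form_deriv_L2(2)[OF x] test_form_deriv_L2(2)[OF y] test_form_deriv_L2(2)[OF z]]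
    by (simp add: H01_form_def algebra_simps)
next
  fix x y :: "'n form"
  show "H01_form x y = H01_form y x" by (simp add: H01_form_def l2_inner_commute)
  show "0 \<le> H01_form x x" by (simp add: H01_form_def)
qed

text \<open>The Riesz representation of the functional \<open>\<psi> \<mapsto> \<langle>u, d\<^sup>* \<psi>\<rangle>\<close> in the energy inner product.\<close>
lemma hodge_dirichlet_problem:
  assumes u: "u \<in> L2 \<Omega>"
  obtains \<phi> w v h where "H01_limit \<Omega> l \<phi> w v h"
    "\<And>\<phi>' w' v' h'. H01_limit \<Omega> l \<phi>' w' v' h' \<Longrightarrow> l2_inner \<Omega> v v' + l2_inner \<Omega> h h' = l2_inner \<Omega> u h'"
proof -
  interpret semi_inner_space "test_form \<Omega> l" lcf H01_form by (rule semi_inner_space_test_form)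
  let ?F = "\<lambda>\<psi>. l2_inner \<Omega> u (coderiv \<psi>)"
  obtain \<phi> where t: "\<And>k. \<phi> k \<in> test_form \<Omega> l"
    and C: "\<And>e. 0 < e \<Longrightarrow> \<exists>N. \<forall>j\<ge>N. \<forall>k\<ge>N. H01_form (lcf 1 (\<phi> j) (-1) (\<phi> k)) (lcf 1 (\<phi> j) (-1) (\<phi> k)) < e"
    and lim: "\<And>\<psi>. \<psi> \<in> test_form \<Omega> l \<Longrightarrow> (\<lambda>k. H01_form (\<phi> k) \<psi>) \<longlonglongrightarrow> ?F \<psi>"
  proof (rule riesz_sequence[of ?F "(l2_norm \<Omega> u)\<^sup>2"])
    fix a b and x y :: "'n form" assume x: "x \<in> test_form \<Omega> l" and y: "y \<in> test_form \<Omega> l"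
    have "coderiv (lcf a x b y) = lcf a (coderiv x) b (coderiv y)"
      by (rule ext, rule coderiv_lc[OF test_formD(2)[OF x] test_formD(2)[OF y]])
    thus "?F (lcf a x b y) = a * ?F x + b * ?F y"
      using l2_inner_lc[OF test_form_deriv_L2(2)[OF x] test_form_deriv_L2(2)[OF y] u] by simp
  next
    fix x assume x: "x \<in> test_form \<Omega> l"
    have "\<bar>?F x\<bar> \<le> l2_norm \<Omega> u * l2_norm \<Omega> (coderiv x)" by (rule l2_cauchy_schwarz[OF u test_form_deriv_L2(2)[OF x]])
    also have "\<dots> \<le> l2_norm \<Omega> u * energy_norm \<Omega> x" by (intro mult_left_mono energy_bounds[OF op x]) simp
    finally have "\<bar>?F x\<bar>\<^sup>2 \<le> (l2_norm \<Omega> u * energy_norm \<Omega> x)\<^sup>2" by (intro power_mono) auto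
    thus "(?F x)\<^sup>2 \<le> (l2_norm \<Omega> u)\<^sup>2 * H01_form x x" by (simp add: H01_form_self[OF x] power_mult_distrib)
  qed blast
  have "energy_Cauchy \<phi>" unfolding energy_Cauchy_def
  proof (intro allI impI)
    fix e :: real assume e: "0 < e"
    obtain N where N: "\<forall>j\<ge>N. \<forall>k\<ge>N. H01_form (lcf 1 (\<phi> j) (-1) (\<phi> k)) (lcf 1 (\<phi> j) (-1) (\<phi> k)) < e\<^sup>2"
      using C[of "e\<^sup>2"] e by auto
    show "\<exists>N. \<forall>j\<ge>N. \<forall>k\<ge>N. energy_norm \<Omega> (\<lambda>x. \<phi> j x - \<phi> k x) < e"
    proof (intro exI[of _ N] allI impI)
      fix j k assume "N \<le> j" "N \<le> k"
      hence "H01_form (lcf 1 (\<phi> j) (-1) (\<phi> k)) (lcf 1 (\<phi> j) (-1) (\<phi> k)) < e\<^sup>2" using N by blast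
      hence "(energy_norm \<Omega> (\<lambda>x. \<phi> j x - \<phi> k x))\<^sup>2 < e\<^sup>2" using H01_form_self[OF test_form_diff[OF t t]] by simp
      thus "energy_norm \<Omega> (\<lambda>x. \<phi> j x - \<phi> k x) < e" by (rule power2_less_imp_less) (use e in simp)
    qed
  qed
  then obtain w v h where A: "H01_limit \<Omega> l \<phi> w v h" using H01_complete[of \<phi>] t by blast
  have test: "l2_inner \<Omega> v (ext_deriv \<psi>) + l2_inner \<Omega> h (coderiv \<psi>) = l2_inner \<Omega> u (coderiv \<psi>)"
    if p: "\<psi> \<in> test_form \<Omega> l" for \<psi>
  proof (rule LIMSEQ_unique)
    show "(\<lambda>k. H01_form (\<phi> k) \<psi>) \<longlonglongrightarrow> l2_inner \<Omega> u (coderiv \<psi>)" by (rule lim[OF p])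
    show "(\<lambda>k. H01_form (\<phi> k) \<psi>) \<longlonglongrightarrow> l2_inner \<Omega> v (ext_deriv \<psi>) + l2_inner \<Omega> h (coderiv \<psi>)"
      unfolding H01_form_def
      by (rule tendsto_add; rule l2_tendsto_inner_const) (use A test_form_deriv_L2[OF p] in \<open>auto simp: H01_limit_def\<close>)
  qed
  show ?thesis
  proof (rule that[OF A])
    fix \<phi>' w' v' h' assume B: "H01_limit \<Omega> l \<phi>' w' v' h'"
    have L: "v \<in> L2 \<Omega>" "h \<in> L2 \<Omega>" using A L2_form_L2 by (auto simp: H01_limit_def)
    have B': "l2_tendsto \<Omega> (\<lambda>k. ext_deriv (\<phi>' k)) v'" "l2_tendsto \<Omega> (\<lambda>k. coderiv (\<phi>' k)) h'"
      "\<And>k. \<phi>' k \<in> test_form \<Omega> l" using B by (auto simp: H01_limit_def)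
    have 1: "(\<lambda>k. l2_inner \<Omega> v (ext_deriv (\<phi>' k)) + l2_inner \<Omega> h (coderiv (\<phi>' k))) \<longlonglongrightarrow> l2_inner \<Omega> v v' + l2_inner \<Omega> h h'"
      by (rule tendsto_add[OF l2_tendsto_inner[OF l2_tendsto_const[OF L(1)] B'(1)] l2_tendsto_inner[OF l2_tendsto_const[OF L(2)] B'(2)]])
    have 2: "(\<lambda>k. l2_inner \<Omega> u (coderiv (\<phi>' k))) \<longlonglongrightarrow> l2_inner \<Omega> u h'"
      by (rule l2_tendsto_inner[OF l2_tendsto_const[OF u] B'(2)])
    show "l2_inner \<Omega> v v' + l2_inner \<Omega> h h' = l2_inner \<Omega> u h'"
      using 1 2 unfolding test[OF B'(3)] by (rule LIMSEQ_unique)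
  qed
qed

text \<open>Here \<open>h = S u\<close> and \<open>t = u - S u\<close> in the notation of the introduction. The Friedrichs-Velte inequality is
  applied to the conjugate pair \<open>t\<close> and \<open>v\<close>, and \<open>\<parallel>v\<parallel>\<^sup>2 = \<langle>t, h\<rangle>\<close> is read off from the
  equation tested with its own solution. Bounding \<open>t\<close> instead of \<open>u\<close> directly is what gives
  the sharp constant.\<close>
lemma friedrichs_velte_inf_sup:
  assumes FV: "friedrichs_velte \<Omega> l \<Gamma>" and u: "u \<in> M_space \<Omega> l" and A: "H01_limit \<Omega> l \<phi> w v h"
    and sol: "\<And>\<phi>' w' v' h'. H01_limit \<Omega> l \<phi>' w' v' h' \<Longrightarrow> l2_inner \<Omega> v v' + l2_inner \<Omega> h h' = l2_inner \<Omega> u h'"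
  shows "(l2_norm \<Omega> u)\<^sup>2 \<le> (1 + \<Gamma>) * l2_inner \<Omega> u h"
proof -
  have \<Gamma>: "0 < \<Gamma>" using FV by (simp add: friedrichs_velte_def)
  have h: "h \<in> M_space \<Omega> l" by (rule coderiv_in_M_space[OF A])
  have L: "u \<in> L2 \<Omega>" "h \<in> L2 \<Omega>" "v \<in> L2 \<Omega>" and v: "v \<in> L2_form \<Omega> (l + 1)"
    using M_space_L2[OF u] M_space_L2[OF h] A L2_form_L2 by (auto simp: H01_limit_def)
  define t where "t x = u x - h x" for x
  have t: "t \<in> M_space \<Omega> l" using M_space_lc[OF u h, of 1 "-1"] by (simp add: t_def[abs_def])
  have tL: "t \<in> L2 \<Omega>" by (rule M_space_L2[OF t])
  have tin: "l2_inner \<Omega> t f = l2_inner \<Omega> u f - l2_inner \<Omega> h f" if "f \<in> L2 \<Omega>" for f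
    unfolding t_def using l2_inner_diff(2)[OF L(1,2) that] .
  have "conjugate_forms \<Omega> l t v" unfolding conjugate_forms_def
  proof
    fix f
    show "d_dual \<Omega> l t f = dstar_dual \<Omega> l v f"
    proof (cases "f \<in> H01 \<Omega> l")
      case True
      then obtain \<psi> v' h' where B: "H01_limit \<Omega> l \<psi> f v' h'" using H01_limit_exists by blast
      have h': "h' \<in> L2 \<Omega>" using B L2_form_L2 by (auto simp: H01_limit_def)
      show ?thesis using sol[OF B] by (simp add: d_dual_eq[OF B tL] dstar_dual_eq[OF B L(3)] tin[OF h'])
    qed (simp add: d_dual_def dstar_dual_def)
  qed
  hence fv: "(l2_norm \<Omega> t)\<^sup>2 \<le> \<Gamma> * (l2_norm \<Omega> v)\<^sup>2" using FV t v unfolding friedrichs_velte_def by blast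
  have vv: "(l2_norm \<Omega> v)\<^sup>2 = l2_inner \<Omega> t h"
    using sol[OF A] by (simp add: l2_norm_square tin[OF L(2)])
  have tt: "(l2_norm \<Omega> t)\<^sup>2 = l2_inner \<Omega> t u - l2_inner \<Omega> t h"
    unfolding l2_norm_square using l2_inner_diff(1)[OF L(1,2) tL] by (simp add: t_def[abs_def])
  define T where "T = l2_norm \<Omega> t"
  define U where "U = l2_norm \<Omega> u"
  have T0: "0 \<le> T" "0 \<le> U" by (simp_all add: T_def U_def)
  have tu: "l2_inner \<Omega> t u \<le> T * U" using l2_cauchy_schwarz[OF tL L(1)] by (simp add: T_def U_def)
  have "T\<^sup>2 \<le> \<Gamma> * (l2_inner \<Omega> t u - T\<^sup>2)" using fv vv tt by (simp add: T_def)
  hence "(1 + \<Gamma>) * T\<^sup>2 \<le> \<Gamma> * l2_inner \<Omega> t u" by (simp add: algebra_simps)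
  also have "\<dots> \<le> \<Gamma> * (T * U)" using tu \<Gamma> by (intro mult_left_mono) auto
  finally have le: "T * ((1 + \<Gamma>) * T) \<le> T * (\<Gamma> * U)" by (simp add: power2_eq_square mult_ac)
  have "(1 + \<Gamma>) * T \<le> \<Gamma> * U"
  proof (cases "T = 0")
    case False
    hence "0 < T" using T0 by simp
    with le show ?thesis by simp
  qed (use \<Gamma> T0 in simp)
  hence "(1 + \<Gamma>) * T * U \<le> \<Gamma> * U * U" using T0 by (intro mult_right_mono) auto
  moreover have "(1 + \<Gamma>) * l2_inner \<Omega> t u \<le> (1 + \<Gamma>) * (T * U)" using tu \<Gamma> by (intro mult_left_mono) auto
  ultimately have "(1 + \<Gamma>) * l2_inner \<Omega> t u \<le> \<Gamma> * U\<^sup>2" by (simp add: power2_eq_square mult_ac)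
  moreover have "l2_inner \<Omega> t u = U\<^sup>2 - l2_inner \<Omega> u h"
    using tin[OF L(1)] by (simp add: U_def l2_norm_square l2_inner_commute)
  ultimately show ?thesis by (simp add: U_def algebra_simps)
qed

lemma l2_tendsto_close:
  assumes f: "l2_tendsto \<Omega> f g" and f': "\<And>k. f' k \<in> L2 \<Omega>"
    and b: "\<And>k. l2_norm \<Omega> (\<lambda>x. f' k x - f k x) \<le> 1 / real (Suc k)"
  shows "l2_tendsto \<Omega> f' g"
proof -
  have m: "f k \<in> L2 \<Omega>" "g \<in> L2 \<Omega>" for k using f by (auto simp: l2_tendsto_def)
  have l0: "(\<lambda>k. l2_norm \<Omega> (\<lambda>x. f k x - g x)) \<longlonglongrightarrow> 0" using f by (simp add: l2_tendsto_def)
  have "(\<lambda>k. 1 / real (Suc k) + l2_norm \<Omega> (\<lambda>x. f k x - g x)) \<longlonglongrightarrow> 0 + 0"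
    by (rule tendsto_add[OF LIMSEQ_Suc[OF lim_1_over_n] l0])
  hence l1: "(\<lambda>k. 1 / real (Suc k) + l2_norm \<Omega> (\<lambda>x. f k x - g x)) \<longlonglongrightarrow> 0" by simp
  have "norm (l2_norm \<Omega> (\<lambda>x. f' k x - g x)) \<le> 1 / real (Suc k) + l2_norm \<Omega> (\<lambda>x. f k x - g x)" for k
    using l2_norm_triangle3[OF f' m(1)[of k] m(2), of k] b[of k] by simp
  hence "(\<lambda>k. l2_norm \<Omega> (\<lambda>x. f' k x - g x)) \<longlonglongrightarrow> 0"
    by (intro Lim_null_comparison[OF always_eventually l1] allI)
  thus ?thesis using f' m by (simp add: l2_tendsto_def)
qed

text \<open>A diagonal sequence of test forms.\<close>
lemma H01_closed:
  assumes A: "\<And>k. H01_limit \<Omega> l (\<phi> k) (w k) (v k) (h k)" and C: "l2_Cauchy \<Omega> v" "l2_Cauchy \<Omega> h"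
  obtains \<psi> w' v' h' where "H01_limit \<Omega> l \<psi> w' v' h'" "l2_tendsto \<Omega> v v'" "l2_tendsto \<Omega> h h'"
proof -
  have vf: "v k \<in> L2_form \<Omega> (l + 1)" and hf: "h k \<in> L2_form \<Omega> (l - 1)" for k using A[of k] by (auto simp: H01_limit_def)
  obtain v' where v': "v' \<in> L2_form \<Omega> (l + 1)" "l2_tendsto \<Omega> v v'"
    using L2_form_complete[where f=v, OF op bd vf C(1)] by blast
  obtain h' where h': "h' \<in> L2_form \<Omega> (l - 1)" "l2_tendsto \<Omega> h h'"
    using L2_form_complete[where f=h, OF op bd hf C(2)] by blast
  have ex: "\<exists>n. l2_norm \<Omega> (\<lambda>x. ext_deriv (\<phi> k n) x - v k x) \<le> 1 / real (Suc k) \<and>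
      l2_norm \<Omega> (\<lambda>x. coderiv (\<phi> k n) x - h k x) \<le> 1 / real (Suc k)" for k
  proof -
    have l: "(\<lambda>n. l2_norm \<Omega> (\<lambda>x. ext_deriv (\<phi> k n) x - v k x)) \<longlonglongrightarrow> 0"
      "(\<lambda>n. l2_norm \<Omega> (\<lambda>x. coderiv (\<phi> k n) x - h k x)) \<longlonglongrightarrow> 0"
      using A[of k] by (auto simp: H01_limit_def l2_tendsto_def)
    have "\<forall>\<^sub>F n in sequentially. l2_norm \<Omega> (\<lambda>x. ext_deriv (\<phi> k n) x - v k x) < 1 / real (Suc k)"
      "\<forall>\<^sub>F n in sequentially. l2_norm \<Omega> (\<lambda>x. coderiv (\<phi> k n) x - h k x) < 1 / real (Suc k)"
      by (rule order_tendstoD(2)[OF l(1)], simp, rule order_tendstoD(2)[OF l(2)], simp)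
    hence "\<forall>\<^sub>F n in sequentially. l2_norm \<Omega> (\<lambda>x. ext_deriv (\<phi> k n) x - v k x) \<le> 1 / real (Suc k) \<and>
      l2_norm \<Omega> (\<lambda>x. coderiv (\<phi> k n) x - h k x) \<le> 1 / real (Suc k)" by eventually_elim simp
    thus ?thesis by (rule eventually_happens'[OF sequentially_bot])
  qed
  from choice[OF allI[OF ex]] obtain n where
    "\<forall>k. l2_norm \<Omega> (\<lambda>x. ext_deriv (\<phi> k (n k)) x - v k x) \<le> 1 / real (Suc k) \<and>
      l2_norm \<Omega> (\<lambda>x. coderiv (\<phi> k (n k)) x - h k x) \<le> 1 / real (Suc k)" ..
  hence n: "l2_norm \<Omega> (\<lambda>x. ext_deriv (\<phi> k (n k)) x - v k x) \<le> 1 / real (Suc k)"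
     "l2_norm \<Omega> (\<lambda>x. coderiv (\<phi> k (n k)) x - h k x) \<le> 1 / real (Suc k)" for k by simp_all
  let ?\<psi> = "\<lambda>k. \<phi> k (n k)"
  have t: "?\<psi> k \<in> test_form \<Omega> l" for k using A[of k] by (simp add: H01_limit_def)
  have lv: "l2_tendsto \<Omega> (\<lambda>k. ext_deriv (?\<psi> k)) v'"
    by (rule l2_tendsto_close[OF v'(2) test_form_deriv_L2(1)[OF t] n(1)])
  have lh: "l2_tendsto \<Omega> (\<lambda>k. coderiv (?\<psi> k)) h'"
    by (rule l2_tendsto_close[OF h'(2) test_form_deriv_L2(2)[OF t] n(2)])
  have "energy_Cauchy ?\<psi>" unfolding energy_Cauchy_iff[where \<phi>="?\<psi>", OF t] using l2_tendsto_Cauchy lv lh by blast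
  then obtain w' v'' h'' where "H01_limit \<Omega> l ?\<psi> w' v'' h''" using H01_complete[where \<phi>="?\<psi>", OF t] by blast
  hence "H01_limit \<Omega> l ?\<psi> w' v' h'" using v' h' lv lh by (simp add: H01_limit_def)
  thus ?thesis using that v' h' by blast
qed

text \<open>The form \<open>\<langle>S q, q'\<rangle>\<close> is coercive on \<open>M\<close>, so the functional \<open>\<langle>u, _\<rangle>\<close> is represented by a
  sequence \<open>q k\<close> in \<open>M\<close>. The solutions of the Dirichlet problem for \<open>q k\<close> converge in \<open>H01\<close>, and the
  coderivative of their limit is \<open>u\<close>.\<close>
lemma friedrichs_velte_imp_babuska_aziz:
  assumes FV: "friedrichs_velte \<Omega> l \<Gamma>"
  shows "babuska_aziz \<Omega> l (1 + \<Gamma>)"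
proof -
  have \<Gamma>: "0 < \<Gamma>" using FV by (simp add: friedrichs_velte_def)
  let ?M = "M_space \<Omega> l"
  have "\<forall>q. \<exists>p. q \<in> ?M \<longrightarrow> (case p of (\<phi>, w, v, h) \<Rightarrow> H01_limit \<Omega> l \<phi> w v h \<and>
     (\<forall>\<phi>' w' v' h'. H01_limit \<Omega> l \<phi>' w' v' h' \<longrightarrow> l2_inner \<Omega> v v' + l2_inner \<Omega> h h' = l2_inner \<Omega> q h'))"
  proof
    fix q
    show "\<exists>p. q \<in> ?M \<longrightarrow> (case p of (\<phi>, w, v, h) \<Rightarrow> H01_limit \<Omega> l \<phi> w v h \<and>
     (\<forall>\<phi>' w' v' h'. H01_limit \<Omega> l \<phi>' w' v' h' \<longrightarrow> l2_inner \<Omega> v v' + l2_inner \<Omega> h h' = l2_inner \<Omega> q h'))"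
    proof (cases "q \<in> ?M")
      case True
      obtain \<phi> w v h where "H01_limit \<Omega> l \<phi> w v h"
        "\<And>\<phi>' w' v' h'. H01_limit \<Omega> l \<phi>' w' v' h' \<Longrightarrow> l2_inner \<Omega> v v' + l2_inner \<Omega> h h' = l2_inner \<Omega> q h'"
        using hodge_dirichlet_problem[OF M_space_L2[OF True]] by blast
      thus ?thesis by (intro exI[of _ "(\<phi>, w, v, h)"]) auto
    qed simp
  qed
  from choice[OF this] obtain p where p: "\<forall>q. q \<in> ?M \<longrightarrow> (case p q of (\<phi>, w, v, h) \<Rightarrow> H01_limit \<Omega> l \<phi> w v h \<and>
     (\<forall>\<phi>' w' v' h'. H01_limit \<Omega> l \<phi>' w' v' h' \<longrightarrow> l2_inner \<Omega> v v' + l2_inner \<Omega> h h' = l2_inner \<Omega> q h'))" ..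
  define f where "f q = fst (p q)" for q
  define w where "w q = fst (snd (p q))" for q
  define v where "v q = fst (snd (snd (p q)))" for q
  define h where "h q = snd (snd (snd (p q)))" for q
  have A: "H01_limit \<Omega> l (f q) (w q) (v q) (h q)"
    and sol: "\<And>\<phi>' w' v' h'. H01_limit \<Omega> l \<phi>' w' v' h' \<Longrightarrow> l2_inner \<Omega> (v q) v' + l2_inner \<Omega> (h q) h' = l2_inner \<Omega> q h'"
    if "q \<in> ?M" for q
    using p[rule_format, OF that] by (auto simp: f_def w_def v_def h_def split: prod.splits)
  have L: "v q \<in> L2 \<Omega>" "h q \<in> L2 \<Omega>" if "q \<in> ?M" for q
    using A[OF that] L2_form_L2 by (auto simp: H01_limit_def)
  define B where "B q q' = l2_inner \<Omega> (h q) q'" for q q'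
  have B_eq: "B q q' = l2_inner \<Omega> (v q) (v q') + l2_inner \<Omega> (h q) (h q')" if "q \<in> ?M" "q' \<in> ?M" for q q'
    using sol[OF that(2) A[OF that(1)]] unfolding B_def by (simp add: l2_inner_commute)
  have S: "semi_inner_space ?M lcf B"
  proof
    show "?M \<noteq> {}" using coderiv_in_M_space[OF test_form_H01_limit[OF test_form_zero]] by blast
    show "lcf a x b y \<in> ?M" if "x \<in> ?M" "y \<in> ?M" for x y a b by (rule M_space_lc[OF that])
    show "B z (lcf a x b y) = a * B z x + b * B z y" if "x \<in> ?M" "y \<in> ?M" "z \<in> ?M" for x y z a b
      unfolding B_def by (rule l2_inner_lc[OF M_space_L2[OF that(1)] M_space_L2[OF that(2)] L(2)[OF that(3)]])
    show "B x y = B y x" if "x \<in> ?M" "y \<in> ?M" for x y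
      unfolding B_eq[OF that] B_eq[OF that(2,1)] by (simp add: l2_inner_commute)
    show "0 \<le> B x x" if "x \<in> ?M" for x unfolding B_eq[OF that that] by simp
  qed
  interpret semi_inner_space ?M lcf B by (rule S)
  have coer: "(l2_norm \<Omega> q)\<^sup>2 \<le> (1 + \<Gamma>) * B q q" if q: "q \<in> ?M" for q
    using friedrichs_velte_inf_sup[OF FV q A[OF q] sol[OF q]] by (simp add: B_def l2_inner_commute)
  have "\<exists>w\<in>H01 \<Omega> l. is_coderiv \<Omega> (l - 1) w u \<and> (H01_norm \<Omega> l w)\<^sup>2 \<le> (1 + \<Gamma>) * (l2_norm \<Omega> u)\<^sup>2" if u: "u \<in> ?M" for u
  proof -
    have uL: "u \<in> L2 \<Omega>" by (rule M_space_L2[OF u])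
    obtain q where qM: "\<And>k. q k \<in> ?M"
      and qC: "\<And>e. 0 < e \<Longrightarrow> \<exists>N. \<forall>j\<ge>N. \<forall>k\<ge>N. B (lcf 1 (q j) (-1) (q k)) (lcf 1 (q j) (-1) (q k)) < e"
      and qlim: "\<And>y. y \<in> ?M \<Longrightarrow> (\<lambda>k. B (q k) y) \<longlonglongrightarrow> l2_inner \<Omega> u y"
    proof (rule riesz_sequence[of "l2_inner \<Omega> u" "(l2_norm \<Omega> u)\<^sup>2 * (1 + \<Gamma>)"])
      show "l2_inner \<Omega> u (lcf a x b y) = a * l2_inner \<Omega> u x + b * l2_inner \<Omega> u y" if "x \<in> ?M" "y \<in> ?M" for a x b y
        by (rule l2_inner_lc[OF M_space_L2[OF that(1)] M_space_L2[OF that(2)] uL])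
      fix x assume x: "x \<in> ?M"
      have "\<bar>l2_inner \<Omega> u x\<bar>\<^sup>2 \<le> (l2_norm \<Omega> u * l2_norm \<Omega> x)\<^sup>2"
        by (intro power_mono l2_cauchy_schwarz uL M_space_L2[OF x]) simp
      also have "\<dots> \<le> (l2_norm \<Omega> u)\<^sup>2 * ((1 + \<Gamma>) * B x x)"
        unfolding power_mult_distrib by (intro mult_left_mono coer x) simp
      finally show "(l2_inner \<Omega> u x)\<^sup>2 \<le> (l2_norm \<Omega> u)\<^sup>2 * (1 + \<Gamma>) * B x x" by (simp add: mult_ac)
    qed blast
    have diff: "B (lcf 1 (q j) (-1) (q k)) (lcf 1 (q j) (-1) (q k))
       = (l2_norm \<Omega> (\<lambda>x. v (q j) x - v (q k) x))\<^sup>2 + (l2_norm \<Omega> (\<lambda>x. h (q j) x - h (q k) x))\<^sup>2" for j k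
    proof -
      have e: "(l2_norm \<Omega> (\<lambda>x. a x - b x))\<^sup>2 = l2_inner \<Omega> a a - 2 * l2_inner \<Omega> a b + l2_inner \<Omega> b b"
        if "a \<in> L2 \<Omega>" "b \<in> L2 \<Omega>" for a b :: "'n form"
        unfolding l2_norm_square
        using l2_inner_diff[OF that] L2_diff[OF that] that by (simp add: l2_inner_commute[of \<Omega> b a])
      show ?thesis
        unfolding B_lc_self[OF qM qM] B_eq[OF qM qM] e[OF L(1)[OF qM] L(1)[OF qM]] e[OF L(2)[OF qM] L(2)[OF qM]]
        by simp
    qed
    have C: "l2_Cauchy \<Omega> (\<lambda>k. v (q k)) \<and> l2_Cauchy \<Omega> (\<lambda>k. h (q k))"
      unfolding l2_Cauchy_def
    proof (intro conjI allI impI L qM)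
      fix e :: real assume e: "0 < e"
      obtain N where N: "\<forall>j\<ge>N. \<forall>k\<ge>N. B (lcf 1 (q j) (-1) (q k)) (lcf 1 (q j) (-1) (q k)) < e\<^sup>2"
        using qC[of "e\<^sup>2"] e by auto
      have "l2_norm \<Omega> (\<lambda>x. v (q j) x - v (q k) x) < e \<and> l2_norm \<Omega> (\<lambda>x. h (q j) x - h (q k) x) < e"
        if "N \<le> j" "N \<le> k" for j k
      proof -
        have "B (lcf 1 (q j) (-1) (q k)) (lcf 1 (q j) (-1) (q k)) < e\<^sup>2" using N that by blast
        hence "(l2_norm \<Omega> (\<lambda>x. v (q j) x - v (q k) x))\<^sup>2 < e\<^sup>2" "(l2_norm \<Omega> (\<lambda>x. h (q j) x - h (q k) x))\<^sup>2 < e\<^sup>2"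
          unfolding diff by (auto intro: le_less_trans[rotated])
        thus ?thesis using e by (auto intro: power2_less_imp_less)
      qed
      thus "\<exists>N. \<forall>j\<ge>N. \<forall>k\<ge>N. l2_norm \<Omega> (\<lambda>x. v (q j) x - v (q k) x) < e"
        "\<exists>N. \<forall>j\<ge>N. \<forall>k\<ge>N. l2_norm \<Omega> (\<lambda>x. h (q j) x - h (q k) x) < e" by blast+
    qed
    obtain \<psi> w' v' h' where A': "H01_limit \<Omega> l \<psi> w' v' h'"
      and lv: "l2_tendsto \<Omega> (\<lambda>k. v (q k)) v'" and lh: "l2_tendsto \<Omega> (\<lambda>k. h (q k)) h'"
      using H01_closed[where \<phi>="\<lambda>k. f (q k)" and w="\<lambda>k. w (q k)" and v="\<lambda>k. v (q k)" and h="\<lambda>k. h (q k)", OF A[OF qM]] C by blast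
    have h'M: "h' \<in> ?M" by (rule coderiv_in_M_space[OF A'])
    have hL: "h' \<in> L2 \<Omega>" by (rule M_space_L2[OF h'M])
    have hy: "l2_inner \<Omega> h' y = l2_inner \<Omega> u y" if y: "y \<in> ?M" for y
      by (rule LIMSEQ_unique[OF l2_tendsto_inner_const[OF lh M_space_L2[OF y]] qlim[OF y, unfolded B_def]])
    have dM: "(\<lambda>x. u x - h' x) \<in> ?M" using M_space_lc[OF u h'M, of 1 "-1"] by simp
    have "l2_inner \<Omega> (\<lambda>x. u x - h' x) (\<lambda>x. u x - h' x) = 0"
      using l2_inner_diff(2)[OF uL hL M_space_L2[OF dM]] hy[OF dM] by simp
    hence uh: "l2_norm \<Omega> (\<lambda>x. u x - h' x) = 0" by (simp add: l2_norm_def)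
    have ic: "is_coderiv \<Omega> (l - 1) w' u"
      using H01_limit_is_deriv(2)[OF A'] M_space_L2_form[OF u] l2_inner_cong_AE[OF uL hL test_L2 uh]
      by (simp add: is_coderiv_def)
    \<comment> \<open>\<open>X\<close> is the squared norm of the limit \<open>w'\<close>. Testing the equation for \<open>q k\<close> with \<open>w'\<close> yields
      \<open>X = lim \<langle>q k, u\<rangle>\<close>, and coercivity bounds \<open>\<parallel>q k\<parallel>\<^sup>2\<close> by \<open>(1 + \<Gamma>) B (q k) (q k)\<close>, which tends to
      \<open>(1 + \<Gamma>) X\<close>.\<close>
    define X where "X = (l2_norm \<Omega> v')\<^sup>2 + (l2_norm \<Omega> h')\<^sup>2"
    have X0: "0 \<le> X" by (simp add: X_def)
    have XB: "(\<lambda>k. B (q k) (q k)) \<longlonglongrightarrow> X"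
      unfolding B_eq[OF qM qM] X_def l2_norm_square
      by (rule tendsto_add[OF l2_tendsto_inner[OF lv lv] l2_tendsto_inner[OF lh lh]])
    have v'L: "v' \<in> L2 \<Omega>" using A' L2_form_L2 by (auto simp: H01_limit_def)
    have "(\<lambda>k. l2_inner \<Omega> (v (q k)) v' + l2_inner \<Omega> (h (q k)) h') \<longlonglongrightarrow> X"
      unfolding X_def l2_norm_square
      by (rule tendsto_add[OF l2_tendsto_inner_const[OF lv v'L] l2_tendsto_inner_const[OF lh hL]])
    hence Xq: "(\<lambda>k. l2_inner \<Omega> (q k) h') \<longlonglongrightarrow> X" unfolding sol[OF qM A'] .
    have "(l2_inner \<Omega> (q k) h')\<^sup>2 \<le> ((1 + \<Gamma>) * B (q k) (q k)) * (l2_norm \<Omega> u)\<^sup>2" for k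
    proof -
      have "l2_inner \<Omega> (q k) h' = l2_inner \<Omega> (q k) u"
        using l2_inner_cong_AE[OF uL hL M_space_L2[OF qM] uh] by (simp add: l2_inner_commute)
      hence "\<bar>l2_inner \<Omega> (q k) h'\<bar>\<^sup>2 \<le> (l2_norm \<Omega> (q k) * l2_norm \<Omega> u)\<^sup>2"
        using l2_cauchy_schwarz[OF M_space_L2[OF qM] uL] by (intro power_mono) auto
      also have "\<dots> \<le> ((1 + \<Gamma>) * B (q k) (q k)) * (l2_norm \<Omega> u)\<^sup>2"
        unfolding power_mult_distrib by (intro mult_right_mono coer qM) simp
      finally show ?thesis by simp
    qed
    moreover have "(\<lambda>k. (l2_inner \<Omega> (q k) h')\<^sup>2) \<longlonglongrightarrow> X\<^sup>2" by (rule tendsto_power[OF Xq])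
    moreover have "(\<lambda>k. ((1 + \<Gamma>) * B (q k) (q k)) * (l2_norm \<Omega> u)\<^sup>2) \<longlonglongrightarrow> ((1 + \<Gamma>) * X) * (l2_norm \<Omega> u)\<^sup>2"
      by (rule tendsto_mult_right[OF tendsto_mult_left[OF XB]])
    ultimately have XX: "X * X \<le> X * ((1 + \<Gamma>) * (l2_norm \<Omega> u)\<^sup>2)"
      using LIMSEQ_le[of _ "X\<^sup>2"] by (auto simp: power2_eq_square mult_ac)
    have "X \<le> (1 + \<Gamma>) * (l2_norm \<Omega> u)\<^sup>2"
    proof (cases "X = 0")
      case False
      hence "0 < X" using X0 by simp
      with XX show ?thesis by simp
    qed (use \<Gamma> in simp)
    thus ?thesis using ic H01_limit_H01[OF A'] H01_limit_norm[OF A'] by (auto simp: X_def)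
  qed
  thus ?thesis using \<Gamma> by (simp add: babuska_aziz_def)
qed

end

section \<open>Non-triviality of \<open>M\<close>\<close>

lemma rho_pos:
  assumes "open \<Omega>" "bounded \<Omega>" "x \<in> \<Omega>"
  shows "0 < rho \<Omega> x"
proof -
  have "\<Omega> \<noteq> UNIV" using assms(2) not_bounded_UNIV by blast
  hence ne: "frontier \<Omega> \<noteq> {}" using assms(3) frontier_not_empty[of \<Omega>] by blast
  have "x \<notin> frontier \<Omega>" using assms(1,3) frontier_disjoint_eq[of \<Omega>] by blast
  hence "infdist x (frontier \<Omega>) \<noteq> 0" using in_closed_iff_infdist_zero[OF frontier_closed ne] by blast
  thus ?thesis unfolding rho_def using infdist_nonneg[of x "frontier \<Omega>"] by linarith
qed

lemma continuous_rho: "continuous_on UNIV (rho \<Omega>)"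
  unfolding rho_def by (intro continuous_intros)

context form_domain begin

lemma ex_bump_at:
  assumes "x0 \<in> \<Omega>"
  obtains b :: "(real, 'n) vec \<Rightarrow> real" and r where "b \<in> test_fun \<Omega>" "0 < r" "\<And>x. x \<in> ball x0 r \<Longrightarrow> 0 < b x" "ball x0 r \<subseteq> \<Omega>"
proof -
  obtain r where r: "0 < r" "cball x0 r \<subseteq> \<Omega>" using op assms open_contains_cball by blast
  obtain b :: "(real, 'n) vec \<Rightarrow> real" where b: "smooth b" "\<And>x. r \<le> norm x \<Longrightarrow> b x = 0" "\<And>x. norm x < r \<Longrightarrow> 0 < b x"
    using ex_bump[OF r(1)] by blast
  have z: "b (x0 - x) = 0" if "x \<notin> cball x0 r" for x using b(2)[of "x0 - x"] that by (simp add: dist_norm)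
  have "(\<lambda>x. b (x0 - x)) \<in> test_fun \<Omega>" unfolding test_fun_iff
    using smooth_reflect[OF b(1), of x0] compact_cball r(2) z by blast
  moreover have "0 < b (x0 - x)" if "x \<in> ball x0 r" for x using b(3)[of "x0 - x"] that by (simp add: dist_norm)
  ultimately show ?thesis using that r ball_subset_cball by (metis order_trans)
qed

lemma l2_norm_pos:
  assumes u: "u \<in> L2 \<Omega>" and r: "0 < r" "ball x0 r \<subseteq> \<Omega>" and p: "\<And>x. x \<in> ball x0 r \<Longrightarrow> u x \<noteq> 0"
  shows "0 < l2_norm \<Omega> u"
proof -
  have "l2_norm \<Omega> u \<noteq> 0"
  proof
    assume "l2_norm \<Omega> u = 0"
    hence "AE x in lebesgue_on \<Omega>. u x = 0" using l2_norm_zero_iff[OF u] by simp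
    hence "AE x in lebesgue. x \<in> \<Omega> \<longrightarrow> u x = 0" using op by (subst (asm) AE_restrict_space_iff) auto
    hence "AE x in lebesgue. x \<notin> ball x0 r" by eventually_elim (use p r(2) in blast)
    hence "negligible (ball x0 r)" by (simp add: negligible_iff_null_sets AE_iff_null_sets)
    thus False using open_not_negligible[of "ball x0 r"] r(1) by simp
  qed
  thus ?thesis using l2_norm_nonneg[of \<Omega> u] by linarith
qed

text \<open>For a bump \<open>b\<close> and \<open>i \<in> I\<close> the coderivative of \<open>b dx\<^sub>I\<close> has the component \<open>\<partial>\<^sub>i b\<close> up to sign, which
  does not vanish identically by the Poincare inequality. So \<open>M\<close> is not trivial, which bounds the
  constants in the inequalities from below.\<close>
lemma ex_test_form_coderiv_nonzero:
  assumes ne: "\<Omega> \<noteq> {}" and l: "l \<le> CARD('n)"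
  obtains \<phi> where "\<phi> \<in> test_form \<Omega> l" "0 < l2_norm \<Omega> (coderiv \<phi>)"
proof -
  obtain x0 where x0: "x0 \<in> \<Omega>" using ne by blast
  obtain b :: "(real, 'n) vec \<Rightarrow> real" and r where b: "b \<in> test_fun \<Omega>" "0 < r" "\<And>x. x \<in> ball x0 r \<Longrightarrow> 0 < b x" "ball x0 r \<subseteq> \<Omega>"
    using ex_bump_at[OF x0] by blast
  obtain I :: "'n set" where I: "card I = l" using obtain_subset_with_card_n[of l "UNIV :: 'n set"] l by auto
  then obtain i where i: "i \<in> I" using l1 by (metis card.empty ex_in_conv not_one_le_zero)
  define \<phi> where "\<phi> x = b x *\<^sub>R axis I (1::real)" for x
  have "\<phi> \<in> test_fun \<Omega>" unfolding \<phi>_def by (rule test_fun_scaleR[OF b(1)])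
  hence t: "\<phi> \<in> test_form \<Omega> l" using I by (auto simp: test_form_def Lam_def \<phi>_def axis_def)
  note s = test_formD(2)[OF t]
  have sb: "smooth b" using b(1) by (simp add: test_fun_iff)
  have pd: "partial_deriv j \<phi> x = partial_deriv j b x *\<^sub>R axis I 1" for j x
    unfolding \<phi>_def by (rule partial_deriv_bounded_linear[OF bounded_linear_scaleR_left smoothD_diff[OF sb]])
  have cd: "\<bar>coderiv \<phi> x $ (I - {i})\<bar> = norm (partial_deriv i \<phi> x)" for x
  proof -
    have "(\<Sum>j\<in>- (I - {i}). wedge_sign j (I - {i}) * partial_deriv j \<phi> x $ (insert j (I - {i})))
        = (\<Sum>j\<in>{i}. wedge_sign j (I - {i}) * partial_deriv j b x)"
    proof (rule sum.mono_neutral_cong_right)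
      show "\<forall>j\<in>- (I - {i}) - {i}. wedge_sign j (I - {i}) * partial_deriv j \<phi> x $ (insert j (I - {i})) = 0"
      proof
        fix j assume "j \<in> - (I - {i}) - {i}"
        hence "insert j (I - {i}) \<noteq> I" using i by auto
        thus "wedge_sign j (I - {i}) * partial_deriv j \<phi> x $ (insert j (I - {i})) = 0" by (simp add: pd axis_def)
      qed
      show "wedge_sign j (I - {i}) * partial_deriv j \<phi> x $ (insert j (I - {i})) = wedge_sign j (I - {i}) * partial_deriv j b x"
        if "j \<in> {i}" for j using that i by (simp add: pd insert_absorb)
    qed (use i in auto)
    hence "coderiv \<phi> x $ (I - {i}) = - (wedge_sign i (I - {i}) * partial_deriv i b x)" by (simp add: coderiv_def)
    moreover have "\<bar>wedge_sign i (I - {i})\<bar> = 1" by (simp add: wedge_sign_def power_abs)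
    ultimately show ?thesis by (simp add: pd abs_mult)
  qed
  have "l2_norm \<Omega> (partial_deriv i \<phi>) \<le> 1 * l2_norm \<Omega> (coderiv \<phi>)"
  proof (rule l2_norm_mono(2)[OF test_form_deriv_L2(2)[OF t] _ op])
    show "partial_deriv i \<phi> \<in> borel_measurable (lebesgue_on \<Omega>)"
      by (intro borel_imp_lebesgue_on borel_measurable_continuous_onI smoothD_cont smooth_partial_deriv s)
    show "norm (partial_deriv i \<phi> x) \<le> 1 * norm (coderiv \<phi> x)" for x
      unfolding cd[symmetric] using component_le_norm_cart[of "coderiv \<phi> x" "I - {i}"] by simp
  qed simp
  moreover obtain c where c: "0 < c" "l2_norm \<Omega> \<phi> \<le> c * l2_norm \<Omega> (partial_deriv i \<phi>)"
    using poincare_forms[OF op bd] t by metis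
  moreover have "0 < l2_norm \<Omega> \<phi>"
    by (rule l2_norm_pos[OF test_L2[OF t] b(2,4)]) (use b(3) in \<open>force simp: \<phi>_def\<close>)
  ultimately have "0 < c * l2_norm \<Omega> (partial_deriv i \<phi>)" by linarith
  hence "0 < l2_norm \<Omega> (partial_deriv i \<phi>)" using c(1) by (simp add: zero_less_mult_iff)
  hence "0 < l2_norm \<Omega> (coderiv \<phi>)" using \<open>l2_norm \<Omega> (partial_deriv i \<phi>) \<le> 1 * l2_norm \<Omega> (coderiv \<phi>)\<close> by linarith
  thus ?thesis using that t by blast
qed

text \<open>The energy of any preimage of \<open>u\<close> under \<open>d\<^sup>*\<close> contains \<open>\<parallel>u\<parallel>\<^sup>2\<close>.\<close>
lemma babuska_aziz_ge_1:
  assumes "\<Omega> \<noteq> {}" "l \<le> CARD('n)" and BA: "babuska_aziz \<Omega> l C"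
  shows "1 \<le> C"
proof -
  obtain \<phi> where t: "\<phi> \<in> test_form \<Omega> l" and p: "0 < l2_norm \<Omega> (coderiv \<phi>)"
    using ex_test_form_coderiv_nonzero[OF assms(1,2)] by blast
  let ?u = "coderiv \<phi>"
  have "?u \<in> M_space \<Omega> l" by (rule coderiv_in_M_space[OF test_form_H01_limit[OF t]])
  then obtain w where w: "w \<in> H01 \<Omega> l" "is_coderiv \<Omega> (l - 1) w ?u" "(H01_norm \<Omega> l w)\<^sup>2 \<le> C * (l2_norm \<Omega> ?u)\<^sup>2"
    using BA unfolding babuska_aziz_def by blast
  obtain \<psi> v h where A: "H01_limit \<Omega> l \<psi> w v h" using H01_limit_exists[OF w(1)] by blast
  have "h \<in> L2 \<Omega>" using A L2_form_L2 by (auto simp: H01_limit_def)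
  hence "l2_norm \<Omega> ?u = l2_norm \<Omega> h"
    using l2_norm_eq[OF test_form_deriv_L2(2)[OF t] _ coderiv_unique[OF w(2) H01_limit_is_deriv(2)[OF A]]] by blast
  hence "(l2_norm \<Omega> ?u)\<^sup>2 \<le> C * (l2_norm \<Omega> ?u)\<^sup>2" using w(3) H01_limit_norm[OF A] by (smt (verit) zero_le_power2)
  thus ?thesis using p by simp
qed

lemma rho_form_L2:
  assumes "g \<in> test_form \<Omega> m"
  shows "(\<lambda>x. rho \<Omega> x *\<^sub>R g x) \<in> L2_form \<Omega> m"
proof -
  obtain K where K: "compact K" "K \<subseteq> \<Omega>" "\<And>x. x \<notin> K \<Longrightarrow> g x = 0" using test_form_support[OF assms] by blast
  have "continuous_on UNIV (\<lambda>x. rho \<Omega> x *\<^sub>R g x)"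
    by (intro continuous_on_scaleR continuous_rho smoothD_cont test_formD(2)[OF assms])
  hence "(\<lambda>x. rho \<Omega> x *\<^sub>R g x) \<in> L2 \<Omega>" by (rule L2_csupp[OF op _ K(1)]) (simp add: K(3))
  thus ?thesis using test_formD(3)[OF assms] subspace_scale[OF subspace_Lam] by (auto simp: L2_form_def)
qed

lemma improved_poincare_pos:
  assumes "\<Omega> \<noteq> {}" "l \<le> CARD('n)" and IP: "improved_poincare \<Omega> l P"
  shows "0 < P"
proof -
  obtain \<phi> where t: "\<phi> \<in> test_form \<Omega> l" and p: "0 < l2_norm \<Omega> (coderiv \<phi>)"
    using ex_test_form_coderiv_nonzero[OF assms(1,2)] by blast
  let ?u = "coderiv \<phi>" let ?g = "ext_deriv (coderiv \<phi>)"
  have u: "?u \<in> M_space \<Omega> l" by (rule coderiv_in_M_space[OF test_form_H01_limit[OF t]])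
  have g: "?g \<in> test_form \<Omega> l" using test_form_ext_deriv[OF test_form_coderiv[OF t l1]] l1 by simp
  have "weighted_d_repr \<Omega> l ?u ?g" unfolding weighted_d_repr_def
  proof (intro conjI ballI)
    show "(\<lambda>x. rho \<Omega> x *\<^sub>R ?g x) \<in> L2_form \<Omega> l" by (rule rho_form_L2[OF g])
    fix \<psi> assume q: "\<psi> \<in> test_form \<Omega> l"
    show "d_dual \<Omega> l ?u \<psi> = l2_inner \<Omega> ?g \<psi>"
      unfolding d_dual_eq[OF test_form_H01_limit[OF q] M_space_L2[OF u]]
      by (rule l2_green(1)[OF op smooth_coderiv[OF test_formD(2)[OF t]] q, symmetric])
  qed
  hence "(l2_norm \<Omega> ?u)\<^sup>2 \<le> P * (l2_norm \<Omega> (\<lambda>x. rho \<Omega> x *\<^sub>R ?g x))\<^sup>2"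
    using IP u unfolding improved_poincare_def by blast
  moreover have "0 < (l2_norm \<Omega> ?u)\<^sup>2" using p by simp
  ultimately have pos: "0 < P * (l2_norm \<Omega> (\<lambda>x. rho \<Omega> x *\<^sub>R ?g x))\<^sup>2" by linarith
  show ?thesis
  proof (rule ccontr)
    assume "\<not> 0 < P"
    hence "P * (l2_norm \<Omega> (\<lambda>x. rho \<Omega> x *\<^sub>R ?g x))\<^sup>2 \<le> 0" by (intro mult_nonpos_nonneg) auto
    thus False using pos by linarith
  qed
qed

end

section \<open>The Hardy inequality for forms\<close>

definition gradient :: "(real^'n \<Rightarrow> real) \<Rightarrow> real^'n \<Rightarrow> real^'n" where
  "gradient f x = (\<chi> i. partial_deriv i f x)"

lemma grad_norm_eq: "grad_norm \<Omega> f = l2_norm \<Omega> (gradient f)"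
  by (simp add: grad_norm_def gradient_def[abs_def])

lemma gradient_diff: "smooth f \<Longrightarrow> smooth g \<Longrightarrow> gradient (\<lambda>x. f x - g x) x = gradient f x - gradient g x"
  by (simp add: gradient_def vec_eq_iff partial_deriv_diff)

lemma L2_vec_component:
  fixes u :: "real^'n \<Rightarrow> real^'m"
  assumes "open \<Omega>" "u \<in> L2 \<Omega>" shows "(\<lambda>x. u x $ c) \<in> L2 \<Omega>"
proof (rule l2_norm_mono(1)[OF assms(2) _ assms(1), of _ 1])
  show "(\<lambda>x. u x $ c) \<in> borel_measurable (lebesgue_on \<Omega>)"
    by (rule measurable_compose[OF L2_measurable[OF assms(2)] borel_measurable_continuous_onI])
       (intro continuous_intros)
qed (auto simp: component_le_norm_cart)

lemma l2_inner_components: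
  fixes u v :: "real^'n \<Rightarrow> real^'m"
  assumes "open \<Omega>" "u \<in> L2 \<Omega>" "v \<in> L2 \<Omega>"
  shows "l2_inner \<Omega> u v = (\<Sum>c\<in>UNIV. l2_inner \<Omega> (\<lambda>x. u x $ c) (\<lambda>x. v x $ c))"
  unfolding l2_inner_def inner_vec_def
  by (rule Bochner_Integration.integral_sum)
     (rule L2_inner_integrable[OF L2_vec_component[OF assms(1,2)] L2_vec_component[OF assms(1,3)]])

lemma L2_vecI:
  fixes u :: "real^'n \<Rightarrow> real^'m"
  assumes "\<And>c. (\<lambda>x. u x $ c) \<in> L2 \<Omega>"
  shows "u \<in> L2 \<Omega>"
  unfolding L2_iff_inner
proof
  show "u \<in> borel_measurable (lebesgue_on \<Omega>)"
    using L2_measurable[OF assms]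
    by (subst borel_measurable_euclidean_space) (auto simp: Basis_vec_def inner_axis)
  show "integrable (lebesgue_on \<Omega>) (\<lambda>x. u x \<bullet> u x)"
    unfolding inner_vec_def by (rule Bochner_Integration.integrable_sum) (rule L2_inner_integrable[OF assms assms])
qed

lemma test_fun_gradient_L2:
  assumes "open \<Omega>" "\<phi> \<in> test_fun \<Omega>" shows "gradient \<phi> \<in> L2 \<Omega>"
proof (rule L2_vecI)
  fix i
  obtain K where K: "compact K" "K \<subseteq> \<Omega>" "\<forall>x. x \<notin> K \<longrightarrow> \<phi> x = 0" and s: "smooth \<phi>"
    using assms(2) unfolding test_fun_iff by blast
  have "partial_deriv i \<phi> \<in> L2 \<Omega>"
    by (rule L2_csupp[OF assms(1) smoothD_cont[OF smooth_partial_deriv[OF s]] K(1)])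
       (rule partial_deriv_zero_off_closed[OF compact_imp_closed[OF K(1)]], use K(3) in auto)
  thus "(\<lambda>x. gradient \<phi> x $ i) \<in> L2 \<Omega>" by (simp add: gradient_def)
qed

lemma l2_inner_gradient:
  assumes \<Omega>: "open \<Omega>" and f: "\<phi> \<in> test_fun \<Omega>" and g: "\<psi> \<in> test_fun \<Omega>"
  shows "l2_inner \<Omega> (gradient \<phi>) (\<lambda>x. \<psi> x *\<^sub>R axis i 1) = - l2_inner \<Omega> \<phi> (partial_deriv i \<psi>)"
proof -
  have sf: "smooth \<phi>" and sg: "smooth \<psi>" using f g by (auto simp: test_fun_iff)
  obtain K where K: "compact K" "K \<subseteq> \<Omega>" "\<And>x. x \<notin> K \<Longrightarrow> \<psi> x = 0" using g unfolding test_fun_iff by blast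
  have pz: "partial_deriv i \<psi> x = 0" if "x \<notin> K" for x
    by (rule partial_deriv_zero_off_closed[OF compact_imp_closed[OF K(1)] K(3) that])
  have "l2_inner \<Omega> (gradient \<phi>) (\<lambda>x. \<psi> x *\<^sub>R axis i 1) = l2_inner \<Omega> (partial_deriv i \<phi>) \<psi>"
    by (simp add: l2_inner_def gradient_def inner_axis mult.commute)
  also have "\<dots> = (LINT x|lborel. partial_deriv i \<phi> x \<bullet> \<psi> x)"
    by (rule l2_inner_smooth[OF \<Omega> smooth_partial_deriv[OF sf] sg]) (use K in auto)
  also have "\<dots> = - (LINT x|lborel. \<phi> x \<bullet> partial_deriv i \<psi> x)"
    by (rule integral_by_parts'[OF sf sg K(1,3)])
  also have "(LINT x|lborel. \<phi> x \<bullet> partial_deriv i \<psi> x) = l2_inner \<Omega> \<phi> (partial_deriv i \<psi>)"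
    by (rule l2_inner_smooth[OF \<Omega> sf smooth_partial_deriv[OF sg], symmetric]) (use K pz in auto)
  finally show ?thesis .
qed

text \<open>As for forms, the value of the norm does not depend on the sequence because the weak gradient is unique.\<close>
lemma H01_scalar_limit:
  fixes \<Omega> :: "(real^'n) set"
  assumes \<Omega>: "open \<Omega>" "bounded \<Omega>" and t: "\<And>k. \<phi> k \<in> test_fun \<Omega>"
    and f: "l2_tendsto \<Omega> \<phi> f" and G: "l2_tendsto \<Omega> (\<lambda>k. gradient (\<phi> k)) G"
  shows "f \<in> H01_scalar \<Omega>" "H01_scalar_norm \<Omega> f = l2_norm \<Omega> G"
proof -
  let ?C = "completion_seq \<Omega> (test_fun \<Omega>) (grad_norm \<Omega>) f"
  have sm: "smooth \<psi>" if "\<psi> \<in> test_fun \<Omega>" for \<psi> :: "real^'n \<Rightarrow> real" using that by (simp add: test_fun_iff)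
  have gd: "grad_norm \<Omega> (\<lambda>x. \<psi> j x - \<psi> k x) = l2_norm \<Omega> (\<lambda>x. gradient (\<psi> j) x - gradient (\<psi> k) x)"
    if "\<And>k. \<psi> k \<in> test_fun \<Omega>" for \<psi> :: "nat \<Rightarrow> real^'n \<Rightarrow> real" and j k
  proof -
    have "gradient (\<lambda>x. \<psi> j x - \<psi> k x) = (\<lambda>x. gradient (\<psi> j) x - gradient (\<psi> k) x)"
      by (rule ext) (rule gradient_diff[OF sm[OF that] sm[OF that]])
    thus ?thesis by (simp add: grad_norm_eq)
  qed
  have GL: "G \<in> L2 \<Omega>" and fL: "f \<in> L2 \<Omega>" using f G by (auto simp: l2_tendsto_def)
  have C: "?C \<phi>" unfolding completion_seq_def
    using t f l2_tendsto_Cauchy[OF G] by (simp add: gd[where \<psi>=\<phi>, OF t] l2_Cauchy_def l2_tendsto_def)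
  thus "f \<in> H01_scalar \<Omega>" using fL unfolding H01_scalar_def by blast
  define \<psi> where "\<psi> = (SOME \<phi>. ?C \<phi>)"
  have C': "?C \<psi>" unfolding \<psi>_def by (rule someI[of ?C, OF C])
  hence t': "\<psi> k \<in> test_fun \<Omega>" for k by (simp add: completion_seq_def)
  have "l2_Cauchy \<Omega> (\<lambda>k. gradient (\<psi> k))"
    using C' unfolding completion_seq_def l2_Cauchy_def by (simp add: gd[where \<psi>=\<psi>, OF t'] test_fun_gradient_L2[OF \<Omega>(1) t'])
  then obtain G' where G': "l2_tendsto \<Omega> (\<lambda>k. gradient (\<psi> k)) G'"
    using l2_complete[OF finite_measure_lebesgue_on[OF \<Omega>(2,1)]] by blast
  have f': "l2_tendsto \<Omega> \<psi> f" using C' fL test_fun_L2[OF \<Omega>(1) t'] by (simp add: l2_tendsto_def completion_seq_def)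
  have GL': "G' \<in> L2 \<Omega>" using G' by (simp add: l2_tendsto_def)
  have weak: "l2_inner \<Omega> H (\<lambda>x. p x *\<^sub>R axis i 1) = - l2_inner \<Omega> f (partial_deriv i p)"
    if q: "\<And>k. q k \<in> test_fun \<Omega>" "l2_tendsto \<Omega> q f" "l2_tendsto \<Omega> (\<lambda>k. gradient (q k)) H" and p: "p \<in> test_fun \<Omega>"
    for q H p i
  proof (rule LIMSEQ_unique)
    show "(\<lambda>k. l2_inner \<Omega> (gradient (q k)) (\<lambda>x. p x *\<^sub>R axis i 1)) \<longlonglongrightarrow> l2_inner \<Omega> H (\<lambda>x. p x *\<^sub>R axis i 1)"
      by (rule l2_tendsto_inner_const[OF q(3) test_fun_L2[OF \<Omega>(1) test_fun_scaleR[OF p]]])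
    have "partial_deriv i p \<in> L2 \<Omega>"
      using L2_vec_component[OF \<Omega>(1) test_fun_gradient_L2[OF \<Omega>(1) p], of i] by (simp add: gradient_def)
    thus "(\<lambda>k. l2_inner \<Omega> (gradient (q k)) (\<lambda>x. p x *\<^sub>R axis i 1)) \<longlonglongrightarrow> - l2_inner \<Omega> f (partial_deriv i p)"
      unfolding l2_inner_gradient[OF \<Omega>(1) q(1) p] by (intro tendsto_minus l2_tendsto_inner_const[OF q(2)])
  qed
  have "l2_norm \<Omega> (\<lambda>x. G x - G' x) = 0"
  proof (rule fundamental_lemma[OF \<Omega> L2_diff[OF GL GL']])
    fix p :: "real^'n \<Rightarrow> real" and b :: "real^'n" assume p: "p \<in> test_fun \<Omega>" and "b \<in> Basis"
    then obtain i where b: "b = axis i 1" by (auto simp: Basis_vec_def)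
    show "l2_inner \<Omega> (\<lambda>x. G x - G' x) (\<lambda>x. p x *\<^sub>R b) = 0"
      unfolding b l2_inner_diff(2)[OF GL GL' test_fun_L2[OF \<Omega>(1) test_fun_scaleR[OF p]]]
      by (simp add: weak[OF t f G p] weak[OF t' f' G' p])
  qed
  hence n: "l2_norm \<Omega> G = l2_norm \<Omega> G'"
    using l2_inner_cong_AE[OF GL GL' GL] l2_inner_cong_AE[OF GL GL' GL']
    by (simp add: l2_norm_def l2_inner_commute[of \<Omega> G G'])
  have "(\<lambda>k. grad_norm \<Omega> (\<psi> k)) \<longlonglongrightarrow> l2_norm \<Omega> G'" unfolding grad_norm_eq by (rule l2_tendsto_norm[OF G'])
  thus "H01_scalar_norm \<Omega> f = l2_norm \<Omega> G"
    unfolding H01_scalar_norm_def completion_norm_def \<psi>_def[symmetric] n by (rule limI)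
qed

context form_domain begin

lemma energy_gradient:
  assumes g: "g \<in> test_form \<Omega> l"
  shows "(energy_norm \<Omega> g)\<^sup>2 = (\<Sum>I\<in>UNIV. (l2_norm \<Omega> (gradient (\<lambda>x. g x $ I)))\<^sup>2)"
    "(\<lambda>x. g x $ I) \<in> test_fun \<Omega>"
proof -
  obtain K where K: "compact K" "K \<subseteq> \<Omega>" "\<And>x. x \<notin> K \<Longrightarrow> g x = 0" using test_form_support[OF g] by blast
  note s = test_formD(2)[OF g]
  show t: "(\<lambda>x. g x $ I) \<in> test_fun \<Omega>" for I
    unfolding test_fun_iff by (intro conjI exI[of _ K] K(1,2) smooth_component[OF s]) (simp add: K(3))
  have pL: "partial_deriv i g \<in> L2 \<Omega>" for i
    by (rule L2_csupp[OF op smoothD_cont[OF smooth_partial_deriv[OF s]] K(1)])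
       (rule partial_deriv_zero_off_closed[OF compact_imp_closed[OF K(1)] K(3)])
  have "(energy_norm \<Omega> g)\<^sup>2 = (\<Sum>i\<in>UNIV. \<Sum>I\<in>UNIV. l2_inner \<Omega> (\<lambda>x. partial_deriv i g x $ I) (\<lambda>x. partial_deriv i g x $ I))"
    unfolding energy_eq(2)[OF op g] l2_norm_square by (simp add: l2_inner_components[OF op pL pL])
  also have "\<dots> = (\<Sum>I\<in>UNIV. \<Sum>i\<in>UNIV. l2_inner \<Omega> (\<lambda>x. partial_deriv i g x $ I) (\<lambda>x. partial_deriv i g x $ I))"
    by (rule sum.swap)
  also have "\<dots> = (\<Sum>I\<in>UNIV. (l2_norm \<Omega> (gradient (\<lambda>x. g x $ I)))\<^sup>2)"
    unfolding l2_norm_square l2_inner_components[OF op test_fun_gradient_L2[OF op t] test_fun_gradient_L2[OF op t]]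
    by (simp add: gradient_def partial_deriv_component[OF s])
  finally show "(energy_norm \<Omega> g)\<^sup>2 = (\<Sum>I\<in>UNIV. (l2_norm \<Omega> (gradient (\<lambda>x. g x $ I)))\<^sup>2)" .
qed

lemma H01_component:
  assumes A: "H01_limit \<Omega> l \<phi> w v h"
  shows "(\<lambda>x. w x $ I) \<in> H01_scalar \<Omega>"
    "(\<Sum>I\<in>UNIV. (H01_scalar_norm \<Omega> (\<lambda>x. w x $ I))\<^sup>2) = (l2_norm \<Omega> v)\<^sup>2 + (l2_norm \<Omega> h)\<^sup>2"
proof -
  have t: "\<phi> k \<in> test_form \<Omega> l" for k using A by (simp add: H01_limit_def)
  have C: "energy_Cauchy \<phi>" using H01_limit_completion_seq[OF A] by (simp add: completion_seq_iff)
  note tI = energy_gradient(2)[OF t]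
  have wL: "w \<in> L2 \<Omega>" and lw: "(\<lambda>k. l2_norm \<Omega> (\<lambda>x. \<phi> k x - w x)) \<longlonglongrightarrow> 0"
    using A by (auto simp: H01_limit_def l2_tendsto_def)
  have lim: "l2_tendsto \<Omega> (\<lambda>k x. \<phi> k x $ I) (\<lambda>x. w x $ I)" for I
    unfolding l2_tendsto_def
  proof (intro conjI allI test_fun_L2[OF op tI] L2_vec_component[OF op wL])
    have dL: "(\<lambda>x. \<phi> k x - w x) \<in> L2 \<Omega>" for k by (rule L2_diff[OF test_L2[OF t] wL])
    have "l2_norm \<Omega> (\<lambda>x. (\<phi> k x - w x) $ I) \<le> 1 * l2_norm \<Omega> (\<lambda>x. \<phi> k x - w x)" for k
      by (rule l2_norm_mono(2)[OF dL L2_measurable[OF L2_vec_component[OF op dL]] op])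
         (auto simp: component_le_norm_cart simp del: vector_minus_component)
    hence b: "\<forall>k. norm (l2_norm \<Omega> (\<lambda>x. \<phi> k x $ I - w x $ I)) \<le> l2_norm \<Omega> (\<lambda>x. \<phi> k x - w x)" by simp
    show "(\<lambda>k. l2_norm \<Omega> (\<lambda>x. \<phi> k x $ I - w x $ I)) \<longlonglongrightarrow> 0"
      by (rule Lim_null_comparison[OF always_eventually[OF b] lw])
  qed
  have "l2_Cauchy \<Omega> (\<lambda>k. gradient (\<lambda>x. \<phi> k x $ I))" for I
    unfolding l2_Cauchy_def
  proof (intro conjI allI impI test_fun_gradient_L2[OF op tI])
    fix e :: real assume "0 < e"
    then obtain N where N: "\<forall>j\<ge>N. \<forall>k\<ge>N. energy_norm \<Omega> (\<lambda>x. \<phi> j x - \<phi> k x) < e"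
      using C unfolding energy_Cauchy_def by blast
    have "l2_norm \<Omega> (\<lambda>x. gradient (\<lambda>x. \<phi> j x $ I) x - gradient (\<lambda>x. \<phi> k x $ I) x) < e" if "N \<le> j" "N \<le> k" for j k
    proof -
      note d = test_form_diff[OF t[of j] t[of k]]
      have e: "gradient (\<lambda>x. (\<phi> j x - \<phi> k x) $ I) = (\<lambda>x. gradient (\<lambda>x. \<phi> j x $ I) x - gradient (\<lambda>x. \<phi> k x $ I) x)"
        using gradient_diff[OF smooth_component[OF test_formD(2)[OF t[of j]]] smooth_component[OF test_formD(2)[OF t[of k]]]]
        by (intro ext) simp
      have "(l2_norm \<Omega> (gradient (\<lambda>x. (\<phi> j x - \<phi> k x) $ I)))\<^sup>2 \<le> (energy_norm \<Omega> (\<lambda>x. \<phi> j x - \<phi> k x))\<^sup>2"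
        unfolding energy_gradient(1)[OF d]
        by (rule member_le_sum[where f="\<lambda>I. (l2_norm \<Omega> (gradient (\<lambda>x. (\<phi> j x - \<phi> k x) $ I)))\<^sup>2"]) auto
      hence "l2_norm \<Omega> (gradient (\<lambda>x. (\<phi> j x - \<phi> k x) $ I)) \<le> energy_norm \<Omega> (\<lambda>x. \<phi> j x - \<phi> k x)"
        by (rule power2_le_imp_le[OF _ energy_eq(3)[OF op d]])
      also have "\<dots> < e" using N that by blast
      finally show ?thesis unfolding e .
    qed
    thus "\<exists>N. \<forall>j\<ge>N. \<forall>k\<ge>N. l2_norm \<Omega> (\<lambda>x. gradient (\<lambda>x. \<phi> j x $ I) x - gradient (\<lambda>x. \<phi> k x $ I) x) < e" by blast
  qed
  hence "\<forall>I. \<exists>G. l2_tendsto \<Omega> (\<lambda>k. gradient (\<lambda>x. \<phi> k x $ I)) G"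
    using l2_complete[OF finite_measure_lebesgue_on[OF bd op]] by blast
  from choice[OF this] obtain G where G: "\<forall>I. l2_tendsto \<Omega> (\<lambda>k. gradient (\<lambda>x. \<phi> k x $ I)) (G I)" ..
  note sc = H01_scalar_limit[OF op bd tI lim G[rule_format]]
  show "(\<lambda>x. w x $ I) \<in> H01_scalar \<Omega>" by (rule sc(1))
  have "(\<lambda>k. (energy_norm \<Omega> (\<phi> k))\<^sup>2) \<longlonglongrightarrow> (\<Sum>I\<in>UNIV. (l2_norm \<Omega> (G I))\<^sup>2)"
    unfolding energy_gradient(1)[OF t]
    by (rule tendsto_sum) (rule tendsto_power[OF l2_tendsto_norm[OF G[rule_format]]])
  moreover have "(\<lambda>k. (energy_norm \<Omega> (\<phi> k))\<^sup>2) \<longlonglongrightarrow> (sqrt ((l2_norm \<Omega> v)\<^sup>2 + (l2_norm \<Omega> h)\<^sup>2))\<^sup>2"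
    by (rule tendsto_power[OF H01_limit_energy[OF A]])
  ultimately have "(\<Sum>I\<in>UNIV. (l2_norm \<Omega> (G I))\<^sup>2) = (sqrt ((l2_norm \<Omega> v)\<^sup>2 + (l2_norm \<Omega> h)\<^sup>2))\<^sup>2"
    by (rule LIMSEQ_unique)
  thus "(\<Sum>I\<in>UNIV. (H01_scalar_norm \<Omega> (\<lambda>x. w x $ I))\<^sup>2) = (l2_norm \<Omega> v)\<^sup>2 + (l2_norm \<Omega> h)\<^sup>2"
    unfolding sc(2) by simp
qed

text \<open>The scalar Hardy inequality is summed over the coefficients, whose Dirichlet integrals add up to the
  energy of the form.\<close>
lemma hardy_forms:
  assumes H: "hardy_inequality \<Omega> H" and A: "H01_limit \<Omega> l \<phi> w v h"
  shows "(\<lambda>x. (1 / rho \<Omega> x) *\<^sub>R w x) \<in> L2 \<Omega>"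
    "(l2_norm \<Omega> (\<lambda>x. (1 / rho \<Omega> x) *\<^sub>R w x))\<^sup>2 \<le> H * ((l2_norm \<Omega> v)\<^sup>2 + (l2_norm \<Omega> h)\<^sup>2)"
proof -
  have c: "((1 / rho \<Omega> x) *\<^sub>R w x) $ I = w x $ I / rho \<Omega> x" for x I by simp
  have HI: "(\<lambda>x. w x $ I / rho \<Omega> x) \<in> L2 \<Omega>"
    "(l2_norm \<Omega> (\<lambda>x. w x $ I / rho \<Omega> x))\<^sup>2 \<le> H * (H01_scalar_norm \<Omega> (\<lambda>x. w x $ I))\<^sup>2" for I
    using H H01_component(1)[OF A, of I] unfolding hardy_inequality_def by auto
  show L: "(\<lambda>x. (1 / rho \<Omega> x) *\<^sub>R w x) \<in> L2 \<Omega>" by (rule L2_vecI) (unfold c, rule HI(1))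
  have "(l2_norm \<Omega> (\<lambda>x. (1 / rho \<Omega> x) *\<^sub>R w x))\<^sup>2 = (\<Sum>I\<in>UNIV. (l2_norm \<Omega> (\<lambda>x. w x $ I / rho \<Omega> x))\<^sup>2)"
    unfolding l2_norm_square l2_inner_components[OF op L L] c ..
  also have "\<dots> \<le> (\<Sum>I\<in>UNIV. H * (H01_scalar_norm \<Omega> (\<lambda>x. w x $ I))\<^sup>2)" by (rule sum_mono) (rule HI(2))
  also have "\<dots> = H * ((l2_norm \<Omega> v)\<^sup>2 + (l2_norm \<Omega> h)\<^sup>2)"
    unfolding sum_distrib_left[symmetric] H01_component(2)[OF A] ..
  finally show "(l2_norm \<Omega> (\<lambda>x. (1 / rho \<Omega> x) *\<^sub>R w x))\<^sup>2 \<le> H * ((l2_norm \<Omega> v)\<^sup>2 + (l2_norm \<Omega> h)\<^sup>2)" .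
qed

lemma hardy_const_nonneg:
  assumes "\<Omega> \<noteq> {}" "l \<le> CARD('n)" and H: "hardy_inequality \<Omega> H"
  shows "0 \<le> H"
proof -
  obtain \<phi> where t: "\<phi> \<in> test_form \<Omega> l" and p: "0 < l2_norm \<Omega> (coderiv \<phi>)"
    using ex_test_form_coderiv_nonzero[OF assms(1,2)] by blast
  let ?X = "(l2_norm \<Omega> (ext_deriv \<phi>))\<^sup>2 + (l2_norm \<Omega> (coderiv \<phi>))\<^sup>2"
  have "0 \<le> H * ?X" using hardy_forms(2)[OF H test_form_H01_limit[OF t]] by (rule order_trans[rotated]) simp
  moreover have "0 < ?X" using p by (intro add_nonneg_pos) auto
  ultimately show ?thesis by (simp add: zero_le_mult_iff)
qed

text \<open>The identity \<open>\<langle>u, d\<^sup>* \<phi>\<rangle> = \<langle>\<rho> g, \<phi> / \<rho>\<rangle>\<close> extends from test forms to \<open>w\<close>, because by the Hardy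
  inequality \<open>\<phi> / \<rho>\<close> depends continuously on \<open>\<phi>\<close> in the energy norm.\<close>
lemma babuska_aziz_imp_improved_poincare:
  assumes "\<Omega> \<noteq> {}" "l \<le> CARD('n)" and BA: "babuska_aziz \<Omega> l C" and H: "hardy_inequality \<Omega> H"
  shows "improved_poincare \<Omega> l (H * C)"
  unfolding improved_poincare_def
proof (intro ballI allI impI)
  fix u g assume u: "u \<in> M_space \<Omega> l" and "weighted_d_repr \<Omega> l u g"
  hence gL: "(\<lambda>x. rho \<Omega> x *\<^sub>R g x) \<in> L2 \<Omega>" and gd: "\<And>\<phi>. \<phi> \<in> test_form \<Omega> l \<Longrightarrow> d_dual \<Omega> l u \<phi> = l2_inner \<Omega> g \<phi>"
    unfolding weighted_d_repr_def using L2_form_L2 by auto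
  have H0: "0 \<le> H" by (rule hardy_const_nonneg[OF assms(1,2) H])
  have C0: "0 < C" using BA by (simp add: babuska_aziz_def)
  have uL: "u \<in> L2 \<Omega>" by (rule M_space_L2[OF u])
  obtain w where w: "w \<in> H01 \<Omega> l" "is_coderiv \<Omega> (l - 1) w u" "(H01_norm \<Omega> l w)\<^sup>2 \<le> C * (l2_norm \<Omega> u)\<^sup>2"
    using BA u unfolding babuska_aziz_def by blast
  obtain \<phi> v h where A: "H01_limit \<Omega> l \<phi> w v h" using H01_limit_exists[OF w(1)] by blast
  have t: "\<phi> k \<in> test_form \<Omega> l" for k using A by (simp add: H01_limit_def)
  have L: "v \<in> L2 \<Omega>" "h \<in> L2 \<Omega>" "w \<in> L2 \<Omega>" using A L2_form_L2 by (auto simp: H01_limit_def)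
  have lims: "l2_tendsto \<Omega> \<phi> w" "l2_tendsto \<Omega> (\<lambda>k. ext_deriv (\<phi> k)) v" "l2_tendsto \<Omega> (\<lambda>k. coderiv (\<phi> k)) h"
    using A by (auto simp: H01_limit_def)
  let ?q = "\<lambda>f x. (1 / rho \<Omega> x) *\<^sub>R f x :: (real, 'n set) vec"
  let ?r = "\<lambda>x. rho \<Omega> x *\<^sub>R g x"
  have qw: "?q w \<in> L2 \<Omega>" "(l2_norm \<Omega> (?q w))\<^sup>2 \<le> H * ((l2_norm \<Omega> v)\<^sup>2 + (l2_norm \<Omega> h)\<^sup>2)"
    using hardy_forms[OF H A] by auto
  have qk: "?q (\<phi> k) \<in> L2 \<Omega>" for k by (rule hardy_forms(1)[OF H test_form_H01_limit[OF t]])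
  have diffA: "H01_limit \<Omega> l (\<lambda>j x. \<phi> j x - \<phi> k x) (\<lambda>x. w x - \<phi> k x)
      (\<lambda>x. v x - ext_deriv (\<phi> k) x) (\<lambda>x. h x - coderiv (\<phi> k) x)" for k
  proof -
    have e: "ext_deriv (\<lambda>x. \<phi> j x - \<phi> k x) = (\<lambda>x. ext_deriv (\<phi> j) x - ext_deriv (\<phi> k) x)"
      "coderiv (\<lambda>x. \<phi> j x - \<phi> k x) = (\<lambda>x. coderiv (\<phi> j) x - coderiv (\<phi> k) x)" for j
      by (rule ext, rule ext_deriv_diff[OF test_formD(2)[OF t] test_formD(2)[OF t]],
          rule ext, rule coderiv_diff[OF test_formD(2)[OF t] test_formD(2)[OF t]])
    have c: "l2_tendsto \<Omega> (\<lambda>j x. a j x - c x) (\<lambda>x. b x - c x)" if "l2_tendsto \<Omega> a b" "c \<in> L2 \<Omega>"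
      for a b and c :: "'n form" using that by (auto simp: l2_tendsto_def L2_diff)
    have F: "w \<in> L2_form \<Omega> l" "v \<in> L2_form \<Omega> (l + 1)" "h \<in> L2_form \<Omega> (l - 1)"
      using A by (auto simp: H01_limit_def)
    show ?thesis unfolding H01_limit_def e
      by (intro conjI allI test_form_diff[OF t t] L2_form_diff[OF F(1) test_form_L2_form[OF op t]]
          L2_form_diff[OF F(2) test_form_L2_form[OF op test_form_ext_deriv[OF t]]]
          L2_form_diff[OF F(3) test_form_L2_form[OF op test_form_coderiv[OF t l1]]]
          c[OF lims(1) test_L2[OF t]] c[OF lims(2) test_form_deriv_L2(1)[OF t]] c[OF lims(3) test_form_deriv_L2(2)[OF t]])
  qed
  have qlim: "l2_tendsto \<Omega> (\<lambda>k. ?q (\<phi> k)) (?q w)" unfolding l2_tendsto_def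
  proof (intro conjI allI qk qw(1))
    have b: "(l2_norm \<Omega> (\<lambda>x. ?q (\<phi> k) x - ?q w x))\<^sup>2
        \<le> H * ((l2_norm \<Omega> (\<lambda>x. ext_deriv (\<phi> k) x - v x))\<^sup>2 + (l2_norm \<Omega> (\<lambda>x. coderiv (\<phi> k) x - h x))\<^sup>2)" for k
      using hardy_forms(2)[OF H diffA[of k]]
      by (simp add: scaleR_diff_right l2_norm_minus_commute[of \<Omega> "?q w"] l2_norm_minus_commute[of \<Omega> v] l2_norm_minus_commute[of \<Omega> h])
    have "(\<lambda>k. H * ((l2_norm \<Omega> (\<lambda>x. ext_deriv (\<phi> k) x - v x))\<^sup>2 + (l2_norm \<Omega> (\<lambda>x. coderiv (\<phi> k) x - h x))\<^sup>2))
        \<longlonglongrightarrow> H * (0\<^sup>2 + 0\<^sup>2)"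
      by (rule tendsto_mult_left[OF tendsto_add[OF tendsto_power tendsto_power]])
         (use lims in \<open>auto simp: l2_tendsto_def\<close>)
    hence z: "(\<lambda>k. H * ((l2_norm \<Omega> (\<lambda>x. ext_deriv (\<phi> k) x - v x))\<^sup>2 + (l2_norm \<Omega> (\<lambda>x. coderiv (\<phi> k) x - h x))\<^sup>2)) \<longlonglongrightarrow> 0"
      by simp
    have "(\<lambda>k. (l2_norm \<Omega> (\<lambda>x. ?q (\<phi> k) x - ?q w x))\<^sup>2) \<longlonglongrightarrow> 0"
      by (rule Lim_null_comparison[OF always_eventually z]) (use b in simp)
    thus "(\<lambda>k. l2_norm \<Omega> (\<lambda>x. ?q (\<phi> k) x - ?q w x)) \<longlonglongrightarrow> 0" by simp
  qed
  have dk: "l2_inner \<Omega> u (coderiv (\<phi> k)) = l2_inner \<Omega> ?r (?q (\<phi> k))" for k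
  proof -
    have "l2_inner \<Omega> u (coderiv (\<phi> k)) = l2_inner \<Omega> g (\<phi> k)"
      using gd[OF t] d_dual_eq[OF test_form_H01_limit[OF t] uL] by simp
    also have "\<dots> = l2_inner \<Omega> ?r (?q (\<phi> k))"
      unfolding l2_inner_def
    proof (rule Bochner_Integration.integral_cong[OF refl])
      fix x assume "x \<in> space (lebesgue_on \<Omega>)"
      hence "0 < rho \<Omega> x" using rho_pos[OF op bd] by simp
      thus "g x \<bullet> \<phi> k x = ?r x \<bullet> ?q (\<phi> k) x" by simp
    qed
    finally show ?thesis .
  qed
  have "l2_inner \<Omega> u h = l2_inner \<Omega> ?r (?q w)"
  proof (rule LIMSEQ_unique)
    show "(\<lambda>k. l2_inner \<Omega> u (coderiv (\<phi> k))) \<longlonglongrightarrow> l2_inner \<Omega> u h"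
      by (rule l2_tendsto_inner[OF l2_tendsto_const[OF uL] lims(3)])
    show "(\<lambda>k. l2_inner \<Omega> u (coderiv (\<phi> k))) \<longlonglongrightarrow> l2_inner \<Omega> ?r (?q w)"
      unfolding dk by (rule l2_tendsto_inner[OF l2_tendsto_const[OF gL] qlim])
  qed
  moreover have "l2_inner \<Omega> u h = (l2_norm \<Omega> u)\<^sup>2"
    using l2_inner_cong_AE[OF uL L(2) uL coderiv_unique[OF w(2) H01_limit_is_deriv(2)[OF A]]]
    by (simp add: l2_norm_square l2_inner_commute)
  ultimately have 1: "(l2_norm \<Omega> u)\<^sup>2 \<le> l2_norm \<Omega> ?r * l2_norm \<Omega> (?q w)"
    using l2_cauchy_schwarz[OF gL qw(1)] by simp
  have 2: "(l2_norm \<Omega> (?q w))\<^sup>2 \<le> H * (C * (l2_norm \<Omega> u)\<^sup>2)"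
    using qw(2) mult_left_mono[OF w(3) H0] unfolding H01_limit_norm[OF A] by linarith
  show "(l2_norm \<Omega> u)\<^sup>2 \<le> H * C * (l2_norm \<Omega> ?r)\<^sup>2"
  proof (cases "l2_norm \<Omega> u = 0")
    case True thus ?thesis using H0 C0 by simp
  next
    case False
    hence p: "0 < (l2_norm \<Omega> u)\<^sup>2" by simp
    have "((l2_norm \<Omega> u)\<^sup>2)\<^sup>2 \<le> (l2_norm \<Omega> ?r * l2_norm \<Omega> (?q w))\<^sup>2" by (rule power_mono[OF 1]) simp
    also have "\<dots> = (l2_norm \<Omega> ?r)\<^sup>2 * (l2_norm \<Omega> (?q w))\<^sup>2" by (rule power_mult_distrib)
    also have "\<dots> \<le> (l2_norm \<Omega> ?r)\<^sup>2 * (H * (C * (l2_norm \<Omega> u)\<^sup>2))" by (rule mult_left_mono[OF 2]) simp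
    finally have "(l2_norm \<Omega> u)\<^sup>2 * (l2_norm \<Omega> u)\<^sup>2 \<le> (H * C * (l2_norm \<Omega> ?r)\<^sup>2) * (l2_norm \<Omega> u)\<^sup>2"
      by (simp add: power2_eq_square mult_ac)
    thus ?thesis using p by (rule mult_right_le_imp_le)
  qed
qed

end

section \<open>From the improved Poincare inequality to the Friedrichs-Velte inequality\<close>

subsection \<open>The distance to the boundary\<close>

text \<open>A segment from \<open>x\<close> to a point outside \<open>\<Omega>\<close> meets the boundary. The distance to the complement is
  convenient because it vanishes outside \<open>\<Omega>\<close> and has Lipschitz constant one on the whole space.\<close>
lemma rho_eq_infdist_compl:
  assumes "open \<Omega>" "bounded \<Omega>" "x \<in> \<Omega>"
  shows "rho \<Omega> x = infdist x (- \<Omega>)"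
proof -
  have "\<Omega> \<noteq> UNIV" using assms(2) not_bounded_UNIV by blast
  hence ne: "frontier \<Omega> \<noteq> {}" "- \<Omega> \<noteq> {}" using assms(3) frontier_not_empty[of \<Omega>] by blast+
  have "frontier \<Omega> \<subseteq> - \<Omega>" using assms(1) frontier_disjoint_eq[of \<Omega>] by blast
  hence "infdist x (- \<Omega>) \<le> rho \<Omega> x" unfolding rho_def by (rule infdist_mono[OF _ ne(1)])
  moreover have "rho \<Omega> x \<le> infdist x (- \<Omega>)"
    unfolding infdist_notempty[OF ne(2)]
  proof (rule cINF_greatest[OF ne(2)])
    fix y assume y: "y \<in> - \<Omega>"
    have "closed_segment x y \<inter> frontier \<Omega> \<noteq> {}"
      by (rule connected_Int_frontier) (use y assms(3) in auto)
    then obtain z where z: "z \<in> closed_segment x y" "z \<in> frontier \<Omega>" by blast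
    have "rho \<Omega> x \<le> dist x z" unfolding rho_def by (rule infdist_le[OF z(2)])
    also have "\<dots> \<le> dist x y" using dist_in_closed_segment[OF z(1)] by (simp add: dist_commute)
    finally show "rho \<Omega> x \<le> dist x y" .
  qed
  ultimately show ?thesis by simp
qed

lemma infdist_compl_pos_imp: "0 < infdist x (- \<Omega>) \<Longrightarrow> x \<in> \<Omega>"
  by (rule ccontr) simp

lemma infdist_compl_gt_imp: "e < infdist x (- \<Omega>) \<Longrightarrow> dist x y \<le> e \<Longrightarrow> y \<in> \<Omega>"
  using infdist_le[of y "- \<Omega>" x] by force

lemma compact_infdist_compl_ge:
  fixes \<Omega> :: "(real^'n) set"
  assumes "bounded \<Omega>" "0 < e"
  shows "compact {x. e \<le> infdist x (- \<Omega>)}" "{x. e \<le> infdist x (- \<Omega>)} \<subseteq> \<Omega>"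
proof -
  show sub: "{x. e \<le> infdist x (- \<Omega>)} \<subseteq> \<Omega>" 
  proof
    fix x assume "x \<in> {x. e \<le> infdist x (- \<Omega>)}"
    hence "0 < infdist x (- \<Omega>)" using assms(2) by simp
    thus "x \<in> \<Omega>" by (rule infdist_compl_pos_imp)
  qed
  have "closed {x. e \<le> infdist x (- \<Omega>)}" by (intro closed_Collect_le continuous_intros)
  thus "compact {x. e \<le> infdist x (- \<Omega>)}" using sub assms(1) bounded_subset compact_eq_bounded_closed by blast
qed

lemma smooth_csupp_lipschitz:
  fixes f :: "real^'n \<Rightarrow> 'b::euclidean_space"
  assumes f: "smooth f" and K: "compact K" "\<And>x. x \<notin> K \<Longrightarrow> f x = 0"
  obtains L where "\<And>x y. norm (f x - f y) \<le> L * norm (x - y)"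
proof -
  have "\<exists>B. \<forall>x. norm (partial_deriv i f x) \<le> B" for i
    using bounded_csupp[OF smoothD_cont[OF smooth_partial_deriv[OF f]] K(1)
        partial_deriv_zero_off_closed[OF compact_imp_closed[OF K(1)] K(2)]] by blast
  hence "\<forall>i. \<exists>B. \<forall>x. norm (partial_deriv i f x) \<le> B" by blast
  from choice[OF this] obtain B where B: "\<forall>i x. norm (partial_deriv i f x) \<le> B i" by blast
  have "norm (f x - f y) \<le> (\<Sum>i\<in>UNIV. B i) * norm (x - y)" for x y
  proof (rule differentiable_bound[of UNIV f "\<lambda>x h. \<Sum>i\<in>UNIV. h $ i *\<^sub>R partial_deriv i f x"])
    show "(f has_derivative (\<lambda>h. \<Sum>i\<in>UNIV. h $ i *\<^sub>R partial_deriv i f x)) (at x within UNIV)" for x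
      using has_derivative_partial_deriv[OF smoothD_diff[OF f]] by simp
    show "onorm (\<lambda>h. \<Sum>i\<in>UNIV. h $ i *\<^sub>R partial_deriv i f x) \<le> (\<Sum>i\<in>UNIV. B i)" for x
    proof (rule onorm_le)
      fix h :: "real^'n"
      have "norm (\<Sum>i\<in>UNIV. h $ i *\<^sub>R partial_deriv i f x) \<le> (\<Sum>i\<in>UNIV. norm (h $ i *\<^sub>R partial_deriv i f x))"
        by (rule norm_sum)
      also have "\<dots> \<le> (\<Sum>i\<in>UNIV. B i * norm h)"
      proof (rule sum_mono)
        fix i
        have "\<bar>h $ i\<bar> * norm (partial_deriv i f x) \<le> norm h * B i"
          by (rule mult_mono[OF component_le_norm_cart]) (use B in auto)
        thus "norm (h $ i *\<^sub>R partial_deriv i f x) \<le> B i * norm h" by (simp add: mult.commute)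
      qed
      finally show "norm (\<Sum>i\<in>UNIV. h $ i *\<^sub>R partial_deriv i f x) \<le> (\<Sum>i\<in>UNIV. B i) * norm h"
        by (simp add: sum_distrib_right)
    qed
  qed auto
  thus ?thesis using that by blast
qed

lemma ext_deriv_scaleR_fun:
  assumes f: "smooth f" and g: "smooth g"
  shows "ext_deriv (\<lambda>x. f x *\<^sub>R g x) x = f x *\<^sub>R ext_deriv g x + (\<Sum>i\<in>UNIV. partial_deriv i f x *\<^sub>R ext_mult i (g x))"
proof -
  have "partial_deriv i (\<lambda>x. f x *\<^sub>R g x) x = f x *\<^sub>R partial_deriv i g x + partial_deriv i f x *\<^sub>R g x" for i
    by (rule partial_deriv_bilinear[OF bounded_bilinear_scaleR smoothD_diff[OF f] smoothD_diff[OF g]])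
  thus ?thesis
    by (simp add: ext_deriv_eq linear_add[OF linear_ext_mult] linear_scale[OF linear_ext_mult] sum.distrib scaleR_sum_right)
qed

text \<open>Differentiating the kernel turns the value of \<open>d\<close> of a mollified form at a point into a pairing with
  a test form. Thus a weak equation holds pointwise for mollified forms.\<close>
lemma ext_deriv_mollify:
  fixes U :: "'n::{finite,linorder} form"
  assumes m: "mollifier \<epsilon> \<eta>" and U: "integrable lborel U"
  shows "ext_deriv (conv \<eta> U) x \<bullet> b = (LINT y|lborel. U y \<bullet> coderiv (\<lambda>y. \<eta> (x - y) *\<^sub>R b) y)"
    "coderiv (conv \<eta> U) x \<bullet> b = (LINT y|lborel. U y \<bullet> ext_deriv (\<lambda>y. \<eta> (x - y) *\<^sub>R b) y)"
proof -
  have s: "smooth \<eta>" by (rule mollifierD(1)[OF m])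
  have sr: "smooth (\<lambda>y. \<eta> (x - y))" by (rule smooth_reflect[OF s])
  note pz = partial_deriv_zero_off_closed[OF closed_cball mollifierD(6)[OF m]]
  have i: "integrable lborel (\<lambda>y. partial_deriv i \<eta> (x - y) *\<^sub>R U y)" for i
    by (rule integrable_conv[OF smoothD_cont[OF smooth_partial_deriv[OF s]] compact_cball pz U])
  have pc: "partial_deriv i (conv \<eta> U) x = (LINT y|lborel. partial_deriv i \<eta> (x - y) *\<^sub>R U y)" for i
    using fun_cong[OF partial_deriv_conv[where i=i, OF s compact_cball[of 0 \<epsilon>] mollifierD(6)[OF m] U], of x]
    unfolding conv_def .
  have pt: "partial_deriv i (\<lambda>y. \<eta> (x - y) *\<^sub>R b) y = - partial_deriv i \<eta> (x - y) *\<^sub>R b" for i y and b :: "real^('n set)"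
    by (simp add: partial_deriv_bounded_linear[OF bounded_linear_scaleR_left smoothD_diff[OF sr]]
        partial_deriv_reflect[OF smoothD_diff[OF s]])
  have pi: "partial_deriv i (conv \<eta> U) x \<bullet> c = (LINT y|lborel. (partial_deriv i \<eta> (x - y) *\<^sub>R U y) \<bullet> c)" for i c
    unfolding pc by (rule integral_inner_left[symmetric, OF i])
  have ii: "integrable lborel (\<lambda>y. (partial_deriv i \<eta> (x - y) *\<^sub>R U y) \<bullet> c)" for i c
    by (rule integrable_inner_left[OF i])
  have "ext_deriv (conv \<eta> U) x \<bullet> b = (\<Sum>i\<in>UNIV. LINT y|lborel. (partial_deriv i \<eta> (x - y) *\<^sub>R U y) \<bullet> int_mult i b)"
    by (simp only: ext_deriv_eq inner_sum_left ext_mult_inner pi)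
  also have "\<dots> = (LINT y|lborel. (\<Sum>i\<in>UNIV. (partial_deriv i \<eta> (x - y) *\<^sub>R U y) \<bullet> int_mult i b))"
    by (rule Bochner_Integration.integral_sum[symmetric]) (rule ii)
  also have "\<dots> = (LINT y|lborel. U y \<bullet> coderiv (\<lambda>y. \<eta> (x - y) *\<^sub>R b) y)"
    by (simp add: coderiv_eq pt linear_neg[OF linear_int_mult] linear_scale[OF linear_int_mult] sum_negf inner_sum_right)
  finally show "ext_deriv (conv \<eta> U) x \<bullet> b = (LINT y|lborel. U y \<bullet> coderiv (\<lambda>y. \<eta> (x - y) *\<^sub>R b) y)" .
  have im: "int_mult i a \<bullet> c = a \<bullet> ext_mult i c" for i and a c :: "real^('n set)"
    using ext_mult_inner[of i c a] by (simp add: inner_commute)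
  have "coderiv (conv \<eta> U) x \<bullet> b = - (\<Sum>i\<in>UNIV. LINT y|lborel. (partial_deriv i \<eta> (x - y) *\<^sub>R U y) \<bullet> ext_mult i b)"
    by (simp only: coderiv_eq inner_minus_left inner_sum_left im pi)
  also have "\<dots> = - (LINT y|lborel. (\<Sum>i\<in>UNIV. (partial_deriv i \<eta> (x - y) *\<^sub>R U y) \<bullet> ext_mult i b))"
    by (subst Bochner_Integration.integral_sum) (rule ii, rule refl)
  also have "\<dots> = (LINT y|lborel. - (\<Sum>i\<in>UNIV. (partial_deriv i \<eta> (x - y) *\<^sub>R U y) \<bullet> ext_mult i b))"
    by (rule Bochner_Integration.integral_minus[symmetric])
  also have "\<dots> = (LINT y|lborel. U y \<bullet> ext_deriv (\<lambda>y. \<eta> (x - y) *\<^sub>R b) y)"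
    by (simp add: ext_deriv_eq pt linear_neg[OF linear_ext_mult] linear_scale[OF linear_ext_mult] sum_negf inner_sum_right)
  finally show "coderiv (conv \<eta> U) x \<bullet> b = (LINT y|lborel. U y \<bullet> ext_deriv (\<lambda>y. \<eta> (x - y) *\<^sub>R b) y)" .
qed

text \<open>This is \<open>\<parallel>\<zeta> g\<parallel>\<^sup>2 = \<langle>d (\<zeta>\<^sup>2 g), W\<rangle> = \<langle>2 \<zeta> d\<zeta> \<and> g, W\<rangle>\<close>, where \<open>|d\<zeta> \<and> g| \<le> |g|\<close>; half of the
  left-hand side is absorbed.\<close>
lemma cutoff_estimate:
  fixes W g :: "'n::{finite,linorder} form"
  assumes \<zeta>: "smooth \<zeta>" and K: "compact K" "\<And>x. x \<notin> K \<Longrightarrow> \<zeta> x = 0"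
    and grad: "\<And>x. (\<Sum>i\<in>UNIV. (partial_deriv i \<zeta> x)\<^sup>2) \<le> 1"
    and g: "smooth g" "\<And>x. ext_deriv g x = 0" and W: "smooth W" "integrable lborel (\<lambda>x. (norm (W x))\<^sup>2)"
    and eq: "\<And>x. \<zeta> x \<noteq> 0 \<Longrightarrow> g x = coderiv W x"
  shows "(LINT x|lborel. (norm (\<zeta> x *\<^sub>R g x))\<^sup>2) \<le> 4 * (LINT x|lborel. (norm (W x))\<^sup>2)"
proof -
  define \<psi> where "\<psi> x = (\<zeta> x * \<zeta> x) *\<^sub>R g x" for x
  define \<theta> where "\<theta> x = (\<Sum>i\<in>UNIV. partial_deriv i \<zeta> x *\<^sub>R ext_mult i (g x))" for x
  have s2: "smooth (\<lambda>x. \<zeta> x * \<zeta> x)" by (rule smooth_mult[OF \<zeta> \<zeta>])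
  have s\<psi>: "smooth \<psi>" unfolding \<psi>_def by (rule smooth_scaleR_fun[OF s2 g(1)])
  have z\<psi>: "\<forall>x. x \<notin> K \<longrightarrow> \<psi> x = 0" using K(2) by (simp add: \<psi>_def)
  have p2: "partial_deriv i (\<lambda>x. \<zeta> x * \<zeta> x) x = 2 * \<zeta> x * partial_deriv i \<zeta> x" for i x
    using partial_deriv_bilinear[OF bounded_bilinear_mult smoothD_diff[OF \<zeta>] smoothD_diff[OF \<zeta>], of i x] by simp
  have d\<psi>: "ext_deriv \<psi> x = (2 * \<zeta> x) *\<^sub>R \<theta> x" for x
    unfolding \<psi>_def ext_deriv_scaleR_fun[OF s2 g(1)] by (simp add: g(2) p2 \<theta>_def scaleR_sum_right)
  have n\<theta>: "norm (\<theta> x) \<le> norm (g x)" for x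
  proof (rule power2_le_imp_le)
    have "(norm (\<theta> x))\<^sup>2 \<le> (\<Sum>i\<in>UNIV. (partial_deriv i \<zeta> x)\<^sup>2) * (norm (g x))\<^sup>2"
      unfolding \<theta>_def by (rule norm_wedge_le)
    also have "\<dots> \<le> 1 * (norm (g x))\<^sup>2" by (rule mult_right_mono[OF grad]) simp
    finally show "(norm (\<theta> x))\<^sup>2 \<le> (norm (g x))\<^sup>2" by simp
  qed simp
  have iX: "integrable lborel (\<lambda>x. (norm (\<zeta> x *\<^sub>R g x))\<^sup>2)"
    unfolding power2_norm_eq_inner
    by (rule integrable_csupp[OF smoothD_cont[OF smooth_inner[OF smooth_scaleR_fun[OF \<zeta> g(1)] smooth_scaleR_fun[OF \<zeta> g(1)]]] K(1)])
       (simp add: K(2))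
  have iY: "integrable lborel (\<lambda>x. ext_deriv \<psi> x \<bullet> W x)"
    by (rule integrable_csupp[OF smoothD_cont[OF smooth_inner[OF smooth_ext_deriv[OF s\<psi>] W(1)]] K(1)])
       (simp add: d\<psi> K(2))
  let ?X = "LINT x|lborel. (norm (\<zeta> x *\<^sub>R g x))\<^sup>2"
  have pw: "(norm (\<zeta> x *\<^sub>R g x))\<^sup>2 = \<psi> x \<bullet> coderiv W x" for x
    using eq[of x] unfolding \<psi>_def power2_norm_eq_inner by (cases "\<zeta> x = 0") (simp_all add: mult_ac)
  have "?X = (LINT x|lborel. \<psi> x \<bullet> coderiv W x)" unfolding pw ..
  also have "\<dots> = (LINT x|lborel. ext_deriv \<psi> x \<bullet> W x)"
    by (rule green_ext_coderiv[OF s\<psi> W(1) K(1) disjI1[OF z\<psi>], symmetric])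
  also have "\<dots> \<le> (LINT x|lborel. (norm (\<zeta> x *\<^sub>R g x))\<^sup>2 / 2 + 2 * (norm (W x))\<^sup>2)"
  proof (rule integral_mono[OF iY])
    show "integrable lborel (\<lambda>x. (norm (\<zeta> x *\<^sub>R g x))\<^sup>2 / 2 + 2 * (norm (W x))\<^sup>2)" using iX W(2) by simp
    fix x
    have "ext_deriv \<psi> x \<bullet> W x \<le> norm (ext_deriv \<psi> x) * norm (W x)" by (rule norm_cauchy_schwarz)
    also have "\<dots> = 2 * (\<bar>\<zeta> x\<bar> * norm (\<theta> x) * norm (W x))" by (simp add: d\<psi> abs_mult)
    also have "\<dots> \<le> 2 * (\<bar>\<zeta> x\<bar> * norm (g x) * norm (W x))"
      by (intro mult_left_mono mult_right_mono n\<theta>) auto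
    also have "\<dots> = 2 * norm (\<zeta> x *\<^sub>R g x) * norm (W x)" by simp
    also have "\<dots> \<le> (norm (\<zeta> x *\<^sub>R g x))\<^sup>2 / 2 + 2 * (norm (W x))\<^sup>2"
      using sum_squares_bound[of "norm (\<zeta> x *\<^sub>R g x)" "2 * norm (W x)"] by (simp add: power2_eq_square)
    finally show "ext_deriv \<psi> x \<bullet> W x \<le> (norm (\<zeta> x *\<^sub>R g x))\<^sup>2 / 2 + 2 * (norm (W x))\<^sup>2" .
  qed
  also have "\<dots> = ?X / 2 + 2 * (LINT x|lborel. (norm (W x))\<^sup>2)" using iX W(2) by simp
  finally show ?thesis by simp
qed

context form_domain begin

lemma compl_nonempty: "- \<Omega> \<noteq> {}"
proof
  assume "- \<Omega> = {}"
  hence "\<Omega> = UNIV" by auto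
  thus False using bd by (simp add: not_bounded_UNIV)
qed

text \<open>In degrees other than \<open>l\<close> both sides vanish pointwise.\<close>
lemma conjugate_test_fun:
  assumes u: "u \<in> L2_form \<Omega> (l - 1)" and v: "v \<in> L2_form \<Omega> (l + 1)"
    and conj: "\<And>\<phi>. \<phi> \<in> test_form \<Omega> l \<Longrightarrow> l2_inner \<Omega> u (coderiv \<phi>) = l2_inner \<Omega> v (ext_deriv \<phi>)"
    and p: "p \<in> test_fun \<Omega>"
  shows "l2_inner \<Omega> u (coderiv (\<lambda>x. p x *\<^sub>R axis I 1)) = l2_inner \<Omega> v (ext_deriv (\<lambda>x. p x *\<^sub>R axis I 1))"
proof (cases "card I = l")
  case True
  have "(\<lambda>x. p x *\<^sub>R axis I (1::real)) \<in> test_form \<Omega> l"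
    using test_fun_scaleR[OF p, of "axis I 1"] True by (auto simp: test_form_def Lam_def axis_def)
  thus ?thesis by (rule conj)
next
  case False
  have s: "smooth p" using p by (simp add: test_fun_iff)
  have pd: "partial_deriv j (\<lambda>x. p x *\<^sub>R axis I (1::real)) x = partial_deriv j p x *\<^sub>R axis I 1" for j x
    by (rule partial_deriv_bounded_linear[OF bounded_linear_scaleR_left smoothD_diff[OF s]])
  have a: "u x \<bullet> int_mult i (axis I 1) = 0" if "x \<in> \<Omega>" for x i
  proof -
    have "ext_mult i (u x) \<in> Lam (l - 1 + 1)" using u that by (intro ext_mult_Lam) (simp add: L2_form_def)
    hence "ext_mult i (u x) $ I = 0" using False l1 by (simp add: Lam_def)
    thus ?thesis by (simp add: ext_mult_inner[symmetric] inner_axis)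
  qed
  have b: "v x \<bullet> ext_mult i (axis I 1) = 0" if "x \<in> \<Omega>" for x i
  proof -
    have "int_mult i (v x) \<in> Lam l" using v that by (intro int_mult_Lam) (simp add: L2_form_def)
    hence "int_mult i (v x) $ I = 0" using False by (simp add: Lam_def)
    thus ?thesis using ext_mult_inner[of i "axis I 1" "v x"] by (simp add: inner_axis' inner_commute[of "v x"])
  qed
  have "l2_inner \<Omega> u (coderiv (\<lambda>x. p x *\<^sub>R axis I 1)) = (LINT x|lebesgue_on \<Omega>. 0)"
    unfolding l2_inner_def
    by (rule Bochner_Integration.integral_cong[OF refl])
       (simp add: coderiv_eq pd linear_scale[OF linear_int_mult] inner_sum_right a)
  moreover have "l2_inner \<Omega> v (ext_deriv (\<lambda>x. p x *\<^sub>R axis I 1)) = (LINT x|lebesgue_on \<Omega>. 0)"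
    unfolding l2_inner_def
    by (rule Bochner_Integration.integral_cong[OF refl])
       (simp add: ext_deriv_eq pd linear_scale[OF linear_ext_mult] inner_sum_right b)
  ultimately show ?thesis by simp
qed

lemma weighted_quotient_L2:
  assumes t: "\<phi> \<in> test_form \<Omega> l"
  shows "(\<lambda>x. (1 / rho \<Omega> x) *\<^sub>R \<phi> x) \<in> L2_form \<Omega> l"
proof -
  obtain K where K: "compact K" "K \<subseteq> \<Omega>" "\<And>x. x \<notin> K \<Longrightarrow> \<phi> x = 0" using test_form_support[OF t] by blast
  obtain d where d: "0 < d" "\<And>x y. x \<in> K \<Longrightarrow> dist x y \<le> d \<Longrightarrow> y \<in> \<Omega>"
    using compact_separation[OF K(1) op K(2)] by blast
  have mr: "rho \<Omega> \<in> borel_measurable borel" by (rule borel_measurable_continuous_onI[OF continuous_rho])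
  have m: "(\<lambda>x. (1 / rho \<Omega> x) *\<^sub>R \<phi> x) \<in> borel_measurable borel"
    using mr borel_measurable_continuous_onI[OF smoothD_cont[OF test_formD(2)[OF t]]] by measurable
  note ne = compl_nonempty
  have "(\<lambda>x. (1 / rho \<Omega> x) *\<^sub>R \<phi> x) \<in> L2 \<Omega>"
  proof (rule l2_norm_mono(1)[OF test_L2[OF t] borel_imp_lebesgue_on[OF m] op, of "1 / d"])
    fix x assume x: "x \<in> \<Omega>"
    show "norm ((1 / rho \<Omega> x) *\<^sub>R \<phi> x) \<le> 1 / d * norm (\<phi> x)"
    proof (cases "x \<in> K")
      case True
      have "d \<le> rho \<Omega> x"
        unfolding rho_eq_infdist_compl[OF op bd x] infdist_notempty[OF ne]
        by (rule cINF_greatest[OF ne]) (use d(2)[OF True] in force)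
      hence "\<bar>1 / rho \<Omega> x\<bar> \<le> 1 / d" using d(1) by (simp add: frac_le)
      thus ?thesis unfolding norm_scaleR by (rule mult_right_mono) simp
    qed (simp add: K(3))
  qed (use d in simp)
  thus ?thesis using test_formD(3)[OF t] subspace_scale[OF subspace_Lam] by (auto simp: L2_form_def)
qed

text \<open>The cutoff \<open>\<zeta>\<close> is a mollification of \<open>(\<rho> - 2 \<epsilon>)\<^sup>+\<close>. It vanishes where \<open>\<rho> \<le> \<epsilon>\<close>, so the equation
  \<open>d u = d\<^sup>* v\<close> holds for the mollified forms on its support, and it is at least \<open>\<rho> - 3 \<epsilon>\<close>.
  On the support of \<open>\<phi>\<close> it is therefore comparable with \<open>\<rho>\<close>, with a factor that
  tends to one with \<open>\<epsilon>\<close>.\<close>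
lemma weighted_bound_mollified:
  assumes u: "u \<in> L2_form \<Omega> (l - 1)" and v: "v \<in> L2_form \<Omega> (l + 1)"
    and conj: "\<And>\<phi>. \<phi> \<in> test_form \<Omega> l \<Longrightarrow> l2_inner \<Omega> u (coderiv \<phi>) = l2_inner \<Omega> v (ext_deriv \<phi>)"
    and t: "\<phi> \<in> test_form \<Omega> l" and K: "compact K" "\<And>x. x \<notin> K \<Longrightarrow> \<phi> x = 0" "K \<subseteq> \<Omega>"
    and \<kappa>: "\<And>x. x \<in> K \<Longrightarrow> \<kappa> \<le> rho \<Omega> x" and \<epsilon>: "0 < \<epsilon>" "3 * \<epsilon> < \<kappa>" and m: "mollifier \<epsilon> \<eta>"
    and U: "U \<in> borel_measurable borel" "AE x in lebesgue_on \<Omega>. U x = u x" "\<And>x. x \<notin> \<Omega> \<Longrightarrow> U x = 0"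
    "integrable lborel U" "integrable lborel (\<lambda>x. (norm (U x))\<^sup>2)" "U \<in> L2 \<Omega>"
  shows "\<bar>LINT x|lborel. conv \<eta> U x \<bullet> coderiv \<phi> x\<bar>
    \<le> (1 / (1 - 3 * \<epsilon> / \<kappa>)) * (2 * l2_norm \<Omega> v * l2_norm \<Omega> (\<lambda>x. (1 / rho \<Omega> x) *\<^sub>R \<phi> x))"
proof -
  obtain V where V: "V \<in> borel_measurable borel" "AE x in lebesgue_on \<Omega>. V x = v x" "\<And>x. x \<notin> \<Omega> \<Longrightarrow> V x = 0"
    "integrable lborel V" "integrable lborel (\<lambda>x. (norm (V x))\<^sup>2)" "V \<in> L2 \<Omega>"
    using L2_borel_representative[OF op bd L2_form_L2[OF v]] by blast
  note ne = compl_nonempty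
  define g where "g = ext_deriv (conv \<eta> U)"
  have sU: "smooth (conv \<eta> U)" and sV: "smooth (conv \<eta> V)" by (rule smooth_mollify[OF m U(4)], rule smooth_mollify[OF m V(4)])
  have sg: "smooth g" unfolding g_def by (rule smooth_ext_deriv[OF sU])
  have gV: "g x = coderiv (conv \<eta> V) x" if x: "\<epsilon> < infdist x (- \<Omega>)" for x
  proof (rule euclidean_eqI)
    fix b :: "(real, 'n set) vec" assume "b \<in> Basis"
    then obtain I where b: "b = axis I 1" by (auto simp: Basis_vec_def)
    define p where "p y = \<eta> (x - y)" for y
    have sp: "smooth p" unfolding p_def by (rule smooth_reflect[OF mollifierD(1)[OF m]])
    have "p y = 0" if "y \<notin> cball x \<epsilon>" for y
      unfolding p_def using that by (intro mollifierD(3)[OF m]) (simp add: dist_norm)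
    moreover have "cball x \<epsilon> \<subseteq> \<Omega>" using infdist_compl_gt_imp[OF x] by auto
    ultimately have p: "p \<in> test_fun \<Omega>" unfolding test_fun_iff using sp compact_cball by blast
    have sb: "smooth (\<lambda>y. p y *\<^sub>R axis I (1::real))" by (rule smooth_scaleR_fun[OF sp smooth_const])
    have tb: "(\<lambda>y. p y *\<^sub>R axis I (1::real)) \<in> test_fun \<Omega>" by (rule test_fun_scaleR[OF p])
    then obtain K' where K': "compact K'" "K' \<subseteq> \<Omega>" "\<And>y. y \<notin> K' \<Longrightarrow> p y *\<^sub>R axis I (1::real) = 0"
      unfolding test_fun_iff by blast
    have dL: "coderiv (\<lambda>y. p y *\<^sub>R axis I 1) \<in> L2 \<Omega>" "ext_deriv (\<lambda>y. p y *\<^sub>R axis I 1) \<in> L2 \<Omega>"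
      using L2_csupp[OF op smoothD_cont[OF smooth_coderiv[OF sb]] K'(1) coderiv_zero_off_closed[OF compact_imp_closed[OF K'(1)] K'(3)]]
        L2_csupp[OF op smoothD_cont[OF smooth_ext_deriv[OF sb]] K'(1) ext_deriv_zero_off_closed[OF compact_imp_closed[OF K'(1)] K'(3)]]
      by simp_all
    have "g x \<bullet> b = (LINT y|lborel. U y \<bullet> coderiv (\<lambda>y. p y *\<^sub>R axis I 1) y)"
      unfolding g_def b p_def by (rule ext_deriv_mollify(1)[OF m U(4)])
    also have "\<dots> = l2_inner \<Omega> U (coderiv (\<lambda>y. p y *\<^sub>R axis I 1))"
      by (rule l2_inner_whole_space[OF op U(1) borel_measurable_continuous_onI[OF smoothD_cont[OF smooth_coderiv[OF sb]]], symmetric])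
         (simp add: U(3))
    also have "\<dots> = l2_inner \<Omega> u (coderiv (\<lambda>y. p y *\<^sub>R axis I 1))"
      by (rule l2_inner_cong_AE[OF U(6) L2_form_L2[OF u] dL(1) l2_norm_AE[OF U(2)]])
    also have "\<dots> = l2_inner \<Omega> v (ext_deriv (\<lambda>y. p y *\<^sub>R axis I 1))"
      by (rule conjugate_test_fun[OF u v conj p])
    also have "\<dots> = l2_inner \<Omega> V (ext_deriv (\<lambda>y. p y *\<^sub>R axis I 1))"
      by (rule l2_inner_cong_AE[OF V(6) L2_form_L2[OF v] dL(2) l2_norm_AE[OF V(2)], symmetric])
    also have "\<dots> = (LINT y|lborel. V y \<bullet> ext_deriv (\<lambda>y. p y *\<^sub>R axis I 1) y)"
      by (rule l2_inner_whole_space[OF op V(1) borel_measurable_continuous_onI[OF smoothD_cont[OF smooth_ext_deriv[OF sb]]]])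
         (simp add: V(3))
    also have "\<dots> = coderiv (conv \<eta> V) x \<bullet> b"
      unfolding b p_def by (rule ext_deriv_mollify(2)[OF m V(4), symmetric])
    finally show "g x \<bullet> b = coderiv (conv \<eta> V) x \<bullet> b" .
  qed
  define r where "r x = max 0 (infdist x (- \<Omega>) - 2 * \<epsilon>)" for x
  have rc: "continuous_on UNIV r" unfolding r_def by (intro continuous_intros)
  have rl: "norm (r x - r y) \<le> 1 * norm (x - y)" for x y
    using infdist_triangle_abs[of x "- \<Omega>" y] unfolding r_def dist_norm by (auto simp: max_def)
  note cK = compact_infdist_compl_ge[OF bd \<epsilon>(1)]
  have rz: "r x = 0" if "x \<notin> {x. \<epsilon> \<le> infdist x (- \<Omega>)}" for x using that \<epsilon>(1) by (auto simp: r_def)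
  have ri: "integrable lborel r" by (rule integrable_csupp[OF rc cK(1) rz])
  define \<zeta> where "\<zeta> = conv \<eta> r"
  have s\<zeta>: "smooth \<zeta>" unfolding \<zeta>_def by (rule smooth_mollify[OF m ri])
  have z\<zeta>: "\<zeta> x = 0" if x: "infdist x (- \<Omega>) \<le> \<epsilon>" for x
    unfolding \<zeta>_def
  proof (rule mollify_zero[OF m])
    fix y assume "dist x y < \<epsilon>"
    hence "infdist y (- \<Omega>) \<le> 2 * \<epsilon>" using infdist_triangle[of y "- \<Omega>" x] x by (simp add: dist_commute)
    thus "r y = 0" by (simp add: r_def)
  qed
  have z\<zeta>': "\<zeta> x = 0" if "x \<notin> {x. \<epsilon> \<le> infdist x (- \<Omega>)}" for x using that z\<zeta> by simp
  have l\<zeta>: "\<bar>\<zeta> x - \<zeta> y\<bar> \<le> 1 * norm (x - y)" for x y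
    using mollify_lipschitz(2)[OF m ri rl, of x y] by (simp add: \<zeta>_def)
  have c\<zeta>: "infdist x (- \<Omega>) - 3 * \<epsilon> \<le> \<zeta> x" for x
  proof -
    have "\<bar>\<zeta> x - r x\<bar> \<le> \<epsilon>" using mollify_lipschitz(1)[OF m ri rl, of x] by (simp add: \<zeta>_def)
    moreover have "infdist x (- \<Omega>) - 2 * \<epsilon> \<le> r x" by (simp add: r_def)
    ultimately show ?thesis by linarith
  qed
  have X: "(LINT x|lborel. (norm (\<zeta> x *\<^sub>R g x))\<^sup>2) \<le> 4 * (l2_norm \<Omega> v)\<^sup>2"
  proof -
    have "(LINT x|lborel. (norm (\<zeta> x *\<^sub>R g x))\<^sup>2) \<le> 4 * (LINT x|lborel. (norm (conv \<eta> V x))\<^sup>2)"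
    proof (rule cutoff_estimate[OF s\<zeta> cK(1) z\<zeta>' _ sg _ sV mollify_young(1)[OF m V(4,5)]])
      show "(\<Sum>i\<in>UNIV. (partial_deriv i \<zeta> x)\<^sup>2) \<le> 1" for x
        using gradient_bound_lipschitz[OF s\<zeta> l\<zeta>, of x] by simp
      show "ext_deriv g x = 0" for x unfolding g_def by (rule ext_deriv_ext_deriv[OF sU])
      show "g x = coderiv (conv \<eta> V) x" if "\<zeta> x \<noteq> 0" for x
        using that z\<zeta> by (intro gV) force
    qed
    also have "\<dots> \<le> 4 * (LINT x|lborel. (norm (V x))\<^sup>2)" using mollify_young(2)[OF m V(4,5)] by simp
    also have "(LINT x|lborel. (norm (V x))\<^sup>2) = (l2_norm \<Omega> V)\<^sup>2"
      unfolding l2_norm_square power2_norm_eq_inner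
      by (rule l2_inner_whole_space[OF op V(1) V(1), symmetric]) (simp add: V(3))
    also have "l2_norm \<Omega> V = l2_norm \<Omega> v" by (rule l2_norm_eq[OF V(6) L2_form_L2[OF v] l2_norm_AE[OF V(2)]])
    finally show ?thesis .
  qed
  have s\<zeta>g: "smooth (\<lambda>x. \<zeta> x *\<^sub>R g x)" by (rule smooth_scaleR_fun[OF s\<zeta> sg])
  have \<zeta>gL: "(\<lambda>x. \<zeta> x *\<^sub>R g x) \<in> L2 \<Omega>" by (rule L2_csupp[OF op smoothD_cont[OF s\<zeta>g] cK(1)]) (simp add: z\<zeta>')
  have "(l2_norm \<Omega> (\<lambda>x. \<zeta> x *\<^sub>R g x))\<^sup>2 = (LINT x|lborel. (norm (\<zeta> x *\<^sub>R g x))\<^sup>2)"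
    unfolding l2_norm_square power2_norm_eq_inner
    by (rule l2_inner_smooth[OF op s\<zeta>g s\<zeta>g]) (use cK(2) z\<zeta>' in auto)
  hence "(l2_norm \<Omega> (\<lambda>x. \<zeta> x *\<^sub>R g x))\<^sup>2 \<le> (2 * l2_norm \<Omega> v)\<^sup>2" using X by (simp add: power_mult_distrib)
  hence n\<zeta>g: "l2_norm \<Omega> (\<lambda>x. \<zeta> x *\<^sub>R g x) \<le> 2 * l2_norm \<Omega> v" by (rule power2_le_imp_le) simp
  let ?q = "\<lambda>x. (1 / rho \<Omega> x) *\<^sub>R \<phi> x"
  have qL: "?q \<in> L2 \<Omega>" by (rule L2_form_L2[OF weighted_quotient_L2[OF t]])
  define \<theta> where "\<theta> = 1 - 3 * \<epsilon> / \<kappa>"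
  have \<theta>: "0 < \<theta>" using \<epsilon> by (simp add: \<theta>_def)
  have nL: "(\<lambda>x. norm (\<zeta> x *\<^sub>R g x)) \<in> L2 \<Omega>" "(\<lambda>x. norm (?q x)) \<in> L2 \<Omega>"
    using \<zeta>gL qL by (auto simp: L2_def simp del: norm_scaleR)
  have nn: "l2_norm \<Omega> (\<lambda>x. norm (f x)) = l2_norm \<Omega> f" for f :: "'n form"
    by (simp add: l2_norm_def l2_inner_def flip: power2_norm_eq_inner) (simp add: power2_eq_square)
  have pw: "\<bar>g x \<bullet> \<phi> x\<bar> \<le> (1 / \<theta>) * (norm (\<zeta> x *\<^sub>R g x) * norm (?q x))" if x: "x \<in> \<Omega>" for x
  proof (cases "x \<in> K")
    case True
    have r: "rho \<Omega> x = infdist x (- \<Omega>)" by (rule rho_eq_infdist_compl[OF op bd x])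
    have \<kappa>0: "0 < \<kappa>" using \<epsilon> by linarith
    have r0: "0 < rho \<Omega> x" by (rule rho_pos[OF op bd x])
    have "3 * \<epsilon> * \<kappa> \<le> 3 * \<epsilon> * rho \<Omega> x" using \<kappa>[OF True] \<epsilon>(1) by (intro mult_left_mono) auto
    hence "3 * \<epsilon> \<le> 3 * \<epsilon> / \<kappa> * rho \<Omega> x" using \<kappa>0 by (simp add: field_simps)
    hence "\<theta> * rho \<Omega> x \<le> rho \<Omega> x - 3 * \<epsilon>" by (simp add: \<theta>_def algebra_simps)
    hence c: "\<theta> * rho \<Omega> x \<le> \<bar>\<zeta> x\<bar>" using c\<zeta>[of x] r by linarith
    have "\<bar>g x \<bullet> \<phi> x\<bar> \<le> norm (g x) * norm (\<phi> x)" by (rule Cauchy_Schwarz_ineq2)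
    also have "\<dots> \<le> (\<bar>\<zeta> x\<bar> / (\<theta> * rho \<Omega> x)) * (norm (g x) * norm (\<phi> x))"
    proof -
      have "1 \<le> \<bar>\<zeta> x\<bar> / (\<theta> * rho \<Omega> x)" using c \<theta> r0 by simp
      from mult_right_mono[OF this, of "norm (g x) * norm (\<phi> x)"] show ?thesis by simp
    qed
    also have "\<dots> = (1 / \<theta>) * (norm (\<zeta> x *\<^sub>R g x) * norm (?q x))" using r0 by simp
    finally show ?thesis .
  qed (simp add: K(2))
  have off: "\<phi> x = 0" if "x \<notin> \<Omega>" for x using K that by blast
  have "(LINT x|lborel. conv \<eta> U x \<bullet> coderiv \<phi> x) = (LINT x|lborel. g x \<bullet> \<phi> x)"
    unfolding g_def using green_ext_coderiv[OF sU test_formD(2)[OF t] K(1)] K(2) by simp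
  also have "\<dots> = l2_inner \<Omega> g \<phi>"
    by (rule l2_inner_smooth[OF op sg test_formD(2)[OF t], symmetric]) (simp add: off)
  finally have "\<bar>LINT x|lborel. conv \<eta> U x \<bullet> coderiv \<phi> x\<bar> = \<bar>LINT x|lebesgue_on \<Omega>. g x \<bullet> \<phi> x\<bar>" by (simp add: l2_inner_def)
  also have "\<dots> \<le> (LINT x|lebesgue_on \<Omega>. (1 / \<theta>) * (norm (\<zeta> x *\<^sub>R g x) * norm (?q x)))"
  proof (rule integral_abs_bound_integral)
    have gi: "g \<in> borel_measurable borel" by (rule borel_measurable_continuous_onI[OF smoothD_cont[OF sg]])
    have "continuous_on UNIV (\<lambda>x. g x \<bullet> \<phi> x)" by (intro continuous_on_inner smoothD_cont sg test_formD(2)[OF t])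
    hence mm: "(\<lambda>x. g x \<bullet> \<phi> x) \<in> borel_measurable borel" by (rule borel_measurable_continuous_onI)
    have "integrable lborel (\<lambda>x. g x \<bullet> \<phi> x)"
      by (rule integrable_csupp[OF smoothD_cont[OF smooth_inner[OF sg test_formD(2)[OF t]]] K(1)]) (simp add: K(2))
    thus "integrable (lebesgue_on \<Omega>) (\<lambda>x. g x \<bullet> \<phi> x)"
      using integrable_whole_space[OF op mm] off by simp
    show "integrable (lebesgue_on \<Omega>) (\<lambda>x. (1 / \<theta>) * (norm (\<zeta> x *\<^sub>R g x) * norm (?q x)))"
      using L2_inner_integrable[OF nL] by (intro integrable_mult_right) (simp only: inner_real_def)
    show "\<bar>g x \<bullet> \<phi> x\<bar> \<le> (1 / \<theta>) * (norm (\<zeta> x *\<^sub>R g x) * norm (?q x))" if "x \<in> space (lebesgue_on \<Omega>)" for x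
      using pw[of x] that by simp
  qed
  also have "\<dots> = (1 / \<theta>) * l2_inner \<Omega> (\<lambda>x. norm (\<zeta> x *\<^sub>R g x)) (\<lambda>x. norm (?q x))"
    unfolding l2_inner_def inner_real_def by (rule integral_mult_right_zero)
  also have "\<dots> \<le> (1 / \<theta>) * (2 * l2_norm \<Omega> v * l2_norm \<Omega> ?q)"
  proof (rule mult_left_mono)
    have "l2_inner \<Omega> (\<lambda>x. norm (\<zeta> x *\<^sub>R g x)) (\<lambda>x. norm (?q x)) \<le> l2_norm \<Omega> (\<lambda>x. \<zeta> x *\<^sub>R g x) * l2_norm \<Omega> ?q"
      using l2_cauchy_schwarz[OF nL] unfolding nn by linarith
    also have "\<dots> \<le> 2 * l2_norm \<Omega> v * l2_norm \<Omega> ?q" by (rule mult_right_mono[OF n\<zeta>g]) simp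
    finally show "l2_inner \<Omega> (\<lambda>x. norm (\<zeta> x *\<^sub>R g x)) (\<lambda>x. norm (?q x)) \<le> 2 * l2_norm \<Omega> v * l2_norm \<Omega> ?q" .
  qed (use \<theta> in simp)
  finally show ?thesis by (simp add: \<theta>_def)
qed

lemma weighted_bound:
  assumes u: "u \<in> L2_form \<Omega> (l - 1)" and v: "v \<in> L2_form \<Omega> (l + 1)"
    and conj: "\<And>\<phi>. \<phi> \<in> test_form \<Omega> l \<Longrightarrow> l2_inner \<Omega> u (coderiv \<phi>) = l2_inner \<Omega> v (ext_deriv \<phi>)"
    and t: "\<phi> \<in> test_form \<Omega> l"
  shows "\<bar>l2_inner \<Omega> u (coderiv \<phi>)\<bar> \<le> 2 * l2_norm \<Omega> v * l2_norm \<Omega> (\<lambda>x. (1 / rho \<Omega> x) *\<^sub>R \<phi> x)"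
proof -
  obtain K where K: "compact K" "K \<subseteq> \<Omega>" "\<And>x. x \<notin> K \<Longrightarrow> \<phi> x = 0" using test_form_support[OF t] by blast
  obtain \<kappa> where \<kappa>: "0 < \<kappa>" "\<And>x y. x \<in> K \<Longrightarrow> dist x y \<le> \<kappa> \<Longrightarrow> y \<in> \<Omega>"
    using compact_separation[OF K(1) op K(2)] by blast
  note ne = compl_nonempty
  have \<kappa>r: "\<kappa> \<le> rho \<Omega> x" if x: "x \<in> K" for x
    unfolding rho_eq_infdist_compl[OF op bd subsetD[OF K(2) x]] infdist_notempty[OF ne]
    by (rule cINF_greatest[OF ne]) (use \<kappa>(2)[OF x] in force)
  obtain U where U: "U \<in> borel_measurable borel" "AE x in lebesgue_on \<Omega>. U x = u x" "\<And>x. x \<notin> \<Omega> \<Longrightarrow> U x = 0"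
    "integrable lborel U" "integrable lborel (\<lambda>x. (norm (U x))\<^sup>2)" "U \<in> L2 \<Omega>"
    using L2_borel_representative[OF op bd L2_form_L2[OF u]] by blast
  \<comment> \<open>The factor 1/4 ensures \<open>3 \<epsilon> < \<kappa>\<close> from the first index on.\<close>
  let ?e = "\<lambda>k. \<kappa> / 4 * (1 / real (Suc k))"
  have e: "0 < ?e k" "3 * ?e k < \<kappa>" for k
  proof -
    show "0 < ?e k" using \<kappa>(1) by simp
    have "1 / real (Suc k) \<le> 1" by simp
    hence "\<kappa> / 4 * (1 / real (Suc k)) \<le> \<kappa> / 4 * 1" using \<kappa>(1) by (intro mult_left_mono) auto
    thus "3 * ?e k < \<kappa>" using \<kappa>(1) by linarith
  qed
  have "\<forall>k. \<exists>\<eta> :: (real, 'n) vec \<Rightarrow> real. mollifier (?e k) \<eta>" using ex_mollifier[OF e(1)] by blast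
  from choice[OF this] obtain \<eta> :: "nat \<Rightarrow> (real, 'n) vec \<Rightarrow> real" where m: "\<forall>k. mollifier (?e k) (\<eta> k)" ..
  have e0: "?e \<longlonglongrightarrow> 0"
  proof -
    have "?e \<longlonglongrightarrow> \<kappa> / 4 * 0" by (rule tendsto_mult_left[OF LIMSEQ_Suc[OF lim_1_over_n]])
    thus ?thesis by simp
  qed
  have sc: "smooth (coderiv \<phi>)" by (rule smooth_coderiv[OF test_formD(2)[OF t]])
  note cz = coderiv_zero_off_closed[OF compact_imp_closed[OF K(1)] K(3)]
  obtain L where L: "\<And>x y. norm (coderiv \<phi> x - coderiv \<phi> y) \<le> L * norm (x - y)"
    using smooth_csupp_lipschitz[OF sc K(1) cz] by blast
  obtain B where B: "\<And>x. norm (coderiv \<phi> x) \<le> B" using bounded_csupp[OF smoothD_cont[OF sc] K(1) cz] by blast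
  have bc: "bounded (range (coderiv \<phi>))" using B by (auto simp: bounded_iff)
  have ci: "integrable lborel (coderiv \<phi>)" by (rule integrable_csupp[OF smoothD_cont[OF sc] K(1) cz])
  have lim: "(\<lambda>k. LINT x|lborel. conv (\<eta> k) U x \<bullet> coderiv \<phi> x) \<longlonglongrightarrow> (LINT x|lborel. U x \<bullet> coderiv \<phi> x)"
    by (rule mollify_weak_limit[OF m[rule_format] e0 U(4) ci bc L])
  have "(LINT x|lborel. U x \<bullet> coderiv \<phi> x) = l2_inner \<Omega> U (coderiv \<phi>)"
    by (rule l2_inner_whole_space[OF op U(1) borel_measurable_continuous_onI[OF smoothD_cont[OF sc]], symmetric]) (simp add: U(3))
  also have "\<dots> = l2_inner \<Omega> u (coderiv \<phi>)"
    by (rule l2_inner_cong_AE[OF U(6) L2_form_L2[OF u] test_form_deriv_L2(2)[OF t] l2_norm_AE[OF U(2)]])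
  finally have lim': "(\<lambda>k. \<bar>LINT x|lborel. conv (\<eta> k) U x \<bullet> coderiv \<phi> x\<bar>) \<longlonglongrightarrow> \<bar>l2_inner \<Omega> u (coderiv \<phi>)\<bar>"
    using tendsto_rabs[OF lim] by simp
  let ?C = "2 * l2_norm \<Omega> v * l2_norm \<Omega> (\<lambda>x. (1 / rho \<Omega> x) *\<^sub>R \<phi> x)"
  have "(\<lambda>k. (1 / (1 - 3 * ?e k / \<kappa>)) * ?C) \<longlonglongrightarrow> (1 / (1 - 3 * 0 / \<kappa>)) * ?C"
    by (rule tendsto_mult_right, rule tendsto_divide[OF tendsto_const tendsto_diff[OF tendsto_const
          tendsto_divide[OF tendsto_mult_left[OF e0] tendsto_const]]]) (use \<kappa>(1) in auto)
  hence limC: "(\<lambda>k. (1 / (1 - 3 * ?e k / \<kappa>)) * ?C) \<longlonglongrightarrow> ?C" by simp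
  show ?thesis
  proof (rule LIMSEQ_le[OF lim' limC], intro exI[of _ 0] allI impI)
    fix k
    show "\<bar>LINT x|lborel. conv (\<eta> k) U x \<bullet> coderiv \<phi> x\<bar> \<le> (1 / (1 - 3 * ?e k / \<kappa>)) * ?C"
      by (rule weighted_bound_mollified[OF u v conj t K(1,3,2) \<kappa>r e m[rule_format] U])
  qed
qed

text \<open>The functional \<open>\<phi> \<mapsto> \<langle>u, d\<^sup>* \<phi>\<rangle>\<close> is bounded in the inner product \<open>\<langle>\<phi> / \<rho>, \<psi> / \<rho>\<rangle>\<close>. If \<open>f\<close>
  is the \<open>L\<^sub>2\<close> limit of the representing \<open>\<phi> k / \<rho>\<close>, then \<open>g = f / \<rho>\<close> represents \<open>d u\<close>.\<close>
lemma ex_weighted_d_repr: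
  assumes u: "u \<in> L2_form \<Omega> (l - 1)" and v: "v \<in> L2_form \<Omega> (l + 1)" and conj: "conjugate_forms \<Omega> l u v"
  obtains g where "weighted_d_repr \<Omega> l u g" "l2_norm \<Omega> (\<lambda>x. rho \<Omega> x *\<^sub>R g x) \<le> 2 * l2_norm \<Omega> v"
proof -
  have uL: "u \<in> L2 \<Omega>" and vL: "v \<in> L2 \<Omega>" using u v L2_form_L2 by blast+
  have conj': "l2_inner \<Omega> u (coderiv \<phi>) = l2_inner \<Omega> v (ext_deriv \<phi>)" if t: "\<phi> \<in> test_form \<Omega> l" for \<phi>
    using conj d_dual_eq[OF test_form_H01_limit[OF t] uL] dstar_dual_eq[OF test_form_H01_limit[OF t] vL]
    by (simp add: conjugate_forms_def)
  have bound: "\<bar>l2_inner \<Omega> u (coderiv \<phi>)\<bar> \<le> 2 * l2_norm \<Omega> v * l2_norm \<Omega> (\<lambda>x. (1 / rho \<Omega> x) *\<^sub>R \<phi> x)"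
    if "\<phi> \<in> test_form \<Omega> l" for \<phi> by (rule weighted_bound[OF u v conj' that])
  let ?q = "\<lambda>f x. (1 / rho \<Omega> x) *\<^sub>R f x :: (real, 'n set) vec"
  note qF = weighted_quotient_L2
  have qL: "?q \<phi> \<in> L2 \<Omega>" if "\<phi> \<in> test_form \<Omega> l" for \<phi> by (rule L2_form_L2[OF qF[OF that]])
  have qlc: "?q (lcf a x b y) = lcf a (?q x) b (?q y)" for a b and x y :: "'n form"
    by (auto simp: algebra_simps)
  define B where "B \<phi> \<psi> = l2_inner \<Omega> (?q \<phi>) (?q \<psi>)" for \<phi> \<psi>
  let ?F = "\<lambda>\<psi>. l2_inner \<Omega> u (coderiv \<psi>)"
  have "semi_inner_space (test_form \<Omega> l) lcf B"
  proof
    show "test_form \<Omega> l \<noteq> {}" using test_form_zero by blast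
    show "lcf a x b y \<in> test_form \<Omega> l" if "x \<in> test_form \<Omega> l" "y \<in> test_form \<Omega> l" for x y :: "'n form" and a b
      by (rule test_form_lc[OF that])
    show "B z (lcf a x b y) = a * B z x + b * B z y"
      if "x \<in> test_form \<Omega> l" "y \<in> test_form \<Omega> l" "z \<in> test_form \<Omega> l" for x y z a b
      unfolding B_def qlc by (rule l2_inner_lc[OF qL[OF that(1)] qL[OF that(2)] qL[OF that(3)]])
    show "B x y = B y x" for x y unfolding B_def by (rule l2_inner_commute)
    show "0 \<le> B x x" for x unfolding B_def by (rule l2_inner_self_nonneg)
  qed
  then interpret semi_inner_space "test_form \<Omega> l" lcf B .
  obtain \<phi> where t: "\<And>k. \<phi> k \<in> test_form \<Omega> l"
    and C: "\<And>e. 0 < e \<Longrightarrow> \<exists>N. \<forall>j\<ge>N. \<forall>k\<ge>N. B (lcf 1 (\<phi> j) (-1) (\<phi> k)) (lcf 1 (\<phi> j) (-1) (\<phi> k)) < e"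
    and lim: "\<And>\<psi>. \<psi> \<in> test_form \<Omega> l \<Longrightarrow> (\<lambda>k. B (\<phi> k) \<psi>) \<longlonglongrightarrow> ?F \<psi>"
  proof (rule riesz_sequence[of ?F "(2 * l2_norm \<Omega> v)\<^sup>2"])
    fix a b and x y :: "'n form" assume x: "x \<in> test_form \<Omega> l" and y: "y \<in> test_form \<Omega> l"
    have "coderiv (lcf a x b y) = lcf a (coderiv x) b (coderiv y)"
      by (rule ext, rule coderiv_lc[OF test_formD(2)[OF x] test_formD(2)[OF y]])
    thus "?F (lcf a x b y) = a * ?F x + b * ?F y"
      using l2_inner_lc[OF test_form_deriv_L2(2)[OF x] test_form_deriv_L2(2)[OF y] uL] by simp
  next
    fix x assume x: "x \<in> test_form \<Omega> l"
    have "\<bar>?F x\<bar>\<^sup>2 \<le> (2 * l2_norm \<Omega> v * l2_norm \<Omega> (?q x))\<^sup>2" by (rule power_mono[OF bound[OF x]]) simp_all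
    thus "(?F x)\<^sup>2 \<le> (2 * l2_norm \<Omega> v)\<^sup>2 * B x x" by (simp add: B_def power_mult_distrib l2_norm_square)
  qed blast
  have "l2_Cauchy \<Omega> (\<lambda>k. ?q (\<phi> k))" unfolding l2_Cauchy_def
  proof (intro conjI allI impI qL t)
    fix e :: real assume e: "0 < e"
    obtain N where N: "\<forall>j\<ge>N. \<forall>k\<ge>N. B (lcf 1 (\<phi> j) (-1) (\<phi> k)) (lcf 1 (\<phi> j) (-1) (\<phi> k)) < e\<^sup>2"
      using C[of "e\<^sup>2"] e by auto
    show "\<exists>N. \<forall>j\<ge>N. \<forall>k\<ge>N. l2_norm \<Omega> (\<lambda>x. ?q (\<phi> j) x - ?q (\<phi> k) x) < e"
    proof (intro exI[of _ N] allI impI)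
      fix j k assume "N \<le> j" "N \<le> k"
      hence "B (lcf 1 (\<phi> j) (-1) (\<phi> k)) (lcf 1 (\<phi> j) (-1) (\<phi> k)) < e\<^sup>2" using N by blast
      hence "(l2_norm \<Omega> (\<lambda>x. ?q (\<phi> j) x - ?q (\<phi> k) x))\<^sup>2 < e\<^sup>2"
        unfolding B_def qlc l2_norm_square by simp
      thus "l2_norm \<Omega> (\<lambda>x. ?q (\<phi> j) x - ?q (\<phi> k) x) < e" by (rule power2_less_imp_less) (use e in simp)
    qed
  qed
  then obtain f where f: "f \<in> L2_form \<Omega> l" "l2_tendsto \<Omega> (\<lambda>k. ?q (\<phi> k)) f"
    using L2_form_complete[where f="\<lambda>k. ?q (\<phi> k)", OF op bd qF[OF t]] by blast
  have fL: "f \<in> L2 \<Omega>" by (rule L2_form_L2[OF f(1)])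
  have fF: "l2_inner \<Omega> f (?q \<psi>) = ?F \<psi>" if p: "\<psi> \<in> test_form \<Omega> l" for \<psi>
    by (rule LIMSEQ_unique[OF l2_tendsto_inner_const[OF f(2) qL[OF p]] lim[OF p, unfolded B_def]])
  have fn: "l2_norm \<Omega> f \<le> 2 * l2_norm \<Omega> v"
  proof -
    have 1: "(\<lambda>k. l2_inner \<Omega> f (?q (\<phi> k))) \<longlonglongrightarrow> l2_inner \<Omega> f f"
      by (rule l2_tendsto_inner[OF l2_tendsto_const[OF fL] f(2)])
    have 2: "(\<lambda>k. 2 * l2_norm \<Omega> v * l2_norm \<Omega> (?q (\<phi> k))) \<longlonglongrightarrow> 2 * l2_norm \<Omega> v * l2_norm \<Omega> f"
      by (rule tendsto_mult_left[OF l2_tendsto_norm[OF f(2)]])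
    have "l2_inner \<Omega> f (?q (\<phi> k)) \<le> 2 * l2_norm \<Omega> v * l2_norm \<Omega> (?q (\<phi> k))" for k
      unfolding fF[OF t] using bound[OF t[of k]] by linarith
    hence "l2_inner \<Omega> f f \<le> 2 * l2_norm \<Omega> v * l2_norm \<Omega> f" using LIMSEQ_le[OF 1 2] by blast
    hence le: "l2_norm \<Omega> f * l2_norm \<Omega> f \<le> 2 * l2_norm \<Omega> v * l2_norm \<Omega> f"
      unfolding l2_norm_square[symmetric] by (simp add: power2_eq_square)
    show ?thesis
    proof (cases "l2_norm \<Omega> f = 0")
      case False
      hence "0 < l2_norm \<Omega> f" using l2_norm_nonneg[of \<Omega> f] by linarith
      with le show ?thesis by simp
    qed simp
  qed
  have on: "rho \<Omega> x *\<^sub>R ?q f x = f x" if "x \<in> \<Omega>" for x using rho_pos[OF op bd that] by simp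
  have mr: "rho \<Omega> \<in> borel_measurable (lebesgue_on \<Omega>)"
    by (rule borel_imp_lebesgue_on[OF borel_measurable_continuous_onI[OF continuous_rho]])
  have mq: "(\<lambda>x. rho \<Omega> x *\<^sub>R ?q f x) \<in> borel_measurable (lebesgue_on \<Omega>)"
    using mr L2_measurable[OF fL] by measurable
  have r: "(\<lambda>x. rho \<Omega> x *\<^sub>R ?q f x) \<in> L2 \<Omega>" "l2_norm \<Omega> (\<lambda>x. rho \<Omega> x *\<^sub>R ?q f x) \<le> 1 * l2_norm \<Omega> f"
    using l2_norm_mono[OF fL mq op, of 1] by (simp_all add: on)
  have "(\<lambda>x. rho \<Omega> x *\<^sub>R ?q f x) \<in> L2_form \<Omega> l" using r(1) f(1) on by (simp add: L2_form_def)
  moreover have "d_dual \<Omega> l u \<psi> = l2_inner \<Omega> (?q f) \<psi>" if p: "\<psi> \<in> test_form \<Omega> l" for \<psi>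
  proof -
    have "l2_inner \<Omega> (?q f) \<psi> = l2_inner \<Omega> f (?q \<psi>)" by (simp add: l2_inner_def)
    thus ?thesis using d_dual_eq[OF test_form_H01_limit[OF p] uL] fF[OF p] by simp
  qed
  ultimately have "weighted_d_repr \<Omega> l u (?q f)" unfolding weighted_d_repr_def by blast
  moreover have "l2_norm \<Omega> (\<lambda>x. rho \<Omega> x *\<^sub>R ?q f x) \<le> 2 * l2_norm \<Omega> v" using r(2) fn by linarith
  ultimately show ?thesis by (rule that)
qed

lemma improved_poincare_imp_friedrichs_velte:
  assumes IP: "improved_poincare \<Omega> l P" and P: "0 < P"
  shows "friedrichs_velte \<Omega> l (4 * P)"
  unfolding friedrichs_velte_def
proof (intro conjI ballI impI)
  show "0 < 4 * P" using P by simp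
  fix u v assume u: "u \<in> M_space \<Omega> l" and v: "v \<in> L2_form \<Omega> (l + 1)" and conj: "conjugate_forms \<Omega> l u v"
  obtain g where g: "weighted_d_repr \<Omega> l u g" "l2_norm \<Omega> (\<lambda>x. rho \<Omega> x *\<^sub>R g x) \<le> 2 * l2_norm \<Omega> v"
    using ex_weighted_d_repr[OF M_space_L2_form[OF u] v conj] by blast
  have "(l2_norm \<Omega> u)\<^sup>2 \<le> P * (l2_norm \<Omega> (\<lambda>x. rho \<Omega> x *\<^sub>R g x))\<^sup>2"
    using IP u g(1) unfolding improved_poincare_def by blast
  also have "\<dots> \<le> P * (2 * l2_norm \<Omega> v)\<^sup>2"
    using P by (intro mult_left_mono power_mono[OF g(2)]) auto
  finally show "(l2_norm \<Omega> u)\<^sup>2 \<le> 4 * P * (l2_norm \<Omega> v)\<^sup>2" by (simp add: power_mult_distrib)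
qed

end

section \<open>Equivalence of the three inequalities\<close>

lemma cInf_mult_ge:
  fixes A B :: "real set" and m :: real
  assumes ne: "A \<noteq> {}" "B \<noteq> {}" and A: "\<And>a. a \<in> A \<Longrightarrow> 0 \<le> a" and B: "\<And>b. b \<in> B \<Longrightarrow> 0 < b"
    and le: "\<And>a b. a \<in> A \<Longrightarrow> b \<in> B \<Longrightarrow> m \<le> a * b"
  shows "m \<le> Inf A * Inf B"
proof -
  have A0: "0 \<le> Inf A" by (rule cInf_greatest[OF ne(1) A])
  have 1: "m \<le> Inf A * b" if b: "b \<in> B" for b
  proof -
    have "m / b \<le> Inf A"
      by (rule cInf_greatest[OF ne(1)]) (use le[OF _ b] B[OF b] in \<open>simp add: pos_divide_le_eq\<close>)
    thus ?thesis using B[OF b] by (simp add: pos_divide_le_eq)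
  qed
  show ?thesis
  proof (cases "Inf A = 0")
    case True
    obtain b where "b \<in> B" using ne(2) by blast
    thus ?thesis using 1 True by fastforce
  next
    case False
    hence p: "0 < Inf A" using A0 by simp
    have "m / Inf A \<le> Inf B"
      by (rule cInf_greatest[OF ne(2)]) (use 1 p in \<open>simp add: pos_divide_le_eq mult.commute\<close>)
    thus ?thesis using p by (simp add: pos_divide_le_eq mult.commute)
  qed
qed

theorem theorem3p5:
  fixes \<Omega> :: "(real ^ 'n::{finite,linorder}) set" and l :: nat
  assumes "2 \<le> CARD('n)" and "1 \<le> l" and "l \<le> CARD('n) - 1"
    and "open \<Omega>" and "connected \<Omega>" and "\<Omega> \<noteq> {}" and "bounded \<Omega>"
    and "supports_hardy \<Omega>"
  shows "(supports_friedrichs_velte \<Omega> l \<longleftrightarrow> supports_improved_poincare \<Omega> l) \<and>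
    (supports_babuska_aziz \<Omega> l \<longleftrightarrow> supports_improved_poincare \<Omega> l) \<and>
    (supports_improved_poincare \<Omega> l \<longrightarrow>
      1 / 4 * (babuska_aziz_const \<Omega> l - 1) = 1 / 4 * friedrichs_velte_const \<Omega> l \<and>
      1 / 4 * friedrichs_velte_const \<Omega> l \<le> improved_poincare_const \<Omega> l \<and>
      improved_poincare_const \<Omega> l \<le> hardy_const \<Omega> * babuska_aziz_const \<Omega> l \<and>
      hardy_const \<Omega> * babuska_aziz_const \<Omega> l = hardy_const \<Omega> * (1 + friedrichs_velte_const \<Omega> l))"
proof -
  interpret form_domain \<Omega> l by unfold_locales (use assms in auto)
  have ne: "\<Omega> \<noteq> {}" and l: "l \<le> CARD('n)" using assms by auto
  have BA_ge: "1 \<le> C" if "babuska_aziz \<Omega> l C" for C by (rule babuska_aziz_ge_1[OF ne l that])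
  have BA_mono: "babuska_aziz \<Omega> l C'" if C: "babuska_aziz \<Omega> l C" and le: "C \<le> C'" for C C'
  proof -
    have "x \<le> C' * (l2_norm \<Omega> u)\<^sup>2" if "x \<le> C * (l2_norm \<Omega> u)\<^sup>2" for x and u :: "'n form"
      using that mult_right_mono[OF le, of "(l2_norm \<Omega> u)\<^sup>2"] by simp
    moreover have "0 < C'" using C le by (simp add: babuska_aziz_def)
    ultimately show ?thesis using C unfolding babuska_aziz_def by blast
  qed
  have BA_FV: "friedrichs_velte \<Omega> l (C - 1)" if C: "babuska_aziz \<Omega> l C" and gt: "1 < C" for C
    unfolding friedrichs_velte_def
    using babuska_aziz_imp_friedrichs_velte[OF C less_imp_le[OF gt]] gt by auto
  note FV_BA = friedrichs_velte_imp_babuska_aziz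
  have IP_pos: "0 < P" if "improved_poincare \<Omega> l P" for P by (rule improved_poincare_pos[OF ne l that])
  have IP_FV: "friedrichs_velte \<Omega> l (4 * P)" if "improved_poincare \<Omega> l P" for P
    by (rule improved_poincare_imp_friedrichs_velte[OF that IP_pos[OF that]])
  note BA_IP = babuska_aziz_imp_improved_poincare[OF ne l]
  obtain H0 where H0: "hardy_inequality \<Omega> H0" using assms(8) unfolding supports_hardy_def by blast
  have FV_iff: "supports_friedrichs_velte \<Omega> l \<longleftrightarrow> supports_improved_poincare \<Omega> l"
    unfolding supports_friedrichs_velte_def supports_improved_poincare_def
    using IP_FV BA_IP[OF FV_BA H0] by blast
  have BA_iff: "supports_babuska_aziz \<Omega> l \<longleftrightarrow> supports_improved_poincare \<Omega> l"
    unfolding supports_babuska_aziz_def supports_improved_poincare_def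
    using FV_BA[OF IP_FV] BA_IP[OF _ H0] by blast
  have "1 / 4 * (babuska_aziz_const \<Omega> l - 1) = 1 / 4 * friedrichs_velte_const \<Omega> l \<and>
      1 / 4 * friedrichs_velte_const \<Omega> l \<le> improved_poincare_const \<Omega> l \<and>
      improved_poincare_const \<Omega> l \<le> hardy_const \<Omega> * babuska_aziz_const \<Omega> l \<and>
      hardy_const \<Omega> * babuska_aziz_const \<Omega> l = hardy_const \<Omega> * (1 + friedrichs_velte_const \<Omega> l)"
    if "supports_improved_poincare \<Omega> l"
  proof -
    let ?C = "{C. babuska_aziz \<Omega> l C}" and ?G = "{\<Gamma>. friedrichs_velte \<Omega> l \<Gamma>}" and ?P = "{P. improved_poincare \<Omega> l P}"
    have nP: "?P \<noteq> {}" using that by (auto simp: supports_improved_poincare_def)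
    have nG: "?G \<noteq> {}" using nP IP_FV by blast
    have nC: "?C \<noteq> {}" using nG FV_BA by blast
    have bC: "bdd_below ?C" by (rule bdd_belowI[of _ 1]) (use BA_ge in auto)
    have bG: "bdd_below ?G" by (rule bdd_belowI[of _ 0]) (auto simp: friedrichs_velte_def)
    have bP: "bdd_below ?P" by (rule bdd_belowI[of _ 0]) (use IP_pos in \<open>auto intro: less_imp_le\<close>)
    have "Inf ?C - 1 \<le> Inf ?G"
    proof (rule cInf_greatest[OF nG])
      fix \<Gamma> assume "\<Gamma> \<in> ?G"
      hence "Inf ?C \<le> 1 + \<Gamma>" using FV_BA by (intro cInf_lower bC) auto
      thus "Inf ?C - 1 \<le> \<Gamma>" by simp
    qed
    moreover have "Inf ?G + 1 \<le> Inf ?C"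
    proof (rule cInf_greatest[OF nC])
      fix C assume C: "C \<in> ?C"
      \<comment> \<open>The constant \<open>C\<close> may be equal to 1, and then \<open>C - 1\<close> is not an admissible positive constant.\<close>
      show "Inf ?G + 1 \<le> C"
      proof (rule field_le_epsilon)
        fix e :: real assume e: "0 < e"
        have "babuska_aziz \<Omega> l (C + e)" using BA_mono C e by auto
        moreover have "1 < C + e" using BA_ge C e by force
        ultimately have "Inf ?G \<le> C + e - 1" using BA_FV by (intro cInf_lower bG) auto
        thus "Inf ?G + 1 \<le> C + e" by simp
      qed
    qed
    ultimately have CG: "Inf ?C = 1 + Inf ?G" by simp
    have GP: "1 / 4 * Inf ?G \<le> Inf ?P"
    proof (rule cInf_greatest[OF nP])
      fix P assume "P \<in> ?P"
      hence "Inf ?G \<le> 4 * P" using IP_FV by (intro cInf_lower bG) auto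
      thus "1 / 4 * Inf ?G \<le> P" by simp
    qed
    have "Inf ?P \<le> Inf {H. hardy_inequality \<Omega> H} * Inf ?C"
    proof (rule cInf_mult_ge[OF _ nC])
      show "{H. hardy_inequality \<Omega> H} \<noteq> {}" using H0 by blast
      show "0 \<le> H" if "H \<in> {H. hardy_inequality \<Omega> H}" for H using hardy_const_nonneg[OF ne l] that by blast
      show "0 < C" if "C \<in> ?C" for C using that by (simp add: babuska_aziz_def)
      show "Inf ?P \<le> H * C" if "H \<in> {H. hardy_inequality \<Omega> H}" "C \<in> ?C" for H C
        using BA_IP that by (intro cInf_lower bP) auto
    qed
    thus ?thesis using CG GP
      by (simp add: babuska_aziz_const_def friedrichs_velte_const_def improved_poincare_const_def hardy_const_def)
  qed
  thus ?thesis using FV_iff BA_iff by blast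
qed

end
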